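(* Let $f(x_1,\ldots,x_n)$ be an invertible polynomial and let $G$ be a subgroup of the group $G_f$ of diagonal symmetries of $f$. Let $(\widetilde f,\widetilde G)$ be the Berglund--H\"ubsch--Henningson dual pair of $(f,G)$. Then the orbifoldized elliptic genera satisfy $$Z(f,G)(\tau,z)=(-1)^n\,Z(\widetilde f,\widetilde G)(\tau,z)$$ as meromorphic functions of $(\tau,z)$, where $\tau$ is in the upper half plane and $z\in\mathbb{C}$.
   Context: Write $\mathbf{e}[x]=e^{2\pi\sqrt{-1}x}$. Invertible polynomials: a polynomial $f(x_1,\ldots,x_n)=\sum_{i=1}^n c_i\prod_{j=1}^n x_j^{E_{ij}}$ with $c_i\in\mathbb{C}^*$, $E_{ij}\in\mathbb{Z}_{\ge 0}$, is invertible if the matrix $E=(E_{ij})$ is invertible over $\mathbb{Q}$, and $f$ is a non-degenerate weighted homogeneous polynomial. The latter means that $f$ has an isolated singularity at the origin and there are positive rational weights $w_1,\ldots,w_n$ with $f(\lambda^{w_1}x_1,\ldots,\lambda^{w_n}x_n)=\lambda f(x_1,\ldots,x_n)$ for $\lambda\in\mathbb{C}\setminus\{0\}$; the weights are then uniquely determined by $E(w_1,\ldots,w_n)^T=(1,\ldots,1)^T$. Symmetry group: $G_f=\{(\lambda_1,\ldots,\lambda_n)\in(\mathbb{C}^* )^n : f(\lambda_1x_1,\ldots,\lambda_nx_n)=f(x_1,\ldots,x_n)\}$, a finite abelian group. Dual pair: $\widetilde f(x_1,\ldots,x_n)=\sum_{i=1}^n c_i\prod_{j=1}^n x_j^{E_{ji}}$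 (again invertible), and $\widetilde G=\mathrm{Hom}(G_f/G,\mathbb{C}^* )$, regarded as a subgroup of $G_{\widetilde f}\cong \mathrm{Hom}(G_f,\mathbb{C}^* )$. Explicitly, $G_f=\{(\mathbf{e}[a_1],\ldots,\mathbf{e}[a_n]) : a\in E^{-1}\mathbb{Z}^n\}$ and $G_{\widetilde f}=\{(\mathbf{e}[b_1],\ldots,\mathbf{e}[b_n]) : b\in (E^T)^{-1}\mathbb{Z}^n\}$ are paired perfectly by $(a,b)\mapsto \mathbf{e}[b^TEa]$, and $\widetilde G$ is the annihilator of $G$ in $G_{\widetilde f}$. Orbifoldized elliptic genus: put $q=e^{2\pi\sqrt{-1}\tau}$, $y=e^{2\pi\sqrt{-1}z}$ and $$\vartheta_1(\tau,z)=\sqrt{-1}\,q^{1/8}y^{-1/2}\prod_{l=1}^\infty(1-q^l)(1-q^{l-1}y)(1-q^ly^{-1}).$$ For $g\in G_f$ let $\alpha_i(g)\in[0,1)$ be the real numbers with $g=(\mathbf{e}[\alpha_1(g)],\ldots,\mathbf{e}[\alpha_n(g)])$. Then $$Z(f,G)(\tau,z)=\frac{1}{|G|}\sum_{g,h\in G}\ \prod_{i=1}^n \mathbf{e}[-\alpha_i(g)z]\;\frac{\vartheta_1\big(\tau,(1-w_i)z-\alpha_i(g)\tau-\alpha_i(h)\big)}{\vartheta_1\big(\tau,w_iz+\alpha_i(g)\tau+\alpha_i(h)\big)}.$$ The function $Z(\widetilde f,\widetilde G)$ is defined by the same formula using the weights of $\widetilde f$ and the group $\widetilde G$.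
   Formalization: The transposed polynomial is assumed to be invertible too; this is not automatic: xy+y² is invertible, but its transpose x+xy² has weights (1,0), so its elliptic genus has an identically zero denominator and is undefined. *)

theory Defs
  imports "HOL-Analysis.Analysis" "HOL-Algebra.Group"
begin

section \<open>Invertible polynomials\<close>

definition of_nat_matrix :: "nat^'n^'n \<Rightarrow> ('a::semiring_1)^'n^'n" where
  "of_nat_matrix E = (\<chi> i j. of_nat (E $ i $ j))"

definition poly_of :: "complex^'n \<Rightarrow> nat^'n^'n \<Rightarrow> complex^'n \<Rightarrow> complex" where
  "poly_of c E x = (\<Sum>i\<in>UNIV. c $ i * (\<Prod>j\<in>UNIV. x $ j ^ (E $ i $ j)))"

definition critical_point :: "(complex^'n \<Rightarrow> complex) \<Rightarrow> complex^'n \<Rightarrow> bool" where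
  "critical_point f x \<longleftrightarrow> (f has_derivative (\<lambda>_. 0)) (at x)"

definition isolated_singularity_at_origin :: "(complex^'n \<Rightarrow> complex) \<Rightarrow> bool" where
  "isolated_singularity_at_origin f \<longleftrightarrow>
     critical_point f 0 \<and> (\<forall>\<^sub>F x in at 0. \<not> critical_point f x)"

text \<open>\<open>t powr w\<close> is the principal branch.  For a polynomial the condition does not depend on
  the branch: positive real \<open>t\<close> already force every monomial to have weight 1.\<close>

definition weighted_homogeneous :: "(complex^'n \<Rightarrow> complex) \<Rightarrow> rat^'n \<Rightarrow> bool" where
  "weighted_homogeneous f w \<longleftrightarrow>
     (\<forall>t x. t \<noteq> 0 \<longrightarrow> f (\<chi> j. t powr of_rat (w $ j) * x $ j) = t * f x)"

definition nondegenerate :: "(complex^'n \<Rightarrow> complex) \<Rightarrow> bool" where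
  "nondegenerate f \<longleftrightarrow>
     isolated_singularity_at_origin f \<and> (\<exists>w. (\<forall>i. 0 < w $ i) \<and> weighted_homogeneous f w)"

definition invertible_polynomial :: "complex^'n \<Rightarrow> nat^'n^'n \<Rightarrow> bool" where
  "invertible_polynomial c E \<longleftrightarrow>
     (\<forall>i. c $ i \<noteq> 0) \<and> invertible (of_nat_matrix E :: rat^'n^'n) \<and> nondegenerate (poly_of c E)"

text \<open>With this definition the transpose of an invertible polynomial need not be invertible:
  \<open>x y + y\<^sup>2\<close> is invertible, but its transpose \<open>x + x y\<^sup>2\<close> has weights \<open>(1, 0)\<close>.\<close>

text \<open>If all \<open>c $ i\<close> are nonzero and \<open>E\<close> is invertible over the rationals, then \<open>poly_of c E\<close> has
  exactly one rational weight vector, the solution of \<open>E w = (1,\<dots>,1)\<close>.  Positivity is not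
  needed for this and is only demanded in \<open>nondegenerate\<close>.\<close>

definition weights :: "(complex^'n \<Rightarrow> complex) \<Rightarrow> rat^'n" where
  "weights f = (THE w. weighted_homogeneous f w)"

section \<open>Diagonal symmetries and the dual group\<close>

text \<open>Multiplication and \<open>1\<close> on vectors are the componentwise ones.\<close>

definition diag_group :: "(complex^'n \<Rightarrow> complex) \<Rightarrow> (complex^'n) monoid" where
  "diag_group f =
     \<lparr>carrier = {g. (\<forall>i. g $ i \<noteq> 0) \<and> (\<forall>x. f (g * x) = f x)}, monoid.mult = (*), one = 1\<rparr>"

definition e2pi :: "complex \<Rightarrow> complex" where
  "e2pi x = exp (2 * of_real pi * \<i> * x)"

definition e2pi_vec :: "real^'n \<Rightarrow> complex^'n" where
  "e2pi_vec a = (\<chi> i. e2pi (of_real (a $ i)))"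

text \<open>The annihilator of \<open>G\<close> in the symmetry group of the transposed polynomial, under the
  pairing \<open>(a, b) \<mapsto> e2pi (b\<^sup>T E a)\<close>.  All elements of the two symmetry groups are of the form
  \<open>e2pi_vec a\<close>, and the value of the pairing does not depend on the logarithms \<open>a\<close>, \<open>b\<close>.\<close>

definition dual_group :: "complex^'n \<Rightarrow> nat^'n^'n \<Rightarrow> (complex^'n) set \<Rightarrow> (complex^'n) set" where
  "dual_group c E G =
     {g \<in> carrier (diag_group (poly_of c (transpose E))).
        \<forall>a b. e2pi_vec a \<in> G \<and> e2pi_vec b = g \<longrightarrow>
          e2pi (of_real (b \<bullet> (of_nat_matrix E *v a))) = 1}"

section \<open>The orbifoldized elliptic genus\<close>

definition theta1 :: "complex \<Rightarrow> complex \<Rightarrow> complex" where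
  "theta1 \<tau> z = (let q = e2pi \<tau>; y = e2pi z in
     \<i> * e2pi (\<tau> / 8) * e2pi (- z / 2) *
     (\<Prod>l. (1 - q ^ Suc l) * (1 - q ^ l * y) * (1 - q ^ Suc l * inverse y)))"

definition alpha :: "complex \<Rightarrow> real" where
  "alpha \<zeta> = (THE \<alpha>. 0 \<le> \<alpha> \<and> \<alpha> < 1 \<and> \<zeta> = e2pi (of_real \<alpha>))"

definition genus_denom ::
    "(complex^'n \<Rightarrow> complex) \<Rightarrow> complex^'n \<Rightarrow> complex^'n \<Rightarrow> 'n \<Rightarrow> complex \<Rightarrow> complex \<Rightarrow> complex" where
  "genus_denom f g h i \<tau> z =
     theta1 \<tau> (of_rat (weights f $ i) * z + of_real (alpha (g $ i)) * \<tau> + of_real (alpha (h $ i)))"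

definition elliptic_genus ::
    "(complex^'n \<Rightarrow> complex) \<Rightarrow> (complex^'n) set \<Rightarrow> complex \<Rightarrow> complex \<Rightarrow> complex" where
  "elliptic_genus f G \<tau> z =
     1 / of_nat (card G) *
     (\<Sum>g\<in>G. \<Sum>h\<in>G. \<Prod>i\<in>UNIV.
        e2pi (- of_real (alpha (g $ i)) * z) *
        (theta1 \<tau> ((1 - of_rat (weights f $ i)) * z
                     - of_real (alpha (g $ i)) * \<tau> - of_real (alpha (h $ i)))
         / genus_denom f g h i \<tau> z))"

text \<open>The set of points at which some term of the defining formula of \<open>elliptic_genus\<close> has a
  vanishing denominator; only outside this set is the value of \<open>elliptic_genus\<close> meaningful,
  since division by zero yields zero.\<close>

definition genus_polar_set ::
    "(complex^'n \<Rightarrow> complex) \<Rightarrow> (complex^'n) set \<Rightarrow> (complex \<times> complex) set" where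
  "genus_polar_set f G = {(\<tau>, z). \<exists>g\<in>G. \<exists>h\<in>G. \<exists>i. genus_denom f g h i \<tau> z = 0}"

definition genus_domain :: "(complex \<times> complex) set" where
  "genus_domain = {\<tau>. 0 < Im \<tau>} \<times> UNIV"

end

theory Submission
  imports Defs "HOL-Complex_Analysis.Conformal_Mappings"
begin

text \<open>
  Kronecker's formula: for \<open>0 < Im u < Im \<tau>\<close> the quotient \<open>\<vartheta>\<^sub>1(\<tau>, z - u) / \<vartheta>\<^sub>1(\<tau>, u)\<close> is, up to a factor not
  involving \<open>u\<close>, the sum of \<open>([m > 0] - [k < 0]) e(m u - k z + m k \<tau>)\<close> over all integers \<open>m, k\<close>.  Insert
  it in every factor of the genus, for small \<open>Im z / Im \<tau> > 0\<close>.  Let \<open>L\<close> be the lattice of logarithms of elements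
  of \<open>G\<close>, and \<open>M\<close> that of the dual group.  The sum over \<open>h\<close> restricts \<open>m\<close> to the vectors \<open>E\<^sup>T b\<close> with
  \<open>b \<in> M\<close>, the sum over \<open>g\<close> completes \<open>k\<close> to a vector \<open>a \<in> L\<close>, and the genus becomes the sum of
  \<open>\<Prod>\<^sub>i ([(E\<^sup>T b)\<^sub>i > 0] - [a\<^sub>i < 0]) \<cdot> e((\<Sum> b - \<Sum> a) z + b\<^sup>T E a \<tau>)\<close> over \<open>L \<times> M\<close>.  Up to \<open>(-1)\<^sup>n\<close> the dual
  genus is the same sum with the sign factors \<open>[b\<^sub>j > 0] - [(E a)\<^sub>j < 0]\<close>.

  Assume first that no monomial is a product of two distinct variables.  After reordering the monomials, \<open>E\<close> has diagonal at least 2 and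
  off-diagonal row and column sums at most 1.  Gauss--Jordan elimination leads from the coordinates \<open>b\<close> to
  \<open>E\<^sup>T b\<close> in \<open>n\<close> steps.  In each step the two sign products differ by sign products for pairs of dual
  bases in which another coordinate has been exchanged, and the sum of each of these over \<open>L \<times> M\<close> is zero, because
  an involution \<open>(a, b) \<mapsto> (a - t e\<^sub>p, b - t e\<^sub>l)\<close> preserves the exponential and reverses the sign.  Generic shifts
  of the arguments, which tend to zero in the end, avoid the boundary cases of the signs.

  If \<open>x y\<close> is a monomial, the theta factors of \<open>x\<close> and \<open>y\<close> cancel, and the two variables can be eliminated from
  \<open>f\<close>, as can two variables from its transpose; this gives an induction on \<open>n\<close>.  Finally, analytic continuation in
  \<open>z\<close> extends the identity from the strip where the series converge.
\<close>

section \<open>Jacobi's triple product\<close>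

text \<open>The two sign products of the overview come from two pairs of dual bases for one bilinear
  form. They differ pointwise and agree only after summation, so no term-by-term comparison can
  work. What replaces it is an identity for signs along a single linear relation,
  \<open>circuit_sign_sum\<close>, applied once per pivot. Exchanging the new coordinate
  \<open>col k\<close> against an index \<open>l\<close> other than \<open>k\<close> gives bases in
  which \<open>b l\<close> enters exactly one coordinate and some \<open>a p\<close> with
  \<open>E l p = 1\<close> enters only its dual; the involution moves just this pair.

  Diagonal entries at least 2 keep every pivot positive. A monomial \<open>x y\<close> breaks this
  estimate, hence its separate treatment.

  The shifts are under two opposing demands: generic enough that no sign argument vanishes, yet with
  equal shifts of \<open>u l\<close> and \<open>v p\<close> whenever \<open>E l p = 1\<close>, since
  otherwise the involution would change the exponential. Both can be met because a column has at
  most one off-diagonal entry. All estimates must be uniform in the shifts, so that these can tend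
  to zero inside the sum.

  The sign \<open>(-1)^n\<close> is one minus sign per coordinate under
  \<open>(a, b) \<mapsto> (- a, - b)\<close>, which exchanges the two arguments of
  \<open>sgn_pair\<close>.\<close>

lemma summable_on_int_halves:
  fixes f :: "int \<Rightarrow> real"
  assumes nn: "\<And>n. 0 \<le> f n"
    and pos: "summable (\<lambda>n. f (int n))" and neg: "summable (\<lambda>n. f (- int n))"
  shows "f summable_on UNIV"
proof -
  have 1: "(\<lambda>n. f (int n)) summable_on UNIV"
    using pos nn by (intro summable_nonneg_imp_summable_on) auto
  have 2: "(\<lambda>n. f (- int n)) summable_on UNIV"
    using neg nn by (intro summable_nonneg_imp_summable_on) auto
  have "f summable_on range int"
    using 1 by (subst summable_on_reindex) (auto simp: o_def inj_on_def)
  moreover have "f summable_on range (\<lambda>n. - int n)"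
    using 2 by (subst summable_on_reindex) (auto simp: o_def inj_on_def)
  ultimately have "f summable_on (range int \<union> range (\<lambda>n. - int n))"
    by (rule summable_on_union)
  also have "range int \<union> range (\<lambda>n. - int n) = UNIV"
  proof -
    have "n \<in> range int \<union> range (\<lambda>n. - int n)" for n :: int
      by (cases n rule: int_cases2) auto
    then show ?thesis by blast
  qed
  finally show ?thesis .
qed

text \<open>A finite set of functions lies in the box spanned by its coordinate projections, and
  over a box the sum of products factors. Hence all finite partial sums are bounded by the product
  of the single sums.\<close>

lemma summable_on_PiE_prod:
  fixes f :: "'a \<Rightarrow> 'b \<Rightarrow> real"
  assumes fin: "finite A" and nn: "\<And>x y. 0 \<le> f x y"
    and sm: "\<And>x. x \<in> A \<Longrightarrow> f x summable_on B x"
  shows "(\<lambda>g. \<Prod>x\<in>A. f x (g x)) summable_on PiE A B"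
proof (rule nonneg_bdd_above_summable_on)
  show "bdd_above (sum (\<lambda>g. \<Prod>x\<in>A. f x (g x)) ` {F. F \<subseteq> PiE A B \<and> finite F})"
  proof (rule bdd_aboveI2)
    fix F assume "F \<in> {F. F \<subseteq> PiE A B \<and> finite F}"
    then have F: "F \<subseteq> PiE A B" "finite F" by auto
    define C where "C x = (\<lambda>g. g x) ` F" for x
    have C: "finite (C x)" for x using F by (simp add: C_def)
    have CB: "C x \<subseteq> B x" if "x \<in> A" for x
      using F that by (auto simp: C_def)
    have "F \<subseteq> PiE A C"
    proof
      fix g assume "g \<in> F"
      then have "g \<in> PiE A B" "\<And>x. g x \<in> C x" using F(1) by (auto simp: C_def)
      then show "g \<in> PiE A C" by (simp add: PiE_iff)
    qed
    then have "(\<Sum>g\<in>F. \<Prod>x\<in>A. f x (g x)) \<le> (\<Sum>g\<in>PiE A C. \<Prod>x\<in>A. f x (g x))"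
      using fin C nn by (intro sum_mono2) (auto intro: finite_PiE prod_nonneg)
    also have "\<dots> = (\<Prod>x\<in>A. \<Sum>y\<in>C x. f x y)"
      using fin C by (subst prod_sum_PiE) auto
    also have "\<dots> \<le> (\<Prod>x\<in>A. infsum (f x) (B x))"
      using nn sm C CB by (intro prod_mono conjI sum_nonneg finite_sum_le_infsum) auto
    finally show "(\<Sum>g\<in>F. \<Prod>x\<in>A. f x (g x)) \<le> (\<Prod>x\<in>A. infsum (f x) (B x))" .
  qed
qed (auto intro: prod_nonneg nn)

section \<open>Gaussian binomials and the finite triple product\<close>

fun gauss_binom :: "'a::comm_ring_1 \<Rightarrow> nat \<Rightarrow> nat \<Rightarrow> 'a" where
  "gauss_binom q m 0 = 1"
| "gauss_binom q 0 (Suc k) = 0"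
| "gauss_binom q (Suc m) (Suc k) = gauss_binom q m k + q ^ Suc k * gauss_binom q m (Suc k)"

lemma gauss_binom_eq_0: "m < k \<Longrightarrow> gauss_binom q m k = 0"
  by (induction q m k rule: gauss_binom.induct) auto

text \<open>Splitting off the factor \<open>1 + x\<close> leaves the product for
  \<open>q * x\<close>; comparing coefficients of \<open>x ^ Suc k\<close> gives exactly the
  \<open>q\<close>-Pascal rule that defines \<open>gauss_binom\<close>.\<close>

lemma gauss_binomial_theorem:
  fixes q x :: "'a::comm_ring_1"
  shows "(\<Prod>l<m. 1 + q ^ l * x) = (\<Sum>k\<le>m. q ^ (k choose 2) * gauss_binom q m k * x ^ k)"
proof (induction m arbitrary: x)
  case (Suc m)
  let ?c = "\<lambda>m k. q ^ (k choose 2) * gauss_binom q m k"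
  have "(\<Prod>l<Suc m. 1 + q ^ l * x) = (1 + x) * (\<Prod>l<m. 1 + q ^ l * (q * x))"
    by (subst prod.lessThan_Suc_shift) (simp add: mult_ac)
  also have "\<dots> = (1 + x) * (\<Sum>k\<le>m. ?c m k * (q * x) ^ k)"
    by (simp add: Suc.IH)
  also have "\<dots> = (\<Sum>k\<le>m. ?c m k * (q * x) ^ k) + (\<Sum>k\<le>m. ?c m k * q ^ k * x ^ Suc k)"
    by (simp add: algebra_simps sum_distrib_left power_mult_distrib sum.distrib)
  also have "(\<Sum>k\<le>m. ?c m k * (q * x) ^ k) = (\<Sum>k\<le>Suc m. ?c m k * (q * x) ^ k)"
    by (simp add: gauss_binom_eq_0)
  also have "\<dots> = 1 + (\<Sum>k\<le>m. ?c m (Suc k) * (q * x) ^ Suc k)"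
    by (subst sum.atMost_Suc_shift) (simp add: numeral_2_eq_2)
  also have "1 + (\<Sum>k\<le>m. ?c m (Suc k) * (q * x) ^ Suc k) + (\<Sum>k\<le>m. ?c m k * q ^ k * x ^ Suc k)
     = 1 + (\<Sum>k\<le>m. ?c (Suc m) (Suc k) * x ^ Suc k)"
  proof -
    have "Suc k choose 2 = k + (k choose 2)" for k by (simp add: numeral_2_eq_2)
    then show ?thesis
      unfolding add.assoc sum.distrib[symmetric]
      by (intro arg_cong2[where f="(+)"] refl sum.cong[OF refl]) (simp add: algebra_simps power_add power_mult_distrib)
  qed
  also have "\<dots> = (\<Sum>k\<le>Suc m. ?c (Suc m) k * x ^ k)"
    by (subst sum.atMost_Suc_shift) (simp add: numeral_2_eq_2)
  finally show ?case .
qed (simp add: numeral_2_eq_2)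

definition qpoch :: "'a::comm_ring_1 \<Rightarrow> nat \<Rightarrow> 'a" where
  "qpoch q m = (\<Prod>l<m. 1 - q ^ Suc l)"

text \<open>The closed form of the Gaussian binomial, with denominators cleared so that it makes
  sense in any commutative ring. The induction rests on
  \<open>1 - q^(k+j) = (1 - q^k) + q^k (1 - q^j)\<close>.\<close>

lemma gauss_binom_qpoch:
  fixes q :: "'a::comm_ring_1"
  shows "gauss_binom q (k + j) k * qpoch q k * qpoch q j = qpoch q (k + j)"
proof (induction "k + j" arbitrary: k j)
  case 0
  then show ?case by (simp add: qpoch_def)
next
  case (Suc m)
  show ?case
  proof (cases "k = 0 \<or> j = 0")
    case True
    have gn: "gauss_binom q n n = 1" for n
      by (induction n) (auto simp: gauss_binom_eq_0)
    from True show ?thesis using gn by (auto simp: qpoch_def)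
  next
    case False
    then obtain k' j' where kj: "k = Suc k'" "j = Suc j'" by (metis not0_implies_Suc)
    have 1: "gauss_binom q (k' + j) k' * qpoch q k' * qpoch q j = qpoch q (k' + j)"
      using Suc.hyps(1)[of k' j] Suc.hyps(2) kj by simp
    have 2: "gauss_binom q (k + j') k * qpoch q k * qpoch q j' = qpoch q (k + j')"
      using Suc.hyps(1)[of k j'] Suc.hyps(2) kj by simp
    have e: "k' + j = k + j'" "k + j = Suc (k + j')" using kj by auto
    have q: "qpoch q (Suc n) = qpoch q n * (1 - q ^ Suc n)" for n :: nat by (simp add: qpoch_def)
    have "gauss_binom q (k + j) k * qpoch q k * qpoch q j
      = (gauss_binom q (k' + j) k' + q ^ k * gauss_binom q (k + j') k) * qpoch q k * qpoch q j"
      using kj by simp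
    also have "\<dots> = (gauss_binom q (k' + j) k' * qpoch q k' * qpoch q j) * (1 - q ^ k)
        + q ^ k * (1 - q ^ j) * (gauss_binom q (k + j') k * qpoch q k * qpoch q j')"
      unfolding kj q by (simp only: algebra_simps)
    also have "\<dots> = qpoch q (k' + j) * (1 - q ^ k) + q ^ k * (1 - q ^ j) * qpoch q (k + j')"
      by (simp only: 1 2)
    also have "\<dots> = qpoch q (k + j)"
      unfolding e q by (simp add: algebra_simps power_add kj)
    finally show ?thesis .
  qed
qed

definition tri :: "int \<Rightarrow> int" where "tri n = n * (n - 1) div 2"

lemma two_tri: "2 * tri n = n * (n - 1)"
  by (simp add: tri_def)

lemma tri_add1: "tri (n + 1) = tri n + n"
  using two_tri[of n] two_tri[of "n + 1"] by (simp add: algebra_simps)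

lemma tri_refl: "tri (1 - n) = tri n"
  by (simp add: tri_def algebra_simps)

definition theta_term :: "complex \<Rightarrow> complex \<Rightarrow> int \<Rightarrow> complex" where
  "theta_term q x n = q powi tri n * x powi n"

lemma finite_triple_product:
  fixes q y :: complex
  assumes q: "q \<noteq> 0" and y: "y \<noteq> 0"
  shows "(\<Prod>l<N. (1 - q ^ l * y) * (1 - q ^ Suc l * inverse y))
    = (\<Sum>k\<le>2*N. gauss_binom q (2*N) k * theta_term q (- y) (int k - int N))"
proof -
  \<comment> \<open>With this \<open>x\<close> the upper half of the \<open>2 N\<close> factors of
    Gauss's product is \<open>1 - q ^ l * y\<close>. The lower half, read backwards, is
    \<open>1 - q ^ Suc l * inverse y\<close> up to a monomial, which the exponent \<open>tri\<close>
    then absorbs.\<close>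
  define x where "x = - y / q ^ N"
  have s1: "(\<Prod>l<2*N. 1 + q ^ l * x) = (\<Prod>l<N. 1 + q ^ l * x) * (\<Prod>l<N. 1 + q ^ (N + l) * x)"
  proof -
    have "(\<Prod>l<N + M. 1 + q ^ l * x) = (\<Prod>l<N. 1 + q ^ l * x) * (\<Prod>l<M. 1 + q ^ (N + l) * x)" for M
      by (induction M) (simp_all add: mult_ac)
    then show ?thesis unfolding mult_2 .
  qed
  have s2: "(\<Prod>l<N. 1 + q ^ (N + l) * x) = (\<Prod>l<N. 1 - q ^ l * y)"
    using q by (simp add: x_def power_add)
  have "(\<Prod>l<N. 1 + q ^ l * x) = (\<Prod>l<N. 1 + q ^ (N - Suc l) * x)"
    by (rule prod.nat_diff_reindex[symmetric])
  also have "\<dots> = (\<Prod>l<N. (- y / q ^ Suc l) * (1 - q ^ Suc l * inverse y))"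
  proof (rule prod.cong[OF refl])
    fix l assume "l \<in> {..<N}"
    then have "q ^ N = q ^ (N - Suc l) * q ^ Suc l" by (simp add: power_add[symmetric] del: power_Suc)
    then show "1 + q ^ (N - Suc l) * x = (- y / q ^ Suc l) * (1 - q ^ Suc l * inverse y)"
      using q y by (simp add: x_def field_simps)
  qed
  also have "\<dots> = (\<Prod>l<N. (- y / q ^ Suc l)) * (\<Prod>l<N. 1 - q ^ Suc l * inverse y)"
    by (rule prod.distrib)
  also have "(\<Prod>l<N. (- y / q ^ Suc l)) = (- y) ^ N / q ^ (Suc N choose 2)"
    by (induction N) (simp_all add: power_add numeral_2_eq_2 field_simps)
  finally have s3: "(\<Prod>l<N. 1 + q ^ l * x)
      = (- y) ^ N / q ^ (Suc N choose 2) * (\<Prod>l<N. 1 - q ^ Suc l * inverse y)" .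
  have "(- y) ^ N / q ^ (Suc N choose 2) * (\<Prod>l<N. (1 - q ^ l * y) * (1 - q ^ Suc l * inverse y))
    = (\<Prod>l<2*N. 1 + q ^ l * x)"
    unfolding s1 s2 s3 prod.distrib by (simp only: mult_ac)
  also have "\<dots> = (\<Sum>k\<le>2*N. q ^ (k choose 2) * gauss_binom q (2*N) k * x ^ k)"
    by (rule gauss_binomial_theorem)
  also have "\<dots> = (\<Sum>k\<le>2*N. (- y) ^ N / q ^ (Suc N choose 2)
      * (gauss_binom q (2*N) k * theta_term q (- y) (int k - int N)))"
  proof (rule sum.cong[OF refl])
    fix k
    have c2: "2 * int (j choose 2) = int j * (int j - 1)" for j
      by (induction j) (auto simp: numeral_2_eq_2 algebra_simps)
    have "2 * tri (int k - int N) = 2 * (int (k choose 2) + int (Suc N choose 2) - int N * int k)"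
      unfolding right_diff_distrib distrib_left two_tri c2 by (simp add: algebra_simps)
    then have "tri (int k - int N) = int (k choose 2) + int (Suc N choose 2) - int N * int k"
      by simp
    then have t: "theta_term q (- y) (int k - int N)
        = q ^ (k choose 2) * q ^ (Suc N choose 2) / q ^ (N * k) * ((- y) ^ k / (- y) ^ N)"
      using q y by (simp add: theta_term_def power_int_diff power_int_add flip: power_int_of_nat of_nat_mult)
    show "q ^ (k choose 2) * gauss_binom q (2*N) k * x ^ k = (- y) ^ N / q ^ (Suc N choose 2)
      * (gauss_binom q (2*N) k * theta_term q (- y) (int k - int N))"
      unfolding t x_def power_divide power_mult using q y by (simp add: field_simps)
  qed
  finally show ?thesis
    using q y unfolding sum_distrib_left[symmetric] by (simp add: divide_eq_0_iff)
qed

text \<open>Lebesgue's theorem for the counting measure. It is used twice: for the limit in the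
  triple product and for letting the shifts tend to zero.\<close>

lemma infsum_dominated_convergence:
  fixes f :: "nat \<Rightarrow> 'a \<Rightarrow> complex"
  assumes D: "D summable_on A" and dom: "\<And>N x. x \<in> A \<Longrightarrow> norm (f N x) \<le> D x"
    and lim: "\<And>x. x \<in> A \<Longrightarrow> (\<lambda>N. f N x) \<longlonglongrightarrow> g x"
  shows "(\<lambda>N. infsum (f N) A) \<longlonglongrightarrow> infsum g A"
proof -
  have D0: "0 \<le> D x" if "x \<in> A" for x
    using dom[OF that, of 0] norm_ge_zero order_trans by blast
  have gD: "norm (g x) \<le> D x" if "x \<in> A" for x
    using lim[OF that] dom[OF that] by (intro tendsto_upperbound[OF tendsto_norm]) auto
  have abs: "(\<lambda>x. norm (D x)) summable_on A"
    using D D0 by (subst summable_on_cong[where g=D]) auto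
  have eq: "infsum h A = integral\<^sup>L (count_space A) h"
    if "\<And>x. x \<in> A \<Longrightarrow> norm (h x) \<le> D x" for h :: "'a \<Rightarrow> complex"
  proof -
    have "(\<lambda>x. norm (h x)) summable_on A"
      using D that by (intro summable_on_comparison_test[OF D]) auto
    then have "Infinite_Set_Sum.abs_summable_on h A"
      by (simp add: abs_summable_equivalent)
    then show ?thesis
      by (simp add: infsetsum_infsum[symmetric] infsetsum_def)
  qed
  have "Infinite_Set_Sum.abs_summable_on D A"
    using abs by (simp only: abs_summable_equivalent)
  then have "integrable (count_space A) D"
    by (simp only: Infinite_Set_Sum.abs_summable_on_def)
  then have "(\<lambda>N. integral\<^sup>L (count_space A) (f N)) \<longlonglongrightarrow> integral\<^sup>L (count_space A) g"
    using dom lim by (intro integral_dominated_convergence[where w=D]) (auto simp: AE_count_space)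
  then show ?thesis
    using eq[of g] eq[of "f _"] gD dom by simp
qed

text \<open>Consecutive terms have ratio \<open>x * q ^ n\<close>, which tends to 0 for every
  \<open>x\<close>; so the power series in \<open>x\<close> is entire.\<close>

lemma summable_theta_power:
  fixes q x :: complex
  assumes q: "norm q < 1"
  shows "summable (\<lambda>n::nat. norm (q ^ (n choose 2) * x ^ n))"
proof -
  have "(\<lambda>n. norm (x * q ^ n)) \<longlonglongrightarrow> norm (x * 0)"
    using q by (intro tendsto_intros LIMSEQ_power_zero)
  then have "eventually (\<lambda>n. norm (x * q ^ n) < 1/2) sequentially"
    by (rule order_tendstoD) simp
  then obtain n0 where n0: "\<And>n. n \<ge> n0 \<Longrightarrow> norm (x * q ^ n) < 1/2"
    by (auto simp: eventually_sequentially)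
  show ?thesis
  proof (rule summable_ratio_test[where c="1/2" and N=n0])
    fix n assume "n \<ge> n0"
    have "norm (q ^ (Suc n choose 2) * x ^ Suc n) = norm (x * q ^ n) * norm (q ^ (n choose 2) * x ^ n)"
      by (simp add: numeral_2_eq_2 power_add norm_mult)
    also have "\<dots> \<le> 1/2 * norm (q ^ (n choose 2) * x ^ n)"
      using n0[OF \<open>n \<ge> n0\<close>] by (intro mult_right_mono) auto
    finally show "norm (norm (q ^ (Suc n choose 2) * x ^ Suc n)) \<le> 1/2 * norm (norm (q ^ (n choose 2) * x ^ n))"
      by simp
  qed simp
qed

lemma tri_of_nat: "tri (int n) = int (n choose 2)" and tri_uminus_of_nat: "tri (- int n) = int (n + (n choose 2))"
proof -
  have c2: "2 * int (j choose 2) = int j * (int j - 1)" for j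
    by (induction j) (auto simp: numeral_2_eq_2 algebra_simps)
  show "tri (int n) = int (n choose 2)" using c2[of n] two_tri[of "int n"] by simp
  show "tri (- int n) = int (n + (n choose 2))"
    using c2[of n] two_tri[of "- int n"] by (simp add: algebra_simps)
qed

lemma theta_term_of_nat: "theta_term q x (int n) = q ^ (n choose 2) * x ^ n"
  and theta_term_uminus_of_nat:
    "q \<noteq> 0 \<Longrightarrow> x \<noteq> 0 \<Longrightarrow> theta_term q x (- int n) = q ^ (n choose 2) * (q / x) ^ n"
  unfolding theta_term_def tri_of_nat tri_uminus_of_nat power_int_minus power_int_of_nat
  by (simp_all add: power_add power_divide field_simps)

lemma theta_term_summable:
  assumes q: "norm q < 1" "q \<noteq> 0" and x: "x \<noteq> 0"
  shows "(\<lambda>n. norm (theta_term q x n)) summable_on UNIV"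
  using summable_theta_power[OF q(1), of x] summable_theta_power[OF q(1), of "q / x"] q x
  by (intro summable_on_int_halves) (simp_all add: theta_term_of_nat theta_term_uminus_of_nat)

definition theta_series :: "complex \<Rightarrow> complex \<Rightarrow> complex" where
  "theta_series q x = (\<Sum>\<^sub>\<infinity>n\<in>UNIV. theta_term q x n)"

lemma qpoch_convergent:
  fixes q :: complex
  assumes q: "norm q < 1"
  shows "\<exists>Q. Q \<noteq> 0 \<and> (\<lambda>m. qpoch q m) \<longlonglongrightarrow> Q" and "qpoch q m \<noteq> 0"
proof -
  have nz: "1 - q ^ Suc l \<noteq> 0" for l
  proof
    assume "1 - q ^ Suc l = 0"
    then have "norm (q ^ Suc l) = 1" by (metis diff_eq_diff_eq diff_self norm_one right_minus_eq)
    moreover have "norm (q ^ Suc l) < 1" using q by (simp add: norm_power power_less_one_iff del: power_Suc)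
    ultimately show False by simp
  qed
  show "qpoch q m \<noteq> 0" using nz by (simp add: qpoch_def)
  have "summable (\<lambda>l. norm ((1 - q ^ Suc l) - 1))"
    using summable_geometric[of "norm q"] q by (simp add: norm_power norm_mult summable_mult)
  then have "convergent_prod (\<lambda>l. 1 - q ^ Suc l)"
    by (intro abs_convergent_prod_imp_convergent_prod summable_imp_abs_convergent_prod)
  note cp = this
  have "(\<lambda>n. \<Prod>l\<le>n. 1 - q ^ Suc l) \<longlonglongrightarrow> prodinf (\<lambda>l. 1 - q ^ Suc l)"
    by (rule convergent_prod_LIMSEQ[OF cp])
  moreover have "prodinf (\<lambda>l. 1 - q ^ Suc l) \<noteq> 0"
    using prodinf_nonzero[OF cp] nz by blast
  moreover have "(\<lambda>n. \<Prod>l\<le>n. 1 - q ^ Suc l) = (\<lambda>n. qpoch q (Suc n))"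
    by (simp add: qpoch_def lessThan_Suc_atMost)
  ultimately show "\<exists>Q. Q \<noteq> 0 \<and> (\<lambda>m. qpoch q m) \<longlonglongrightarrow> Q"
    using LIMSEQ_imp_Suc by metis
qed

lemma triple_product_convergent:
  fixes q y :: complex
  assumes q: "norm q < 1"
  shows "convergent_prod (\<lambda>l. (1 - q ^ Suc l) * (1 - q ^ l * y) * (1 - q ^ Suc l * inverse y))"
proof -
  have "convergent_prod (\<lambda>l. 1 - q ^ l * c)" for c :: complex
  proof -
    have "summable (\<lambda>l. norm ((1 - q ^ l * c) - 1))"
      using summable_geometric[of "norm q"] q by (simp add: norm_power norm_mult summable_mult2)
    then show ?thesis
      by (intro abs_convergent_prod_imp_convergent_prod summable_imp_abs_convergent_prod)
  qed
  from this[of q] this[of y] this[of "q * inverse y"] show ?thesis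
    by (intro convergent_prod_mult) (simp_all add: mult_ac)
qed

text \<open>The finite triple product, multiplied by \<open>qpoch q N\<close>, has coefficients that
  are bounded uniformly in \<open>N\<close> and tend to 1, so the limit may be taken inside the
  sum.\<close>

theorem jacobi_triple_product:
  fixes q y :: complex
  assumes q: "norm q < 1" "q \<noteq> 0" and y: "y \<noteq> 0"
  shows "(\<Prod>l. (1 - q ^ Suc l) * (1 - q ^ l * y) * (1 - q ^ Suc l * inverse y)) = theta_series q (- y)"
proof -
  let ?P = "\<lambda>l. (1 - q ^ Suc l) * (1 - q ^ l * y) * (1 - q ^ Suc l * inverse y)"
  obtain Q where Q: "Q \<noteq> 0" "(\<lambda>m. qpoch q m) \<longlonglongrightarrow> Q" using qpoch_convergent[OF q(1)] by blast
  have nz: "qpoch q m \<noteq> 0" for m by (rule qpoch_convergent[OF q(1)])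
  obtain M where M: "M > 0" "\<And>m. norm (qpoch q m) \<le> M"
    using convergent_imp_Bseq[OF convergentI[OF Q(2)]] by (auto simp: Bseq_def)
  have "(\<lambda>m. inverse (qpoch q m)) \<longlonglongrightarrow> inverse Q" by (intro tendsto_inverse Q)
  then obtain M' where M': "M' > 0" "\<And>m. norm (inverse (qpoch q m)) \<le> M'"
    using convergent_imp_Bseq[OF convergentI] by (force simp: Bseq_def)
  \<comment> \<open>This is \<open>qpoch q N\<close> times the Gaussian binomial with lower index
    \<open>N + n\<close>, written through \<open>qpoch\<close> and continued by 0 for
    \<open>\<bar>n\<bar> > N\<close>. In this form every partial product is a sum over all integers,
    and both the bound and the limit \<open>Q * Q / (Q * Q)\<close> are visible.\<close>
  define c where "c N n = (if \<bar>n\<bar> \<le> int N then qpoch q N * qpoch q (2*N)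
     * inverse (qpoch q (nat (int N + n))) * inverse (qpoch q (nat (int N - n))) else 0)" for N n
  define f where "f N n = c N n * theta_term q (- y) n" for N n
  have cb: "norm (c N n) \<le> M * M * M' * M'" for N n
    unfolding c_def norm_mult using M M' by (auto intro!: mult_mono simp: norm_mult)
  have partial: "infsum (f N) UNIV = (\<Prod>l<N. ?P l)" for N
  proof -
    have gb: "qpoch q N * gauss_binom q (2*N) k = c N (int k - int N)" if "k \<le> 2*N" for k
    proof -
      have "gauss_binom q (2*N) k * qpoch q k * qpoch q (2*N - k) = qpoch q (2*N)"
        using gauss_binom_qpoch[of q k "2*N - k"] that by simp
      moreover have "nat (int N - (int k - int N)) = 2*N - k" using that by simp
      ultimately show ?thesis using that nz by (auto simp: c_def field_simps)
    qed
    have "infsum (f N) UNIV = infsum (f N) ((\<lambda>k. int k - int N) ` {..2*N})"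
    proof (rule infsum_cong_neutral)
      fix n assume "n \<in> UNIV - (\<lambda>k. int k - int N) ` {..2*N}"
      moreover have "n \<in> (\<lambda>k. int k - int N) ` {..2*N}" if "\<bar>n\<bar> \<le> int N"
        by (rule image_eqI[of _ _ "nat (n + int N)"]) (use that in auto)
      ultimately have "\<not> \<bar>n\<bar> \<le> int N" by blast
      then show "f N n = 0" by (simp add: f_def c_def)
    qed auto
    also have "\<dots> = (\<Sum>k\<le>2*N. f N (int k - int N))"
      by (subst infsum_finite) (auto simp: sum.reindex inj_on_def)
    also have "\<dots> = qpoch q N * (\<Sum>k\<le>2*N. gauss_binom q (2*N) k * theta_term q (- y) (int k - int N))"
      unfolding sum_distrib_left f_def by (intro sum.cong refl) (simp add: gb[symmetric] mult.assoc)
    also have "\<dots> = (\<Prod>l<N. ?P l)"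
      unfolding finite_triple_product[OF q(2) y, symmetric] qpoch_def prod.distrib[symmetric]
      by (simp add: mult.assoc)
    finally show ?thesis .
  qed
  have "(\<lambda>N. infsum (f N) UNIV) \<longlonglongrightarrow> infsum (theta_term q (- y)) UNIV"
  proof (rule infsum_dominated_convergence)
    show "(\<lambda>n. M * M * M' * M' * norm (theta_term q (- y) n)) summable_on UNIV"
      using theta_term_summable[OF q, of "- y"] y by (intro summable_on_cmult_right) auto
    show "norm (f N n) \<le> M * M * M' * M' * norm (theta_term q (- y) n)" for N n
      unfolding f_def norm_mult by (intro mult_right_mono cb) auto
    fix n :: int
    have l1: "filterlim (\<lambda>N. nat (int N + n)) at_top sequentially" "filterlim (\<lambda>N. nat (int N - n)) at_top sequentially"
      by (rule filterlim_at_top_mono[OF filterlim_minus_const_nat_at_top[of "nat \<bar>n\<bar>"]], 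
          auto intro!: always_eventually)+
    have l2: "filterlim (\<lambda>N::nat. 2 * N) at_top sequentially"
      by (rule filterlim_subseq) (auto simp: strict_mono_def)
    have "(\<lambda>N. qpoch q N * qpoch q (2*N) * inverse (qpoch q (nat (int N + n)))
        * inverse (qpoch q (nat (int N - n)))) \<longlonglongrightarrow> Q * Q * inverse Q * inverse Q"
      by (intro tendsto_mult tendsto_inverse Q filterlim_compose[OF Q(2)] l1 l2)
    moreover have "eventually (\<lambda>N. qpoch q N * qpoch q (2*N) * inverse (qpoch q (nat (int N + n)))
        * inverse (qpoch q (nat (int N - n))) = c N n) sequentially"
      using eventually_ge_at_top[of "nat \<bar>n\<bar>"] by eventually_elim (auto simp: c_def)
    ultimately have "(\<lambda>N. c N n) \<longlonglongrightarrow> Q * Q * inverse Q * inverse Q"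
      by (rule Lim_transform_eventually)
    then have "(\<lambda>N. c N n) \<longlonglongrightarrow> 1" using Q(1) by (simp add: field_simps)
    from tendsto_mult[OF this tendsto_const[of "theta_term q (- y) n"]]
    show "(\<lambda>N. f N n) \<longlonglongrightarrow> theta_term q (- y) n" by (simp add: f_def)
  qed
  then have "(\<lambda>N. \<Prod>l<N. ?P l) \<longlonglongrightarrow> theta_series q (- y)"
    unfolding partial theta_series_def .
  then have "(\<lambda>N. \<Prod>l\<le>N. ?P l) \<longlonglongrightarrow> theta_series q (- y)"
    using LIMSEQ_Suc by (fastforce simp: lessThan_Suc_atMost)
  with convergent_prod_LIMSEQ[OF triple_product_convergent[OF q(1), of y]] show ?thesis
    using LIMSEQ_unique by blast
qed

section \<open>The theta function\<close>

lemma e2pi_add: "e2pi (x + y) = e2pi x * e2pi y"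
  by (simp add: e2pi_def ring_distribs exp_add)

lemma e2pi_0 [simp]: "e2pi 0 = 1"
  by (simp add: e2pi_def)

lemma e2pi_nonzero [simp]: "e2pi x \<noteq> 0"
  by (simp add: e2pi_def)

lemma e2pi_minus: "e2pi (- x) = inverse (e2pi x)"
  by (simp add: e2pi_def exp_minus)

lemma e2pi_diff: "e2pi (x - y) = e2pi x / e2pi y"
  by (metis add_uminus_conv_diff divide_inverse e2pi_add e2pi_minus)

lemma e2pi_sum: "e2pi (sum f A) = (\<Prod>x\<in>A. e2pi (f x))"
  by (induction A rule: infinite_finite_induct) (auto simp: e2pi_add)

lemma e2pi_of_int_mult: "e2pi (of_int n * x) = e2pi x powi n"
proof -
  have "e2pi (of_nat m * x) = e2pi x ^ m" for m
    by (induction m) (auto simp: ring_distribs e2pi_add)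
  then show ?thesis
    by (cases n rule: int_cases2) (auto simp: e2pi_minus power_int_minus)
qed

lemma norm_e2pi: "norm (e2pi x) = exp (- (2 * pi * Im x))"
  by (simp add: e2pi_def)

lemma e2pi_eq_1_iff: "e2pi x = 1 \<longleftrightarrow> x \<in> \<int>"
proof -
  have "e2pi x = 1 \<longleftrightarrow> Im x = 0 \<and> (\<exists>n::int. 2 * pi * Re x = of_int (2 * n) * pi)"
    by (auto simp: e2pi_def exp_eq_1)
  also have "\<dots> \<longleftrightarrow> Im x = 0 \<and> (\<exists>n::int. Re x = of_int n)" by auto
  also have "\<dots> \<longleftrightarrow> x \<in> \<int>"
    by (auto simp: Ints_def complex_eq_iff)
  finally show ?thesis .
qed

lemma e2pi_of_int [simp]: "e2pi (of_int n) = 1"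
  by (simp add: e2pi_eq_1_iff)

lemma e2pi_nome:
  assumes "0 < Im \<tau>"
  shows "norm (e2pi \<tau>) < 1"
  using assms by (simp add: norm_e2pi)

text \<open>Index shift by one, with \<open>tri (n + 1) = tri n + n\<close>. This is the
  quasi-periodicity of theta in the direction \<open>\<tau>\<close>.\<close>

lemma theta_series_shift:
  assumes "q \<noteq> 0" "x \<noteq> 0"
  shows "theta_series q (q * x) = inverse x * theta_series q x"
proof -
  have "theta_series q (q * x) = (\<Sum>\<^sub>\<infinity>n\<in>UNIV. inverse x * theta_term q x (n + 1))"
    unfolding theta_series_def
  proof (rule infsum_cong)
    fix n :: int
    show "theta_term q (q * x) n = inverse x * theta_term q x (n + 1)"
      using assms by (simp add: theta_term_def tri_add1 power_int_add power_int_mult_distrib)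
  qed
  also have "\<dots> = inverse x * (\<Sum>\<^sub>\<infinity>n\<in>UNIV. theta_term q x (n + 1))"
    by (rule infsum_cmult_right')
  also have "(\<Sum>\<^sub>\<infinity>n\<in>UNIV. theta_term q x (n + 1)) = theta_series q x"
    unfolding theta_series_def
    by (rule infsum_reindex_bij_witness[of _ "\<lambda>n. n - 1" "\<lambda>n. n + 1"]) auto
  finally show ?thesis .
qed

lemma theta_series_inverse:
  assumes "x \<noteq> 0"
  shows "theta_series q (inverse x) = inverse x * theta_series q x"
proof -
  have "theta_series q (inverse x) = (\<Sum>\<^sub>\<infinity>n\<in>UNIV. inverse x * theta_term q x (1 - n))"
    unfolding theta_series_def
  proof (rule infsum_cong)
    fix n :: int
    show "theta_term q (inverse x) n = inverse x * theta_term q x (1 - n)"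
      using assms by (simp add: theta_term_def tri_refl power_int_diff power_int_inverse field_simps)
  qed
  also have "\<dots> = inverse x * (\<Sum>\<^sub>\<infinity>n\<in>UNIV. theta_term q x (1 - n))"
    by (rule infsum_cmult_right')
  also have "(\<Sum>\<^sub>\<infinity>n\<in>UNIV. theta_term q x (1 - n)) = theta_series q x"
    unfolding theta_series_def
    by (rule infsum_reindex_bij_witness[of _ "\<lambda>n. 1 - n" "\<lambda>n. 1 - n"]) auto
  finally show ?thesis .
qed

text \<open>\<open>- 1\<close> is fixed by inversion, where the functional equation has the factor
  \<open>- 1\<close>. This zero is what makes the recursion in \<open>conv_add_1\<close>
  homogeneous.\<close>

lemma theta_series_minus_1: "theta_series q (- 1) = 0"
  using theta_series_inverse[of "- 1" q] by simp

lemma theta_series_eq_0D: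
  assumes q: "norm q < 1" "q \<noteq> 0" and y: "y \<noteq> 0" and 0: "theta_series q (- y) = 0"
  shows "\<exists>l. q ^ l * y = 1 \<or> q ^ Suc l * inverse y = 1"
proof (rule ccontr)
  assume *: "\<not> ?thesis"
  have "(1 - q ^ Suc l) * (1 - q ^ l * y) * (1 - q ^ Suc l * inverse y) \<noteq> 0" for l
  proof -
    have "q ^ Suc l \<noteq> 1"
    proof
      assume "q ^ Suc l = 1"
      then have "norm (q ^ Suc l) = 1" by (simp only: norm_one)
      moreover have "norm (q ^ Suc l) < 1" unfolding norm_power using q(1) power_less_one_iff[of "norm q" "Suc l"] by simp
      ultimately show False by simp
    qed
    with * show ?thesis by auto
  qed
  with prodinf_nonzero[OF triple_product_convergent[OF q(1), of y]] jacobi_triple_product[OF q y] 0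
  show False by simp
qed

lemma theta1_eq_series:
  assumes "0 < Im \<tau>"
  shows "theta1 \<tau> z = \<i> * e2pi (\<tau> / 8) * e2pi (- z / 2) * theta_series (e2pi \<tau>) (- e2pi z)"
  using jacobi_triple_product[OF e2pi_nome[OF assms], of "e2pi z"] by (simp add: theta1_def Let_def)

lemma theta1_minus:
  assumes "0 < Im \<tau>"
  shows "theta1 \<tau> (- z) = - theta1 \<tau> z"
proof -
  have "theta_series (e2pi \<tau>) (- e2pi (- z)) = - inverse (e2pi z) * theta_series (e2pi \<tau>) (- e2pi z)"
    using theta_series_inverse[of "- e2pi z" "e2pi \<tau>"] by (simp add: e2pi_minus)
  moreover have "e2pi (z / 2) * inverse (e2pi z) = e2pi (- z / 2)"
    by (simp add: e2pi_minus[symmetric] e2pi_add[symmetric])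
  ultimately show ?thesis
    by (simp add: theta1_eq_series[OF assms])
qed

lemma theta1_add_1:
  assumes "0 < Im \<tau>"
  shows "theta1 \<tau> (z + 1) = - theta1 \<tau> z"
proof -
  have "e2pi 1 = 1" using e2pi_of_int[of 1] by simp
  moreover have "e2pi (- 1 / 2) = - 1"
    by (simp add: e2pi_def exp_minus exp_pi_i' mult.commute)
  moreover have "- (z + 1) / 2 = - z / 2 + (- 1 / 2)" by (simp add: field_simps)
  ultimately have "e2pi (- (z + 1) / 2) = - e2pi (- z / 2)" "e2pi (z + 1) = e2pi z"
    by (simp_all only: e2pi_add) simp_all
  then show ?thesis
    by (simp only: theta1_eq_series[OF assms]) simp
qed

lemma theta1_add_tau:
  assumes "0 < Im \<tau>"
  shows "theta1 \<tau> (z + \<tau>) = - e2pi (- \<tau> / 2 - z) * theta1 \<tau> z"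
proof -
  have "theta_series (e2pi \<tau>) (- e2pi (z + \<tau>)) = - inverse (e2pi z) * theta_series (e2pi \<tau>) (- e2pi z)"
    using theta_series_shift[of "e2pi \<tau>" "- e2pi z"] by (simp add: e2pi_add mult.commute)
  moreover have "e2pi (- (z + \<tau>) / 2) * inverse (e2pi z) = e2pi (- \<tau> / 2 - z) * e2pi (- z / 2)"
    unfolding e2pi_minus[symmetric] e2pi_add[symmetric]
    by (rule arg_cong[where f=e2pi]) (simp add: field_simps)
  ultimately show ?thesis
    by (simp add: theta1_eq_series[OF assms])
qed

text \<open>A zero of the infinite product is a zero of one of its factors; taking logarithms turns
  it into a point of the period lattice.\<close>

lemma theta1_eq_0D:
  assumes \<tau>: "0 < Im \<tau>" and 0: "theta1 \<tau> z = 0"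
  shows "\<exists>m n::int. z = of_int m + of_int n * \<tau>"
proof -
  have "theta_series (e2pi \<tau>) (- e2pi z) = 0" using 0 by (simp add: theta1_eq_series[OF \<tau>])
  from theta_series_eq_0D[OF e2pi_nome[OF \<tau>] _ _ this] obtain l
    where l: "e2pi \<tau> ^ l * e2pi z = 1 \<or> e2pi \<tau> ^ Suc l * inverse (e2pi z) = 1" by auto
  have pw: "e2pi \<tau> ^ n = e2pi (of_int (int n) * \<tau>)" for n
    by (simp only: e2pi_of_int_mult power_int_of_nat)
  from l show ?thesis
  proof
    assume "e2pi \<tau> ^ l * e2pi z = 1"
    then have "e2pi (of_int (int l) * \<tau> + z) = 1" by (simp only: pw e2pi_add)
    then obtain k :: int where "of_int (int l) * \<tau> + z = of_int k" by (auto simp: e2pi_eq_1_iff elim: Ints_cases)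
    then have "z = of_int k + of_int (- int l) * \<tau>" by (simp add: algebra_simps)
    then show ?thesis by blast
  next
    assume "e2pi \<tau> ^ Suc l * inverse (e2pi z) = 1"
    then have "e2pi (of_int (int (Suc l)) * \<tau> - z) = 1" by (simp only: pw e2pi_diff divide_inverse)
    then obtain k :: int where "of_int (int (Suc l)) * \<tau> - z = of_int k" by (auto simp: e2pi_eq_1_iff elim: Ints_cases)
    then have "z = of_int (- k) + of_int (int (Suc l)) * \<tau>" by (simp add: algebra_simps)
    then show ?thesis by blast
  qed
qed

text \<open>The halves \<open>n \<ge> 0\<close> and \<open>n \<le> 0\<close> are values of one
  entire power series, at \<open>x\<close> and at \<open>q / x\<close>; the term
  \<open>n = 0\<close> is counted twice, hence the \<open>- 1\<close>. Holomorphy of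
  \<open>theta1\<close> follows from this form.\<close>

lemma theta_series_eq_powser:
  assumes q: "norm q < 1" "q \<noteq> 0" and x: "x \<noteq> 0"
  defines "G \<equiv> \<lambda>x. \<Sum>n. q ^ (n choose 2) * x ^ n"
  shows "theta_series q x = G x + G (q / x) - 1"
proof -
  let ?t = "theta_term q x"
  have sm: "?t summable_on A" for A
    using abs_summable_summable[OF theta_term_summable[OF q x]] summable_on_subset_banach by blast
  have S: "infsum (\<lambda>n. q ^ (n choose 2) * y ^ n) UNIV = G y" for y
    unfolding G_def using norm_summable_imp_has_sum[OF summable_theta_power[OF q(1), of y] summable_sums[OF summable_norm_cancel[OF summable_theta_power[OF q(1), of y]]]]
    by (rule infsumI)
  have "infsum ?t UNIV = infsum ?t (range int \<union> range (\<lambda>n. - int n))"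
  proof -
    have "n \<in> range int \<union> range (\<lambda>n. - int n)" for n :: int
      by (cases n rule: int_cases2) auto
    then have "range int \<union> range (\<lambda>n. - int n) = UNIV" by blast
    then show ?thesis by simp
  qed
  also have "\<dots> = infsum ?t (range int) + infsum ?t (range (\<lambda>n. - int n)) - infsum ?t (range int \<inter> range (\<lambda>n. - int n))"
    by (intro infsum_Un_Int sm)
  also have "range int \<inter> range (\<lambda>n. - int n) = {0}" by auto
  also have "infsum ?t (range int) = G x"
    by (subst infsum_reindex) (auto simp: o_def theta_term_of_nat S inj_on_def)
  also have "infsum ?t (range (\<lambda>n. - int n)) = G (q / x)"
    using q x by (subst infsum_reindex) (auto simp: o_def theta_term_uminus_of_nat S inj_on_def)
  finally show ?thesis by (simp add: theta_series_def theta_term_def tri_def)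
qed

lemma theta1_holomorphic:
  assumes \<tau>: "0 < Im \<tau>"
  shows "theta1 \<tau> holomorphic_on A"
proof -
  define q where "q = e2pi \<tau>"
  have q: "norm q < 1" "q \<noteq> 0" using e2pi_nome[OF \<tau>] by (auto simp: q_def)
  define G where "G = (\<lambda>x. \<Sum>n. q ^ (n choose 2) * x ^ n)"
  have "(G has_field_derivative (\<Sum>n. diffs (\<lambda>n. q ^ (n choose 2)) n * x ^ n)) (at x)" for x
    unfolding G_def using summable_norm_cancel[OF summable_theta_power[OF q(1)]]
    by (rule termdiffs_strong_converges_everywhere)
  then have G: "G holomorphic_on B" for B
    by (meson DERIV_subset holomorphic_on_def field_differentiable_def has_field_derivative_at_within)
  have e: "e2pi holomorphic_on B" for B
    unfolding e2pi_def by (intro holomorphic_intros)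
  have GG: "(\<lambda>z. G (h z)) holomorphic_on A" if "h holomorphic_on A" for h
    using holomorphic_on_compose[OF that G] by (simp add: o_def)
  have ee: "(\<lambda>z. e2pi (h z)) holomorphic_on A" if "h holomorphic_on A" for h
    using holomorphic_on_compose[OF that e] by (simp add: o_def)
  have "(\<lambda>z. \<i> * e2pi (\<tau> / 8) * e2pi (- z / 2) * (G (- e2pi z) + G (q / (- e2pi z)) - 1)) holomorphic_on A"
    by (intro holomorphic_intros GG ee) auto
  moreover have "theta1 \<tau> = (\<lambda>z. \<i> * e2pi (\<tau> / 8) * e2pi (- z / 2) * (G (- e2pi z) + G (q / (- e2pi z)) - 1))"
    using theta_series_eq_powser[OF q] by (auto simp: theta1_eq_series[OF \<tau>] q_def[symmetric] G_def)
  ultimately show ?thesis by simp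
qed

section \<open>Kronecker's formula\<close>

text \<open>Half the sum of the two signs, except on the boundary: \<open>x = 0\<close> counts as
  negative and \<open>y = 0\<close> as positive. For integers this is the pattern of the expansion
  in \<open>kron_term\<close>, and it explains why later \<open>x\<close> is shifted down and
  \<open>y\<close> is shifted up.\<close>

definition sgn_pair :: "real \<Rightarrow> real \<Rightarrow> real" where
  "sgn_pair x y = (if 0 < x then 1 else 0) - (if y < 0 then 1 else 0)"

lemma summable_on_powr_abs_int:
  fixes r :: real
  assumes "0 \<le> r" "r < 1"
  shows "(\<lambda>n. r ^ nat \<bar>n\<bar>) summable_on (UNIV :: int set)"
  using assms by (intro summable_on_int_halves) auto

lemma norm_summable_on_product:
  fixes f :: "'a \<Rightarrow> complex" and g :: "'b \<Rightarrow> complex"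
  assumes f: "(\<lambda>x. norm (f x)) summable_on A" and g: "(\<lambda>y. norm (g y)) summable_on B"
  shows "(\<lambda>(x,y). norm (f x * g y)) summable_on A \<times> B"
proof -
  have "(\<lambda>p. norm ((\<lambda>(x,y). f x * g y) p)) summable_on A \<times> B"
  proof (rule Infinite_Sum.abs_summable_on_Sigma_iff[THEN iffD2], intro conjI ballI)
    fix x assume "x \<in> A"
    show "(\<lambda>y. norm (case (x, y) of (x, y) \<Rightarrow> f x * g y)) summable_on B"
      using g by (simp add: norm_mult summable_on_cmult_right)
  next
    have "(\<lambda>x. norm (\<Sum>\<^sub>\<infinity>y\<in>B. norm (f x * g y))) = (\<lambda>x. norm (f x) * norm (\<Sum>\<^sub>\<infinity>y\<in>B. norm (g y)))"
      by (simp add: norm_mult infsum_cmult_right' abs_mult)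
    then show "(\<lambda>x. norm (\<Sum>\<^sub>\<infinity>y\<in>B. norm (case (x, y) of (x, y) \<Rightarrow> f x * g y))) summable_on A"
      using f by (simp add: summable_on_cmult_left)
  qed
  then show ?thesis by (simp add: case_prod_unfold)
qed

text \<open>With \<open>q = e2pi \<tau>\<close> and \<open>w = e2pi (- z)\<close> the inequalities
  mean \<open>0 < Im z < Im \<tau>\<close>. They keep \<open>w * q powi m\<close> off the unit
  circle for every integer \<open>m\<close>.\<close>

locale kronecker_params =
  fixes q w :: complex
  assumes q0: "q \<noteq> 0" and q1: "norm q < 1" and w1: "1 < norm w" and wq: "norm w * norm q < 1"
begin

definition coef :: "int \<Rightarrow> complex" where
  "coef m = inverse (1 - w * q powi m)"

definition gap :: real where
  "gap = min (norm w - 1) (1 - norm w * norm q)"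

lemma gap_pos: "0 < gap"
  using w1 wq by (simp add: gap_def)

lemma norm_wq_pos:
  assumes "1 \<le> m" shows "norm (w * q powi m) \<le> norm w * norm q"
proof -
  have "norm q powi m \<le> norm q powi 1"
    using q0 q1 assms by (intro power_int_decreasing) auto
  then show ?thesis by (simp add: norm_mult norm_power_int mult_left_mono)
qed

lemma norm_wq_nonpos:
  assumes "m \<le> 0" shows "norm w \<le> norm (w * q powi m)"
proof -
  have "norm q powi 0 \<le> norm q powi m"
    using q0 q1 assms by (intro power_int_decreasing) auto
  then show ?thesis
    using w1 mult_left_mono[of 1 "norm q powi m" "norm w"] by (simp add: norm_mult norm_power_int)
qed

lemma gap_le: "gap \<le> norm (1 - w * q powi m)"
proof (cases "1 \<le> m")
  case True
  then show ?thesis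
    using norm_wq_pos[OF True] norm_triangle_ineq2[of 1 "w * q powi m"] by (simp add: gap_def)
next
  case False
  then show ?thesis
    using norm_wq_nonpos[of m] norm_triangle_ineq2[of "w * q powi m" 1]
    by (simp add: gap_def norm_minus_commute)
qed

lemma norm_coef: "norm (coef m) \<le> inverse gap"
  using gap_le[of m] gap_pos by (simp add: coef_def norm_inverse le_imp_inverse_le)

lemma wq_ne_1: "1 - w * q powi m \<noteq> 0"
  using gap_le[of m] gap_pos by auto

text \<open>The coefficient of \<open>p powi N\<close> in the product of the Laurent series
  \<open>theta_series q (- p)\<close> and \<open>lerch p\<close>.\<close>

definition conv :: "int \<Rightarrow> complex" where
  "conv N = (\<Sum>\<^sub>\<infinity>n\<in>UNIV. theta_term q (- 1) n * coef (N - n))"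

lemma conv_summable: "(\<lambda>n. theta_term q (- 1) n * coef (N - n)) summable_on UNIV"
proof (rule abs_summable_summable, rule summable_on_comparison_test)
  show "(\<lambda>n. norm (theta_term q (- 1) n) * inverse gap) summable_on UNIV"
    using theta_term_summable[OF q1 q0] by (intro summable_on_cmult_left) auto
  show "norm (theta_term q (- 1) n * coef (N - n)) \<le> norm (theta_term q (- 1) n) * inverse gap" for n
    unfolding norm_mult by (intro mult_left_mono norm_coef) auto
qed auto

text \<open>From \<open>1 / (1 - X) = 1 + X / (1 - X)\<close> with
  \<open>X = w * q powi (N - n)\<close>, the shifted sum is a multiple of \<open>conv N\<close> plus
  \<open>theta_series q (- 1)\<close>, which is 0. The resulting recursion is the one satisfied by
  the coefficients of theta at \<open>w * p\<close>.\<close>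

lemma conv_add_1: "conv (N + 1) = - w * q powi N * conv N"
proof -
  let ?t = "theta_term q (- 1)"
  have sh: "?t (n + 1) = - (q powi n) * ?t n" for n
    using q0 by (simp add: theta_term_def tri_add1 power_int_add)
  have "conv (N + 1) = (\<Sum>\<^sub>\<infinity>n\<in>UNIV. ?t (n + 1) * coef (N - n))"
    unfolding conv_def
    by (rule infsum_reindex_bij_witness[of _ "\<lambda>n. n + 1" "\<lambda>n. n - 1"]) (auto simp: algebra_simps)
  also have "\<dots> = (\<Sum>\<^sub>\<infinity>n\<in>UNIV. ?t (n + 1) + (- w * q powi N) * (?t n * coef (N - n)))"
  proof (rule infsum_cong)
    fix n :: int
    have "q powi n * coef (N - n) = q powi n + w * q powi N * coef (N - n)"
    proof -
      have "q powi N = q powi n * q powi (N - n)" using q0 by (simp add: power_int_diff)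
      then show ?thesis using wq_ne_1[of "N - n"] by (simp add: coef_def field_simps)
    qed
    then have "- ?t n * (q powi n * coef (N - n)) = - ?t n * (q powi n + w * q powi N * coef (N - n))"
      by simp
    then show "?t (n + 1) * coef (N - n) = ?t (n + 1) + (- w * q powi N) * (?t n * coef (N - n))"
      unfolding sh by (simp add: algebra_simps)
  qed
  also have "\<dots> = (\<Sum>\<^sub>\<infinity>n\<in>UNIV. ?t (n + 1)) + (\<Sum>\<^sub>\<infinity>n\<in>UNIV. (- w * q powi N) * (?t n * coef (N - n)))"
  proof (rule infsum_add)
    have "?t summable_on UNIV"
      using abs_summable_summable[OF theta_term_summable[OF q1 q0]] by simp
    then show "(\<lambda>n. ?t (n + 1)) summable_on UNIV"
      by (rule summable_on_reindex_bij_witness[where i="\<lambda>n. n - 1" and j="\<lambda>n. n + 1", THEN iffD2, rotated 5]) auto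
    show "(\<lambda>n. (- w * q powi N) * (?t n * coef (N - n))) summable_on UNIV"
      by (rule summable_on_cmult_right[OF conv_summable])
  qed
  also have "(\<Sum>\<^sub>\<infinity>n\<in>UNIV. ?t (n + 1)) = theta_series q (- 1)"
    unfolding theta_series_def
    by (rule infsum_reindex_bij_witness[of _ "\<lambda>n. n - 1" "\<lambda>n. n + 1"]) auto
  also have "theta_series q (- 1) = 0" by (rule theta_series_minus_1)
  also have "(\<Sum>\<^sub>\<infinity>n\<in>UNIV. (- w * q powi N) * (?t n * coef (N - n))) = - w * q powi N * conv N"
    unfolding conv_def by (rule infsum_cmult_right')
  finally show ?thesis by simp
qed

lemma conv_eq: "conv N = conv 0 * theta_term q (- w) N"
proof (induction N rule: int_induct[where k=0])
  case base
  then show ?case by (simp add: theta_term_def tri_def)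
next
  case (step1 N)
  then show ?case
    using q0 w1 by (simp add: conv_add_1 theta_term_def tri_add1 power_int_add)
next
  case (step2 N)
  have w0: "w \<noteq> 0" using w1 by auto
  have "- w * q powi (N - 1) * conv (N - 1) = conv 0 * theta_term q (- w) N"
    using conv_add_1[of "N - 1"] step2 by simp
  moreover have "theta_term q (- w) N = - w * q powi (N - 1) * theta_term q (- w) (N - 1)"
    using q0 w0 tri_add1[of "N - 1"] by (simp add: theta_term_def power_int_add power_int_diff)
  ultimately show ?case using q0 w0 by simp
qed

definition lerch :: "complex \<Rightarrow> complex" where
  "lerch p = (\<Sum>\<^sub>\<infinity>m\<in>UNIV. p powi m * coef m)"

text \<open>For negative \<open>m\<close> the power \<open>p powi m\<close> grows; the decay of
  \<open>coef m\<close> like \<open>norm q ^ nat (- m)\<close> outweighs it as long as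
  \<open>norm q < norm p\<close>.\<close>

lemma norm_coef_nonpos:
  assumes "m \<le> 0"
  shows "norm (coef m) \<le> inverse (norm w - 1) * norm q ^ nat (- m)"
proof -
  have a: "norm (w * q powi m) = norm w * norm q powi m" by (simp add: norm_mult norm_power_int)
  have b: "1 \<le> norm q powi m"
    using power_int_decreasing[of m 0 "norm q"] q0 q1 assms by auto
  have "(norm w - 1) * norm q powi m \<le> norm (w * q powi m) - 1"
    unfolding a using b by (simp add: algebra_simps)
  also have "\<dots> \<le> norm (1 - w * q powi m)"
    using norm_triangle_ineq2[of "w * q powi m" 1] by (simp add: norm_minus_commute)
  finally have "inverse (norm (1 - w * q powi m)) \<le> inverse ((norm w - 1) * norm q powi m)"
    using w1 q0 by (intro le_imp_inverse_le) auto
  also have "norm q powi m = inverse (norm q ^ nat (- m))"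
    using assms q0 power_int_minus[of "norm q" "- m"] by (simp add: power_int_def)
  finally show ?thesis by (simp add: coef_def norm_inverse)
qed

lemma lerch_summable:
  assumes p: "norm q < norm p" "norm p < 1"
  shows "(\<lambda>m. norm (p powi m * coef m)) summable_on UNIV"
proof -
  define r where "r = max (norm p) (norm q / norm p)"
  have p0: "p \<noteq> 0" using p(1) by auto
  have r: "0 \<le> r" "r < 1" using p p0 by (auto simp: r_def max_def field_simps)
  define C where "C = max (inverse gap) (inverse (norm w - 1))"
  have bound: "norm (p powi m * coef m) \<le> C * r ^ nat \<bar>m\<bar>" for m
  proof (cases "1 \<le> m")
    case True
    then have "norm (p powi m) = norm p ^ nat \<bar>m\<bar>" by (simp add: norm_power power_int_def)
    also have "\<dots> \<le> r ^ nat \<bar>m\<bar>" by (intro power_mono) (auto simp: r_def)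
    finally have "norm (p powi m) * norm (coef m) \<le> r ^ nat \<bar>m\<bar> * C"
      using norm_coef[of m] r by (intro mult_mono) (auto simp: C_def)
    then show ?thesis by (simp add: norm_mult mult.commute)
  next
    case False
    have "norm (p powi m) = inverse (norm p) ^ nat \<bar>m\<bar>"
      using False by (auto simp: norm_power power_int_def norm_inverse)
    then have "norm (p powi m) * norm (coef m)
        \<le> inverse (norm p) ^ nat \<bar>m\<bar> * (inverse (norm w - 1) * norm q ^ nat \<bar>m\<bar>)"
      using norm_coef_nonpos[of m] False by (auto intro!: mult_left_mono)
    also have "\<dots> = inverse (norm w - 1) * (norm q / norm p) ^ nat \<bar>m\<bar>"
      by (simp add: power_mult_distrib power_divide divide_inverse)
    also have "\<dots> \<le> C * r ^ nat \<bar>m\<bar>"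
      using w1 p0 gap_pos by (intro mult_mono power_mono) (auto simp: C_def r_def le_max_iff_disj)
    finally show ?thesis by (simp add: norm_mult)
  qed
  show ?thesis
    by (rule summable_on_comparison_test[OF summable_on_cmult_right[OF summable_on_powr_abs_int[OF r]]])
       (use bound in auto)
qed

text \<open>Cauchy product of two absolutely convergent Laurent series, summed along
  \<open>n + m = N\<close>. The coefficients are those of theta at \<open>w * p\<close> by
  \<open>conv_eq\<close>, up to the factor \<open>conv 0\<close>.\<close>

lemma theta_lerch:
  assumes p: "norm q < norm p" "norm p < 1"
  shows "theta_series q (- p) * lerch p = conv 0 * theta_series q (- (w * p))"
proof -
  have p0: "p \<noteq> 0" using p(1) by auto
  have w0: "w \<noteq> 0" using w1 by auto
  let ?f = "\<lambda>(n, m). theta_term q (- p) n * (p powi m * coef m)"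
  have "(\<lambda>x. norm (?f x)) summable_on UNIV \<times> UNIV"
    using norm_summable_on_product[OF theta_term_summable[OF q1 q0, of "- p", unfolded neg_equal_0_iff_equal, OF p0] lerch_summable[OF p]]
    by (simp add: case_prod_unfold)
  then have sm: "?f summable_on UNIV \<times> UNIV"
    by (rule abs_summable_summable)
  have "theta_series q (- p) * lerch p = (\<Sum>\<^sub>\<infinity>n\<in>UNIV. \<Sum>\<^sub>\<infinity>m\<in>UNIV. ?f (n, m))"
    unfolding theta_series_def infsum_cmult_left'[symmetric]
    by (simp only: prod.case infsum_cmult_right' lerch_def)
  also have "\<dots> = infsum ?f (UNIV \<times> UNIV)"
    using infsum_Sigma'_banach[of "\<lambda>n m. ?f (n, m)" UNIV "\<lambda>_. UNIV"] sm by simp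
  also have "\<dots> = infsum (\<lambda>(N, n). ?f (n, N - n)) (UNIV \<times> UNIV)"
    by (rule infsum_reindex_bij_witness[of _ "\<lambda>(N, n). (n, N - n)" "\<lambda>(n, m). (n + m, n)"]) auto
  also have "\<dots> = (\<Sum>\<^sub>\<infinity>N\<in>UNIV. \<Sum>\<^sub>\<infinity>n\<in>UNIV. ?f (n, N - n))"
  proof -
    have "(\<lambda>(N, n). ?f (n, N - n)) summable_on UNIV \<times> UNIV"
      using sm by (rule summable_on_reindex_bij_witness[where i="\<lambda>(n, m). (n + m, n)" and j="\<lambda>(N, n). (n, N - n)", THEN iffD2, rotated 5]) auto
    then show ?thesis
      using infsum_Sigma'_banach[of "\<lambda>N n. ?f (n, N - n)" UNIV "\<lambda>_. UNIV"] by simp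
  qed
  also have "\<dots> = (\<Sum>\<^sub>\<infinity>N\<in>UNIV. conv 0 * theta_term q (- (w * p)) N)"
  proof (rule infsum_cong)
    fix N :: int
    have "(\<Sum>\<^sub>\<infinity>n\<in>UNIV. ?f (n, N - n)) = (\<Sum>\<^sub>\<infinity>n\<in>UNIV. p powi N * (theta_term q (- 1) n * coef (N - n)))"
    proof (rule infsum_cong)
      fix n :: int
      have "(- p) powi n * p powi (N - n) = p powi N * (- 1) powi n"
        using p0 power_int_mult_distrib[of "- 1" p n] by (simp add: power_int_diff)
      then show "?f (n, N - n) = p powi N * (theta_term q (- 1) n * coef (N - n))"
        by (simp add: theta_term_def algebra_simps)
    qed
    also have "\<dots> = p powi N * conv N" unfolding conv_def by (rule infsum_cmult_right')
    also have "\<dots> = conv 0 * theta_term q (- (w * p)) N"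
      using power_int_mult_distrib[of "- w" p N] by (simp add: conv_eq[of N] theta_term_def)
    finally show "(\<Sum>\<^sub>\<infinity>n\<in>UNIV. ?f (n, N - n)) = conv 0 * theta_term q (- (w * p)) N" .
  qed
  also have "\<dots> = conv 0 * theta_series q (- (w * p))"
    unfolding theta_series_def by (rule infsum_cmult_right')
  finally show ?thesis .
qed

text \<open>The zeros in \<open>p\<close> have modulus a power of \<open>norm q\<close>, and none of
  these lies strictly between \<open>norm q\<close> and 1.\<close>

lemma theta_series_annulus_nonzero:
  assumes p: "norm q < norm p" "norm p < 1"
  shows "theta_series q (- p) \<noteq> 0"
proof
  assume "theta_series q (- p) = 0"
  moreover have p0: "p \<noteq> 0" using p(1) by auto
  ultimately obtain l where l: "q ^ l * p = 1 \<or> q ^ Suc l * inverse p = 1"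
    using theta_series_eq_0D[OF q1 q0] by blast
  have ql: "norm q ^ l \<le> 1" using q1 by (simp add: power_le_one)
  have "norm (q ^ l * p) \<le> 1 * norm p" unfolding norm_mult norm_power using ql by (intro mult_right_mono) auto
  moreover have "norm (q ^ Suc l * inverse p) \<le> 1 * (norm q * inverse (norm p))"
    unfolding norm_mult norm_power norm_inverse power_Suc2 mult.assoc
    using ql by (intro mult_right_mono) auto
  moreover have "norm q * inverse (norm p) < 1" using p p0 by (simp add: field_simps)
  ultimately show False using l p(2) by (auto simp del: power_Suc)
qed

text \<open>The series \<open>lerch\<close> blows up as \<open>p\<close> tends to \<open>1\<close>, hence it is not identically zero.\<close>

lemma conv_0_nonzero: "conv 0 \<noteq> 0"
proof
  assume 0: "conv 0 = 0"
  define r where "r = (1 + norm q) / 2"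
  have r: "norm q < r" "r < 1" "0 < r" using q1 by (auto simp: r_def field_simps intro: add_pos_nonneg)
  define \<rho> where "\<rho> = norm q / r"
  have \<rho>: "0 \<le> \<rho>" "\<rho> < 1" "norm q \<le> \<rho>" using r q1 mult_left_le[of r "norm q"] by (auto simp: \<rho>_def le_divide_eq divide_less_eq mult.commute)
  define C where "C = max (norm w * inverse gap) (inverse (norm w - 1))"
  define K where "K = (\<Sum>\<^sub>\<infinity>m\<in>UNIV. C * \<rho> ^ nat \<bar>m :: int\<bar>)"
  have Ks: "(\<lambda>m. C * \<rho> ^ nat \<bar>m\<bar>) summable_on (UNIV :: int set)"
    by (rule summable_on_cmult_right[OF summable_on_powr_abs_int[OF \<rho>(1,2)]])
  \<comment> \<open>If \<open>conv 0\<close> were 0, \<open>lerch p\<close> would vanish on the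
    whole annulus. Removing the plain geometric series \<open>h\<close> from it leaves a series
    bounded by \<open>K\<close> uniformly up to \<open>p = 1\<close>, so \<open>p / (1 - p)\<close>
    would be bounded there.\<close>
  have main: "t / (1 - t) \<le> K" if t: "r \<le> t" "t < 1" for t :: real
  proof -
    define p :: complex where "p = of_real t"
    have np: "norm p = t" using t r by (simp add: p_def)
    have p0: "p \<noteq> 0" using np t r by auto
    have p: "norm q < norm p" "norm p < 1" using np t r by auto
    define h :: "int \<Rightarrow> complex" where "h = (\<lambda>m. if 1 \<le> m then p powi m else 0)"
    have hsum: "(h has_sum (p / (1 - p))) UNIV"
    proof -
      have "((\<lambda>n. p ^ n) has_sum (p / (1 - p))) {1..}"
        using has_sum_geometric_from_1[of p] p(2) by simp
      then have "((\<lambda>m. p ^ nat m) has_sum (p / (1 - p))) {1..}"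
        by (rule has_sum_reindex_bij_witness[where i=int and j=nat, THEN iffD2, rotated 6]) auto
      moreover have "h m = (if 1 \<le> m then p ^ nat m else 0)" for m
        by (simp add: h_def power_int_def)
      ultimately show ?thesis
        by (subst has_sum_cong_neutral[where T="{1..}" and g="\<lambda>m. p ^ nat m"]) auto
    qed
    have "lerch p = 0"
      using theta_lerch[OF p] theta_series_annulus_nonzero[OF p] 0 by simp
    have gs: "(\<lambda>m. p powi m * coef m) summable_on UNIV"
      by (rule abs_summable_summable[OF lerch_summable[OF p]])
    have hs: "h summable_on UNIV" using hsum by (rule has_sum_imp_summable)
    have "((\<lambda>m. p powi m * coef m + - h m) has_sum (lerch p + - (p / (1 - p)))) UNIV"
      using gs unfolding lerch_def by (intro has_sum_add has_sum_infsum has_sum_uminus[THEN iffD2]) (auto intro: hsum)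
    then have hd: "((\<lambda>m. p powi m * coef m - h m) has_sum (lerch p - p / (1 - p))) UNIV" by simp
    then have "infsum (\<lambda>m. p powi m * coef m - h m) UNIV = lerch p - p / (1 - p)"
      by (rule infsumI)
    then have "norm (p / (1 - p)) = norm (infsum (\<lambda>m. p powi m * coef m - h m) UNIV)"
      using \<open>lerch p = 0\<close> by simp
    also have "\<dots> \<le> K"
      unfolding K_def
    proof (rule norm_infsum_le)
      show "((\<lambda>m. p powi m * coef m - h m) has_sum infsum (\<lambda>m. p powi m * coef m - h m) UNIV) UNIV"
        using hd by (intro has_sum_infsum has_sum_imp_summable)
      show "((\<lambda>m. C * \<rho> ^ nat \<bar>m\<bar>) has_sum (\<Sum>\<^sub>\<infinity>m\<in>UNIV. C * \<rho> ^ nat \<bar>m :: int\<bar>)) UNIV"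
        by (intro has_sum_infsum Ks)
      fix m :: int
      show "norm (p powi m * coef m - h m) \<le> C * \<rho> ^ nat \<bar>m\<bar>"
      proof (cases "1 \<le> m")
        case True
        \<comment> \<open>Subtracting 1 from \<open>1 / (1 - w * q powi m)\<close> leaves a factor
          \<open>w * q powi m\<close>, and this supplies decay independent of
          \<open>p\<close>.\<close>
        have "p powi m * coef m - h m = p powi m * (w * q powi m * coef m)"
          using True wq_ne_1[of m] by (simp add: h_def coef_def field_simps)
        then have "norm (p powi m * coef m - h m) = norm p powi m * ((norm w * norm (coef m)) * norm q powi m)"
          by (simp add: norm_mult norm_power_int)
        also have "\<dots> \<le> 1 * ((norm w * inverse gap) * \<rho> ^ nat \<bar>m\<bar>)"
          using True p \<rho> q1 norm_coef[of m] gap_pos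
          by (intro mult_mono) (auto simp: power_int_def power_le_one intro!: power_mono)
        also have "\<dots> \<le> C * \<rho> ^ nat \<bar>m\<bar>" using \<rho> by (auto simp: C_def intro!: mult_right_mono)
        finally show ?thesis .
      next
        case False
        have "norm (p powi m * coef m - h m) = inverse (norm p) ^ nat \<bar>m\<bar> * norm (coef m)"
          using False by (auto simp: h_def norm_mult norm_power power_int_def norm_inverse)
        also have "\<dots> \<le> inverse (norm p) ^ nat \<bar>m\<bar> * (inverse (norm w - 1) * norm q ^ nat \<bar>m\<bar>)"
          using norm_coef_nonpos[of m] False by (auto intro!: mult_left_mono)
        also have "\<dots> = inverse (norm w - 1) * (norm q / norm p) ^ nat \<bar>m\<bar>"
          by (simp add: power_mult_distrib power_divide divide_inverse)
        also have "\<dots> \<le> C * \<rho> ^ nat \<bar>m\<bar>"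
          using w1 np t r gap_pos p0 by (intro mult_mono power_mono) (auto simp: C_def \<rho>_def le_max_iff_disj intro!: divide_left_mono mult_pos_pos)
        finally show ?thesis .
      qed
    qed
    also have "norm (p / (1 - p)) = t / (1 - t)"
    proof -
      have "1 - p = of_real (1 - t)" by (simp add: p_def)
      then show ?thesis using np t by (simp add: norm_divide del: of_real_diff)
    qed
    finally show ?thesis .
  qed
  have "0 < r / (1 - r)" using r by simp
  then have K: "0 < K" using main[of r] r by linarith
  \<comment> \<open>The bound forces \<open>t \<le> K / (1 + K)\<close>; the value
    \<open>(K + 1) / (K + 2)\<close> is the same expression with \<open>K + 1\<close> for
    \<open>K\<close>, hence larger and still below 1.\<close>
  define t where "t = max r ((K + 1) / (K + 2))"
  have t: "r \<le> t" "t < 1" "(K + 1) / (K + 2) \<le> t" using K r by (auto simp: t_def)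
  have "t \<le> K * (1 - t)" using main[OF t(1,2)] t by (simp add: field_simps)
  then have "t * (1 + K) \<le> K" by (simp add: algebra_simps)
  then have "t \<le> K / (1 + K)" using K by (simp add: field_simps)
  also have "\<dots> < (K + 1) / (K + 2)" using K by (simp add: field_simps)
  finally show False using t(3) by simp
qed

text \<open>The double series behind \<open>lerch\<close>: \<open>coef m\<close> is expanded in
  powers \<open>k \<ge> 0\<close> of \<open>w * q powi m\<close> when \<open>m \<ge> 1\<close>, and
  in powers \<open>k < 0\<close> with a minus sign when \<open>m \<le> 0\<close>.\<close>

definition kron_term :: "complex \<Rightarrow> int \<times> int \<Rightarrow> complex" where
  "kron_term p = (\<lambda>(m, k). of_real (sgn_pair (of_int m) (of_int k)) * (p powi m * w powi k * q powi (m * k)))"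

lemma kron_term_summable:
  assumes p: "norm q < norm p" "norm p < 1"
  shows "(\<lambda>x. norm (kron_term p x)) summable_on UNIV"
proof -
  have p0: "p \<noteq> 0" and w0: "w \<noteq> 0" using p(1) w1 by auto
  define r where "r = max (norm p) (norm q / norm p)"
  have r: "0 \<le> r" "r < 1" using p p0 by (auto simp: r_def max_def field_simps)
  define \<rho> where "\<rho> = max (norm w * norm q) (inverse (norm w))"
  have \<rho>: "0 \<le> \<rho>" "\<rho> < 1" using wq one_less_inverse_iff[of "inverse (norm w)"] inverse_less_1_iff[of "norm w"] w1 by (auto simp: \<rho>_def max_def)
  have "(\<lambda>(m, k). norm (of_real (r ^ nat \<bar>m\<bar>) * of_real (\<rho> ^ nat \<bar>k\<bar>) :: complex)) summable_on (UNIV :: int set) \<times> (UNIV :: int set)"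
    using summable_on_powr_abs_int[OF r] summable_on_powr_abs_int[OF \<rho>] r \<rho>
    by (intro norm_summable_on_product) (auto simp: norm_power)
  then have "(\<lambda>(m, k). r ^ nat \<bar>m\<bar> * \<rho> ^ nat \<bar>k\<bar>) summable_on (UNIV :: int set) \<times> (UNIV :: int set)"
    using r \<rho> by (simp add: norm_mult norm_power)
  then have "(\<lambda>x. case x of (m, k) \<Rightarrow> r ^ nat \<bar>m\<bar> * \<rho> ^ nat \<bar>k\<bar>) summable_on (UNIV :: (int \<times> int) set)"
    by simp
  then show ?thesis
  proof (rule summable_on_comparison_test)
    fix x :: "int \<times> int"
    obtain m k where x: "x = (m, k)" by (cases x)
    have n: "norm (p powi m * w powi k * q powi (m * k)) = norm p powi m * norm w powi k * norm q powi (m * k)"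
      by (simp add: norm_mult norm_power_int)
    have "norm (kron_term p (m, k)) \<le> r ^ nat \<bar>m\<bar> * \<rho> ^ nat \<bar>k\<bar>"
    proof -
      consider "1 \<le> m" "0 \<le> k" | "m \<le> 0" "k < 0" | "1 \<le> m \<longleftrightarrow> k < 0" by linarith
      then show ?thesis
      proof cases
        case 1
        have e: "norm w powi k * norm q powi (m * k) = (norm w * norm q powi m) ^ nat \<bar>k\<bar>"
          using 1 by (simp add: power_int_mult power_mult_distrib) (simp add: power_int_def)
        have "norm q powi m \<le> norm q powi 1"
          using q0 q1 1 by (intro power_int_decreasing) auto
        then have "norm w * norm q powi m \<le> \<rho>"
          by (auto simp: \<rho>_def intro!: le_max_iff_disj[THEN iffD2] disjI1 mult_left_mono)
        then have "(norm w * norm q powi m) ^ nat \<bar>k\<bar> \<le> \<rho> ^ nat \<bar>k\<bar>" by (intro power_mono) auto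
        moreover have "norm p powi m \<le> r ^ nat \<bar>m\<bar>"
          using 1 by (auto simp: power_int_def r_def intro!: power_mono)
        ultimately have "norm p powi m * (norm w powi k * norm q powi (m * k)) \<le> r ^ nat \<bar>m\<bar> * \<rho> ^ nat \<bar>k\<bar>"
          unfolding e using r by (intro mult_mono) auto
        then show ?thesis using 1 n by (simp add: kron_term_def sgn_pair_def mult.assoc)
      next
        case 2
        define M where "M = nat (- m)"
        define J where "J = nat (- k)"
        have mk: "m = - int M" "k = - int J" "1 \<le> J" using 2 by (auto simp: M_def J_def)
        have "m * k = int (M * J)" by (simp add: mk(1,2))
        then have "norm q powi (m * k) = norm q ^ (M * J)" by (simp only: power_int_of_nat)
        moreover have "norm p powi m = inverse (norm p) ^ M"
          by (simp add: mk(1) power_int_minus power_inverse)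
        ultimately have "norm p powi m * norm q powi (m * k) = inverse (norm p) ^ M * norm q ^ (M * J)"
          by simp
        \<comment> \<open>One of the \<open>J \<ge> 1\<close> powers of \<open>norm q ^ M\<close>
          suffices to beat \<open>inverse (norm p) ^ M\<close>; the decay in \<open>k\<close> is
          left to the powers of \<open>w\<close>.\<close>
        also have "\<dots> \<le> inverse (norm p) ^ M * norm q ^ M"
          using q1 mk by (intro mult_left_mono power_decreasing) auto
        also have "\<dots> = (norm q / norm p) ^ M" by (simp add: power_mult_distrib divide_inverse)
        also have "\<dots> \<le> r ^ nat \<bar>m\<bar>" using mk by (auto simp: r_def intro!: power_mono)
        finally have a: "norm p powi m * norm q powi (m * k) \<le> r ^ nat \<bar>m\<bar>" .
        have b: "norm w powi k \<le> \<rho> ^ nat \<bar>k\<bar>"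
          using w1 unfolding mk(2) by (auto simp: \<rho>_def power_int_minus simp flip: power_inverse intro!: power_mono)
        have "(norm p powi m * norm q powi (m * k)) * norm w powi k \<le> r ^ nat \<bar>m\<bar> * \<rho> ^ nat \<bar>k\<bar>"
          using r by (intro mult_mono a b) auto
        then show ?thesis using 2 n by (simp add: kron_term_def sgn_pair_def mult_ac)
      next
        case 3
        then have "kron_term p (m, k) = 0" by (auto simp: kron_term_def sgn_pair_def)
        then show ?thesis using r \<rho> by simp
      qed
    qed
    then show "norm (kron_term p x) \<le> (case x of (m, k) \<Rightarrow> r ^ nat \<bar>m\<bar> * \<rho> ^ nat \<bar>k\<bar>)"
      by (simp add: x)
  qed auto
qed

lemma kron_term_sum:
  assumes p: "norm q < norm p" "norm p < 1"
  shows "infsum (kron_term p) UNIV = lerch p"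
proof -
  have p0: "p \<noteq> 0" and w0: "w \<noteq> 0" using p(1) w1 by auto
  have "infsum (kron_term p) (UNIV \<times> UNIV) = (\<Sum>\<^sub>\<infinity>m\<in>UNIV. \<Sum>\<^sub>\<infinity>k\<in>UNIV. kron_term p (m, k))"
    using infsum_Sigma'_banach[of "\<lambda>m k. kron_term p (m, k)" UNIV "\<lambda>_. UNIV"]
      abs_summable_summable[OF kron_term_summable[OF p]] by simp
  also have "\<dots> = lerch p"
    unfolding lerch_def
  proof (rule infsum_cong)
    fix m :: int
    define x where "x = w * q powi m"
    have x0: "x \<noteq> 0" using q0 w0 by (simp add: x_def)
    have t: "kron_term p (m, k) = of_real (sgn_pair (of_int m) (of_int k)) * (p powi m * x powi k)" for k
      by (simp add: kron_term_def x_def power_int_mult power_int_mult_distrib mult.assoc)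
    show "(\<Sum>\<^sub>\<infinity>k\<in>UNIV. kron_term p (m, k)) = p powi m * coef m"
    proof (cases "1 \<le> m")
      case True
      have x1: "norm x < 1" using norm_wq_pos[OF True] wq by (simp add: x_def)
      have "((\<lambda>n. x ^ n) has_sum (1 / (1 - x))) UNIV"
        using norm_summable_imp_has_sum[OF _ geometric_sums[OF x1]] x1 by (simp add: norm_power)
      then have "((\<lambda>k. x ^ nat k) has_sum (1 / (1 - x))) {0..}"
        by (rule has_sum_reindex_bij_witness[where i=int and j=nat, THEN iffD2, rotated 6]) auto
      then have "((\<lambda>k. p powi m * x ^ nat k) has_sum (p powi m * (1 / (1 - x)))) {0..}"
        by (rule has_sum_cmult_right)
      then have "((\<lambda>k. kron_term p (m, k)) has_sum (p powi m * (1 / (1 - x)))) UNIV"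
        by (subst has_sum_cong_neutral[where T="{0..}" and g="\<lambda>k. p powi m * x ^ nat k"])
           (use True in \<open>auto simp: t sgn_pair_def power_int_def\<close>)
      then show ?thesis by (simp add: infsumI coef_def x_def divide_inverse)
    next
      case False
      have x1: "norm (inverse x) < 1"
        using norm_wq_nonpos[of m] False w1 inverse_less_1_iff[of "norm x"] unfolding norm_inverse x_def by linarith
      have "((\<lambda>n. inverse x ^ n) has_sum (inverse x / (1 - inverse x))) {1..}"
        using has_sum_geometric_from_1[OF x1] by simp
      then have "((\<lambda>k. inverse x ^ nat (- k)) has_sum (inverse x / (1 - inverse x))) {..-1}"
        by (rule has_sum_reindex_bij_witness[where i="\<lambda>n. - int n" and j="\<lambda>k. nat (- k)", THEN iffD2, rotated 6]) auto
      then have "((\<lambda>k. (- (p powi m)) * inverse x ^ nat (- k)) has_sum ((- (p powi m)) * (inverse x / (1 - inverse x)))) {..-1}"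
        by (rule has_sum_cmult_right)
      then have "((\<lambda>k. kron_term p (m, k)) has_sum ((- (p powi m)) * (inverse x / (1 - inverse x)))) UNIV"
        by (subst has_sum_cong_neutral[where T="{..-1}" and g="\<lambda>k. (- (p powi m)) * inverse x ^ nat (- k)"])
           (use False in \<open>auto simp: t sgn_pair_def power_int_def\<close>)
      moreover have "- (inverse x / (1 - inverse x)) = coef m"
      proof -
        have "x \<noteq> 1" using wq_ne_1[of m] by (simp add: x_def)
        then show ?thesis using x0 unfolding coef_def x_def[symmetric] by (simp add: field_simps)
      qed
      ultimately show ?thesis by (metis infsumI minus_mult_commute)
    qed
  qed
  finally show ?thesis by simp
qed

end

text \<open>Kronecker's formula, with an unspecified constant that does not depend on \<open>u\<close>.\<close>

theorem kronecker_theta1: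
  assumes \<tau>: "0 < Im \<tau>" and z: "0 < Im z" "Im z < Im \<tau>"
  obtains C where "C \<noteq> 0"
    "\<And>u. 0 < Im u \<Longrightarrow> Im u < Im \<tau> \<Longrightarrow> theta1 \<tau> (z - u) / theta1 \<tau> u
      = C * (\<Sum>\<^sub>\<infinity>(m, k)\<in>UNIV. of_real (sgn_pair (of_int m) (of_int k))
               * e2pi (of_int m * u - of_int k * z + of_int (m * k) * \<tau>))"
    "\<And>u. 0 < Im u \<Longrightarrow> Im u < Im \<tau> \<Longrightarrow>
      (\<lambda>(m, k). norm (of_real (sgn_pair (of_int m) (of_int k))
               * e2pi (of_int m * u - of_int k * z + of_int (m * k) * \<tau>))) summable_on UNIV"
proof -
  define q where "q = e2pi \<tau>"
  define w where "w = e2pi (- z)"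
  have nq: "norm q = exp (- (2 * pi * Im \<tau>))" and nw: "norm w = exp (2 * pi * Im z)"
    by (simp_all add: q_def w_def norm_e2pi)
  interpret kronecker_params q w
  proof
    show "norm q < 1" using \<tau> by (simp add: nq)
    show "1 < norm w" using z by (simp add: nw)
    show "norm w * norm q < 1" using z by (simp add: nq nw exp_add[symmetric])
  qed (simp add: q_def)
  have pn: "norm q < norm (e2pi u)" "norm (e2pi u) < 1" if "0 < Im u" "Im u < Im \<tau>" for u
    using that by (simp_all add: nq norm_e2pi)
  have kt: "kron_term (e2pi u) = (\<lambda>(m, k). of_real (sgn_pair (of_int m) (of_int k))
               * e2pi (of_int m * u - of_int k * z + of_int (m * k) * \<tau>))" for u
  proof -
    have "e2pi (of_int m * u - of_int k * z + of_int (m * k) * \<tau>)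
       = e2pi u powi m * w powi k * q powi (m * k)" for m k
      unfolding e2pi_add e2pi_diff e2pi_of_int_mult q_def w_def e2pi_minus
      by (simp add: power_int_inverse divide_inverse)
    then show ?thesis by (simp add: kron_term_def fun_eq_iff)
  qed
  \<comment> \<open>The minus sign comes from
    \<open>theta1 \<tau> (z - u) = - theta1 \<tau> (u - z)\<close>, the exponential from the
    prefactors \<open>e2pi (- z / 2)\<close> of \<open>theta1\<close> in numerator and
    denominator.\<close>
  define C where "C = - e2pi (z / 2) / conv 0"
  show ?thesis
  proof
    show "C \<noteq> 0" using conv_0_nonzero by (simp add: C_def)
    fix u assume u: "0 < Im u" "Im u < Im \<tau>"
    show "(\<lambda>(m, k). norm (of_real (sgn_pair (of_int m) (of_int k))
               * e2pi (of_int m * u - of_int k * z + of_int (m * k) * \<tau>))) summable_on UNIV"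
      using kron_term_summable[OF pn[OF u]] unfolding kt case_prod_unfold .
    have nz: "theta_series q (- e2pi u) \<noteq> 0"
      by (rule theta_series_annulus_nonzero[OF pn[OF u]])
    have wu: "w * e2pi u = e2pi (u - z)"
      by (simp add: w_def e2pi_add[symmetric])
    have "theta1 \<tau> (z - u) = - theta1 \<tau> (u - z)"
      using theta1_minus[OF \<tau>, of "u - z"] by simp
    also have "\<dots> = - (\<i> * e2pi (\<tau> / 8) * e2pi (- (u - z) / 2) * theta_series q (- (w * e2pi u)))"
      by (simp only: theta1_eq_series[OF \<tau>] q_def wu)
    also have "e2pi (- (u - z) / 2) = e2pi (- u / 2) * e2pi (z / 2)"
      unfolding e2pi_add[symmetric] by (rule arg_cong[where f=e2pi]) (simp add: field_simps)
    also have "theta_series q (- (w * e2pi u)) = theta_series q (- e2pi u) * lerch (e2pi u) / conv 0"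
      using theta_lerch[OF pn[OF u]] conv_0_nonzero by simp
    finally have "theta1 \<tau> (z - u) / theta1 \<tau> u = C * lerch (e2pi u)"
      using nz conv_0_nonzero by (simp add: theta1_eq_series[OF \<tau>, of u] q_def[symmetric] C_def)
    then show "theta1 \<tau> (z - u) / theta1 \<tau> u
      = C * (\<Sum>\<^sub>\<infinity>(m, k)\<in>UNIV. of_real (sgn_pair (of_int m) (of_int k))
               * e2pi (of_int m * u - of_int k * z + of_int (m * k) * \<tau>))"
      using kron_term_sum[OF pn[OF u]] unfolding kt by simp
  qed
qed

section \<open>Sign products and dual lattices\<close>

text \<open>Vectors are functions and index sets are explicit finite sets, not types, because the
  induction on the number of variables shrinks them.\<close>

definition lin :: "'k set \<Rightarrow> ('k \<Rightarrow> real) \<Rightarrow> ('k \<Rightarrow> real) \<Rightarrow> real" where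
  "lin K c v = (\<Sum>i\<in>K. c i * v i)"

definition uvec :: "'k \<Rightarrow> 'k \<Rightarrow> real" where
  "uvec i = (\<lambda>k. if k = i then 1 else 0)"

lemma lin_add_right: "lin K c (\<lambda>i. v i + w i) = lin K c v + lin K c w"
  by (simp add: lin_def ring_distribs sum.distrib)

lemma lin_diff_right: "lin K c (\<lambda>i. v i - w i) = lin K c v - lin K c w"
  by (simp add: lin_def ring_distribs sum_subtractf)

lemma lin_scale_right: "lin K c (\<lambda>i. t * v i) = t * lin K c v"
  by (simp add: lin_def sum_distrib_left mult_ac)

lemma lin_minus_right: "lin K c (\<lambda>i. - v i) = - lin K c v"
  by (simp add: lin_def sum_negf)

lemma lin_diff_left: "lin K (\<lambda>i. c i - c' i) v = lin K c v - lin K c' v"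
  by (simp add: lin_def ring_distribs sum_subtractf)

lemma lin_scale_left: "lin K (\<lambda>i. t * c i) v = t * lin K c v"
  by (simp add: lin_def sum_distrib_left mult_ac)

lemma lin_uvec_right: "finite K \<Longrightarrow> p \<in> K \<Longrightarrow> lin K c (uvec p) = c p"
  by (simp add: lin_def uvec_def mult_delta_right)

lemma lin_uvec_left: "finite K \<Longrightarrow> p \<in> K \<Longrightarrow> lin K (uvec p) v = v p"
  by (simp add: lin_def uvec_def mult_delta_left)

lemma lin_sub_uvec:
  assumes "finite K" "p \<in> K"
  shows "lin K c (\<lambda>i. v i - t * uvec p i) = lin K c v - t * c p"
  using assms by (simp add: lin_diff_right lin_scale_right lin_uvec_right)

lemma sgn_pair_minus:
  assumes "x \<noteq> 0" "y \<noteq> 0"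
  shows "sgn_pair (- x) (- y) = - sgn_pair x y"
  using assms by (auto simp: sgn_pair_def)

lemma sgn_pair_scale:
  assumes "c \<noteq> 0" "x \<noteq> 0" "y \<noteq> 0"
  shows "sgn_pair (c * x) (y / c) = sgn c * sgn_pair x y"
  using assms by (auto simp: sgn_pair_def zero_less_mult_iff divide_less_0_iff sgn_if)

lemma abs_sgn_pair_le: "\<bar>sgn_pair x y\<bar> \<le> 1"
  by (simp add: sgn_pair_def)

text \<open>If the \<open>x j\<close> sum to zero, then at most two of the products below are nonzero, namely those for the
  index with the largest \<open>\<mu>\<close> among the negative \<open>x\<close> and for the index with the smallest \<open>\<mu>\<close>
  among the positive \<open>x\<close>; these two cancel.\<close>

lemma circuit_sign_sum:
  fixes x \<mu> :: "'a \<Rightarrow> real"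
  assumes fin: "finite T" and ne: "T \<noteq> {}" and x0: "\<And>t. t \<in> T \<Longrightarrow> x t \<noteq> 0"
    and sum0: "sum x T = 0" and inj: "inj_on \<mu> T"
  shows "(\<Sum>i\<in>T. \<Prod>j\<in>T-{i}. sgn_pair (x j) (\<mu> j - \<mu> i)) = 0"
proof -
  define N P where "N = {t\<in>T. x t < 0}" and "P = {t\<in>T. 0 < x t}"
  have NP: "T = N \<union> P" "N \<inter> P = {}" "finite N" "finite P"
    using x0 fin unfolding N_def P_def by (blast dest: linorder_neqE_linordered_idom, auto)
  have Nne: "N \<noteq> {}"
  proof
    assume "N = {}"
    then have "\<not> x t < 0" if "t \<in> T" for t using that unfolding N_def by blast
    then have "\<And>t. t \<in> T \<Longrightarrow> 0 < x t" using x0 by (meson linorder_neqE_linordered_idom)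
    then have "0 < sum x T" using fin ne by (intro sum_pos) auto
    then show False using sum0 by simp
  qed
  have Pne: "P \<noteq> {}"
  proof
    assume "P = {}"
    then have "\<not> 0 < x t" if "t \<in> T" for t using that unfolding P_def by blast
    then have "\<And>t. t \<in> T \<Longrightarrow> 0 < - x t" using x0 by (metis linorder_neqE_linordered_idom neg_0_less_iff_less)
    then have "0 < sum (\<lambda>t. - x t) T" using fin ne by (intro sum_pos) auto
    then show False using sum0 by (simp add: sum_negf)
  qed
  obtain i0 where i0: "i0 \<in> N" "\<And>j. j \<in> N \<Longrightarrow> \<mu> j \<le> \<mu> i0"
  proof -
    have "Max (\<mu> ` N) \<in> \<mu> ` N" using NP Nne by (intro Max_in) auto
    then obtain i where "i \<in> N" "Max (\<mu> ` N) = \<mu> i" by auto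
    moreover have "\<And>j. j \<in> N \<Longrightarrow> \<mu> j \<le> Max (\<mu> ` N)" using NP by (intro Max_ge) auto
    ultimately show ?thesis using that by simp
  qed
  obtain i1 where i1: "i1 \<in> P" "\<And>j. j \<in> P \<Longrightarrow> \<mu> i1 \<le> \<mu> j"
  proof -
    have "Min (\<mu> ` P) \<in> \<mu> ` P" using NP Pne by (intro Min_in) auto
    then obtain i where "i \<in> P" "Min (\<mu> ` P) = \<mu> i" by auto
    moreover have "\<And>j. j \<in> P \<Longrightarrow> Min (\<mu> ` P) \<le> \<mu> j" using NP by (intro Min_le) auto
    ultimately show ?thesis using that by simp
  qed
  have i01: "i0 \<in> T" "i1 \<in> T" "i0 \<noteq> i1" using i0 i1 NP by auto
  let ?f = "\<lambda>i j. sgn_pair (x j) (\<mu> j - \<mu> i)"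
  let ?p = "\<lambda>i. \<Prod>j\<in>T-{i}. ?f i j"
  have zero: "?p i = 0" if "i \<in> T" "j \<in> T" "j \<noteq> i" "?f i j = 0" for i j
    using that fin by (intro prod_zero) auto
  show ?thesis
  proof (cases "\<mu> i1 < \<mu> i0")
    \<comment> \<open>In this order not even the two candidates survive: each \<open>i\<close>
      either lies below \<open>i0\<close>, whose factor is then 0, or above \<open>i1\<close>, whose
      factor is then 0.\<close>
    case True
    have "?p i = 0" if i: "i \<in> T" for i
    proof (cases "\<mu> i < \<mu> i0 \<or> (\<mu> i = \<mu> i0 \<and> False)")
      case True
      then have "?f i i0 = 0" using i0 by (auto simp: sgn_pair_def N_def)
      then show ?thesis using zero[OF i i01(1)] True by auto
    next
      case False
      then have "\<mu> i1 < \<mu> i" using True by linarith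
      then have "?f i i1 = 0" using i1 by (auto simp: sgn_pair_def P_def)
      then show ?thesis using zero[OF i i01(2)] \<open>\<mu> i1 < \<mu> i\<close> by auto
    qed
    then show ?thesis by (rule sum.neutral[rule_format])
  next
    case False
    moreover have "\<mu> i0 \<noteq> \<mu> i1" using inj i01 by (auto simp: inj_on_def)
    ultimately have less: "\<mu> i0 < \<mu> i1" by simp
    have z: "?p i = 0" if i: "i \<in> T - {i0, i1}" for i
    proof -
      have ne: "\<mu> i \<noteq> \<mu> i0" "\<mu> i \<noteq> \<mu> i1" using inj i i01 by (auto simp: inj_on_def)
      show ?thesis
      proof (cases "\<mu> i < \<mu> i0")
        case True
        then have "?f i i0 = 0" using i0 by (auto simp: sgn_pair_def N_def)
        then show ?thesis using zero[of i i0] i i01 by auto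
      next
        case False
        show ?thesis
        proof (cases "\<mu> i1 < \<mu> i")
          case True
          then have "?f i i1 = 0" using i1 by (auto simp: sgn_pair_def P_def)
          then show ?thesis using zero[of i i1] i i01 by auto
        next
          case f2: False
          from i NP have "i \<in> N \<or> i \<in> P" by auto
          then show ?thesis using i0(2)[of i] i1(2)[of i] ne f2 False by linarith
        qed
      qed
    qed
    have "(\<Sum>i\<in>T. ?p i) = (\<Sum>i\<in>{i0, i1}. ?p i)"
      using i01 fin z by (intro sum.mono_neutral_right) auto
    also have "\<dots> = ?p i0 + ?p i1" using i01 by simp
    also have "?p i0 = ?f i0 i1 * (\<Prod>j\<in>T-{i0,i1}. ?f i0 j)"
      using fin i01 by (subst prod.remove[of _ i1]) (auto intro!: arg_cong2[where f="(*)"] prod.cong)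
    also have "?p i1 = ?f i1 i0 * (\<Prod>j\<in>T-{i0,i1}. ?f i1 j)"
      using fin i01 by (subst prod.remove[of _ i0]) (auto intro!: arg_cong2[where f="(*)"] prod.cong)
    also have "(\<Prod>j\<in>T-{i0,i1}. ?f i0 j) = (\<Prod>j\<in>T-{i0,i1}. ?f i1 j)"
    proof (rule prod.cong[OF refl])
      fix j assume j: "j \<in> T - {i0, i1}"
      have ne: "\<mu> j \<noteq> \<mu> i0" "\<mu> j \<noteq> \<mu> i1" using inj j i01 by (auto simp: inj_on_def)
      from j NP have "j \<in> N \<or> j \<in> P" by auto
      then show "?f i0 j = ?f i1 j"
      proof
        assume "j \<in> N"
        then show ?thesis using i0(2)[of j] ne less by (auto simp: sgn_pair_def N_def)
      next
        assume "j \<in> P"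
        then show ?thesis using i1(2)[of j] ne less by (auto simp: sgn_pair_def P_def)
      qed
    qed
    also have "?f i0 i1 = 1" using i1 less by (auto simp: sgn_pair_def P_def)
    also have "?f i1 i0 = - 1" using i0 less by (auto simp: sgn_pair_def N_def)
    finally show ?thesis by simp
  qed
qed

text \<open>The exchange step for a pair of dual bases: on the right, \<open>Xs\<close> has replaced
  \<open>X l\<close>, and the dual coordinates have undergone the corresponding pivot operation. It
  is \<open>circuit_sign_sum\<close> for the relation
  \<open>Xs = (\<Sum>j\<in>K. c j * X j)\<close>; indices with \<open>c j = 0\<close> only
  contribute a common factor.\<close>

lemma sgn_pair_exchange:
  fixes c X \<nu> :: "'k \<Rightarrow> real"
  assumes fin: "finite K" and Xs: "Xs = (\<Sum>j\<in>K. c j * X j)" and X0: "\<And>j. j \<in> K \<Longrightarrow> X j \<noteq> 0" and Xs0: "Xs \<noteq> 0"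
    and \<nu>0: "\<And>j. j \<in> K \<Longrightarrow> \<nu> j \<noteq> 0"
    and gen: "\<And>j l. j \<in> K \<Longrightarrow> l \<in> K \<Longrightarrow> j \<noteq> l \<Longrightarrow> c l \<noteq> 0 \<Longrightarrow> c l * \<nu> j - c j * \<nu> l \<noteq> 0"
  shows "(\<Prod>j\<in>K. sgn_pair (X j) (\<nu> j)) = (\<Sum>l\<in>{l\<in>K. c l \<noteq> 0}. sgn (c l) *
     (sgn_pair Xs (\<nu> l / c l) * (\<Prod>j\<in>K-{l}. sgn_pair (X j) (\<nu> j - c j / c l * \<nu> l))))"
proof -
  define K0 where "K0 = {l\<in>K. c l \<noteq> 0}"
  have K0: "finite K0" "K0 \<subseteq> K" using fin by (auto simp: K0_def)
  \<comment> \<open>\<open>None\<close> stands for \<open>Xs\<close>, moved to the other side of the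
    relation, with \<open>\<mu> = 0\<close>. Scaling \<open>X j\<close> by \<open>c j\<close> and
    \<open>\<nu> j\<close> by \<open>1 / c j\<close> makes all coefficients of the relation equal to
    1; \<open>gen\<close> and \<open>\<nu>0\<close> make \<open>\<mu>\<close> injective.\<close>
  define x where "x t = (case t of None \<Rightarrow> - Xs | Some j \<Rightarrow> c j * X j)" for t
  define \<mu> where "\<mu> t = (case t of None \<Rightarrow> 0 | Some j \<Rightarrow> \<nu> j / c j)" for t
  define T where "T = insert None (Some ` K0)"
  have "sum x T = - Xs + (\<Sum>j\<in>K0. c j * X j)"
    using K0 by (simp add: T_def x_def sum.reindex)
  also have "(\<Sum>j\<in>K0. c j * X j) = Xs"
    unfolding Xs using fin by (intro sum.mono_neutral_left) (auto simp: K0_def)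
  finally have s0: "sum x T = 0" by simp
  have circ: "(\<Sum>i\<in>T. \<Prod>j\<in>T-{i}. sgn_pair (x j) (\<mu> j - \<mu> i)) = 0"
  proof (rule circuit_sign_sum)
    show "finite T" using K0 by (simp add: T_def)
    show "x t \<noteq> 0" if "t \<in> T" for t using that Xs0 X0 by (auto simp: T_def x_def K0_def)
    show "inj_on \<mu> T"
    proof (rule inj_onI)
      fix s t assume st: "s \<in> T" "t \<in> T" "\<mu> s = \<mu> t"
      show "s = t"
      proof (cases s)
        case None
        then show ?thesis using st \<nu>0 by (auto simp: T_def \<mu>_def K0_def)
      next
        case (Some j)
        show ?thesis
        proof (cases t)
          case None
          then show ?thesis using st Some \<nu>0 by (auto simp: T_def \<mu>_def K0_def)
        next
          case (Some l)
          have jl: "j \<in> K" "l \<in> K" "c j \<noteq> 0" "c l \<noteq> 0" using st Some \<open>s = Some j\<close> by (auto simp: T_def K0_def)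
          have "\<nu> j / c j = \<nu> l / c l" using st Some \<open>s = Some j\<close> by (simp add: \<mu>_def)
          then have "c l * \<nu> j - c j * \<nu> l = 0" using jl by (simp add: field_simps)
          then have "j = l" using gen jl by blast
          then show ?thesis using Some \<open>s = Some j\<close> by simp
        qed
      qed
    qed
  qed (use s0 in \<open>auto simp: T_def\<close>)
  define S where "S = (\<Prod>j\<in>K0. sgn (c j))"
  have S2: "S * S = 1"
  proof -
    have "S * S = (\<Prod>j\<in>K0. sgn (c j) * sgn (c j))" by (simp only: S_def prod.distrib)
    also have "\<dots> = 1" by (intro prod.neutral) (auto simp: K0_def sgn_if)
    finally show ?thesis .
  qed
  define R where "R = (\<Prod>j\<in>K-K0. sgn_pair (X j) (\<nu> j))"
  define Q where "Q l = sgn_pair Xs (\<nu> l / c l) * (\<Prod>j\<in>K0-{l}. sgn_pair (X j) (\<nu> j - c j / c l * \<nu> l))" for l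
  have t0: "(\<Prod>j\<in>T-{None}. sgn_pair (x j) (\<mu> j - \<mu> None)) = S * (\<Prod>j\<in>K0. sgn_pair (X j) (\<nu> j))"
  proof -
    have "T - {None} = Some ` K0" by (auto simp: T_def)
    then have "(\<Prod>j\<in>T-{None}. sgn_pair (x j) (\<mu> j - \<mu> None)) = (\<Prod>j\<in>K0. sgn_pair (c j * X j) (\<nu> j / c j))"
      by (simp add: prod.reindex x_def \<mu>_def)
    also have "\<dots> = (\<Prod>j\<in>K0. sgn (c j) * sgn_pair (X j) (\<nu> j))"
      using X0 \<nu>0 by (intro prod.cong refl sgn_pair_scale) (auto simp: K0_def)
    finally show ?thesis by (simp add: S_def prod.distrib)
  qed
  have tl: "(\<Prod>j\<in>T-{Some l}. sgn_pair (x j) (\<mu> j - \<mu> (Some l))) = - S * (sgn (c l) * Q l)" if l: "l \<in> K0" for l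
  proof -
    have cl: "c l \<noteq> 0" "l \<in> K" using l by (auto simp: K0_def)
    have "T - {Some l} = insert None (Some ` (K0 - {l}))" by (auto simp: T_def)
    then have "(\<Prod>j\<in>T-{Some l}. sgn_pair (x j) (\<mu> j - \<mu> (Some l)))
      = sgn_pair (- Xs) (- (\<nu> l / c l)) * (\<Prod>j\<in>K0-{l}. sgn_pair (c j * X j) (\<nu> j / c j - \<nu> l / c l))"
      using K0 by (simp add: prod.reindex x_def \<mu>_def)
    also have "sgn_pair (- Xs) (- (\<nu> l / c l)) = - sgn_pair Xs (\<nu> l / c l)"
      using Xs0 \<nu>0[of l] cl by (intro sgn_pair_minus) auto
    also have "(\<Prod>j\<in>K0-{l}. sgn_pair (c j * X j) (\<nu> j / c j - \<nu> l / c l))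
      = (\<Prod>j\<in>K0-{l}. sgn (c j) * sgn_pair (X j) (\<nu> j - c j / c l * \<nu> l))"
    proof (rule prod.cong[OF refl])
      fix j assume j: "j \<in> K0 - {l}"
      have e: "\<nu> j / c j - \<nu> l / c l = (\<nu> j - c j / c l * \<nu> l) / c j"
        using j cl by (simp add: K0_def field_simps)
      have "\<nu> j - c j / c l * \<nu> l = (c l * \<nu> j - c j * \<nu> l) / c l"
        using cl by (simp add: field_simps)
      then have "\<nu> j - c j / c l * \<nu> l \<noteq> 0"
        using gen[of j l] j cl by (auto simp: K0_def)
      then show "sgn_pair (c j * X j) (\<nu> j / c j - \<nu> l / c l) = sgn (c j) * sgn_pair (X j) (\<nu> j - c j / c l * \<nu> l)"
        unfolding e using j X0 by (intro sgn_pair_scale) (auto simp: K0_def)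
    qed
    also have "\<dots> = (\<Prod>j\<in>K0-{l}. sgn (c j)) * (\<Prod>j\<in>K0-{l}. sgn_pair (X j) (\<nu> j - c j / c l * \<nu> l))"
      by (rule prod.distrib)
    also have "(\<Prod>j\<in>K0-{l}. sgn (c j)) = S * sgn (c l)"
    proof -
      have "S = sgn (c l) * (\<Prod>j\<in>K0-{l}. sgn (c j))" unfolding S_def using K0 l by (simp add: prod.remove)
      moreover have "sgn (c l) * sgn (c l) = 1" using cl by (simp add: sgn_if)
      ultimately show ?thesis by algebra
    qed
    finally show ?thesis by (simp add: Q_def mult_ac)
  qed
  have "0 = S * (\<Prod>j\<in>K0. sgn_pair (X j) (\<nu> j)) + (\<Sum>l\<in>K0. - S * (sgn (c l) * Q l))"
  proof -
    have "(\<Sum>i\<in>T. \<Prod>j\<in>T-{i}. sgn_pair (x j) (\<mu> j - \<mu> i))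
      = (\<Prod>j\<in>T-{None}. sgn_pair (x j) (\<mu> j - \<mu> None)) + (\<Sum>l\<in>K0. \<Prod>j\<in>T-{Some l}. sgn_pair (x j) (\<mu> j - \<mu> (Some l)))"
      unfolding T_def using K0 by (subst sum.insert) (auto simp: sum.reindex)
    then show ?thesis using circ t0 tl by simp
  qed
  also have "\<dots> = S * ((\<Prod>j\<in>K0. sgn_pair (X j) (\<nu> j)) - (\<Sum>l\<in>K0. sgn (c l) * Q l))"
    by (simp add: sum_distrib_left sum_negf right_diff_distrib)
  finally have main: "(\<Prod>j\<in>K0. sgn_pair (X j) (\<nu> j)) = (\<Sum>l\<in>K0. sgn (c l) * Q l)"
    using S2 by auto
  have "(\<Prod>j\<in>K. sgn_pair (X j) (\<nu> j)) = R * (\<Prod>j\<in>K0. sgn_pair (X j) (\<nu> j))"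
    unfolding R_def using K0 fin by (intro prod.subset_diff) auto
  also have "\<dots> = (\<Sum>l\<in>K0. sgn (c l) * (R * Q l))"
    unfolding main sum_distrib_left by (simp add: mult_ac)
  also have "\<dots> = (\<Sum>l\<in>K0. sgn (c l) *
     (sgn_pair Xs (\<nu> l / c l) * (\<Prod>j\<in>K-{l}. sgn_pair (X j) (\<nu> j - c j / c l * \<nu> l))))"
  proof (rule sum.cong[OF refl])
    fix l assume l: "l \<in> K0"
    have "(\<Prod>j\<in>K-{l}. sgn_pair (X j) (\<nu> j - c j / c l * \<nu> l))
      = (\<Prod>j\<in>(K-{l})-(K0-{l}). sgn_pair (X j) (\<nu> j - c j / c l * \<nu> l)) * (\<Prod>j\<in>K0-{l}. sgn_pair (X j) (\<nu> j - c j / c l * \<nu> l))"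
      using K0 fin by (intro prod.subset_diff) auto
    also have "(\<Prod>j\<in>(K-{l})-(K0-{l}). sgn_pair (X j) (\<nu> j - c j / c l * \<nu> l)) = R"
      unfolding R_def using l by (intro prod.cong) (auto simp: K0_def)
    finally show "sgn (c l) * (R * Q l) = sgn (c l) *
     (sgn_pair Xs (\<nu> l / c l) * (\<Prod>j\<in>K-{l}. sgn_pair (X j) (\<nu> j - c j / c l * \<nu> l)))"
      by (simp add: Q_def mult_ac)
  qed
  finally show ?thesis by (simp add: K0_def)
qed

text \<open>\<open>I\<close> indexes the variables, \<open>J\<close> the monomials. \<open>L\<close>
  and \<open>M\<close> are each other's annihilators modulo the integers under the pairing given by
  \<open>E\<close>; they lie between the integral vectors and the vectors with denominator
  \<open>d\<close>. The two surjectivity clauses express that \<open>E\<close> is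
  nonsingular.\<close>

locale dual_lattices =
  fixes I J :: "'k set" and E :: "'k \<Rightarrow> 'k \<Rightarrow> nat" and L M :: "('k \<Rightarrow> real) set" and d :: nat
  assumes fin_I: "finite I" and fin_J: "finite J" and card_eq: "card I = card J"
    and L_iff: "a \<in> L \<longleftrightarrow> (\<forall>i. i \<notin> I \<longrightarrow> a i = 0) \<and>
        (\<forall>b\<in>M. (\<Sum>j\<in>J. b j * lin I (\<lambda>i. real (E j i)) a) \<in> \<int>)"
    and M_iff: "b \<in> M \<longleftrightarrow> (\<forall>j. j \<notin> J \<longrightarrow> b j = 0) \<and>
        (\<forall>a\<in>L. (\<Sum>j\<in>J. b j * lin I (\<lambda>i. real (E j i)) a) \<in> \<int>)"
    and unit_L: "i \<in> I \<Longrightarrow> uvec i \<in> L" and unit_M: "j \<in> J \<Longrightarrow> uvec j \<in> M"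
    and d_pos: "0 < d" and den_L: "a \<in> L \<Longrightarrow> real d * a i \<in> \<int>" and den_M: "b \<in> M \<Longrightarrow> real d * b i \<in> \<int>"
    and surj_E: "\<exists>a. (\<forall>i. i \<notin> I \<longrightarrow> a i = 0) \<and> (\<forall>j\<in>J. lin I (\<lambda>i. real (E j i)) a = y j)"
    and surj_ET: "\<exists>b. (\<forall>j. j \<notin> J \<longrightarrow> b j = 0) \<and> (\<forall>i\<in>I. lin J (\<lambda>j. real (E j i)) b = y i)"
begin

definition form :: "('k \<Rightarrow> real) \<Rightarrow> ('k \<Rightarrow> real) \<Rightarrow> real" where
  "form a b = (\<Sum>j\<in>J. b j * lin I (\<lambda>i. real (E j i)) a)"

lemma form_alt: "form a b = (\<Sum>i\<in>I. a i * lin J (\<lambda>j. real (E j i)) b)"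
  unfolding form_def lin_def sum_distrib_left by (subst sum.swap) (simp add: mult_ac)

lemma swap: "dual_lattices J I (\<lambda>i j. E j i) M L d"
proof
  show "b \<in> M \<longleftrightarrow> (\<forall>j. j \<notin> J \<longrightarrow> b j = 0) \<and> (\<forall>a\<in>L. (\<Sum>i\<in>I. a i * lin J (\<lambda>j. real (E j i)) b) \<in> \<int>)" for b
    using M_iff[of b] form_alt form_def by simp
  show "a \<in> L \<longleftrightarrow> (\<forall>i. i \<notin> I \<longrightarrow> a i = 0) \<and> (\<forall>b\<in>M. (\<Sum>i\<in>I. a i * lin J (\<lambda>j. real (E j i)) b) \<in> \<int>)" for a
    using L_iff[of a] form_alt form_def by simp
qed (use fin_I fin_J card_eq unit_L unit_M d_pos den_L den_M surj_E surj_ET in auto)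

lemma form_Ints: "a \<in> L \<Longrightarrow> b \<in> M \<Longrightarrow> form a b \<in> \<int>"
  using L_iff by (auto simp: form_def)

lemma form_uvec_right: "j \<in> J \<Longrightarrow> form a (uvec j) = lin I (\<lambda>i. real (E j i)) a"
  using fin_J by (simp add: form_def uvec_def mult_delta_left)

lemma form_uvec_left: "i \<in> I \<Longrightarrow> form (uvec i) b = lin J (\<lambda>j. real (E j i)) b"
  using fin_I by (simp add: form_alt uvec_def mult_delta_left)

lemma row_Ints: "a \<in> L \<Longrightarrow> j \<in> J \<Longrightarrow> lin I (\<lambda>i. real (E j i)) a \<in> \<int>"
  using form_Ints[of a "uvec j"] unit_M by (simp add: form_uvec_right)

lemma col_Ints: "b \<in> M \<Longrightarrow> i \<in> I \<Longrightarrow> lin J (\<lambda>j. real (E j i)) b \<in> \<int>"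
  using form_Ints[of "uvec i" b] unit_L by (simp add: form_uvec_left)

lemma form_add_left: "form (\<lambda>i. a i + a' i) b = form a b + form a' b"
  by (simp add: form_def lin_add_right ring_distribs sum.distrib)

lemma form_scale_left: "form (\<lambda>i. t * a i) b = t * form a b"
  by (simp add: form_def lin_scale_right sum_distrib_left mult_ac)

lemma form_scale_right: "form a (\<lambda>i. t * b i) = t * form a b"
  by (simp add: form_def sum_distrib_left mult_ac)

lemma form_diff_left: "form (\<lambda>i. a i - a' i) b = form a b - form a' b"
  by (simp add: form_def lin_diff_right ring_distribs sum_subtractf)

lemma form_diff_right: "form a (\<lambda>i. b i - b' i) = form a b - form a b'"
  by (simp add: form_def ring_distribs sum_subtractf)

lemma L_add: "a \<in> L \<Longrightarrow> a' \<in> L \<Longrightarrow> (\<lambda>i. a i + a' i) \<in> L"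
  unfolding L_iff[of "\<lambda>i. a i + a' i"] form_def[symmetric] form_add_left
  using L_iff[of a] L_iff[of a'] by (auto simp: form_def)

lemma L_scale: "a \<in> L \<Longrightarrow> t \<in> \<int> \<Longrightarrow> (\<lambda>i. t * a i) \<in> L"
  unfolding L_iff[of "\<lambda>i. t * a i"] form_def[symmetric] form_scale_left
  using L_iff[of a] by (auto simp: form_def)

lemma L_diff: "a \<in> L \<Longrightarrow> a' \<in> L \<Longrightarrow> (\<lambda>i. a i - a' i) \<in> L"
  using L_add[of a "\<lambda>i. (-1) * a' i"] L_scale[of a' "-1"] by simp

lemma L_supp: "a \<in> L \<Longrightarrow> i \<notin> I \<Longrightarrow> a i = 0"
  using L_iff by blast

text \<open>Multiplication by \<open>d\<close> embeds \<open>L\<close> into the integral vectors,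
  where the exponential factors into geometric series.\<close>

lemma L_summable:
  assumes "0 < \<kappa>"
  shows "(\<lambda>a. exp (- \<kappa> * (\<Sum>i\<in>I. \<bar>a i\<bar>))) summable_on L"
proof -
  define r where "r = exp (- \<kappa> / real d)"
  have r: "0 \<le> r" "r < 1" using assms d_pos by (auto simp: r_def divide_neg_pos)
  define h where "h a = restrict (\<lambda>i. \<lfloor>real d * a i\<rfloor>) I" for a :: "'k \<Rightarrow> real"
  have ha: "real d * a i = of_int (h a i)" if "a \<in> L" "i \<in> I" for a i
    using den_L[OF that(1), of i] that(2) by (auto simp: h_def elim: Ints_cases)
  have inj: "inj_on h L"
  proof (rule inj_onI, rule ext)
    fix a a' i assume aa: "a \<in> L" "a' \<in> L" "h a = h a'"
    show "a i = a' i"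
    proof (cases "i \<in> I")
      case True
      then have "real d * a i = real d * a' i" using ha[of a i] ha[of a' i] aa by simp
      then show ?thesis using d_pos by simp
    next
      case False
      then show ?thesis using L_supp[OF aa(1)] L_supp[OF aa(2)] by simp
    qed
  qed
  have "(\<lambda>g. \<Prod>i\<in>I. r ^ nat \<bar>g i\<bar>) summable_on (PiE I (\<lambda>_. UNIV :: int set))"
    using fin_I r by (intro summable_on_PiE_prod[where f="\<lambda>_ n. r ^ nat \<bar>n\<bar>"] summable_on_powr_abs_int) auto
  then have "(\<lambda>g. \<Prod>i\<in>I. r ^ nat \<bar>g i\<bar>) summable_on (h ` L)"
    by (rule summable_on_subset_banach) (auto simp: h_def)
  then have "(\<lambda>a. \<Prod>i\<in>I. r ^ nat \<bar>h a i\<bar>) summable_on L"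
    using inj by (simp add: summable_on_reindex o_def)
  moreover have "(\<Prod>i\<in>I. r ^ nat \<bar>h a i\<bar>) = exp (- \<kappa> * (\<Sum>i\<in>I. \<bar>a i\<bar>))" if a: "a \<in> L" for a
  proof -
    have "r ^ nat \<bar>h a i\<bar> = exp (- \<kappa> * \<bar>a i\<bar>)" if i: "i \<in> I" for i
    proof -
      have "real (nat \<bar>h a i\<bar>) = real d * \<bar>a i\<bar>" using arg_cong[OF ha[OF a i], of abs] by (simp add: abs_mult)
      then show ?thesis using d_pos by (simp add: r_def exp_of_nat_mult[symmetric])
    qed
    then show ?thesis using fin_I by (simp add: sum_distrib_left exp_sum[symmetric] sum_negf)
  qed
  ultimately show ?thesis by (simp cong: summable_on_cong)
qed

end

lemma has_sum_finite_sum: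
  fixes f :: "'l \<Rightarrow> 'a \<Rightarrow> complex"
  assumes "finite T" "\<And>l. l \<in> T \<Longrightarrow> (f l has_sum s l) A"
  shows "((\<lambda>x. \<Sum>l\<in>T. f l x) has_sum (\<Sum>l\<in>T. s l)) A"
  using assms by (induction T rule: finite_induct) (auto intro!: has_sum_add)

lemma infsum_antisym_eq_0:
  fixes f :: "'a \<Rightarrow> complex"
  assumes "\<And>x. x \<in> A \<Longrightarrow> \<sigma> x \<in> A" "\<And>x. x \<in> A \<Longrightarrow> \<sigma> (\<sigma> x) = x" "\<And>x. x \<in> A \<Longrightarrow> f (\<sigma> x) = - f x"
  shows "infsum f A = 0"
proof -
  have "infsum f A = infsum (\<lambda>x. - f x) A"
    by (rule infsum_reindex_bij_witness[of A \<sigma> \<sigma>]) (use assms in auto)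
  also have "\<dots> = - infsum f A" by (rule infsum_uminus)
  finally show ?thesis by simp
qed

section \<open>Duality of the sign-weighted lattice sums\<close>

text \<open>After reordering, monomial \<open>i\<close> is a power of \<open>x_i\<close> of exponent
  at least 2, times at most one further variable to the first power; by \<open>col_le\<close> no
  variable is used in this way twice. So \<open>E\<close> describes a sum of Fermat, chain and loop
  polynomials.\<close>

locale chain_loop_lattices = dual_lattices K K E L M d
  for K :: "'k set" and E :: "'k \<Rightarrow> 'k \<Rightarrow> nat" and L M :: "('k \<Rightarrow> real) set" and d :: nat +
  assumes diag: "i \<in> K \<Longrightarrow> 2 \<le> E i i"
    and row_le: "i \<in> K \<Longrightarrow> (\<Sum>j\<in>K-{i}. E i j) \<le> 1"
    and col_le: "i \<in> K \<Longrightarrow> (\<Sum>j\<in>K-{i}. E j i) \<le> 1"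
begin

abbreviation row :: "'k \<Rightarrow> ('k \<Rightarrow> real) \<Rightarrow> real" where "row j a \<equiv> lin K (\<lambda>i. real (E j i)) a"
abbreviation col :: "'k \<Rightarrow> ('k \<Rightarrow> real) \<Rightarrow> real" where "col i b \<equiv> lin K (\<lambda>j. real (E j i)) b"

definition dual_bases :: "('k \<Rightarrow> 'k \<Rightarrow> real) \<Rightarrow> ('k \<Rightarrow> 'k \<Rightarrow> real) \<Rightarrow> bool" where
  "dual_bases X \<Lambda> \<longleftrightarrow> (\<forall>a b. form a b = (\<Sum>i\<in>K. lin K (X i) b * lin K (\<Lambda> i) a))"

definition sgn_prod :: "('k \<Rightarrow> 'k \<Rightarrow> real) \<Rightarrow> ('k \<Rightarrow> 'k \<Rightarrow> real) \<Rightarrow> ('k \<Rightarrow> real) \<Rightarrow> ('k \<Rightarrow> real) \<Rightarrow>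
    ('k \<Rightarrow> real) \<Rightarrow> ('k \<Rightarrow> real) \<Rightarrow> real" where
  "sgn_prod X \<Lambda> A0 B0 a b = (\<Prod>i\<in>K. sgn_pair (lin K (X i) b - lin K (X i) B0) (lin K (\<Lambda> i) a + lin K (\<Lambda> i) A0))"

text \<open>The imaginary part of the exponent of \<open>weight\<close>, divided by
  \<open>Im \<tau>\<close>, when the arguments have imaginary parts
  \<open>row j A0 * Im \<tau>\<close> and \<open>col i B0 * Im \<tau>\<close>.\<close>

definition expo :: "('k \<Rightarrow> real) \<Rightarrow> ('k \<Rightarrow> real) \<Rightarrow> ('k \<Rightarrow> real) \<Rightarrow> ('k \<Rightarrow> real) \<Rightarrow> real" where
  "expo A0 B0 a b = (\<Sum>j\<in>K. b j * row j A0) - (\<Sum>i\<in>K. a i * col i B0) + form a b"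

text \<open>Completing the product. It explains the shifts in \<open>sgn_prod\<close>: evaluated at
  \<open>a + A0\<close> and \<open>b - B0\<close>, every term with nonzero sign product has an
  exponent that is a sum of nonnegative products plus a constant.\<close>

lemma expo_eq: "expo A0 B0 a b = form (\<lambda>i. a i + A0 i) (\<lambda>i. b i - B0 i) + form A0 B0"
proof -
  have "(\<Sum>j\<in>K. b j * row j A0) = form A0 b" by (simp add: form_def)
  moreover have "(\<Sum>i\<in>K. a i * col i B0) = form a B0" by (simp add: form_alt)
  ultimately show ?thesis
    by (simp add: expo_def form_add_left form_diff_right)
qed

text \<open>The vectors \<open>av j\<close> and \<open>bv j\<close> recover single coordinates as
  values of \<open>form\<close>. Writing \<open>form\<close> in the dual bases bounds these by the
  basis coordinates, with \<open>H\<close> collecting the coefficients.\<close>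

lemma coordinate_bound:
  assumes "dual_bases X \<Lambda>"
  shows "\<exists>H>0. \<forall>a b. (\<Sum>i\<in>K. \<bar>a i\<bar>) \<le> H * (\<Sum>i\<in>K. \<bar>lin K (\<Lambda> i) a\<bar>) \<and>
     (\<Sum>i\<in>K. \<bar>b i\<bar>) \<le> H * (\<Sum>i\<in>K. \<bar>lin K (X i) b\<bar>)"
proof -
  have "\<forall>j. \<exists>a. \<forall>i\<in>K. row i a = uvec j i" using surj_E by meson
  then obtain av where av: "\<And>i j. i \<in> K \<Longrightarrow> row i (av j) = uvec j i" by metis
  have "\<forall>j. \<exists>b. \<forall>i\<in>K. col i b = uvec j i" using surj_ET by meson
  then obtain bv where bv: "\<And>i j. i \<in> K \<Longrightarrow> col i (bv j) = uvec j i" by metis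
  define H where "H = 1 + (\<Sum>j\<in>K. \<Sum>i\<in>K. \<bar>lin K (\<Lambda> i) (av j)\<bar> + \<bar>lin K (X i) (bv j)\<bar>)"
  have H: "0 < H" unfolding H_def by (intro add_pos_nonneg sum_nonneg) auto
  have Hj: "(\<Sum>j\<in>K. \<bar>lin K (\<Lambda> i) (av j)\<bar>) \<le> H" "(\<Sum>j\<in>K. \<bar>lin K (X i) (bv j)\<bar>) \<le> H" if i: "i \<in> K" for i
  proof -
    have le: "\<bar>lin K (\<Lambda> i) (av j)\<bar> + \<bar>lin K (X i) (bv j)\<bar> \<le> (\<Sum>i\<in>K. \<bar>lin K (\<Lambda> i) (av j)\<bar> + \<bar>lin K (X i) (bv j)\<bar>)" for j
      using i fin_I by (intro member_le_sum) auto
    have "(\<Sum>j\<in>K. \<bar>lin K (\<Lambda> i) (av j)\<bar>) \<le> (\<Sum>j\<in>K. \<Sum>i\<in>K. \<bar>lin K (\<Lambda> i) (av j)\<bar> + \<bar>lin K (X i) (bv j)\<bar>)"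
      by (rule sum_mono) (use le in \<open>smt (verit)\<close>)
    then show "(\<Sum>j\<in>K. \<bar>lin K (\<Lambda> i) (av j)\<bar>) \<le> H" unfolding H_def by linarith
    have "(\<Sum>j\<in>K. \<bar>lin K (X i) (bv j)\<bar>) \<le> (\<Sum>j\<in>K. \<Sum>i\<in>K. \<bar>lin K (\<Lambda> i) (av j)\<bar> + \<bar>lin K (X i) (bv j)\<bar>)"
      by (rule sum_mono) (use le in \<open>smt (verit)\<close>)
    then show "(\<Sum>j\<in>K. \<bar>lin K (X i) (bv j)\<bar>) \<le> H" unfolding H_def by linarith
  qed
  have rep: "form a b = (\<Sum>i\<in>K. lin K (X i) b * lin K (\<Lambda> i) a)" for a b
    using assms by (simp add: dual_bases_def)
  have bj: "b j = form (av j) b" if "j \<in> K" for b j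
    using fin_I that by (simp add: form_def av uvec_def mult_delta_right)
  have aj: "a j = form a (bv j)" if "j \<in> K" for a j
    using fin_I that by (simp add: form_alt bv uvec_def mult_delta_right)
  have "(\<Sum>j\<in>K. \<bar>b j\<bar>) \<le> H * (\<Sum>i\<in>K. \<bar>lin K (X i) b\<bar>)" for b
  proof -
    have "(\<Sum>j\<in>K. \<bar>b j\<bar>) \<le> (\<Sum>j\<in>K. \<Sum>i\<in>K. \<bar>lin K (X i) b\<bar> * \<bar>lin K (\<Lambda> i) (av j)\<bar>)"
      unfolding abs_mult[symmetric] by (intro sum_mono) (simp add: bj rep)
    also have "\<dots> = (\<Sum>i\<in>K. \<bar>lin K (X i) b\<bar> * (\<Sum>j\<in>K. \<bar>lin K (\<Lambda> i) (av j)\<bar>))"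
      unfolding sum_distrib_left by (rule sum.swap)
    also have "\<dots> \<le> (\<Sum>i\<in>K. \<bar>lin K (X i) b\<bar> * H)"
      by (intro sum_mono mult_left_mono Hj) auto
    finally show ?thesis by (simp add: sum_distrib_left mult.commute)
  qed
  moreover have "(\<Sum>j\<in>K. \<bar>a j\<bar>) \<le> H * (\<Sum>i\<in>K. \<bar>lin K (\<Lambda> i) a\<bar>)" for a
  proof -
    have "(\<Sum>j\<in>K. \<bar>a j\<bar>) \<le> (\<Sum>j\<in>K. \<Sum>i\<in>K. \<bar>lin K (\<Lambda> i) a\<bar> * \<bar>lin K (X i) (bv j)\<bar>)"
      unfolding abs_mult[symmetric]
    proof (rule sum_mono)
      fix j assume "j \<in> K"
      then have "a j = (\<Sum>i\<in>K. lin K (\<Lambda> i) a * lin K (X i) (bv j))"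
        unfolding mult.commute[of "lin K (\<Lambda> _) a"] rep[symmetric] by (rule aj)
      then show "\<bar>a j\<bar> \<le> (\<Sum>i\<in>K. \<bar>lin K (\<Lambda> i) a * lin K (X i) (bv j)\<bar>)"
        by simp
    qed
    also have "\<dots> = (\<Sum>i\<in>K. \<bar>lin K (\<Lambda> i) a\<bar> * (\<Sum>j\<in>K. \<bar>lin K (X i) (bv j)\<bar>))"
      unfolding sum_distrib_left by (rule sum.swap)
    also have "\<dots> \<le> (\<Sum>i\<in>K. \<bar>lin K (\<Lambda> i) a\<bar> * H)"
      by (intro sum_mono mult_left_mono Hj) auto
    finally show ?thesis by (simp add: sum_distrib_left mult.commute)
  qed
  ultimately show ?thesis using H by blast
qed

definition separated :: "('k \<Rightarrow> 'k \<Rightarrow> real) \<Rightarrow> ('k \<Rightarrow> 'k \<Rightarrow> real) \<Rightarrow> real \<Rightarrow> real \<Rightarrow>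
    ('k \<Rightarrow> real) \<Rightarrow> ('k \<Rightarrow> real) \<Rightarrow> bool" where
  "separated X \<Lambda> \<delta> S A0 B0 \<longleftrightarrow> (\<forall>i\<in>K. (\<forall>b\<in>M. \<delta> \<le> \<bar>lin K (X i) b - lin K (X i) B0\<bar>) \<and>
     (\<forall>a\<in>L. \<delta> \<le> \<bar>lin K (\<Lambda> i) a + lin K (\<Lambda> i) A0\<bar>) \<and>
     \<bar>lin K (X i) B0\<bar> \<le> S \<and> \<bar>lin K (\<Lambda> i) A0\<bar> \<le> S)"

text \<open>A nonzero sign product forces \<open>x i * l i \<ge> 0\<close> for all \<open>i\<close>,
  and then separation gives \<open>x i * l i \<ge> \<delta> / 2 * (\<bar>x i\<bar> + \<bar>l
  i\<bar>)\<close>, so the exponent grows linearly in \<open>a\<close> and \<open>b\<close>.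
  \<open>D\<close> depends on the shifts only through \<open>\<delta>\<close> and \<open>S\<close>,
  as needed for dominated convergence along a sequence of shifts.\<close>

lemma sgn_prod_dominated:
  assumes db: "dual_bases X \<Lambda>" and c: "0 < c" and \<delta>: "0 < \<delta>" and S: "0 \<le> S"
  obtains D where "D summable_on L \<times> M"
    "\<And>A0 B0 a b. separated X \<Lambda> \<delta> S A0 B0 \<Longrightarrow> a \<in> L \<Longrightarrow> b \<in> M \<Longrightarrow>
       \<bar>sgn_prod X \<Lambda> A0 B0 a b\<bar> * exp (- c * expo A0 B0 a b) \<le> D (a, b)"
proof -
  obtain H where H: "0 < H" and Ha: "\<And>a. (\<Sum>i\<in>K. \<bar>a i\<bar>) \<le> H * (\<Sum>i\<in>K. \<bar>lin K (\<Lambda> i) a\<bar>)"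
    and Hb: "\<And>b. (\<Sum>i\<in>K. \<bar>b i\<bar>) \<le> H * (\<Sum>i\<in>K. \<bar>lin K (X i) b\<bar>)"
    using coordinate_bound[OF db] by blast
  have rep: "form a b = (\<Sum>i\<in>K. lin K (X i) b * lin K (\<Lambda> i) a)" for a b
    using db by (simp add: dual_bases_def)
  interpret sw: dual_lattices K K "\<lambda>i j. E j i" M L d by (rule swap)
  define \<kappa> where "\<kappa> = c * \<delta> / 2 / H"
  have \<kappa>: "0 < \<kappa>" using c \<delta> H by (simp add: \<kappa>_def)
  define N where "N = real (card K)"
  \<comment> \<open>The first summand pays for replacing shifted by unshifted coordinates, the
    second for the constant \<open>form A0 B0\<close>.\<close>
  define C where "C = exp (c * \<delta> * N * S + c * N * S * S)"
  define D where "D = (\<lambda>(a, b). C * (exp (- \<kappa> * (\<Sum>i\<in>K. \<bar>a i\<bar>)) * exp (- \<kappa> * (\<Sum>i\<in>K. \<bar>b i\<bar>))))"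
  show ?thesis
  proof
    have "(\<lambda>(a, b). norm (complex_of_real (exp (- \<kappa> * (\<Sum>i\<in>K. \<bar>a i\<bar>))) * complex_of_real (exp (- \<kappa> * (\<Sum>i\<in>K. \<bar>b i\<bar>))))) summable_on L \<times> M"
      using L_summable[OF \<kappa>] sw.L_summable[OF \<kappa>] by (intro norm_summable_on_product) simp_all
    then have "(\<lambda>(a, b). exp (- \<kappa> * (\<Sum>i\<in>K. \<bar>a i\<bar>)) * exp (- \<kappa> * (\<Sum>i\<in>K. \<bar>b i\<bar>))) summable_on L \<times> M"
      by (simp add: norm_mult)
    then show "D summable_on L \<times> M"
      unfolding D_def case_prod_unfold by (rule summable_on_cmult_right)
    fix A0 B0 a b
    assume sep: "separated X \<Lambda> \<delta> S A0 B0" and ab: "a \<in> L" "b \<in> M"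
    define x where "x i = lin K (X i) b - lin K (X i) B0" for i
    define l where "l i = lin K (\<Lambda> i) a + lin K (\<Lambda> i) A0" for i
    have xl: "\<delta> \<le> \<bar>x i\<bar>" "\<delta> \<le> \<bar>l i\<bar>" "\<bar>lin K (X i) B0\<bar> \<le> S" "\<bar>lin K (\<Lambda> i) A0\<bar> \<le> S" if "i \<in> K" for i
      using sep that ab by (auto simp: separated_def x_def l_def)
    have e: "expo A0 B0 a b = (\<Sum>i\<in>K. x i * l i) + form A0 B0"
      unfolding expo_eq rep[of "\<lambda>i. a i + A0 i"] by (simp add: x_def l_def lin_add_right lin_diff_right)
    have f0: "\<bar>form A0 B0\<bar> \<le> N * S * S"
    proof -
      have "\<bar>form A0 B0\<bar> \<le> (\<Sum>i\<in>K. \<bar>lin K (X i) B0 * lin K (\<Lambda> i) A0\<bar>)" unfolding rep by (rule sum_abs)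
      also have "\<dots> \<le> (\<Sum>i\<in>K. S * S)" unfolding abs_mult using S by (intro sum_mono mult_mono xl) auto
      finally show ?thesis by (simp add: N_def)
    qed
    show "\<bar>sgn_prod X \<Lambda> A0 B0 a b\<bar> * exp (- c * expo A0 B0 a b) \<le> D (a, b)"
    proof (cases "\<exists>i\<in>K. sgn_pair (x i) (l i) = 0")
      case True
      then have "sgn_prod X \<Lambda> A0 B0 a b = 0"
        using fin_I by (auto simp: sgn_prod_def x_def[symmetric] l_def[symmetric] intro!: prod_zero)
      then show ?thesis by (simp add: D_def C_def)
    next
      case False
      have "\<delta> / 2 * (\<bar>x i\<bar> + \<bar>l i\<bar>) \<le> x i * l i" if i: "i \<in> K" for i
      proof -
        have "0 \<le> x i * l i" using False i by (force simp: sgn_pair_def zero_le_mult_iff split: if_splits)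
        then have "x i * l i = \<bar>x i\<bar> * \<bar>l i\<bar>" by (simp add: abs_mult[symmetric])
        moreover have "\<delta> * \<bar>l i\<bar> \<le> \<bar>x i\<bar> * \<bar>l i\<bar>" "\<bar>x i\<bar> * \<delta> \<le> \<bar>x i\<bar> * \<bar>l i\<bar>"
          using xl[OF i] by (auto intro: mult_right_mono mult_left_mono)
        ultimately show ?thesis by (simp add: algebra_simps)
      qed
      then have "(\<Sum>i\<in>K. \<delta> / 2 * (\<bar>x i\<bar> + \<bar>l i\<bar>)) \<le> (\<Sum>i\<in>K. x i * l i)" by (rule sum_mono)
      moreover have "(\<Sum>i\<in>K. \<bar>a i\<bar>) / H + (\<Sum>i\<in>K. \<bar>b i\<bar>) / H - 2 * N * S \<le> (\<Sum>i\<in>K. \<bar>x i\<bar> + \<bar>l i\<bar>)"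
      proof -
        have "(\<Sum>i\<in>K. \<bar>lin K (X i) b\<bar>) + (\<Sum>i\<in>K. \<bar>lin K (\<Lambda> i) a\<bar>) = (\<Sum>i\<in>K. \<bar>lin K (X i) b\<bar> + \<bar>lin K (\<Lambda> i) a\<bar>)"
          by (rule sum.distrib[symmetric])
        also have "\<dots> \<le> (\<Sum>i\<in>K. \<bar>x i\<bar> + \<bar>l i\<bar> + 2 * S)"
          by (rule sum_mono) (use xl in \<open>force simp: x_def l_def\<close>)
        also have "\<dots> = (\<Sum>i\<in>K. \<bar>x i\<bar> + \<bar>l i\<bar>) + 2 * N * S" by (simp add: sum.distrib N_def)
        finally have "(\<Sum>i\<in>K. \<bar>lin K (X i) b\<bar>) + (\<Sum>i\<in>K. \<bar>lin K (\<Lambda> i) a\<bar>) \<le> (\<Sum>i\<in>K. \<bar>x i\<bar> + \<bar>l i\<bar>) + 2 * N * S" .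
        moreover have "(\<Sum>i\<in>K. \<bar>a i\<bar>) / H \<le> (\<Sum>i\<in>K. \<bar>lin K (\<Lambda> i) a\<bar>)" "(\<Sum>i\<in>K. \<bar>b i\<bar>) / H \<le> (\<Sum>i\<in>K. \<bar>lin K (X i) b\<bar>)"
          using Ha[of a] Hb[of b] H by (simp_all add: divide_le_eq mult.commute)
        ultimately show ?thesis by linarith
      qed
      then have "\<delta> / 2 * ((\<Sum>i\<in>K. \<bar>a i\<bar>) / H + (\<Sum>i\<in>K. \<bar>b i\<bar>) / H - 2 * N * S) \<le> \<delta> / 2 * (\<Sum>i\<in>K. \<bar>x i\<bar> + \<bar>l i\<bar>)"
        using \<delta> by (intro mult_left_mono) auto
      ultimately have "\<delta> / 2 * ((\<Sum>i\<in>K. \<bar>a i\<bar>) / H + (\<Sum>i\<in>K. \<bar>b i\<bar>) / H - 2 * N * S) - N * S * S \<le> expo A0 B0 a b"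
        using f0 unfolding e sum_distrib_left[symmetric] by linarith
      from mult_left_mono[OF this, of c]
      have "- c * expo A0 B0 a b \<le> c * \<delta> * N * S + c * N * S * S + (- \<kappa> * (\<Sum>i\<in>K. \<bar>a i\<bar>) + - \<kappa> * (\<Sum>i\<in>K. \<bar>b i\<bar>))"
        using c by (simp add: \<kappa>_def field_simps)
      then have ex: "exp (- c * expo A0 B0 a b) \<le> D (a, b)"
        unfolding D_def C_def prod.case exp_add[symmetric] by simp
      have "\<bar>sgn_prod X \<Lambda> A0 B0 a b\<bar> \<le> 1"
        unfolding sgn_prod_def abs_prod using abs_sgn_pair_le by (intro prod_le_1) auto
      then have "\<bar>sgn_prod X \<Lambda> A0 B0 a b\<bar> * exp (- c * expo A0 B0 a b) \<le> 1 * exp (- c * expo A0 B0 a b)"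
        by (intro mult_right_mono) auto
      then show ?thesis by (rule order_trans) (use ex in simp)
    qed
  qed
qed

definition weight :: "complex \<Rightarrow> ('k \<Rightarrow> complex) \<Rightarrow> ('k \<Rightarrow> complex) \<Rightarrow> ('k \<Rightarrow> real) \<Rightarrow> ('k \<Rightarrow> real) \<Rightarrow> complex" where
  "weight \<tau> u v a b = e2pi ((\<Sum>j\<in>K. of_real (b j) * u j) - (\<Sum>i\<in>K. of_real (a i) * v i) + of_real (form a b) * \<tau>)"

definition compatible :: "complex \<Rightarrow> ('k \<Rightarrow> complex) \<Rightarrow> ('k \<Rightarrow> complex) \<Rightarrow> ('k \<Rightarrow> real) \<Rightarrow> ('k \<Rightarrow> real) \<Rightarrow> bool" where
  "compatible \<tau> u v A0 B0 \<longleftrightarrow> 0 < Im \<tau> \<and> (\<forall>j\<in>K. Im (u j) = row j A0 * Im \<tau>) \<and> (\<forall>i\<in>K. Im (v i) = col i B0 * Im \<tau>)"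

lemma norm_weight:
  assumes "compatible \<tau> u v A0 B0"
  shows "norm (weight \<tau> u v a b) = exp (- (2 * pi * Im \<tau>) * expo A0 B0 a b)"
proof -
  have "Im ((\<Sum>j\<in>K. of_real (b j) * u j) - (\<Sum>i\<in>K. of_real (a i) * v i) + of_real (form a b) * \<tau>)
    = (\<Sum>j\<in>K. b j * (row j A0 * Im \<tau>)) - (\<Sum>i\<in>K. a i * (col i B0 * Im \<tau>)) + form a b * Im \<tau>"
    using assms by (simp add: compatible_def)
  also have "\<dots> = expo A0 B0 a b * Im \<tau>"
    unfolding expo_def by (simp add: algebra_simps sum_distrib_left)
  finally show ?thesis by (simp add: weight_def norm_e2pi algebra_simps)
qed

lemma term_summable:
  assumes db: "dual_bases X \<Lambda>" and cp: "compatible \<tau> u v A0 B0" and sep: "\<And>i. i \<in> K \<Longrightarrow>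
     (\<exists>\<delta>>0. \<forall>b\<in>M. \<delta> \<le> \<bar>lin K (X i) b - lin K (X i) B0\<bar>) \<and> (\<exists>\<delta>>0. \<forall>a\<in>L. \<delta> \<le> \<bar>lin K (\<Lambda> i) a + lin K (\<Lambda> i) A0\<bar>)"
  shows "(\<lambda>(a, b). of_real (sgn_prod X \<Lambda> A0 B0 a b) * weight \<tau> u v a b) summable_on L \<times> M"
proof -
  obtain \<delta>1 \<delta>2 where d12: "\<And>i. i \<in> K \<Longrightarrow> 0 < \<delta>1 i \<and> (\<forall>b\<in>M. \<delta>1 i \<le> \<bar>lin K (X i) b - lin K (X i) B0\<bar>)"
    "\<And>i. i \<in> K \<Longrightarrow> 0 < \<delta>2 i \<and> (\<forall>a\<in>L. \<delta>2 i \<le> \<bar>lin K (\<Lambda> i) a + lin K (\<Lambda> i) A0\<bar>)"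
    using sep by metis
  define \<delta> where "\<delta> = Min (insert 1 (\<delta>1 ` K \<union> \<delta>2 ` K))"
  have \<delta>: "0 < \<delta>" "\<And>i. i \<in> K \<Longrightarrow> \<delta> \<le> \<delta>1 i \<and> \<delta> \<le> \<delta>2 i"
    using fin_I d12 by (auto simp: \<delta>_def)
  define S where "S = (\<Sum>i\<in>K. \<bar>lin K (X i) B0\<bar> + \<bar>lin K (\<Lambda> i) A0\<bar>)"
  have S: "\<bar>lin K (X i) B0\<bar> + \<bar>lin K (\<Lambda> i) A0\<bar> \<le> S" if "i \<in> K" for i
    unfolding S_def using that fin_I by (intro member_le_sum) auto
  have "separated X \<Lambda> \<delta> S A0 B0"
    unfolding separated_def
  proof (intro ballI conjI)
    fix i assume i: "i \<in> K"
    show "\<bar>lin K (X i) B0\<bar> \<le> S" "\<bar>lin K (\<Lambda> i) A0\<bar> \<le> S" using S[OF i] by linarith+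
    show "\<delta> \<le> \<bar>lin K (X i) b - lin K (X i) B0\<bar>" if "b \<in> M" for b
      using d12(1)[OF i] \<delta>(2)[OF i] that by force
    show "\<delta> \<le> \<bar>lin K (\<Lambda> i) a + lin K (\<Lambda> i) A0\<bar>" if "a \<in> L" for a
      using d12(2)[OF i] \<delta>(2)[OF i] that by force
  qed
  moreover have "0 < 2 * pi * Im \<tau>" using cp by (simp add: compatible_def)
  moreover have "0 \<le> S" by (simp add: S_def sum_nonneg)
  ultimately obtain D where D: "D summable_on L \<times> M"
    "\<And>a b. a \<in> L \<Longrightarrow> b \<in> M \<Longrightarrow> \<bar>sgn_prod X \<Lambda> A0 B0 a b\<bar> * exp (- (2 * pi * Im \<tau>) * expo A0 B0 a b) \<le> D (a, b)"
    using sgn_prod_dominated[OF db _ \<delta>(1), of "2 * pi * Im \<tau>" S] by metis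
  have "(\<lambda>x. norm (case x of (a, b) \<Rightarrow> of_real (sgn_prod X \<Lambda> A0 B0 a b) * weight \<tau> u v a b)) summable_on L \<times> M"
    using D(2) by (intro summable_on_comparison_test[OF D(1)]) (auto simp: norm_mult norm_weight[OF cp])
  then show ?thesis by (rule abs_summable_summable)
qed

text \<open>One stage of Gauss--Jordan elimination: the coordinates \<open>b j\<close> with \<open>j \<in> A\<close> have been
  replaced by \<open>col j b\<close>; the rows of \<open>C\<close> are the dual coordinates on the other side.\<close>

definition stage_basis :: "'k set \<Rightarrow> 'k \<Rightarrow> 'k \<Rightarrow> real" where
  "stage_basis A j = (if j \<in> A then (\<lambda>l. real (E l j)) else uvec j)"

text \<open>The last clause says that the columns already treated are unit columns, so that at
  \<open>A = K\<close> the dual coordinates are the \<open>a i\<close> themselves. Rational entries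
  are recorded because they bound the denominators of the functionals on \<open>L\<close>.\<close>

definition stage :: "'k set \<Rightarrow> ('k \<Rightarrow> 'k \<Rightarrow> real) \<Rightarrow> bool" where
  "stage A C \<longleftrightarrow> (\<forall>j\<in>K. \<forall>i\<in>K. C j i \<in> \<rat>) \<and> dual_bases (stage_basis A) C \<and>
     (\<forall>y. \<exists>a. \<forall>j\<in>K. lin K (C j) a = y j) \<and> (\<forall>j\<in>K. \<forall>p\<in>A. C j p = (if j = p then 1 else 0))"

lemma stage_empty: "stage {} (\<lambda>j i. real (E j i))"
proof -
  have "dual_bases (stage_basis {}) (\<lambda>j i. real (E j i))"
    using fin_I by (simp add: dual_bases_def stage_basis_def form_def lin_uvec_left cong: sum.cong)
  moreover have "\<forall>y. \<exists>a. \<forall>j\<in>K. row j a = y j" using surj_E by meson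
  ultimately show ?thesis by (simp add: stage_def)
qed

text \<open>Column \<open>k\<close> of \<open>C\<close> has entries of size at most 1/2 in the rows
  of \<open>A\<close>; hence \<open>C k k\<close> differs from \<open>E k k \<ge> 2\<close> by at
  most 1/2.\<close>

lemma stage_pivot_pos:
  assumes st: "stage A C" and A: "A \<subseteq> K" and k: "k \<in> K" "k \<notin> A"
  shows "0 < C k k"
proof -
  have db: "dual_bases (stage_basis A) C" using st by (simp add: stage_def)
  have finA: "finite A" using A fin_I finite_subset by blast
  have eq: "real (E i k) = (\<Sum>j\<in>A. real (E i j) * C j k) + (if i \<in> A then 0 else C i k)" if i: "i \<in> K" for i
  proof -
    have "real (E i k) = form (uvec k) (uvec i)"
      using k i fin_I by (simp add: form_uvec_right lin_uvec_right)
    also have "\<dots> = (\<Sum>j\<in>K. stage_basis A j i * C j k)"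
      using db k i fin_I by (simp add: dual_bases_def lin_uvec_right)
    also have "\<dots> = (\<Sum>j\<in>A. stage_basis A j i * C j k) + (\<Sum>j\<in>K-A. stage_basis A j i * C j k)"
      using A fin_I by (metis (no_types, lifting) add.commute sum.subset_diff)
    also have "(\<Sum>j\<in>K-A. stage_basis A j i * C j k) = (\<Sum>j\<in>K-A. if j = i then C i k else 0)"
      by (intro sum.cong) (auto simp: stage_basis_def uvec_def)
    also have "\<dots> = (if i \<in> A then 0 else C i k)" using i fin_I by simp
    finally show ?thesis by (simp add: stage_basis_def)
  qed
  have half: "\<bar>C i k\<bar> \<le> 1/2" if i: "i \<in> A" for i
  proof -
    \<comment> \<open>Diagonal dominance at a row \<open>p\<close> with the largest entry:
      \<open>E p p \<ge> 2\<close> multiplies it, while the at most one off-diagonal 1 of that row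
      sits either in column \<open>k\<close>, giving \<open>2 m \<le> 1\<close>, or in
      \<open>A\<close>, giving \<open>2 m \<le> m\<close>.\<close>
    define m where "m = Max ((\<lambda>i. \<bar>C i k\<bar>) ` A)"
    have "m \<in> (\<lambda>i. \<bar>C i k\<bar>) ` A" unfolding m_def using finA i by (intro Max_in) auto
    then obtain p where p: "p \<in> A" "m = \<bar>C p k\<bar>" by auto
    have mle: "\<bar>C j k\<bar> \<le> m" if "j \<in> A" for j unfolding m_def using finA that by (intro Max_ge) auto
    have "real (E p k) = real (E p p) * C p k + (\<Sum>j\<in>A-{p}. real (E p j) * C j k)"
      using eq[of p] p A finA by (auto simp: sum.remove)
    then have "real (E p p) * m \<le> real (E p k) + (\<Sum>j\<in>A-{p}. real (E p j) * \<bar>C j k\<bar>)"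
    proof -
      assume a: "real (E p k) = real (E p p) * C p k + (\<Sum>j\<in>A-{p}. real (E p j) * C j k)"
      have "real (E p p) * m = \<bar>real (E p p) * C p k\<bar>" by (simp add: p abs_mult)
      also have "\<dots> \<le> \<bar>real (E p k)\<bar> + \<bar>\<Sum>j\<in>A-{p}. real (E p j) * C j k\<bar>" using a by linarith
      also have "\<bar>\<Sum>j\<in>A-{p}. real (E p j) * C j k\<bar> \<le> (\<Sum>j\<in>A-{p}. \<bar>real (E p j) * C j k\<bar>)" by (rule sum_abs)
      finally show ?thesis by (simp add: abs_mult)
    qed
    also have "(\<Sum>j\<in>A-{p}. real (E p j) * \<bar>C j k\<bar>) \<le> (\<Sum>j\<in>A-{p}. real (E p j) * m)"
      by (intro sum_mono mult_left_mono mle) auto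
    also have "\<dots> = real (\<Sum>j\<in>A-{p}. E p j) * m" by (simp add: sum_distrib_right)
    finally have mb: "real (E p p) * m \<le> real (E p k) + real (\<Sum>j\<in>A-{p}. E p j) * m" by simp
    have "E p k + (\<Sum>j\<in>A-{p}. E p j) = (\<Sum>j\<in>insert k (A-{p}). E p j)" using k finA by simp
    also have "\<dots> \<le> (\<Sum>j\<in>K-{p}. E p j)" using k p A fin_I by (intro sum_mono2) auto
    also have "\<dots> \<le> 1" using row_le p A by blast
    finally consider "E p k = 0" "(\<Sum>j\<in>A-{p}. E p j) \<le> 1" | "E p k = 1" "(\<Sum>j\<in>A-{p}. E p j) = 0"
      by linarith
    moreover have m0: "0 \<le> m" using p by simp
    moreover have "2 * m \<le> real (E p p) * m" using diag[of p] p A m0 by (intro mult_right_mono) auto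
    ultimately have "m \<le> 1/2"
    proof cases
      case 1
      have "real (\<Sum>j\<in>A-{p}. E p j) * m \<le> real 1 * m"
        by (intro mult_right_mono m0 of_nat_mono 1)
      then show ?thesis using \<open>2 * m \<le> real (E p p) * m\<close> mb m0 unfolding 1(1) by linarith
    next
      case 2
      show ?thesis using \<open>2 * m \<le> real (E p p) * m\<close> mb unfolding 2 by simp
    qed
    then show ?thesis using mle[OF i] by simp
  qed
  have "\<bar>\<Sum>j\<in>A. real (E k j) * C j k\<bar> \<le> (\<Sum>j\<in>A. \<bar>real (E k j) * C j k\<bar>)" by (rule sum_abs)
  also have "\<dots> \<le> (\<Sum>j\<in>A. real (E k j) * (1/2))"
    unfolding abs_mult by (intro sum_mono mult_mono half) auto
  also have "\<dots> = real (\<Sum>j\<in>A. E k j) * (1/2)" by (simp add: sum_distrib_right)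
  also have "\<dots> \<le> 1 * (1/2)"
  proof (rule mult_right_mono)
    have "(\<Sum>j\<in>A. E k j) \<le> (\<Sum>j\<in>K-{k}. E k j)" using k A fin_I by (intro sum_mono2) auto
    also have "\<dots> \<le> 1" using row_le k by blast
    finally have "real (\<Sum>j\<in>A. E k j) \<le> real 1" by (rule of_nat_mono)
    then show "real (\<Sum>j\<in>A. E k j) \<le> 1" by simp
  qed simp
  finally show ?thesis using eq[OF k(1)] k diag[OF k(1)] by auto
qed

end

section \<open>Generic shifts and the exchange step\<close>

lemma abs_add_ge_of_denominator:
  fixes x y :: real
  assumes x: "D * x \<in> \<int>" and D: "0 < D" and y: "lo \<le> \<bar>y\<bar>" "\<bar>y\<bar> \<le> 1 / (2 * D)"
  shows "min lo (1 / (2 * D)) \<le> \<bar>x + y\<bar>"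
proof (cases "x = 0")
  case True
  then show ?thesis using y by simp
next
  case False
  obtain n :: int where n: "D * x = of_int n" using x by (auto elim: Ints_cases)
  then have "n \<noteq> 0" using False D by auto
  then have "1 \<le> \<bar>real_of_int n\<bar>" by linarith
  then have "1 \<le> D * \<bar>x\<bar>" using n D by (metis abs_mult abs_of_pos)
  then have "1 / D \<le> \<bar>x\<bar>" using D by (simp add: field_simps)
  moreover have "1 / D = 1 / (2 * D) + 1 / (2 * D)" using D by (simp add: field_simps)
  ultimately show ?thesis using y(2) by linarith
qed

text \<open>A vector that avoids the earlier hyperplanes is moved along a line not contained in the
  new one; each hyperplane excludes at most one parameter on it.\<close>

lemma generic_vector_exists:
  fixes \<F> :: "('k \<Rightarrow> real) set"
  assumes "finite \<F>" "\<And>F. F \<in> \<F> \<Longrightarrow> \<exists>a. lin K F a \<noteq> 0"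
  shows "\<exists>\<theta>. \<forall>F\<in>\<F>. lin K F \<theta> \<noteq> 0"
  using assms
proof (induction \<F> rule: finite_induct)
  case (insert F \<F>)
  then obtain \<theta> where \<theta>: "\<And>G. G \<in> \<F> \<Longrightarrow> lin K G \<theta> \<noteq> 0" by auto
  obtain a where a: "lin K F a \<noteq> 0" using insert.prems by blast
  define bad where "bad = (\<lambda>G. - lin K G \<theta> / lin K G a) ` insert F \<F>"
  have "finite bad" using insert.hyps by (simp add: bad_def)
  then obtain t where t: "t \<notin> bad" using ex_new_if_finite[OF infinite_UNIV_char_0] by blast
  have "lin K G (\<lambda>i. \<theta> i + t * a i) \<noteq> 0" if G: "G \<in> insert F \<F>" for G
  proof
    assume "lin K G (\<lambda>i. \<theta> i + t * a i) = 0"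
    then have e: "lin K G \<theta> + t * lin K G a = 0" by (simp add: lin_add_right lin_scale_right)
    have "lin K G a \<noteq> 0"
    proof
      assume 0: "lin K G a = 0"
      then have "G \<in> \<F>" using G a by auto
      with \<theta> e 0 show False by simp
    qed
    then have "t = - lin K G \<theta> / lin K G a" using e by (simp add: field_simps)
    then show False using t G by (auto simp: bad_def)
  qed
  then show ?case by blast
qed auto

context chain_loop_lattices
begin

text \<open>The condition \<open>u l = v p\<close> makes \<open>weight\<close> invariant under the
  involution of \<open>exch_vanish\<close>. Shifts of the integral values \<open>row l a\<close> and
  \<open>col p b\<close> by less than 1, and of \<open>b j\<close> by less than
  \<open>1 / d\<close>, can only decide how the value 0 is counted.\<close>

definition admissible :: "complex \<Rightarrow> ('k \<Rightarrow> complex) \<Rightarrow> ('k \<Rightarrow> complex) \<Rightarrow> ('k \<Rightarrow> real) \<Rightarrow> ('k \<Rightarrow> real) \<Rightarrow> bool" where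
  "admissible \<tau> u v A0 B0 \<longleftrightarrow> compatible \<tau> u v A0 B0 \<and>
     (\<forall>l\<in>K. \<forall>p\<in>K. l \<noteq> p \<and> E l p = 1 \<longrightarrow> u l = v p) \<and>
     (\<forall>l\<in>K. 0 < row l A0 \<and> row l A0 < 1) \<and> (\<forall>p\<in>K. 0 < col p B0 \<and> col p B0 < 1) \<and>
     (\<forall>j\<in>K. 0 < B0 j \<and> B0 j < 1 / real d)"

definition good :: "('k \<Rightarrow> real) \<Rightarrow> ('k \<Rightarrow> real) \<Rightarrow> bool" where
  "good F A0 \<longleftrightarrow> (\<exists>\<delta>>0. \<forall>a\<in>L. \<delta> \<le> \<bar>lin K F a + lin K F A0\<bar>)"

lemma good_nonzero: "good F A0 \<Longrightarrow> a \<in> L \<Longrightarrow> lin K F a + lin K F A0 \<noteq> 0"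
  unfolding good_def by force

lemma good_scale:
  assumes "good F A0" "t \<noteq> 0"
  shows "good (\<lambda>i. t * F i) A0"
proof -
  obtain \<delta> where \<delta>: "0 < \<delta>" "\<And>a. a \<in> L \<Longrightarrow> \<delta> \<le> \<bar>lin K F a + lin K F A0\<bar>"
    using assms by (auto simp: good_def)
  have "\<bar>t\<bar> * \<delta> \<le> \<bar>lin K (\<lambda>i. t * F i) a + lin K (\<lambda>i. t * F i) A0\<bar>" if "a \<in> L" for a
  proof -
    have "\<bar>t\<bar> * \<delta> \<le> \<bar>t\<bar> * \<bar>lin K F a + lin K F A0\<bar>" using \<delta>(2)[OF that] by (intro mult_left_mono) auto
    then show ?thesis by (simp add: lin_scale_left abs_mult[symmetric] distrib_left)
  qed
  moreover have "0 < \<bar>t\<bar> * \<delta>" using assms \<delta> by simp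
  ultimately show ?thesis unfolding good_def by blast
qed

definition lattice_sum :: "complex \<Rightarrow> ('k \<Rightarrow> complex) \<Rightarrow> ('k \<Rightarrow> complex) \<Rightarrow> ('k \<Rightarrow> real) \<Rightarrow> ('k \<Rightarrow> real) \<Rightarrow>
    ('k \<Rightarrow> 'k \<Rightarrow> real) \<Rightarrow> ('k \<Rightarrow> 'k \<Rightarrow> real) \<Rightarrow> complex" where
  "lattice_sum \<tau> u v A0 B0 X \<Lambda> =
     (\<Sum>\<^sub>\<infinity>(a, b)\<in>L \<times> M. of_real (sgn_prod X \<Lambda> A0 B0 a b) * weight \<tau> u v a b)"

lemma col_separated:
  assumes "admissible \<tau> u v A0 B0" "p \<in> K"
  shows "\<exists>\<delta>>0. \<forall>b\<in>M. \<delta> \<le> \<bar>col p b - col p B0\<bar>"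
proof -
  define y where "y = col p B0"
  have y: "0 < y" "y < 1" using assms by (auto simp: admissible_def y_def)
  have "min y (1 - y) \<le> \<bar>col p b - y\<bar>" if bM: "b \<in> M" for b
  proof -
    obtain n :: int where n: "col p b = of_int n" using col_Ints[OF bM assms(2)] by (auto elim: Ints_cases)
    consider "n \<le> 0" | "1 \<le> n" by linarith
    then show ?thesis
    proof cases
      case 1
      then have "real_of_int n \<le> 0" by simp
      then show ?thesis unfolding n by linarith
    next
      case 2
      then have "1 \<le> real_of_int n" by simp
      then show ?thesis unfolding n by linarith
    qed
  qed
  then show ?thesis using y unfolding y_def by (intro exI[of _ "min (col p B0) (1 - col p B0)"]) auto
qed

lemma stage_basis_separated:
  assumes adm: "admissible \<tau> u v A0 B0" and j: "j \<in> K"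
  shows "\<exists>\<delta>>0. \<forall>b\<in>M. \<delta> \<le> \<bar>lin K (stage_basis A j) b - lin K (stage_basis A j) B0\<bar>"
proof (cases "j \<in> A")
  case True
  then show ?thesis using col_separated[OF adm j] by (simp add: stage_basis_def)
next
  case False
  define y where "y = B0 j"
  have y: "0 < y" "y < 1 / real d" using adm j by (auto simp: admissible_def y_def)
  have "min y (1 / real d - y) \<le> \<bar>b j - y\<bar>" if bM: "b \<in> M" for b
  proof -
    obtain n :: int where n: "real d * b j = of_int n" using den_M[OF bM] by (auto elim: Ints_cases)
    then have b: "b j = of_int n / real d" using d_pos by (simp add: field_simps)
    consider "n \<le> 0" | "1 \<le> n" by linarith
    then show ?thesis
    proof cases
      case 1
      then have "b j \<le> 0" unfolding b using d_pos by (simp add: divide_le_0_iff)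
      then show ?thesis using y by linarith
    next
      case 2
      then have "1 / real d \<le> b j" unfolding b by (intro divide_right_mono) auto
      then show ?thesis using y by linarith
    qed
  qed
  then show ?thesis using y fin_I j False
    by (intro exI[of _ "min y (1 / real d - y)"]) (auto simp: stage_basis_def lin_uvec_left y_def)
qed

text \<open>The exchange with index \<open>l\<close>: the new coordinate \<open>col k\<close> takes
  the place of coordinate \<open>l\<close>. For \<open>l = k\<close> it is the next stage; all other
  \<open>l\<close> produce the terms that sum to zero.\<close>

definition exch_basis :: "'k set \<Rightarrow> 'k \<Rightarrow> 'k \<Rightarrow> 'k \<Rightarrow> 'k \<Rightarrow> real" where
  "exch_basis A k l = (stage_basis A)(l := (\<lambda>j. real (E j k)))"

definition exch_dual :: "('k \<Rightarrow> 'k \<Rightarrow> real) \<Rightarrow> 'k \<Rightarrow> 'k \<Rightarrow> 'k \<Rightarrow> 'k \<Rightarrow> real" where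
  "exch_dual C k l j = (if j = l then (\<lambda>i. inverse (C l k) * C l i) else (\<lambda>i. C j i - C j k / C l k * C l i))"

lemma lin_exch_dual:
  "lin K (exch_dual C k l j) a = (if j = l then lin K (C l) a / C l k else lin K (C j) a - C j k / C l k * lin K (C l) a)"
  by (cases "j = l") (simp_all add: exch_dual_def lin_diff_left lin_scale_left divide_inverse_commute)

lemma col_eq_stage:
  assumes "stage A C" "k \<in> K"
  shows "col k b = (\<Sum>j\<in>K. C j k * lin K (stage_basis A j) b)"
  using assms fin_I form_uvec_left[of k b]
  by (simp add: stage_def dual_bases_def lin_uvec_right mult.commute)

lemma exch_dual_bases:
  assumes st: "stage A C" and k: "k \<in> K" and l: "l \<in> K" "C l k \<noteq> 0"
  shows "dual_bases (exch_basis A k l) (exch_dual C k l)"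
  unfolding dual_bases_def
proof (intro allI)
  fix a b
  define x where "x j = lin K (stage_basis A j) b" for j
  define m where "m j = lin K (C j) a" for j
  define t where "t = m l / C l k"
  have "(\<Sum>i\<in>K. lin K (exch_basis A k l i) b * lin K (exch_dual C k l i) a)
    = col k b * t + (\<Sum>j\<in>K-{l}. x j * (m j - C j k * t))"
    using fin_I l by (simp add: sum.remove[of K l] exch_basis_def lin_exch_dual x_def m_def t_def)
  also have "(\<Sum>j\<in>K-{l}. x j * (m j - C j k * t)) = (\<Sum>j\<in>K-{l}. x j * m j) - (\<Sum>j\<in>K-{l}. C j k * x j) * t"
    by (simp add: algebra_simps sum_subtractf sum_distrib_left)
  also have "col k b = C l k * x l + (\<Sum>j\<in>K-{l}. C j k * x j)"
    using fin_I l unfolding col_eq_stage[OF st k] x_def by (simp add: sum.remove)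
  also have "(C l k * x l + (\<Sum>j\<in>K-{l}. C j k * x j)) * t + ((\<Sum>j\<in>K-{l}. x j * m j) - (\<Sum>j\<in>K-{l}. C j k * x j) * t)
    = x l * m l + (\<Sum>j\<in>K-{l}. x j * m j)"
    using l by (simp add: t_def algebra_simps)
  also have "\<dots> = (\<Sum>j\<in>K. x j * m j)" using fin_I l by (simp add: sum.remove)
  also have "\<dots> = form a b" using st by (simp add: stage_def dual_bases_def x_def m_def)
  finally show "form a b = (\<Sum>i\<in>K. lin K (exch_basis A k l i) b * lin K (exch_dual C k l i) a)" by simp
qed

text \<open>In the exchanged bases \<open>b l\<close> occurs in a single coordinate, equal to
  \<open>col p\<close>, whose dual coordinate is \<open>row l\<close>; and \<open>a p\<close> occurs
  in no other dual coordinate. Hence moving \<open>a p\<close> and \<open>b l\<close> affects one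
  sign factor only, and a suitable move turns \<open>(row l a, col p b)\<close> into
  \<open>(- col p b, - row l a)\<close>.\<close>

lemma exch_vanish:
  assumes st: "stage A C" and A: "A \<subseteq> K" and k: "k \<in> K" "k \<notin> A" and l: "l \<in> K" "C l k \<noteq> 0" "l \<noteq> k"
    and adm: "admissible \<tau> u v A0 B0"
  shows "lattice_sum \<tau> u v A0 B0 (exch_basis A k l) (exch_dual C k l) = 0"
proof -
  let ?X = "exch_basis A k l" and ?\<Lambda> = "exch_dual C k l"
  interpret sw: dual_lattices K K "\<lambda>i j. E j i" M L d by (rule swap)
  have finA: "finite A" using A fin_I finite_subset by blast
  have rep: "form a b = (\<Sum>i\<in>K. lin K (?X i) b * lin K (?\<Lambda> i) a)" for a b
    using exch_dual_bases[OF st k(1) l(1,2)] by (simp add: dual_bases_def)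
  have C\<delta>: "C j p = (if j = p then 1 else 0)" if "j \<in> K" "p \<in> A" for j p
    using st that by (simp add: stage_def)
  \<comment> \<open>The columns present among the new coordinates. Row \<open>l\<close> has a single
    nonzero entry on \<open>T\<close>, equal to 1: more is excluded by \<open>row_le\<close>, and
    none would make \<open>row l\<close> vanish identically, against
    \<open>E l l \<ge> 2\<close>.\<close>
  define T where "T = insert k (A - {l})"
  have T: "finite T" "T \<subseteq> K - {l}" using finA A k l by (auto simp: T_def)
  have Xl: "?X i l = (if i = l then real (E l k) else if i \<in> A then real (E l i) else 0)" for i
    by (auto simp: exch_basis_def stage_basis_def uvec_def)
  have row_eq: "row l a = (\<Sum>i\<in>K. ?X i l * lin K (?\<Lambda> i) a)" for a
    using form_uvec_right[OF l(1), of a] rep[of a "uvec l"] fin_I l by (simp add: lin_uvec_right)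
  have "(\<Sum>j\<in>T. E l j) \<noteq> 0"
  proof
    assume "(\<Sum>j\<in>T. E l j) = 0"
    then have "E l j = 0" if "j \<in> T" for j using T that by simp
    then have "?X i l = 0" for i unfolding Xl using k l by (auto simp: T_def)
    then have "row l (uvec l) = 0" unfolding row_eq by simp
    then have "E l l = 0" using fin_I l by (simp add: lin_uvec_right)
    then show False using diag[OF l(1)] by simp
  qed
  moreover have "(\<Sum>j\<in>T. E l j) \<le> (\<Sum>j\<in>K-{l}. E l j)" using T fin_I by (intro sum_mono2) auto
  ultimately have "(\<Sum>j\<in>T. E l j) = Suc 0" using row_le[OF l(1)] by linarith
  then obtain p where p: "p \<in> T" "E l p = 1" "\<And>j. j \<in> T \<Longrightarrow> j \<noteq> p \<Longrightarrow> E l j = 0"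
    using sum_eq_Suc0_iff[OF T(1)] by (metis One_nat_def)
  have pK: "p \<in> K" "p \<noteq> l" using p T by auto
  \<comment> \<open>The position at which \<open>col p\<close> stands in the exchanged basis:
    \<open>col k\<close> was put at position \<open>l\<close>, every other column keeps its own
    index.\<close>
  define i0 where "i0 = (if p = k then l else p)"
  have i0: "i0 \<in> K" using pK l by (simp add: i0_def)
  have X0: "?X i0 = (\<lambda>j. real (E j p))"
    using p pK k by (auto simp: i0_def exch_basis_def stage_basis_def T_def)
  have Xz: "?X i l = 0" if "i \<in> K" "i \<noteq> i0" for i
    unfolding Xl using that p(3)[of k] p(3)[of i] k by (auto simp: i0_def T_def split: if_splits)
  have \<Lambda>z: "?\<Lambda> i p = 0" if "i \<in> K" "i \<noteq> i0" for i
  proof (cases "p = k")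
    case True
    then show ?thesis using that l by (simp add: i0_def exch_dual_def)
  next
    case False
    then have "p \<in> A" using p by (auto simp: T_def)
    then show ?thesis using that C\<delta>[of i p] C\<delta>[of l p] l pK False by (auto simp: i0_def exch_dual_def)
  qed
  have row_\<Lambda>: "lin K (?\<Lambda> i0) a = row l a" for a
  proof -
    have "row l a = ?X i0 l * lin K (?\<Lambda> i0) a + (\<Sum>i\<in>K-{i0}. ?X i l * lin K (?\<Lambda> i) a)"
      unfolding row_eq using fin_I i0 by (simp add: sum.remove)
    also have "(\<Sum>i\<in>K-{i0}. ?X i l * lin K (?\<Lambda> i) a) = 0" using Xz by (intro sum.neutral) auto
    finally show ?thesis using X0 p by simp
  qed
  \<comment> \<open>Since \<open>form (uvec p) (uvec l) = E l p = 1\<close>, subtracting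
    \<open>t\<close> from \<open>a p\<close> and \<open>b l\<close> changes \<open>form a b\<close>
    by \<open>- t * (row l a + col p b) + t^2\<close>, which is 0 for exactly this nonzero choice of
    \<open>t\<close>.\<close>
  define t where "t x = row l (fst x) + col p (snd x)" for x
  define \<sigma> where "\<sigma> x = ((\<lambda>i. fst x i - t x * uvec p i), (\<lambda>j. snd x j - t x * uvec l j))" for x
  have tInt: "t x \<in> \<int>" if "x \<in> L \<times> M" for x
    using that row_Ints[of "fst x" l] col_Ints[of "snd x" p] l pK by (auto simp: t_def)
  have lr: "row l (fst (\<sigma> x)) = - col p (snd x)" "col p (snd (\<sigma> x)) = - row l (fst x)" for x
    using fin_I pK l p(2) by (simp_all add: \<sigma>_def lin_sub_uvec t_def)
  have "infsum (\<lambda>(a, b). of_real (sgn_prod ?X ?\<Lambda> A0 B0 a b) * weight \<tau> u v a b) (L \<times> M) = 0"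
  proof (rule infsum_antisym_eq_0)
    fix x assume x: "x \<in> L \<times> M"
    obtain a b where ab: "x = (a, b)" "a \<in> L" "b \<in> M" using x by auto
    show "\<sigma> x \<in> L \<times> M"
      using ab L_diff[OF ab(2) L_scale[OF unit_L[OF pK(1)] tInt[OF x]]]
        sw.L_diff[OF ab(3) sw.L_scale[OF unit_M[OF l(1)] tInt[OF x]]]
      by (simp add: \<sigma>_def)
    have "t (\<sigma> x) = - t x" unfolding t_def lr by simp
    then show "\<sigma> (\<sigma> x) = x" unfolding \<sigma>_def[of "\<sigma> x"] by (simp add: \<sigma>_def prod_eq_iff)
    define a' b' where "a' = fst (\<sigma> x)" and "b' = snd (\<sigma> x)"
    have \<sigma>x: "\<sigma> x = (a', b')" by (simp add: a'_def b'_def)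
    have a': "a' = (\<lambda>i. a i - t x * uvec p i)" and b': "b' = (\<lambda>j. b j - t x * uvec l j)"
      using ab by (simp_all add: a'_def b'_def \<sigma>_def)
    have tx: "t x = row l a + col p b" by (simp add: t_def ab)
    have "form a' b' = form a b"
    proof -
      have "form a' b' = form a b - t x * form a (uvec l) - t x * (form (uvec p) b - t x * form (uvec p) (uvec l))"
        unfolding a' b' form_diff_left form_diff_right form_scale_left form_scale_right by (simp add: algebra_simps)
      also have "form (uvec p) (uvec l) = 1"
        using form_uvec_right[OF l(1), of "uvec p"] fin_I pK p by (simp add: lin_uvec_right)
      finally show ?thesis
        using form_uvec_right[OF l(1), of a] form_uvec_left[OF pK(1), of b] by (simp add: tx algebra_simps)
    qed
    moreover have "u l = v p" using adm l pK p(2) by (auto simp: admissible_def)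
    moreover have "(\<Sum>j\<in>K. of_real (b' j) * u j) = (\<Sum>j\<in>K. of_real (b j) * u j) - of_real (t x) * u l"
    proof -
      have "(\<Sum>j\<in>K. of_real (b' j) * u j) = (\<Sum>j\<in>K. of_real (b j) * u j) - (\<Sum>j\<in>K. if j = l then of_real (t x) * u l else 0)"
        unfolding b' sum_subtractf[symmetric] by (intro sum.cong) (auto simp: uvec_def algebra_simps)
      then show ?thesis using fin_I l by simp
    qed
    moreover have "(\<Sum>j\<in>K. of_real (a' j) * v j) = (\<Sum>j\<in>K. of_real (a j) * v j) - of_real (t x) * v p"
    proof -
      have "(\<Sum>j\<in>K. of_real (a' j) * v j) = (\<Sum>j\<in>K. of_real (a j) * v j) - (\<Sum>j\<in>K. if j = p then of_real (t x) * v p else 0)"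
        unfolding a' sum_subtractf[symmetric] by (intro sum.cong) (auto simp: uvec_def algebra_simps)
      then show ?thesis using fin_I pK by simp
    qed
    ultimately have W: "weight \<tau> u v a' b' = weight \<tau> u v a b"
      by (simp add: weight_def)
    define s where "s i a b = sgn_pair (lin K (?X i) b - lin K (?X i) B0) (lin K (?\<Lambda> i) a + lin K (?\<Lambda> i) A0)" for i a b
    have "s i a' b' = s i a b" if i: "i \<in> K - {i0}" for i
      using Xz[of i] \<Lambda>z[of i] i fin_I pK l unfolding s_def a' b' by (simp add: lin_sub_uvec)
    then have "(\<Prod>i\<in>K-{i0}. s i a' b') = (\<Prod>i\<in>K-{i0}. s i a b)" by (rule prod.cong[OF refl])
    moreover have "s i0 a' b' = - s i0 a b"
    proof -
      obtain m n :: int where mn: "col p b = of_int m" "row l a = of_int n"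
        using col_Ints[OF ab(3) pK(1)] row_Ints[OF ab(2) l(1)] by (auto elim!: Ints_cases)
      have e: "row l a' = - col p b" "col p b' = - row l a" using lr[of x] by (simp_all add: a'_def b'_def ab)
      have r: "0 < row l A0" "row l A0 < 1" "0 < col p B0" "col p B0 < 1"
        using adm l pK by (auto simp: admissible_def)
      \<comment> \<open>Shifts strictly between 0 and 1 turn the four comparisons into strict ones
        on integers, so the antisymmetry is exact even where \<open>row l a\<close> or
        \<open>col p b\<close> is 0.\<close>
      have c1: "0 < - of_int n - col p B0 \<longleftrightarrow> n < 0" "of_int n + row l A0 < 0 \<longleftrightarrow> n < 0"
        "0 < of_int m - col p B0 \<longleftrightarrow> 0 < m" "- of_int m + row l A0 < 0 \<longleftrightarrow> 0 < m"
        using r by linarith+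
      show ?thesis unfolding s_def row_\<Lambda> X0 e unfolding mn sgn_pair_def c1 by simp
    qed
    ultimately have "sgn_prod ?X ?\<Lambda> A0 B0 a' b' = - sgn_prod ?X ?\<Lambda> A0 B0 a b"
      using fin_I i0 by (simp add: sgn_prod_def s_def[symmetric] prod.remove)
    then show "(case \<sigma> x of (a, b) \<Rightarrow> of_real (sgn_prod ?X ?\<Lambda> A0 B0 a b) * weight \<tau> u v a b)
      = - (case x of (a, b) \<Rightarrow> of_real (sgn_prod ?X ?\<Lambda> A0 B0 a b) * weight \<tau> u v a b)"
      unfolding ab(1) \<sigma>x[unfolded ab(1)] prod.case W by simp
  qed
  then show ?thesis by (simp add: lattice_sum_def)
qed

text \<open>The functionals that must not vanish at \<open>a + A0\<close> for
  \<open>sgn_pair_exchange\<close> to apply at pivot \<open>k\<close>: the current dual coordinates,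
  and the minors that keep the quotients \<open>\<nu> j / c j\<close> distinct.\<close>

definition stage_functionals :: "('k \<Rightarrow> 'k \<Rightarrow> real) \<Rightarrow> 'k \<Rightarrow> ('k \<Rightarrow> real) set" where
  "stage_functionals C k = C ` K \<union> (\<lambda>(j, l). (\<lambda>i. C l k * C j i - C j k * C l i)) ` {(j, l). j \<in> K \<and> l \<in> K \<and> j \<noteq> l \<and> C l k \<noteq> 0}"

text \<open>\<open>col k\<close> is a combination of the current coordinates with coefficients
  \<open>C j k\<close>, so \<open>sgn_pair_exchange\<close> splits the sign product at each
  \<open>(a, b)\<close>. All terms with \<open>l \<noteq> k\<close> sum to 0, and the remaining one
  has sign \<open>+ 1\<close> because the pivot is positive.\<close>

lemma stage_step_sum:
  assumes st: "stage A C" and A: "A \<subseteq> K" and k: "k \<in> K" "k \<notin> A"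
    and adm: "admissible \<tau> u v A0 B0" and gd: "\<And>F. F \<in> stage_functionals C k \<Longrightarrow> good F A0"
  shows "lattice_sum \<tau> u v A0 B0 (stage_basis (insert k A)) (exch_dual C k k)
    = lattice_sum \<tau> u v A0 B0 (stage_basis A) C"
proof -
  have gC: "good (C j) A0" if "j \<in> K" for j using gd that by (auto simp: stage_functionals_def)
  have gD: "good (\<lambda>i. C l k * C j i - C j k * C l i) A0" if "j \<in> K" "l \<in> K" "j \<noteq> l" "C l k \<noteq> 0" for j l
    using gd[of "\<lambda>i. C l k * C j i - C j k * C l i"] that by (force simp: stage_functionals_def)
  have cp: "compatible \<tau> u v A0 B0" using adm by (simp add: admissible_def)
  have ck: "0 < C k k" by (rule stage_pivot_pos[OF st A k])
  define T where "T = {l\<in>K. C l k \<noteq> 0}"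
  have T: "finite T" "k \<in> T" using fin_I k ck by (auto simp: T_def)
  have basis_k: "exch_basis A k k = stage_basis (insert k A)"
    using k by (auto simp: exch_basis_def stage_basis_def fun_eq_iff)
  have gE: "good (exch_dual C k l j) A0" if "j \<in> K" "l \<in> T" for j l
  proof (cases "j = l")
    case True
    then show ?thesis using good_scale[OF gC[of l], of "inverse (C l k)"] that by (simp add: exch_dual_def T_def)
  next
    case False
    have "good (\<lambda>i. inverse (C l k) * (C l k * C j i - C j k * C l i)) A0"
      using that False by (intro good_scale gD) (auto simp: T_def)
    moreover have "(\<lambda>i. inverse (C l k) * (C l k * C j i - C j k * C l i)) = exch_dual C k l j"
      using that False by (auto simp: exch_dual_def T_def field_simps)
    ultimately show ?thesis by simp
  qed
  have sepX: "\<exists>\<delta>>0. \<forall>b\<in>M. \<delta> \<le> \<bar>lin K (exch_basis A k l j) b - lin K (exch_basis A k l j) B0\<bar>" if "j \<in> K" for j l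
    using stage_basis_separated[OF adm that] col_separated[OF adm k(1)] by (simp add: exch_basis_def)
  have sm: "(\<lambda>(a, b). of_real (sgn_prod (exch_basis A k l) (exch_dual C k l) A0 B0 a b) * weight \<tau> u v a b) summable_on L \<times> M"
    if "l \<in> T" for l
    using that sepX gE unfolding good_def
    by (intro term_summable[OF exch_dual_bases[OF st k(1)] cp]) (auto simp: T_def)
  have pt: "sgn_prod (stage_basis A) C A0 B0 a b = (\<Sum>l\<in>T. sgn (C l k) * sgn_prod (exch_basis A k l) (exch_dual C k l) A0 B0 a b)"
    if ab: "a \<in> L" "b \<in> M" for a b
  proof -
    define X where "X j = lin K (stage_basis A j) b - lin K (stage_basis A j) B0" for j
    define \<nu> where "\<nu> j = lin K (C j) a + lin K (C j) A0" for j
    define Xs where "Xs = col k b - col k B0"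
    have "sgn_prod (stage_basis A) C A0 B0 a b = (\<Prod>j\<in>K. sgn_pair (X j) (\<nu> j))"
      by (simp add: sgn_prod_def X_def \<nu>_def)
    also have "\<dots> = (\<Sum>l\<in>{l\<in>K. C l k \<noteq> 0}. sgn (C l k) *
       (sgn_pair Xs (\<nu> l / C l k) * (\<Prod>j\<in>K-{l}. sgn_pair (X j) (\<nu> j - C j k / C l k * \<nu> l))))"
    proof (rule sgn_pair_exchange[OF fin_I])
      show "Xs = (\<Sum>j\<in>K. C j k * X j)"
        unfolding Xs_def X_def col_eq_stage[OF st k(1)] by (simp add: algebra_simps sum_subtractf)
      show "X j \<noteq> 0" if "j \<in> K" for j
        using stage_basis_separated[OF adm that, of A] ab(2) unfolding X_def by force
      show "Xs \<noteq> 0" using col_separated[OF adm k(1)] ab(2) unfolding Xs_def by force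
      show "\<nu> j \<noteq> 0" if "j \<in> K" for j using good_nonzero[OF gC[OF that] ab(1)] by (simp add: \<nu>_def)
      show "C l k * \<nu> j - C j k * \<nu> l \<noteq> 0" if "j \<in> K" "l \<in> K" "j \<noteq> l" "C l k \<noteq> 0" for j l
        using good_nonzero[OF gD[OF that] ab(1)] unfolding \<nu>_def lin_diff_left lin_scale_left by (simp add: algebra_simps)
    qed
    also have "\<dots> = (\<Sum>l\<in>T. sgn (C l k) * sgn_prod (exch_basis A k l) (exch_dual C k l) A0 B0 a b)"
      unfolding T_def
    proof (rule sum.cong[OF refl])
      fix l assume l: "l \<in> {l\<in>K. C l k \<noteq> 0}"
      define g where "g j = sgn_pair (lin K (exch_basis A k l j) b - lin K (exch_basis A k l j) B0)
           (lin K (exch_dual C k l j) a + lin K (exch_dual C k l j) A0)" for j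
      have "sgn_prod (exch_basis A k l) (exch_dual C k l) A0 B0 a b = g l * (\<Prod>j\<in>K-{l}. g j)"
        unfolding sgn_prod_def g_def[symmetric] using fin_I l by (simp add: prod.remove)
      also have "g l = sgn_pair Xs (\<nu> l / C l k)"
        by (simp add: g_def exch_basis_def lin_exch_dual Xs_def \<nu>_def add_divide_distrib)
      also have "(\<Prod>j\<in>K-{l}. g j) = (\<Prod>j\<in>K-{l}. sgn_pair (X j) (\<nu> j - C j k / C l k * \<nu> l))"
        by (intro prod.cong refl) (simp add: g_def exch_basis_def lin_exch_dual X_def \<nu>_def algebra_simps)
      finally show "sgn (C l k) * (sgn_pair Xs (\<nu> l / C l k) * (\<Prod>j\<in>K-{l}. sgn_pair (X j) (\<nu> j - C j k / C l k * \<nu> l)))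
        = sgn (C l k) * sgn_prod (exch_basis A k l) (exch_dual C k l) A0 B0 a b" by simp
    qed
    finally show ?thesis .
  qed
  have "lattice_sum \<tau> u v A0 B0 (stage_basis A) C = (\<Sum>\<^sub>\<infinity>x\<in>L \<times> M. \<Sum>l\<in>T. of_real (sgn (C l k)) *
      (case x of (a, b) \<Rightarrow> of_real (sgn_prod (exch_basis A k l) (exch_dual C k l) A0 B0 a b) * weight \<tau> u v a b))"
    unfolding lattice_sum_def by (rule infsum_cong) (auto simp: pt sum_distrib_right mult.assoc)
  also have "\<dots> = (\<Sum>l\<in>T. of_real (sgn (C l k)) * lattice_sum \<tau> u v A0 B0 (exch_basis A k l) (exch_dual C k l))"
    unfolding lattice_sum_def
    by (rule infsumI, rule has_sum_finite_sum[OF T(1)], rule has_sum_cmult_right, rule has_sum_infsum, rule sm)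
  also have "\<dots> = of_real (sgn (C k k)) * lattice_sum \<tau> u v A0 B0 (exch_basis A k k) (exch_dual C k k)
     + (\<Sum>l\<in>T-{k}. of_real (sgn (C l k)) * lattice_sum \<tau> u v A0 B0 (exch_basis A k l) (exch_dual C k l))"
    using T by (rule sum.remove)
  also have "(\<Sum>l\<in>T-{k}. of_real (sgn (C l k)) * lattice_sum \<tau> u v A0 B0 (exch_basis A k l) (exch_dual C k l)) = 0"
    by (rule sum.neutral) (auto simp: T_def exch_vanish[OF st A k _ _ _ adm])
  finally show ?thesis using ck basis_k by simp
qed

lemma stage_step:
  assumes st: "stage A C" and A: "A \<subseteq> K" and k: "k \<in> K" "k \<notin> A"
  shows "stage (insert k A) (exch_dual C k k)"
proof -
  have ck: "C k k \<noteq> 0" using stage_pivot_pos[OF st A k] by simp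
  have basis_k: "exch_basis A k k = stage_basis (insert k A)"
    using k by (auto simp: exch_basis_def stage_basis_def fun_eq_iff)
  have rat: "C j i \<in> \<rat>" if "j \<in> K" "i \<in> K" for j i using st that by (simp add: stage_def)
  have C\<delta>: "C j p = (if j = p then 1 else 0)" if "j \<in> K" "p \<in> A" for j p
    using st that by (simp add: stage_def)
  have sj: "\<exists>a. \<forall>j\<in>K. lin K (C j) a = y j" for y using st by (simp add: stage_def)
  have "\<forall>y. \<exists>a. \<forall>j\<in>K. lin K (exch_dual C k k j) a = y j"
  proof
    fix y
    obtain a where a: "\<forall>j\<in>K. lin K (C j) a = (if j = k then C k k * y k else y j + C j k * y k)"
      using sj[of "\<lambda>j. if j = k then C k k * y k else y j + C j k * y k"] by blast
    then have "\<forall>j\<in>K. lin K (exch_dual C k k j) a = y j" using ck k by (simp add: lin_exch_dual)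
    then show "\<exists>a. \<forall>j\<in>K. lin K (exch_dual C k k j) a = y j" by blast
  qed
  moreover have "dual_bases (stage_basis (insert k A)) (exch_dual C k k)"
    using exch_dual_bases[OF st k(1) k(1) ck] by (simp add: basis_k)
  moreover have "\<forall>j\<in>K. \<forall>i\<in>K. exch_dual C k k j i \<in> \<rat>"
    using rat k by (auto simp: exch_dual_def)
  moreover have "\<forall>j\<in>K. \<forall>p\<in>insert k A. exch_dual C k k j p = (if j = p then 1 else 0)"
    using C\<delta> k ck by (auto simp: exch_dual_def)
  ultimately show ?thesis by (simp add: stage_def)
qed

text \<open>The finite set of functionals is chosen before \<open>\<tau>\<close>, the arguments and
  the shifts, so one generic direction can serve all of them.\<close>

lemma stages:
  assumes "finite A" "A \<subseteq> K"
  shows "\<exists>C \<F>. stage A C \<and> finite \<F> \<and> (\<forall>F\<in>\<F>. (\<forall>i\<in>K. F i \<in> \<rat>) \<and> (\<exists>a. lin K F a \<noteq> 0)) \<and>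
    (\<forall>\<tau> u v A0 B0. admissible \<tau> u v A0 B0 \<and> (\<forall>F\<in>\<F>. good F A0) \<longrightarrow>
       lattice_sum \<tau> u v A0 B0 (stage_basis A) C = lattice_sum \<tau> u v A0 B0 (stage_basis {}) (\<lambda>j i. real (E j i)))"
  using assms
proof (induction A rule: finite_induct)
  case empty
  show ?case
    by (rule exI[of _ "\<lambda>j i. real (E j i)"], rule exI[of _ "{}"]) (simp add: stage_empty)
next
  case (insert k A)
  then obtain C \<F> where IH: "stage A C" "finite \<F>" "\<And>F. F \<in> \<F> \<Longrightarrow> (\<forall>i\<in>K. F i \<in> \<rat>) \<and> (\<exists>a. lin K F a \<noteq> 0)"
    "\<And>\<tau> u v A0 B0. admissible \<tau> u v A0 B0 \<Longrightarrow> (\<forall>F\<in>\<F>. good F A0) \<Longrightarrow>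
       lattice_sum \<tau> u v A0 B0 (stage_basis A) C = lattice_sum \<tau> u v A0 B0 (stage_basis {}) (\<lambda>j i. real (E j i))"
    by auto
  have A: "A \<subseteq> K" and k: "k \<in> K" "k \<notin> A" using insert by auto
  have rat: "C j i \<in> \<rat>" if "j \<in> K" "i \<in> K" for j i using IH(1) that by (simp add: stage_def)
  have sj: "\<exists>a. \<forall>j\<in>K. lin K (C j) a = y j" for y using IH(1) by (simp add: stage_def)
  let ?G = "stage_functionals C k"
  have "finite ?G"
  proof -
    have "finite {(j, l). j \<in> K \<and> l \<in> K \<and> j \<noteq> l \<and> C l k \<noteq> 0}"
      by (rule finite_subset[of _ "K \<times> K"]) (use fin_I in auto)
    then show ?thesis using fin_I by (simp add: stage_functionals_def)
  qed
  then have r1: "finite (\<F> \<union> ?G)" using IH(2) by simp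
  have "(\<forall>i\<in>K. F i \<in> \<rat>) \<and> (\<exists>a. lin K F a \<noteq> 0)" if "F \<in> ?G" for F
  proof -
    from that consider j where "j \<in> K" "F = C j"
      | j l where "j \<in> K" "l \<in> K" "j \<noteq> l" "C l k \<noteq> 0" "F = (\<lambda>i. C l k * C j i - C j k * C l i)"
      by (auto simp: stage_functionals_def)
    then show ?thesis
    proof cases
      case 1
      obtain a where "\<forall>j\<in>K. lin K (C j) a = 1" using sj[of "\<lambda>_. 1"] by blast
      then show ?thesis using 1 rat by (auto intro!: exI[of _ a])
    next
      case 2
      obtain a where a: "\<forall>i\<in>K. lin K (C i) a = (if i = j then 1 else 0)"
        using sj[of "\<lambda>i. if i = j then 1 else 0"] by blast
      have "lin K F a = C l k" using 2 a by (simp add: lin_diff_left lin_scale_left)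
      then show ?thesis using 2 rat k by (auto intro!: exI[of _ a])
    qed
  qed
  then have r2: "\<forall>F\<in>\<F> \<union> ?G. (\<forall>i\<in>K. F i \<in> \<rat>) \<and> (\<exists>a. lin K F a \<noteq> 0)" using IH(3) by blast
  have r3: "lattice_sum \<tau> u v A0 B0 (stage_basis (insert k A)) (exch_dual C k k)
      = lattice_sum \<tau> u v A0 B0 (stage_basis {}) (\<lambda>j i. real (E j i))"
    if "admissible \<tau> u v A0 B0" "\<forall>F\<in>\<F> \<union> ?G. good F A0" for \<tau> u v A0 B0
    using stage_step_sum[OF IH(1) A k that(1)] IH(4)[OF that(1)] that(2) by auto
  show ?case
    by (rule exI, rule exI, intro conjI, rule stage_step[OF IH(1) A k], rule r1, rule r2)
      (intro allI impI, elim conjE, rule r3)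
qed

end

section \<open>Choosing the shifts and letting them tend to zero\<close>

lemma Rats_common_denominator:
  fixes F :: "'k \<Rightarrow> real"
  assumes "finite K" "\<And>i. i \<in> K \<Longrightarrow> F i \<in> \<rat>"
  shows "\<exists>n>0. \<forall>i\<in>K. real n * F i \<in> \<int>"
  using assms
proof (induction K rule: finite_induct)
  case (insert i K)
  then obtain n where n: "0 < n" "\<And>j. j \<in> K \<Longrightarrow> real n * F j \<in> \<int>" by auto
  have "F i \<in> \<rat>" using insert.prems by simp
  then obtain a b :: int where ab: "F i = of_int a / of_int b" "0 < b"
    by (elim Rats_cases') auto
  define m where "m = nat b"
  have m: "0 < m" "real m = of_int b" using ab by (auto simp: m_def)
  have "real (n * m) * F j \<in> \<int>" if "j \<in> insert i K" for j
  proof (cases "j = i")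
    case True
    have "real (n * m) * F i = of_int (int n * a)" using m ab by simp
    then show ?thesis using True by (metis Ints_of_int)
  next
    case False
    then have "real m * (real n * F j) \<in> \<int>" using that n by (intro Ints_mult[of "real m" "real n * F j"]) auto
    then show ?thesis by (simp add: mult_ac)
  qed
  then show ?case using n m by (intro exI[of _ "n * m"]) auto
qed (auto intro: exI[of _ 1])

text \<open>Shifts below the spacing of the values can matter only at 0, and there the strict
  inequalities in \<open>sgn_pair\<close> already count \<open>x\<close> as negative and
  \<open>y\<close> as positive, as the shifts do.\<close>

lemma sgn_pair_shift:
  assumes x: "D * x \<in> \<int>" "0 < x0" "x0 < 1 / D" "0 < D" and y: "D' * y \<in> \<int>" "0 < y0" "y0 < 1 / D'" "0 < D'"
  shows "sgn_pair (x - x0) (y + y0) = sgn_pair x y"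
proof -
  have "0 < x - x0 \<longleftrightarrow> 0 < x"
  proof
    assume "0 < x"
    obtain n :: int where n: "D * x = of_int n" using x(1) by (auto elim: Ints_cases)
    have "0 < D * x" using \<open>0 < x\<close> x by simp
    then have "0 < n" unfolding n by simp
    then have "1 \<le> real_of_int n" by simp
    then have "1 \<le> D * x" unfolding n .
    then have "1 / D \<le> x" using x by (simp add: field_simps)
    then show "0 < x - x0" using x by linarith
  qed (use x in simp)
  moreover have "y + y0 < 0 \<longleftrightarrow> y < 0"
  proof
    assume "y < 0"
    obtain n :: int where n: "D' * y = of_int n" using y(1) by (auto elim: Ints_cases)
    have "D' * y < 0" using \<open>y < 0\<close> y by (simp add: mult_pos_neg)
    then have "n \<le> - 1" unfolding n by simp
    then have "real_of_int n \<le> - 1" by linarith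
    then have "D' * y \<le> - 1" unfolding n .
    then have "y \<le> - (1 / D')" using y by (simp add: field_simps)
    then show "y + y0 < 0" using y by linarith
  qed (use y in simp)
  ultimately show ?thesis by (simp add: sgn_pair_def)
qed

lemma eventually_affine_between:
  fixes x y lo hi :: real
  assumes "lo < x" "x < hi"
  shows "eventually (\<lambda>\<eta>. lo < x + \<eta> * y \<and> x + \<eta> * y < hi) (at_right 0)"
proof -
  have "((\<lambda>\<eta>. x + \<eta> * y) \<longlongrightarrow> x + 0 * y) (at_right 0)" by (intro tendsto_intros)
  then have "((\<lambda>\<eta>. x + \<eta> * y) \<longlongrightarrow> x) (at_right 0)" by simp
  from order_tendstoD(1)[OF this assms(1)] order_tendstoD(2)[OF this assms(2)]
  show ?thesis by eventually_elim simp
qed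

lemma eventually_affine_nonzero:
  fixes x y :: real
  assumes "y \<noteq> 0"
  shows "eventually (\<lambda>\<eta>. x + \<eta> * y \<noteq> 0) (at_right 0)"
proof (cases "x = 0")
  case True
  have "eventually (\<lambda>\<eta>::real. 0 < \<eta>) (at_right 0)" by (rule eventually_at_right_less)
  then show ?thesis using True assms by (auto elim!: eventually_mono)
next
  case False
  have "eventually (\<lambda>\<eta>. x - \<bar>x\<bar> < x + \<eta> * y \<and> x + \<eta> * y < x + \<bar>x\<bar>) (at_right 0)"
    by (rule eventually_affine_between) (use False in auto)
  then show ?thesis by eventually_elim (use False in auto)
qed

context chain_loop_lattices
begin

text \<open>The weights solve \<open>row j w = 1\<close> and \<open>col i w' = 1\<close>, so
  multiples of them are shifts compatible with the constant arguments \<open>z\<close>. Perturbing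
  them by \<open>\<eta>\<close> in a generic direction makes all stages applicable; then
  \<open>\<eta>\<close> tends to 0 for fixed \<open>\<tau>\<close> and \<open>z\<close>.\<close>

theorem lattice_sum_duality:
  assumes w: "\<And>j. j \<in> K \<Longrightarrow> row j w = 1" "\<And>i. i \<in> K \<Longrightarrow> 0 < w i"
    and w': "\<And>i. i \<in> K \<Longrightarrow> col i w' = 1" "\<And>j. j \<in> K \<Longrightarrow> 0 < w' j"
  shows "\<exists>s0>0. \<forall>\<tau> z. 0 < Im \<tau> \<longrightarrow> 0 < Im z \<longrightarrow> Im z < s0 * Im \<tau> \<longrightarrow>
    (\<Sum>\<^sub>\<infinity>(a, b)\<in>L \<times> M. of_real (\<Prod>i\<in>K. sgn_pair (col i b) (a i)) * weight \<tau> (\<lambda>_. z) (\<lambda>_. z) a b)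
    = (\<Sum>\<^sub>\<infinity>(a, b)\<in>L \<times> M. of_real (\<Prod>j\<in>K. sgn_pair (b j) (row j a)) * weight \<tau> (\<lambda>_. z) (\<lambda>_. z) a b)"
proof -
  obtain C \<F> where st: "stage K C" and \<F>: "finite \<F>" "\<And>F. F \<in> \<F> \<Longrightarrow> (\<forall>i\<in>K. F i \<in> \<rat>) \<and> (\<exists>a. lin K F a \<noteq> 0)"
    and main: "\<And>\<tau> u v A0 B0. admissible \<tau> u v A0 B0 \<Longrightarrow> (\<forall>F\<in>\<F>. good F A0) \<Longrightarrow>
       lattice_sum \<tau> u v A0 B0 (stage_basis K) C = lattice_sum \<tau> u v A0 B0 (stage_basis {}) (\<lambda>j i. real (E j i))"
    using stages[OF fin_I subset_refl] by metis
  have linC: "lin K (C i) a = a i" if i: "i \<in> K" for i a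
  proof -
    have "lin K (C i) a = lin K (uvec i) a"
      using st i unfolding lin_def stage_def by (intro sum.cong) (auto simp: uvec_def)
    then show ?thesis using fin_I i by (simp add: lin_uvec_left)
  qed
  obtain \<theta> where \<theta>: "\<And>F. F \<in> \<F> \<Longrightarrow> lin K F \<theta> \<noteq> 0"
    using generic_vector_exists[of \<F> K] \<F> by blast
  \<comment> \<open>A column has at most one off-diagonal 1, so \<open>h p\<close> is
    \<open>row l \<theta>\<close> for the unique such row \<open>l\<close>, or 0. Prescribing
    \<open>col p \<psi> = h p\<close> gives \<open>u l = v p\<close> whenever
    \<open>E l p = 1\<close>, while \<open>\<theta>\<close> stays free to be generic.\<close>
  define h where "h p = (\<Sum>l\<in>K-{p}. real (E l p) * row l \<theta>)" for p
  obtain \<psi> where \<psi>: "\<And>p. p \<in> K \<Longrightarrow> col p \<psi> = h p" using surj_ET[of h] by blast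
  have h: "h p = row l \<theta>" if "l \<in> K" "p \<in> K" "l \<noteq> p" "E l p = 1" for l p
  proof -
    have "(\<Sum>i\<in>K-{p}. E i p) = E l p + (\<Sum>i\<in>K-{p}-{l}. E i p)"
      using that fin_I by (intro sum.remove) auto
    then have "(\<Sum>i\<in>K-{p}-{l}. E i p) = 0" using col_le[OF that(2)] that(4) by linarith
    then have z: "E i p = 0" if "i \<in> K-{p}-{l}" for i using that fin_I by auto
    have "h p = real (E l p) * row l \<theta> + (\<Sum>i\<in>K-{p}-{l}. real (E i p) * row i \<theta>)"
      unfolding h_def using that fin_I by (intro sum.remove) auto
    also have "(\<Sum>i\<in>K-{p}-{l}. real (E i p) * row i \<theta>) = 0"
      by (rule sum.neutral) (use z in auto)
    finally show ?thesis using that by simp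
  qed
  have "\<forall>F\<in>\<F>. \<exists>n>0. \<forall>i\<in>K. real n * F i \<in> \<int>"
    using \<F>(2) Rats_common_denominator[OF fin_I] by blast
  then obtain n where n: "\<And>F. F \<in> \<F> \<Longrightarrow> 0 < n F \<and> (\<forall>i\<in>K. real (n F) * F i \<in> \<int>)" by metis
  define D where "D F = real (n F) * real d" for F
  have D: "0 < D F" if "F \<in> \<F>" for F using n[OF that] d_pos by (simp add: D_def)
  have DI: "D F * lin K F a \<in> \<int>" if "F \<in> \<F>" "a \<in> L" for F a
  proof -
    have "D F * lin K F a = (\<Sum>i\<in>K. (real (n F) * F i) * (real d * a i))"
      by (simp add: D_def lin_def sum_distrib_left mult_ac)
    also have "\<dots> \<in> \<int>"
    proof (rule Ints_sum)
      fix i assume "i \<in> K"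
      then have "real (n F) * F i \<in> \<int>" using n[OF that(1)] by blast
      then show "(real (n F) * F i) * (real d * a i) \<in> \<int>" using den_L[OF that(2)] by (rule Ints_mult)
    qed
    finally show ?thesis .
  qed
  \<comment> \<open>The entry 1/4 keeps all \<open>row j A0\<close> and \<open>col j B0\<close> at
    most 1/2. The others keep \<open>lin K F A0\<close>, \<open>A0 i\<close> and \<open>B0 i\<close>
    within half the spacing of the unshifted values; the factor \<open>2 * w i\<close> allows for
    the perturbation, and \<open>+ 1\<close> avoids a zero denominator.\<close>
  define s0 where "s0 = Min (insert (1/4) ((\<lambda>F. 1 / (2 * D F) / (\<bar>lin K F w\<bar> + \<bar>lin K F \<theta>\<bar> + 1)) ` \<F>
     \<union> (\<lambda>i. 1 / (2 * real d) / (2 * w i)) ` K \<union> (\<lambda>i. 1 / (2 * real d) / (2 * w' i)) ` K))"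
  have "0 < s0"
    unfolding s0_def using \<F>(1) fin_I D w(2) w'(2) d_pos
    by (subst Min_gr_iff) (auto intro!: divide_pos_pos add_nonneg_pos)
  have s0: "s0 \<le> 1/4" "\<And>F. F \<in> \<F> \<Longrightarrow> s0 \<le> 1 / (2 * D F) / (\<bar>lin K F w\<bar> + \<bar>lin K F \<theta>\<bar> + 1)"
    "\<And>i. i \<in> K \<Longrightarrow> s0 \<le> 1 / (2 * real d) / (2 * w i)" "\<And>i. i \<in> K \<Longrightarrow> s0 \<le> 1 / (2 * real d) / (2 * w' i)"
    unfolding s0_def using \<F>(1) fin_I by (intro Min_le; blast)+
  show ?thesis
  proof (intro exI[of _ s0] conjI allI impI)
    fix \<tau> z assume \<tau>: "0 < Im \<tau>" and z: "0 < Im z" "Im z < s0 * Im \<tau>"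
    define s where "s = Im z / Im \<tau>"
    have Imz: "Im z = s * Im \<tau>" using \<tau> by (simp add: s_def)
    have s: "0 < s" "s < s0" using \<tau> z by (auto simp: s_def field_simps)
    have sD: "s * (\<bar>lin K F w\<bar> + \<bar>lin K F \<theta>\<bar>) \<le> 1 / (2 * D F)" if "F \<in> \<F>" for F
    proof -
      have "s * (\<bar>lin K F w\<bar> + \<bar>lin K F \<theta>\<bar>) \<le> s0 * (\<bar>lin K F w\<bar> + \<bar>lin K F \<theta>\<bar> + 1)"
        using s by (intro mult_mono) auto
      also have "\<dots> \<le> 1 / (2 * D F)"
        using s0(2)[OF that] by (subst (asm) le_divide_eq) (auto simp: add_nonneg_pos split: if_splits)
      finally show ?thesis .
    qed
    have sw: "s * (2 * w i) \<le> 1 / (2 * real d)" "s * (2 * w' i) \<le> 1 / (2 * real d)" if "i \<in> K" for i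
    proof -
      have "s \<le> 1 / (2 * real d) / (2 * w i)" "s \<le> 1 / (2 * real d) / (2 * w' i)"
        using s s0(3,4)[OF that] by linarith+
      then show "s * (2 * w i) \<le> 1 / (2 * real d)" "s * (2 * w' i) \<le> 1 / (2 * real d)"
        using pos_le_divide_eq[of "2 * w i" s "1 / (2 * real d)"] pos_le_divide_eq[of "2 * w' i" s "1 / (2 * real d)"]
          w(2)[OF that] w'(2)[OF that] by (auto simp only: mult_pos_pos zero_less_numeral)
    qed
    \<comment> \<open>Each perturbed quantity stays between half and twice its unperturbed positive
      value, which yields bounds independent of \<open>\<eta>\<close>, and no functional of
      \<open>\<F>\<close> vanishes.\<close>
    define cond where "cond \<eta> \<longleftrightarrow> \<eta> \<le> 1 \<and> (\<forall>F\<in>\<F>. lin K F w + \<eta> * lin K F \<theta> \<noteq> 0) \<and>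
       (\<forall>i\<in>K. w i / 2 < w i + \<eta> * \<theta> i \<and> w i + \<eta> * \<theta> i < 2 * w i) \<and>
       (\<forall>i\<in>K. w' i / 2 < w' i + \<eta> * \<psi> i \<and> w' i + \<eta> * \<psi> i < 2 * w' i) \<and>
       (\<forall>i\<in>K. 1 / 2 < 1 + \<eta> * row i \<theta> \<and> 1 + \<eta> * row i \<theta> < 2) \<and>
       (\<forall>i\<in>K. 1 / 2 < 1 + \<eta> * h i \<and> 1 + \<eta> * h i < 2) \<and> 0 < \<eta>" for \<eta> :: real
    have "eventually (\<lambda>\<eta>::real. \<eta> \<le> 1) (at_right 0)"
      using eventually_affine_between[of "-1" 0 1 1] by (auto elim!: eventually_mono)
    then have "eventually cond (at_right 0)"
      unfolding cond_def using w(2) w'(2) \<theta> \<F>(1) fin_I eventually_at_right_less[of "0::real"]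
      by (intro eventually_conj eventually_ball_finite ballI eventually_affine_between eventually_affine_nonzero) auto
    moreover have "filterlim (\<lambda>N. inverse (real (Suc N))) (at_right 0) sequentially"
      unfolding filterlim_at by (intro conjI LIMSEQ_inverse_real_of_nat always_eventually) auto
    ultimately have "eventually (\<lambda>N. cond (inverse (real (Suc N)))) sequentially"
      unfolding filterlim_iff by blast
    then obtain N0 where N0: "\<And>N. N0 \<le> N \<Longrightarrow> cond (inverse (real (Suc N)))"
      by (auto simp: eventually_sequentially)
    define \<eta> where "\<eta> N = inverse (real (Suc (N + N0)))" for N
    have cond: "cond (\<eta> N)" for N unfolding \<eta>_def by (rule N0) simp
    have \<eta>0: "\<eta> \<longlonglongrightarrow> 0" unfolding \<eta>_def using LIMSEQ_ignore_initial_segment[OF LIMSEQ_inverse_real_of_nat] .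
    define A0 B0 where "A0 N = (\<lambda>i. s * (w i + \<eta> N * \<theta> i))" and "B0 N = (\<lambda>i. s * (w' i + \<eta> N * \<psi> i))" for N
    define u v where "u N = (\<lambda>j. z * of_real (1 + \<eta> N * row j \<theta>))" and "v N = (\<lambda>i. z * of_real (1 + \<eta> N * h i))" for N
    have linA: "lin K F (A0 N) = s * (lin K F w + \<eta> N * lin K F \<theta>)" for F N
      by (simp add: A0_def lin_scale_right lin_add_right)
    have linB: "lin K F (B0 N) = s * (lin K F w' + \<eta> N * lin K F \<psi>)" for F N
      by (simp add: B0_def lin_scale_right lin_add_right)
    have rA: "s / 2 \<le> row j (A0 N)" "row j (A0 N) \<le> 1 / 2" if "j \<in> K" for j N
    proof -
      have "row j (A0 N) = s * (1 + \<eta> N * row j \<theta>)" using that by (simp add: linA w)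
      moreover have "s * (1 / 2) \<le> s * (1 + \<eta> N * row j \<theta>)" "s * (1 + \<eta> N * row j \<theta>) \<le> s * 2"
        using cond[of N] that s by (auto simp: cond_def intro!: mult_left_mono less_imp_le)
      ultimately show "s / 2 \<le> row j (A0 N)" "row j (A0 N) \<le> 1 / 2" using s s0(1) by linarith+
    qed
    have cB: "s / 2 \<le> col j (B0 N)" "col j (B0 N) \<le> 1 / 2" if "j \<in> K" for j N
    proof -
      have "col j (B0 N) = s * (1 + \<eta> N * h j)" using that by (simp add: linB w' \<psi>)
      moreover have "s * (1 / 2) \<le> s * (1 + \<eta> N * h j)" "s * (1 + \<eta> N * h j) \<le> s * 2"
        using cond[of N] that s by (auto simp: cond_def intro!: mult_left_mono less_imp_le)
      ultimately show "s / 2 \<le> col j (B0 N)" "col j (B0 N) \<le> 1 / 2" using s s0(1) by linarith+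
    qed
    have AB: "s * w i / 2 \<le> A0 N i" "A0 N i \<le> 1 / (2 * real d)" "s * w' i / 2 \<le> B0 N i" "B0 N i \<le> 1 / (2 * real d)"
      if i: "i \<in> K" for i N
    proof -
      have "s * (w i / 2) \<le> A0 N i" "A0 N i \<le> s * (2 * w i)" "s * (w' i / 2) \<le> B0 N i" "B0 N i \<le> s * (2 * w' i)"
        using cond[of N] i s unfolding A0_def B0_def by (auto simp: cond_def intro!: mult_left_mono less_imp_le)
      then show "s * w i / 2 \<le> A0 N i" "A0 N i \<le> 1 / (2 * real d)" "s * w' i / 2 \<le> B0 N i" "B0 N i \<le> 1 / (2 * real d)"
        using sw[OF i] by auto
    qed
    have half_d: "1 / (2 * real d) < 1 / real d" "1 / (2 * real d) \<le> 1 / 2" using d_pos by (auto simp: field_simps)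
    have pos: "0 < s * w i / 2" "0 < s * w' i / 2" if "i \<in> K" for i
      using s w(2)[OF that] w'(2)[OF that] by auto
    have adm: "admissible \<tau> (u N) (v N) (A0 N) (B0 N)" for N
      unfolding admissible_def compatible_def
    proof (intro conjI ballI impI)
      fix j assume j: "j \<in> K"
      show "Im (u N j) = row j (A0 N) * Im \<tau>" using j by (simp add: u_def linA w Imz mult_ac)
      show "Im (v N j) = col j (B0 N) * Im \<tau>" using j by (simp add: v_def linB w' \<psi> Imz mult_ac)
      show "0 < row j (A0 N)" "row j (A0 N) < 1" "0 < col j (B0 N)" "col j (B0 N) < 1"
        using rA[OF j, of N] cB[OF j, of N] s by linarith+
      show "0 < B0 N j" "B0 N j < 1 / real d" using AB[OF j, of N] pos[OF j] half_d by linarith+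
    next
      fix l p assume "l \<in> K" "p \<in> K" "l \<noteq> p \<and> E l p = 1"
      then show "u N l = v N p" using h[of l p] by (simp add: u_def v_def)
    qed (rule \<tau>)
    have gd: "good F (A0 N)" if F: "F \<in> \<F>" for F N
    proof -
      have nz: "lin K F (A0 N) \<noteq> 0" using cond[of N] F s by (simp add: linA cond_def)
      have "\<bar>lin K F (A0 N)\<bar> = s * \<bar>lin K F w + \<eta> N * lin K F \<theta>\<bar>" using s by (simp add: linA abs_mult)
      also have "\<dots> \<le> s * (\<bar>lin K F w\<bar> + \<bar>lin K F \<theta>\<bar>)"
      proof (intro mult_left_mono)
        have eta: "\<eta> N \<le> 1" "0 < \<eta> N" using cond[of N] by (auto simp: cond_def)
        then have "\<eta> N * \<bar>lin K F \<theta>\<bar> \<le> 1 * \<bar>lin K F \<theta>\<bar>" by (intro mult_right_mono) auto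
        then have "\<bar>\<eta> N * lin K F \<theta>\<bar> \<le> \<bar>lin K F \<theta>\<bar>" using eta by (simp add: abs_mult)
        then show "\<bar>lin K F w + \<eta> N * lin K F \<theta>\<bar> \<le> \<bar>lin K F w\<bar> + \<bar>lin K F \<theta>\<bar>" by linarith
      qed (use s in simp)
      also have "\<dots> \<le> 1 / (2 * D F)" by (rule sD[OF F])
      finally have le: "\<bar>lin K F (A0 N)\<bar> \<le> 1 / (2 * D F)" .
      have "min \<bar>lin K F (A0 N)\<bar> (1 / (2 * D F)) \<le> \<bar>lin K F a + lin K F (A0 N)\<bar>" if "a \<in> L" for a
        using abs_add_ge_of_denominator[OF DI[OF F that] D[OF F] order_refl le] .
      then show ?thesis unfolding good_def using nz D[OF F]
        by (intro exI[of _ "min \<bar>lin K F (A0 N)\<bar> (1 / (2 * D F))"]) auto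
    qed
    have eqN: "lattice_sum \<tau> (u N) (v N) (A0 N) (B0 N) (stage_basis K) C
       = lattice_sum \<tau> (u N) (v N) (A0 N) (B0 N) (stage_basis {}) (\<lambda>j i. real (E j i))" for N
      using main[OF adm] gd by blast
    \<comment> \<open>The separation of the first and last bases is uniform in \<open>N\<close>. In
      the intermediate ones it may degenerate as \<open>\<eta>\<close> tends to 0, which is harmless
      because \<open>eqN\<close> mentions only the two ends.\<close>
    define \<delta> where "\<delta> = Min (insert (s / 2) (insert (1 / (2 * real d)) ((\<lambda>i. s * w i / 2) ` K \<union> (\<lambda>i. s * w' i / 2) ` K)))"
    have \<delta>: "0 < \<delta>" unfolding \<delta>_def using fin_I s d_pos pos by (subst Min_gr_iff) auto
    have \<delta>le: "\<delta> \<le> s / 2" "\<delta> \<le> 1 / (2 * real d)" "\<And>i. i \<in> K \<Longrightarrow> \<delta> \<le> s * w i / 2" "\<And>i. i \<in> K \<Longrightarrow> \<delta> \<le> s * w' i / 2"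
      unfolding \<delta>_def using fin_I by (intro Min_le; blast)+
    have bsep: "\<delta> \<le> \<bar>b i - B0 N i\<bar>" if "b \<in> M" "i \<in> K" for b i N
      using abs_add_ge_of_denominator[OF den_M[OF that(1), of i], of "s * w' i / 2" "- B0 N i"]
        AB[OF that(2), of N] pos[OF that(2)] d_pos \<delta>le(2) \<delta>le(4)[OF that(2)] by (auto simp: min_def split: if_splits)
    have asep: "\<delta> \<le> \<bar>a i + A0 N i\<bar>" if "a \<in> L" "i \<in> K" for a i N
      using abs_add_ge_of_denominator[OF den_L[OF that(1), of i], of "s * w i / 2" "A0 N i"]
        AB[OF that(2), of N] pos[OF that(2)] d_pos \<delta>le(2) \<delta>le(3)[OF that(2)] by (auto simp: min_def split: if_splits)
    have rsep: "\<delta> \<le> \<bar>row i a + row i (A0 N)\<bar>" if "a \<in> L" "i \<in> K" for a i N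
      using abs_add_ge_of_denominator[of 1 "row i a" "s / 2" "row i (A0 N)"] row_Ints[OF that]
        rA[OF that(2), of N] s \<delta>le(1,2) half_d by (auto simp: min_def split: if_splits)
    have csep: "\<delta> \<le> \<bar>col i b - col i (B0 N)\<bar>" if "b \<in> M" "i \<in> K" for b i N
      using abs_add_ge_of_denominator[of 1 "col i b" "s / 2" "- col i (B0 N)"] col_Ints[OF that]
        cB[OF that(2), of N] s \<delta>le(1,2) half_d by (auto simp: min_def split: if_splits)
    have A1: "\<bar>A0 N i\<bar> \<le> 1" "\<bar>B0 N i\<bar> \<le> 1" "\<bar>row i (A0 N)\<bar> \<le> 1" "\<bar>col i (B0 N)\<bar> \<le> 1" if "i \<in> K" for i N
      using AB[OF that, of N] pos[OF that] rA[OF that, of N] cB[OF that, of N] half_d s by linarith+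
    have sep1: "separated (stage_basis {}) (\<lambda>j i. real (E j i)) \<delta> 1 (A0 N) (B0 N)" for N
      using fin_I bsep rsep A1 by (simp add: separated_def stage_basis_def lin_uvec_left)
    have sep2: "separated (stage_basis K) C \<delta> 1 (A0 N) (B0 N)" for N
      using csep asep A1 by (simp add: separated_def stage_basis_def linC)
    have sg1: "sgn_prod (stage_basis {}) (\<lambda>j i. real (E j i)) (A0 N) (B0 N) a b = (\<Prod>j\<in>K. sgn_pair (b j) (row j a))"
      if ab: "a \<in> L" "b \<in> M" for a b N
      unfolding sgn_prod_def
    proof (rule prod.cong[OF refl])
      fix i assume i: "i \<in> K"
      have "sgn_pair (b i - B0 N i) (row i a + row i (A0 N)) = sgn_pair (b i) (row i a)"
      proof (rule sgn_pair_shift[where D="real d" and D'=1])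
        show "real d * b i \<in> \<int>" by (rule den_M[OF ab(2)])
        show "1 * row i a \<in> \<int>" using row_Ints[OF ab(1) i] by simp
      qed (use AB[OF i, of N] pos[OF i] rA[OF i, of N] s half_d d_pos in linarith)+
      then show "sgn_pair (lin K (stage_basis {} i) b - lin K (stage_basis {} i) (B0 N)) (row i a + row i (A0 N))
          = sgn_pair (b i) (row i a)"
        using fin_I i by (simp add: stage_basis_def lin_uvec_left)
    qed
    have sg2: "sgn_prod (stage_basis K) C (A0 N) (B0 N) a b = (\<Prod>i\<in>K. sgn_pair (col i b) (a i))"
      if ab: "a \<in> L" "b \<in> M" for a b N
      unfolding sgn_prod_def
    proof (rule prod.cong[OF refl])
      fix i assume i: "i \<in> K"
      have "sgn_pair (col i b - col i (B0 N)) (a i + A0 N i) = sgn_pair (col i b) (a i)"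
      proof (rule sgn_pair_shift[where D=1 and D'="real d"])
        show "real d * a i \<in> \<int>" by (rule den_L[OF ab(1)])
        show "1 * col i b \<in> \<int>" using col_Ints[OF ab(2) i] by simp
      qed (use AB[OF i, of N] pos[OF i] cB[OF i, of N] s half_d d_pos in linarith)+
      then show "sgn_pair (lin K (stage_basis K i) b - lin K (stage_basis K i) (B0 N)) (lin K (C i) a + lin K (C i) (A0 N))
          = sgn_pair (col i b) (a i)"
        using i by (simp add: stage_basis_def linC)
    qed
    have wlim: "(\<lambda>N. weight \<tau> (u N) (v N) a b) \<longlonglongrightarrow> weight \<tau> (\<lambda>_. z) (\<lambda>_. z) a b" for a b
    proof -
      have "(\<lambda>N. weight \<tau> (u N) (v N) a b) \<longlonglongrightarrow>
        e2pi ((\<Sum>j\<in>K. of_real (b j) * (z * of_real (1 + 0 * row j \<theta>))) - (\<Sum>i\<in>K. of_real (a i) * (z * of_real (1 + 0 * h i))) + of_real (form a b) * \<tau>)"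
        unfolding weight_def u_def v_def e2pi_def by (intro tendsto_intros \<eta>0)
      then show ?thesis by (simp add: weight_def)
    qed
    have limit: "(\<lambda>N. lattice_sum \<tau> (u N) (v N) (A0 N) (B0 N) X \<Lambda>) \<longlonglongrightarrow>
        (\<Sum>\<^sub>\<infinity>(a, b)\<in>L \<times> M. of_real (\<sigma> a b) * weight \<tau> (\<lambda>_. z) (\<lambda>_. z) a b)"
      if db: "dual_bases X \<Lambda>" and sep: "\<And>N. separated X \<Lambda> \<delta> 1 (A0 N) (B0 N)"
        and sg: "\<And>N a b. a \<in> L \<Longrightarrow> b \<in> M \<Longrightarrow> sgn_prod X \<Lambda> (A0 N) (B0 N) a b = \<sigma> a b" for X \<Lambda> \<sigma>
    proof -
      have c: "0 < 2 * pi * Im \<tau>" using \<tau> by simp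
      obtain Dm where Dm: "Dm summable_on L \<times> M" "\<And>A0 B0 a b. separated X \<Lambda> \<delta> 1 A0 B0 \<Longrightarrow> a \<in> L \<Longrightarrow> b \<in> M \<Longrightarrow>
         \<bar>sgn_prod X \<Lambda> A0 B0 a b\<bar> * exp (- (2 * pi * Im \<tau>) * expo A0 B0 a b) \<le> Dm (a, b)"
        using sgn_prod_dominated[OF db c \<delta>, of 1] by auto
      show ?thesis
        unfolding lattice_sum_def
      proof (rule infsum_dominated_convergence[OF Dm(1)])
        fix N and x :: "('k \<Rightarrow> real) \<times> ('k \<Rightarrow> real)" assume x: "x \<in> L \<times> M"
        obtain a b where ab: "x = (a, b)" "a \<in> L" "b \<in> M" using x by auto
        have cp: "compatible \<tau> (u N) (v N) (A0 N) (B0 N)" using adm[of N] by (simp add: admissible_def)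
        show "norm (case x of (a, b) \<Rightarrow> of_real (sgn_prod X \<Lambda> (A0 N) (B0 N) a b) * weight \<tau> (u N) (v N) a b) \<le> Dm x"
          using Dm(2)[OF sep[of N] ab(2,3)] unfolding ab(1) prod.case norm_mult norm_weight[OF cp] norm_of_real .
      next
        fix x assume x: "x \<in> L \<times> M"
        obtain a b where ab: "x = (a, b)" "a \<in> L" "b \<in> M" using x by auto
        show "(\<lambda>N. case x of (a, b) \<Rightarrow> of_real (sgn_prod X \<Lambda> (A0 N) (B0 N) a b) * weight \<tau> (u N) (v N) a b)
          \<longlonglongrightarrow> (case x of (a, b) \<Rightarrow> of_real (\<sigma> a b) * weight \<tau> (\<lambda>_. z) (\<lambda>_. z) a b)"
          unfolding ab(1) prod.case sg[OF ab(2,3)] by (intro tendsto_mult tendsto_const wlim)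
      qed
    qed
    have db1: "dual_bases (stage_basis {}) (\<lambda>j i. real (E j i))" and db2: "dual_bases (stage_basis K) C"
      using stage_empty st by (auto simp: stage_def)
    from LIMSEQ_unique[OF limit[OF db2 sep2 sg2] limit[OF db1 sep1 sg1, unfolded eqN[symmetric]]]
    show "(\<Sum>\<^sub>\<infinity>(a, b)\<in>L \<times> M. of_real (\<Prod>i\<in>K. sgn_pair (col i b) (a i)) * weight \<tau> (\<lambda>_. z) (\<lambda>_. z) a b)
      = (\<Sum>\<^sub>\<infinity>(a, b)\<in>L \<times> M. of_real (\<Prod>j\<in>K. sgn_pair (b j) (row j a)) * weight \<tau> (\<lambda>_. z) (\<lambda>_. z) a b)" .
  qed (rule \<open>0 < s0\<close>)
qed

end

section \<open>The genus of a lattice\<close>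

definition theta_factor :: "complex \<Rightarrow> complex \<Rightarrow> real \<Rightarrow> real \<Rightarrow> real \<Rightarrow> complex" where
  "theta_factor \<tau> z x \<alpha> \<beta> = e2pi (- of_real \<alpha> * z) *
     (theta1 \<tau> ((1 - of_real x) * z - of_real \<alpha> * \<tau> - of_real \<beta>) / theta1 \<tau> (of_real x * z + of_real \<alpha> * \<tau> + of_real \<beta>))"

text \<open>Representatives of \<open>L\<close> modulo integral vectors, which is the group itself
  when \<open>L\<close> is its lattice of logarithms.\<close>

definition fund_set :: "'k set \<Rightarrow> ('k \<Rightarrow> real) set \<Rightarrow> ('k \<Rightarrow> real) set" where
  "fund_set I L = {a\<in>L. \<forall>i\<in>I. 0 \<le> a i \<and> a i < 1}"

definition lattice_genus :: "'k set \<Rightarrow> ('k \<Rightarrow> real) set \<Rightarrow> ('k \<Rightarrow> real) \<Rightarrow> complex \<Rightarrow> complex \<Rightarrow> complex" where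
  "lattice_genus I L w \<tau> z = 1 / of_nat (card (fund_set I L)) *
     (\<Sum>\<alpha>\<in>fund_set I L. \<Sum>\<beta>\<in>fund_set I L. \<Prod>i\<in>I. theta_factor \<tau> z (w i) (\<alpha> i) (\<beta> i))"

text \<open>The constant stays abstract: it depends on \<open>\<tau>\<close> and \<open>z\<close>
  alone, so it enters the genus and its dual with the same power and need not be computed.\<close>

definition kronecker_constant :: "complex \<Rightarrow> complex \<Rightarrow> complex \<Rightarrow> bool" where
  "kronecker_constant \<tau> z C \<longleftrightarrow> (\<forall>u. 0 < Im u \<longrightarrow> Im u < Im \<tau> \<longrightarrow>
     theta1 \<tau> (z - u) / theta1 \<tau> u
      = C * (\<Sum>\<^sub>\<infinity>(m, k)\<in>UNIV. of_real (sgn_pair (of_int m) (of_int k))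
               * e2pi (of_int m * u - of_int k * z + of_int (m * k) * \<tau>)) \<and>
     (\<lambda>(m, k). norm (of_real (sgn_pair (of_int m) (of_int k))
               * e2pi (of_int m * u - of_int k * z + of_int (m * k) * \<tau>))) summable_on UNIV)"

lemma e2pi_of_real_Ints: "x \<in> \<int> \<Longrightarrow> e2pi (of_real x) = 1"
  by (auto elim!: Ints_cases)

locale denominator_lattice =
  fixes I :: "'k set" and L :: "('k \<Rightarrow> real) set" and d :: nat
  assumes finite_index: "finite I" and lat_supp: "a \<in> L \<Longrightarrow> i \<notin> I \<Longrightarrow> a i = 0"
    and lat_diff: "a \<in> L \<Longrightarrow> a' \<in> L \<Longrightarrow> (\<lambda>i. a i - a' i) \<in> L"
    and lat_of_int: "(\<And>i. i \<notin> I \<Longrightarrow> n i = 0) \<Longrightarrow> (\<lambda>i. of_int (n i)) \<in> L"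
    and lat_d_pos: "0 < d" and lat_den: "a \<in> L \<Longrightarrow> real d * a i \<in> \<int>"
begin

definition frac_vec :: "('k \<Rightarrow> real) \<Rightarrow> 'k \<Rightarrow> real" where
  "frac_vec v = (\<lambda>i. if i \<in> I then frac (v i) else 0)"

lemma zero_L: "(\<lambda>_. 0) \<in> L"
  using lat_of_int[of "\<lambda>_. 0"] by simp

lemma lat_add: "a \<in> L \<Longrightarrow> a' \<in> L \<Longrightarrow> (\<lambda>i. a i + a' i) \<in> L"
  using lat_diff[of a "\<lambda>i. 0 - a' i"] lat_diff[OF zero_L, of a'] by simp

lemma frac_vec_fund: "v \<in> L \<Longrightarrow> frac_vec v \<in> fund_set I L"
proof -
  assume v: "v \<in> L"
  have "(\<lambda>i. of_int (if i \<in> I then \<lfloor>v i\<rfloor> else 0)) \<in> L" by (rule lat_of_int) auto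
  from lat_diff[OF v this] have "(\<lambda>i. v i - of_int (if i \<in> I then \<lfloor>v i\<rfloor> else 0)) \<in> L" .
  moreover have "(\<lambda>i. v i - of_int (if i \<in> I then \<lfloor>v i\<rfloor> else 0)) = frac_vec v"
    using lat_supp[OF v] by (auto simp: frac_vec_def frac_def)
  ultimately show ?thesis by (simp add: fund_set_def frac_vec_def frac_ge_0 frac_lt_1)
qed

lemma fund_supp: "a \<in> fund_set I L \<Longrightarrow> i \<notin> I \<Longrightarrow> a i = 0"
  using lat_supp by (auto simp: fund_set_def)

lemma fund_finite: "finite (fund_set I L)"
proof (rule finite_subset)
  show "fund_set I L \<subseteq> (\<lambda>g i. if i \<in> I then real_of_int (g i) / real d else 0) ` PiE I (\<lambda>_. {0..<int d})"
  proof
    fix a assume a: "a \<in> fund_set I L"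
    then have aL: "a \<in> L" by (simp add: fund_set_def)
    define g where "g = restrict (\<lambda>i. \<lfloor>real d * a i\<rfloor>) I"
    have gi: "real_of_int (g i) = real d * a i" if "i \<in> I" for i
      using lat_den[OF aL, of i] that by (auto simp: g_def elim: Ints_cases)
    have "g i \<in> {0..<int d}" if i: "i \<in> I" for i
    proof -
      have "0 \<le> real d * a i" "real d * a i < real d * 1"
        using a i lat_d_pos by (auto simp: fund_set_def intro!: mult_strict_left_mono)
      then have "0 \<le> real_of_int (g i)" "real_of_int (g i) < real_of_int (int d)" using gi[OF i] by auto
      then show ?thesis by (simp only: of_int_0_le_iff of_int_less_iff) simp
    qed
    then have "g \<in> PiE I (\<lambda>_. {0..<int d})" by (auto simp: g_def)
    moreover have "a = (\<lambda>i. if i \<in> I then real_of_int (g i) / real d else 0)"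
      using gi lat_d_pos lat_supp[OF aL] by (auto simp: fun_eq_iff)
    ultimately show "a \<in> (\<lambda>g i. if i \<in> I then real_of_int (g i) / real d else 0) ` PiE I (\<lambda>_. {0..<int d})" by blast
  qed
  show "finite ((\<lambda>g i. if i \<in> I then real_of_int (g i) / real d else 0) ` PiE I (\<lambda>_. {0..<int d}))"
    using finite_index by (intro finite_imageI finite_PiE) auto
qed

lemma fund_card: "0 < card (fund_set I L)"
  using fund_finite zero_L by (auto simp: card_gt_0_iff fund_set_def)

lemma frac_vec_id: "a \<in> fund_set I L \<Longrightarrow> frac_vec a = a"
  using fund_supp by (auto simp: frac_vec_def fund_set_def frac_eq fun_eq_iff)

lemma frac_vec_frac_add: "frac_vec (\<lambda>i. frac_vec u i + v i) = frac_vec (\<lambda>i. u i + v i)"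
proof -
  have "frac (frac x + y) = frac (x + y)" for x y :: real
  proof -
    have "frac x + y = (x + y) - of_int \<lfloor>x\<rfloor>" by (simp add: frac_def)
    moreover have "frac ((x + y) - of_int \<lfloor>x\<rfloor>) = frac (x + y)" unfolding frac_def floor_diff_of_int by simp
    ultimately show ?thesis by (simp only:)
  qed
  then show ?thesis by (auto simp: frac_vec_def)
qed

text \<open>Orthogonality for the finite group \<open>L\<close> modulo integral vectors: translating
  by an \<open>a\<close> on which the character is nontrivial multiplies the sum by a number
  different from 1.\<close>

lemma character_sum:
  assumes m: "\<And>i. i \<in> I \<Longrightarrow> m i \<in> \<int>"
  shows "(\<Sum>\<beta>\<in>fund_set I L. e2pi (of_real (\<Sum>i\<in>I. m i * \<beta> i)))
    = (if \<forall>a\<in>L. (\<Sum>i\<in>I. m i * a i) \<in> \<int> then of_nat (card (fund_set I L)) else 0)"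
proof (cases "\<forall>a\<in>L. (\<Sum>i\<in>I. m i * a i) \<in> \<int>")
  case True
  have "e2pi (of_real (\<Sum>i\<in>I. m i * \<beta> i)) = 1" if "\<beta> \<in> fund_set I L" for \<beta>
  proof -
    have "(\<Sum>i\<in>I. m i * \<beta> i) \<in> \<int>" using True that by (simp add: fund_set_def)
    then show ?thesis by (rule e2pi_of_real_Ints)
  qed
  then show ?thesis using True by (simp del: of_real_sum)
next
  case False
  then obtain a where a: "a \<in> L" "(\<Sum>i\<in>I. m i * a i) \<notin> \<int>" by blast
  define ch where "ch v = e2pi (of_real (\<Sum>i\<in>I. m i * v i))" for v
  have ch_frac: "ch (frac_vec v) = ch v" for v
  proof -
    have "(\<Sum>i\<in>I. m i * v i) = (\<Sum>i\<in>I. m i * frac_vec v i) + (\<Sum>i\<in>I. m i * of_int \<lfloor>v i\<rfloor>)"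
      unfolding sum.distrib[symmetric] by (intro sum.cong refl) (simp add: frac_vec_def frac_def algebra_simps)
    moreover have "(\<Sum>i\<in>I. m i * of_int \<lfloor>v i\<rfloor>) \<in> \<int>" using m by (intro Ints_sum Ints_mult) auto
    then have "e2pi (of_real (\<Sum>i\<in>I. m i * of_int \<lfloor>v i\<rfloor>)) = 1" by (rule e2pi_of_real_Ints)
    ultimately show ?thesis by (simp only: ch_def of_real_add e2pi_add mult_1_right)
  qed
  have ch_add: "ch (\<lambda>i. u i + v i) = ch u * ch v" for u v
    by (simp add: ch_def distrib_left sum.distrib e2pi_add)
  let ?f = "\<lambda>\<beta>. frac_vec (\<lambda>i. \<beta> i + a i)" and ?g = "\<lambda>\<beta>. frac_vec (\<lambda>i. \<beta> i + - a i)"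
  have na: "(\<lambda>i. - a i) \<in> L" using lat_diff[OF zero_L a(1)] by simp
  have "(\<Sum>\<beta>\<in>fund_set I L. ch \<beta>) = (\<Sum>\<beta>\<in>fund_set I L. ch (?f \<beta>))"
  proof (rule sum.reindex_bij_witness[of _ ?f ?g])
    fix \<beta> assume b: "\<beta> \<in> fund_set I L"
    then have bL: "\<beta> \<in> L" by (simp add: fund_set_def)
    show "?f (?g \<beta>) = \<beta>" "?g (?f \<beta>) = \<beta>"
      unfolding frac_vec_frac_add using frac_vec_id[OF b] by simp_all
    show "?f \<beta> \<in> fund_set I L" "?g \<beta> \<in> fund_set I L"
      using frac_vec_fund[OF lat_add[OF bL a(1)]] frac_vec_fund[OF lat_add[OF bL na]] by auto
    show "ch (?f (?g \<beta>)) = ch \<beta>"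
      unfolding frac_vec_frac_add using frac_vec_id[OF b] by simp
  qed
  also have "\<dots> = (\<Sum>\<beta>\<in>fund_set I L. ch \<beta>) * ch a"
    unfolding ch_frac ch_add by (rule sum_distrib_right[symmetric])
  finally have "(\<Sum>\<beta>\<in>fund_set I L. ch \<beta>) * (ch a - 1) = 0" by (simp add: algebra_simps)
  moreover have "ch a \<noteq> 1"
  proof
    assume "ch a = 1"
    then have "complex_of_real (\<Sum>i\<in>I. m i * a i) \<in> \<int>" by (simp only: ch_def e2pi_eq_1_iff)
    then obtain n where "complex_of_real (\<Sum>i\<in>I. m i * a i) = of_int n" by (auto elim: Ints_cases)
    then have "(\<Sum>i\<in>I. m i * a i) = of_int n" by (metis of_real_eq_iff of_real_of_int_eq)
    then show False using a(2) by simp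
  qed
  ultimately have "(\<Sum>\<beta>\<in>fund_set I L. ch \<beta>) = 0" by simp
  then show ?thesis unfolding ch_def if_not_P[OF False] .
qed

end

context dual_lattices
begin

lemma L_of_int:
  assumes "\<And>i. i \<notin> I \<Longrightarrow> n i = 0"
  shows "(\<lambda>i. of_int (n i)) \<in> L"
proof -
  have "form (\<lambda>i. of_int (n i)) b \<in> \<int>" if "b \<in> M" for b
    unfolding form_alt using col_Ints[OF that] by (intro Ints_sum Ints_mult) auto
  then show ?thesis using assms L_iff[of "\<lambda>i. of_int (n i)"] by (simp add: form_def)
qed

lemma denominator_lattice_L: "denominator_lattice I L d"
  by (rule denominator_lattice.intro) (use fin_I L_supp L_diff L_of_int d_pos den_L in auto)

end

sublocale dual_lattices \<subseteq> denominator_lattice I L d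
  by (rule denominator_lattice_L)

context dual_lattices
begin

lemma col_inject:
  assumes "b \<in> M" "b' \<in> M" "\<And>i. i \<in> I \<Longrightarrow> lin J (\<lambda>j. real (E j i)) b = lin J (\<lambda>j. real (E j i)) b'"
  shows "b = b'"
proof
  fix j
  show "b j = b' j"
  proof (cases "j \<in> J")
    case True
    obtain a where a: "\<And>j'. j' \<in> J \<Longrightarrow> lin I (\<lambda>i. real (E j' i)) a = uvec j j'"
      using surj_E[of "uvec j"] by blast
    have "form a c = c j" for c
      using a fin_J True by (simp add: form_def uvec_def mult_delta_right)
    moreover have "form a b = form a b'" using assms(3) by (simp add: form_alt)
    ultimately show ?thesis by metis
  next
    case False
    then show ?thesis using assms(1,2) M_iff by simp
  qed
qed

text \<open>After Kronecker's formula \<open>\<beta>\<close> occurs only in the character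
  \<open>m \<cdot> \<beta>\<close>. Summing over \<open>\<beta>\<close> selects the \<open>m\<close>
  that pair integrally with \<open>L\<close>, which are the column vectors of elements of
  \<open>M\<close>, and cancels the normalizing cardinality; \<open>\<alpha> + k\<close> runs
  through \<open>L\<close>.\<close>

lemma lattice_genus_eq_lattice_sum:
  assumes w: "\<And>j. j \<in> J \<Longrightarrow> lin I (\<lambda>i. real (E j i)) w = 1" and wpos: "\<And>i. i \<in> I \<Longrightarrow> 0 < w i"
    and \<tau>: "0 < Im \<tau>" and z: "0 < Im z" "\<And>i. i \<in> I \<Longrightarrow> w i * Im z < Im \<tau> / real d"
    and C: "kronecker_constant \<tau> z C"
  shows "lattice_genus I L w \<tau> z = C ^ card I * (\<Sum>\<^sub>\<infinity>(a, b)\<in>L \<times> M.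
     of_real (\<Prod>i\<in>I. sgn_pair (lin J (\<lambda>j. real (E j i)) b) (a i)) *
     e2pi (of_real ((\<Sum>j\<in>J. b j) - (\<Sum>i\<in>I. a i)) * z + of_real (form a b) * \<tau>))"
proof -
  let ?R = "fund_set I L"
  let ?P = "PiE I (\<lambda>_. UNIV :: (int \<times> int) set)"
  define ann where "ann m \<longleftrightarrow> (\<forall>a\<in>L. (\<Sum>i\<in>I. of_int (m i) * a i) \<in> \<int>)" for m :: "'k \<Rightarrow> int"
  define u where "u \<alpha> \<beta> i = of_real (w i) * z + of_real (\<alpha> i) * \<tau> + of_real (\<beta> i)" for \<alpha> \<beta> :: "'k \<Rightarrow> real" and i
  \<comment> \<open>The formula needs \<open>0 < Im u < Im \<tau>\<close>. As
    \<open>\<alpha> i\<close> is a multiple of \<open>1 / d\<close> below 1, it leaves room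
    \<open>Im \<tau> / d\<close> for \<open>w i * Im z\<close>.\<close>
  have u: "0 < Im (u \<alpha> \<beta> i)" "Im (u \<alpha> \<beta> i) < Im \<tau>" if "\<alpha> \<in> ?R" "i \<in> I" for \<alpha> \<beta> i
  proof -
    have a: "0 \<le> \<alpha> i" "\<alpha> i < 1" "\<alpha> \<in> L" using that by (auto simp: fund_set_def)
    have Imu: "Im (u \<alpha> \<beta> i) = w i * Im z + \<alpha> i * Im \<tau>" by (simp add: u_def)
    show "0 < Im (u \<alpha> \<beta> i)" unfolding Imu using a \<tau> z(1) wpos[OF that(2)] by (intro add_pos_nonneg) auto
    obtain n :: int where n: "real d * \<alpha> i = of_int n" using den_L[OF a(3)] by (auto elim: Ints_cases)
    have "real d * \<alpha> i < real_of_int (int d)" using a d_pos by simp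
    then have "n < int d" unfolding n by (simp only: of_int_less_iff)
    then have "real_of_int n \<le> real d - 1" by linarith
    then have "\<alpha> i \<le> 1 - 1 / real d" using d_pos unfolding n[symmetric] by (simp add: field_simps)
    then have "\<alpha> i * Im \<tau> \<le> (1 - 1 / real d) * Im \<tau>" using \<tau> by (intro mult_right_mono) auto
    then show "Im (u \<alpha> \<beta> i) < Im \<tau>" unfolding Imu using z(2)[OF that(2)] by (simp add: algebra_simps)
  qed
  define g where "g \<alpha> \<beta> i = (\<lambda>(m, k). of_real (sgn_pair (of_int m) (of_int k)) *
      e2pi (of_int m * of_real (w i) * z - of_real (\<alpha> i + of_int k) * z + of_real (of_int m * (\<alpha> i + of_int k)) * \<tau>)
      * e2pi (of_int m * of_real (\<beta> i)))" for \<alpha> \<beta> :: "'k \<Rightarrow> real" and i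
  have g: "theta_factor \<tau> z (w i) (\<alpha> i) (\<beta> i) = C * infsum (g \<alpha> \<beta> i) UNIV" "(\<lambda>x. norm (g \<alpha> \<beta> i x)) summable_on UNIV"
    if "\<alpha> \<in> ?R" "i \<in> I" for \<alpha> \<beta> i
  proof -
    let ?k = "\<lambda>(m, k). of_real (sgn_pair (of_int m) (of_int k)) * e2pi (of_int m * u \<alpha> \<beta> i - of_int k * z + of_int (m * k) * \<tau>)"
    have gk: "g \<alpha> \<beta> i = (\<lambda>x. e2pi (- of_real (\<alpha> i) * z) * ?k x)"
    proof -
      have "e2pi (of_int m * of_real (w i) * z - of_real (\<alpha> i + of_int k) * z + of_real (of_int m * (\<alpha> i + of_int k)) * \<tau>)
          * e2pi (of_int m * of_real (\<beta> i))
        = e2pi (- of_real (\<alpha> i) * z) * e2pi (of_int m * u \<alpha> \<beta> i - of_int k * z + of_int (m * k) * \<tau>)" for m k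
        unfolding e2pi_add[symmetric] u_def by (rule arg_cong[where f=e2pi]) (simp add: algebra_simps)
      then show ?thesis by (simp add: g_def fun_eq_iff mult_ac)
    qed
    have eqk: "theta1 \<tau> (z - u \<alpha> \<beta> i) / theta1 \<tau> (u \<alpha> \<beta> i) = C * infsum ?k UNIV"
      and smk: "(\<lambda>x. norm (?k x)) summable_on UNIV"
      using C u[OF that, of \<beta>] unfolding kronecker_constant_def by (auto simp: case_prod_unfold)
    have "theta_factor \<tau> z (w i) (\<alpha> i) (\<beta> i) = e2pi (- of_real (\<alpha> i) * z) * (theta1 \<tau> (z - u \<alpha> \<beta> i) / theta1 \<tau> (u \<alpha> \<beta> i))"
      by (simp add: theta_factor_def u_def algebra_simps)
    also have "\<dots> = C * infsum (\<lambda>x. e2pi (- of_real (\<alpha> i) * z) * ?k x) UNIV"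
      unfolding eqk infsum_cmult_right' by (simp only: mult_ac)
    finally show "theta_factor \<tau> z (w i) (\<alpha> i) (\<beta> i) = C * infsum (g \<alpha> \<beta> i) UNIV" unfolding gk .
    show "(\<lambda>x. norm (g \<alpha> \<beta> i x)) summable_on UNIV"
      unfolding gk norm_mult by (rule summable_on_cmult_right[OF smk[unfolded norm_mult]])
  qed
  define h where "h \<alpha> f = (\<Prod>i\<in>I. of_real (sgn_pair (of_int (fst (f i))) (of_int (snd (f i))))) *
      e2pi (of_real (\<Sum>i\<in>I. of_int (fst (f i)) * w i) * z - of_real (\<Sum>i\<in>I. \<alpha> i + of_int (snd (f i))) * z
        + of_real (\<Sum>i\<in>I. of_int (fst (f i)) * (\<alpha> i + of_int (snd (f i)))) * \<tau>)"
    for \<alpha> :: "'k \<Rightarrow> real" and f :: "'k \<Rightarrow> int \<times> int"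
  have gprod: "(\<Prod>i\<in>I. g \<alpha> \<beta> i (f i)) = h \<alpha> f * e2pi (of_real (\<Sum>i\<in>I. of_int (fst (f i)) * \<beta> i))" for \<alpha> \<beta> f
  proof -
    have "e2pi (of_real (\<Sum>i\<in>I. of_int (fst (f i)) * w i) * z - of_real (\<Sum>i\<in>I. \<alpha> i + of_int (snd (f i))) * z
        + of_real (\<Sum>i\<in>I. of_int (fst (f i)) * (\<alpha> i + of_int (snd (f i)))) * \<tau>)
      = e2pi (\<Sum>i\<in>I. of_int (fst (f i)) * of_real (w i) * z - of_real (\<alpha> i + of_int (snd (f i))) * z
        + of_real (of_int (fst (f i)) * (\<alpha> i + of_int (snd (f i)))) * \<tau>)"
      unfolding of_real_sum sum_distrib_right
      by (simp only: sum.distrib sum_subtractf of_real_mult of_real_of_int_eq)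
    moreover have "e2pi (of_real (\<Sum>i\<in>I. of_int (fst (f i)) * \<beta> i)) = (\<Prod>i\<in>I. e2pi (of_int (fst (f i)) * of_real (\<beta> i)))"
      by (simp add: e2pi_sum[symmetric])
    ultimately show ?thesis
      by (simp add: h_def g_def case_prod_unfold prod.distrib e2pi_sum)
  qed
  \<comment> \<open>\<open>\<beta>\<close> contributes a phase of modulus 1, so absolute summability
    can be checked at \<open>\<beta> = \<alpha>\<close> and then holds for all
    \<open>\<beta>\<close>.\<close>
  have normg: "norm (\<Prod>i\<in>I. g \<alpha> \<beta> i (f i)) = norm (h \<alpha> f)" for \<alpha> \<beta> f
    unfolding gprod norm_mult by (simp add: norm_e2pi)
  have hsum: "(\<lambda>f. norm (h \<alpha> f)) summable_on ?P" if "\<alpha> \<in> ?R" for \<alpha>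
  proof -
    have "(\<lambda>f. \<Prod>i\<in>I. (if i \<in> I then norm (g \<alpha> \<alpha> i (f i)) else 0)) summable_on ?P"
      using g(2)[OF that, of _ \<alpha>] fin_I
      by (intro summable_on_PiE_prod[where f="\<lambda>i y. if i \<in> I then norm (g \<alpha> \<alpha> i y) else 0"]) auto
    then have "(\<lambda>f. norm (\<Prod>i\<in>I. g \<alpha> \<alpha> i (f i))) summable_on ?P"
      by (simp add: prod_norm cong: prod.cong)
    then show ?thesis unfolding normg .
  qed
  define G where "G = (\<lambda>(a, b). of_real (\<Prod>i\<in>I. sgn_pair (lin J (\<lambda>j. real (E j i)) b) (a i)) *
     e2pi (of_real ((\<Sum>j\<in>J. b j) - (\<Sum>i\<in>I. a i)) * z + of_real (form a b) * \<tau>))"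
  define PP where "PP \<alpha> = {(a, b) \<in> L \<times> M. \<forall>i\<in>I. a i - \<alpha> i \<in> \<int>}" for \<alpha>
  define PA where "PA = {f \<in> ?P. ann (\<lambda>i. fst (f i))}"
  \<comment> \<open>Surjectivity of the transposed matrix gives a real solution \<open>b\<close>,
    and the annihilator description of \<open>M\<close> puts it into the lattice.\<close>
  have "\<exists>b. b \<in> M \<and> (\<forall>i\<in>I. lin J (\<lambda>j. real (E j i)) b = of_int (m i))" if m: "ann m" for m
  proof -
    obtain b where b: "\<And>j. j \<notin> J \<Longrightarrow> b j = 0" "\<And>i. i \<in> I \<Longrightarrow> lin J (\<lambda>j. real (E j i)) b = of_int (m i)"
      using surj_ET[of "\<lambda>i. of_int (m i)"] by blast
    have "form a b \<in> \<int>" if "a \<in> L" for a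
      using m that b(2) by (simp add: form_alt ann_def mult.commute)
    then have "b \<in> M" using b(1) M_iff[of b] by (simp add: form_def)
    then show ?thesis using b(2) by blast
  qed
  then obtain bb where bb: "\<And>m. ann m \<Longrightarrow> bb m \<in> M" "\<And>m i. ann m \<Longrightarrow> i \<in> I \<Longrightarrow> lin J (\<lambda>j. real (E j i)) (bb m) = of_int (m i)"
    by metis
  have bij: "infsum (h \<alpha>) PA = infsum G (PP \<alpha>)" and sumG: "G summable_on PP \<alpha>" if \<alpha>: "\<alpha> \<in> ?R" for \<alpha>
  proof -
    define F1 where "F1 x = restrict (\<lambda>i. (\<lfloor>lin J (\<lambda>j. real (E j i)) (snd x)\<rfloor>, \<lfloor>fst x i - \<alpha> i\<rfloor>)) I" for x :: "('k \<Rightarrow> real) \<times> ('k \<Rightarrow> real)"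
    define F2 where "F2 f = ((\<lambda>i. if i \<in> I then \<alpha> i + of_int (snd (f i)) else 0), bb (\<lambda>i. fst (f i)))" for f :: "'k \<Rightarrow> int \<times> int"
    have \<alpha>L: "\<alpha> \<in> L" "\<And>i. i \<in> I \<Longrightarrow> 0 \<le> \<alpha> i \<and> \<alpha> i < 1" using \<alpha> by (auto simp: fund_set_def)
    have a_in: "(\<lambda>i. if i \<in> I then \<alpha> i + of_int (n i) else 0) \<in> L" for n
    proof -
      have "(\<lambda>i. of_int (if i \<in> I then n i else 0)) \<in> L" by (rule L_of_int) auto
      from L_add[OF \<alpha>L(1) this] have "(\<lambda>i. \<alpha> i + of_int (if i \<in> I then n i else 0)) \<in> L" .
      moreover have "(\<lambda>i. \<alpha> i + of_int (if i \<in> I then n i else 0)) = (\<lambda>i. if i \<in> I then \<alpha> i + of_int (n i) else 0)"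
        using L_supp[OF \<alpha>L(1)] by auto
      ultimately show ?thesis by simp
    qed
    have A1: "F1 (F2 f) = f" if f: "f \<in> PA" for f
    proof
      fix i
      have fa: "ann (\<lambda>i. fst (f i))" "f \<in> ?P" using f by (auto simp: PA_def)
      show "F1 (F2 f) i = f i"
      proof (cases "i \<in> I")
        case True
        then show ?thesis using bb(2)[OF fa(1) True] by (simp add: F1_def F2_def)
      next
        case False
        then show ?thesis using fa(2) by (auto simp: F1_def PiE_def extensional_def)
      qed
    qed
    have A2: "F2 f \<in> PP \<alpha>" if f: "f \<in> PA" for f
      using f a_in bb(1) by (auto simp: F2_def PP_def PA_def)
    have A34: "F1 x \<in> PA \<and> F2 (F1 x) = x" if x: "x \<in> PP \<alpha>" for x
    proof -
      obtain a b where ab: "x = (a, b)" "a \<in> L" "b \<in> M" "\<And>i. i \<in> I \<Longrightarrow> a i - \<alpha> i \<in> \<int>"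
        using x by (auto simp: PP_def)
      define m where "m = (\<lambda>i. fst (F1 x i))"
      have mi: "of_int (m i) = lin J (\<lambda>j. real (E j i)) b" if "i \<in> I" for i
        using col_Ints[OF ab(3) that] that by (auto simp: m_def F1_def ab(1) elim: Ints_cases)
      have "ann m"
        unfolding ann_def
      proof
        fix a' assume "a' \<in> L"
        then have "form a' b \<in> \<int>" using form_Ints ab(3) by blast
        then show "(\<Sum>i\<in>I. of_int (m i) * a' i) \<in> \<int>" by (simp add: form_alt mi mult.commute)
      qed
      then have PAx: "F1 x \<in> PA" by (auto simp: PA_def m_def F1_def)
      have "bb m = b" using bb[OF \<open>ann m\<close>] mi ab(3) by (intro col_inject) auto
      moreover have "(\<lambda>i. if i \<in> I then \<alpha> i + of_int (snd (F1 x i)) else 0) = a"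
      proof
        fix i
        show "(if i \<in> I then \<alpha> i + of_int (snd (F1 x i)) else 0) = a i"
        proof (cases "i \<in> I")
          case True
          then obtain n :: int where n: "a i - \<alpha> i = of_int n" using ab(4) by (auto elim: Ints_cases)
          have "(if i \<in> I then \<alpha> i + of_int (snd (F1 x i)) else 0) = \<alpha> i + of_int \<lfloor>a i - \<alpha> i\<rfloor>"
            using True by (simp add: F1_def ab(1))
          then show ?thesis unfolding n using n by simp
        next
          case False
          then show ?thesis using L_supp[OF ab(2)] by simp
        qed
      qed
      ultimately have "F2 (F1 x) = (a, b)" by (simp only: F2_def m_def)
      with PAx ab(1) show ?thesis by metis
    qed
    have A5: "G (F2 f) = h \<alpha> f" if f: "f \<in> PA" for f
    proof -
      have fa: "ann (\<lambda>i. fst (f i))" using f by (auto simp: PA_def)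
      define a b where "a = fst (F2 f)" and "b = snd (F2 f)"
      have cb: "lin J (\<lambda>j. real (E j i)) b = of_int (fst (f i))" if "i \<in> I" for i
        using bb(2)[OF fa that] by (simp add: b_def F2_def)
      have ai: "a i = \<alpha> i + of_int (snd (f i))" if "i \<in> I" for i using that by (simp add: a_def F2_def)
      have "sgn_pair (lin J (\<lambda>j. real (E j i)) b) (a i) = sgn_pair (of_int (fst (f i))) (of_int (snd (f i)))" if i: "i \<in> I" for i
      proof -
        \<comment> \<open>Because \<open>0 \<le> \<alpha> i < 1\<close>, completing \<open>k\<close>
          to \<open>\<alpha> i + k\<close> does not change the sign condition; here it matters that
          0 counts as nonnegative.\<close>
        have "\<alpha> i + of_int (snd (f i)) < 0 \<longleftrightarrow> snd (f i) < 0" using \<alpha>L(2)[OF i] by linarith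
        then show ?thesis by (simp add: cb[OF i] ai[OF i] sgn_pair_def)
      qed
      moreover have "(\<Sum>i\<in>I. of_int (fst (f i)) * w i) = (\<Sum>j\<in>J. b j)"
      proof -
        have "(\<Sum>i\<in>I. of_int (fst (f i)) * w i) = form w b" by (simp add: form_alt cb mult.commute)
        also have "\<dots> = (\<Sum>j\<in>J. b j)" by (simp add: form_def w)
        finally show ?thesis .
      qed
      moreover have "(\<Sum>i\<in>I. of_int (fst (f i)) * (\<alpha> i + of_int (snd (f i)))) = form a b"
        by (simp add: form_alt cb ai mult.commute)
      moreover have "(\<Sum>i\<in>I. \<alpha> i + of_int (snd (f i))) = (\<Sum>i\<in>I. a i)" by (simp add: ai)
      moreover have "F2 f = (a, b)" by (simp add: a_def b_def)
      ultimately show ?thesis by (simp add: G_def h_def left_diff_distrib)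
    qed
    show "infsum (h \<alpha>) PA = infsum G (PP \<alpha>)"
      by (rule infsum_reindex_bij_witness[of _ F1 F2]) (use A1 A2 A34 A5 in auto)
    have "h \<alpha> summable_on PA"
      using abs_summable_summable[OF hsum[OF \<alpha>]] by (rule summable_on_subset_banach) (auto simp: PA_def)
    then show "G summable_on PP \<alpha>"
      using summable_on_reindex_bij_witness[of PA F1 F2 "PP \<alpha>" G "h \<alpha>"] A1 A2 A34 A5 by auto
  qed
  have inner: "(\<Sum>\<beta>\<in>?R. \<Prod>i\<in>I. theta_factor \<tau> z (w i) (\<alpha> i) (\<beta> i)) = C ^ card I * (of_nat (card ?R) * infsum G (PP \<alpha>))"
    if \<alpha>: "\<alpha> \<in> ?R" for \<alpha>
  proof -
    have "(\<Prod>i\<in>I. theta_factor \<tau> z (w i) (\<alpha> i) (\<beta> i)) = C ^ card I * infsum (\<lambda>f. h \<alpha> f * e2pi (of_real (\<Sum>i\<in>I. of_int (fst (f i)) * \<beta> i))) ?P" for \<beta>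
    proof -
      have "(\<Prod>i\<in>I. theta_factor \<tau> z (w i) (\<alpha> i) (\<beta> i)) = C ^ card I * (\<Prod>i\<in>I. infsum (g \<alpha> \<beta> i) UNIV)"
        using g(1)[OF \<alpha>] by (simp add: prod.distrib)
      also have "(\<Prod>i\<in>I. infsum (g \<alpha> \<beta> i) UNIV) = infsum (\<lambda>f. \<Prod>i\<in>I. g \<alpha> \<beta> i (f i)) ?P"
        using g(2)[OF \<alpha>] fin_I by (intro infsum_prod_PiE_abs[symmetric]) auto
      finally show ?thesis by (simp only: gprod)
    qed
    then have "(\<Sum>\<beta>\<in>?R. \<Prod>i\<in>I. theta_factor \<tau> z (w i) (\<alpha> i) (\<beta> i))
      = C ^ card I * (\<Sum>\<beta>\<in>?R. infsum (\<lambda>f. h \<alpha> f * e2pi (of_real (\<Sum>i\<in>I. of_int (fst (f i)) * \<beta> i))) ?P)"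
      by (simp add: sum_distrib_left)
    also have "(\<Sum>\<beta>\<in>?R. infsum (\<lambda>f. h \<alpha> f * e2pi (of_real (\<Sum>i\<in>I. of_int (fst (f i)) * \<beta> i))) ?P)
      = infsum (\<lambda>f. \<Sum>\<beta>\<in>?R. h \<alpha> f * e2pi (of_real (\<Sum>i\<in>I. of_int (fst (f i)) * \<beta> i))) ?P"
    proof (rule infsumI[symmetric], rule has_sum_finite_sum[OF fund_finite], rule has_sum_infsum)
      fix \<beta>
      have "(\<lambda>f. norm (h \<alpha> f * e2pi (of_real (\<Sum>i\<in>I. of_int (fst (f i)) * \<beta> i)))) summable_on ?P"
        using hsum[OF \<alpha>] by (simp add: norm_mult norm_e2pi)
      then show "(\<lambda>f. h \<alpha> f * e2pi (of_real (\<Sum>i\<in>I. of_int (fst (f i)) * \<beta> i))) summable_on ?P"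
        by (rule abs_summable_summable)
    qed
    also have "\<dots> = infsum (\<lambda>f. of_nat (card ?R) * h \<alpha> f) PA"
    proof (rule infsum_cong_neutral)
      show "(\<Sum>\<beta>\<in>?R. h \<alpha> f * e2pi (of_real (\<Sum>i\<in>I. of_int (fst (f i)) * \<beta> i))) = 0" if "f \<in> ?P - PA" for f
        using that character_sum[of "\<lambda>i. of_int (fst (f i))"] unfolding sum_distrib_left[symmetric] by (auto simp: PA_def ann_def)
      show "(\<Sum>\<beta>\<in>?R. h \<alpha> f * e2pi (of_real (\<Sum>i\<in>I. of_int (fst (f i)) * \<beta> i))) = of_nat (card ?R) * h \<alpha> f" if "f \<in> ?P \<inter> PA" for f
        using that character_sum[of "\<lambda>i. of_int (fst (f i))"] unfolding sum_distrib_left[symmetric] by (auto simp: PA_def ann_def)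
    qed (auto simp: PA_def)
    also have "\<dots> = of_nat (card ?R) * infsum G (PP \<alpha>)"
      by (simp add: infsum_cmult_right' bij[OF \<alpha>])
    finally show ?thesis .
  qed
  have "lattice_genus I L w \<tau> z = 1 / of_nat (card ?R) * (\<Sum>\<alpha>\<in>?R. C ^ card I * (of_nat (card ?R) * infsum G (PP \<alpha>)))"
    unfolding lattice_genus_def by (simp only: inner cong: sum.cong)
  also have "\<dots> = C ^ card I * (\<Sum>\<alpha>\<in>?R. infsum G (PP \<alpha>))"
    unfolding sum_distrib_left using fund_card by (intro sum.cong) auto
  also have "(\<Sum>\<alpha>\<in>?R. infsum G (PP \<alpha>)) = infsum G (\<Union>\<alpha>\<in>?R. PP \<alpha>)"
  proof (rule sum_infsum[OF fund_finite sumG])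
    fix \<alpha> \<alpha>' assume aa: "\<alpha> \<in> ?R" "\<alpha>' \<in> ?R" "\<alpha> \<noteq> \<alpha>'"
    show "PP \<alpha> \<inter> PP \<alpha>' = {}"
    proof (rule ccontr)
      assume "PP \<alpha> \<inter> PP \<alpha>' \<noteq> {}"
      then obtain a where a: "\<And>i. i \<in> I \<Longrightarrow> a i - \<alpha> i \<in> \<int>" "\<And>i. i \<in> I \<Longrightarrow> a i - \<alpha>' i \<in> \<int>"
        by (auto simp: PP_def)
      have "\<alpha> i = \<alpha>' i" for i
      proof (cases "i \<in> I")
        case True
        have "(a i - \<alpha>' i) - (a i - \<alpha> i) \<in> \<int>" by (rule Ints_diff[OF a(2)[OF True] a(1)[OF True]])
        then obtain n :: int where n: "\<alpha> i - \<alpha>' i = of_int n" by (auto elim: Ints_cases)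
        have "0 \<le> \<alpha> i" "\<alpha> i < 1" "0 \<le> \<alpha>' i" "\<alpha>' i < 1" using aa True by (auto simp: fund_set_def)
        then have "n = 0" using n by linarith
        then show ?thesis using n by simp
      next
        case False
        then show ?thesis using fund_supp[OF aa(1)] fund_supp[OF aa(2)] by simp
      qed
      then show False using aa(3) by auto
    qed
  qed
  also have "(\<Union>\<alpha>\<in>?R. PP \<alpha>) = L \<times> M"
  proof
    show "L \<times> M \<subseteq> (\<Union>\<alpha>\<in>?R. PP \<alpha>)"
    proof
      fix x assume "x \<in> L \<times> M"
      then obtain a b where ab: "x = (a, b)" "a \<in> L" "b \<in> M" by auto
      have "a i - frac_vec a i \<in> \<int>" if "i \<in> I" for i using that by (simp add: frac_vec_def frac_def)
      then have "x \<in> PP (frac_vec a)" using ab by (auto simp: PP_def)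
      then show "x \<in> (\<Union>\<alpha>\<in>?R. PP \<alpha>)" using frac_vec_fund[OF ab(2)] by blast
    qed
  qed (auto simp: PP_def)
  finally show ?thesis by (simp add: G_def)
qed

end

context chain_loop_lattices
begin

text \<open>Both genera are sign-weighted sums over \<open>L \<times> M\<close> with the same
  constant. \<open>lattice_sum_duality\<close> moves the sign factors to the other basis, and
  negating \<open>a\<close> and \<open>b\<close> brings them into the form belonging to the dual
  genus.\<close>

theorem lattice_genus_duality:
  assumes w: "\<And>j. j \<in> K \<Longrightarrow> row j w = 1" "\<And>i. i \<in> K \<Longrightarrow> 0 < w i"
    and w': "\<And>i. i \<in> K \<Longrightarrow> col i w' = 1" "\<And>j. j \<in> K \<Longrightarrow> 0 < w' j"
  shows "\<exists>s0>0. \<forall>\<tau> z. 0 < Im \<tau> \<longrightarrow> 0 < Im z \<longrightarrow> Im z < s0 * Im \<tau> \<longrightarrow>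
    lattice_genus K L w \<tau> z = (- 1) ^ card K * lattice_genus K M w' \<tau> z"
proof -
  interpret sw: dual_lattices K K "\<lambda>i j. E j i" M L d by (rule swap)
  obtain s1 where s1: "0 < s1" "\<And>\<tau> z. 0 < Im \<tau> \<Longrightarrow> 0 < Im z \<Longrightarrow> Im z < s1 * Im \<tau> \<Longrightarrow>
    (\<Sum>\<^sub>\<infinity>(a, b)\<in>L \<times> M. of_real (\<Prod>i\<in>K. sgn_pair (col i b) (a i)) * weight \<tau> (\<lambda>_. z) (\<lambda>_. z) a b)
    = (\<Sum>\<^sub>\<infinity>(a, b)\<in>L \<times> M. of_real (\<Prod>j\<in>K. sgn_pair (b j) (row j a)) * weight \<tau> (\<lambda>_. z) (\<lambda>_. z) a b)"
    using lattice_sum_duality[OF w w'] by blast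
  define s0 where "s0 = Min (insert 1 (insert s1 ((\<lambda>i. 1 / real d / w i) ` K \<union> (\<lambda>i. 1 / real d / w' i) ` K)))"
  have "0 < s0" unfolding s0_def using fin_I s1(1) d_pos w(2) w'(2) by (subst Min_gr_iff) auto
  have s0: "s0 \<le> 1" "s0 \<le> s1" "\<And>i. i \<in> K \<Longrightarrow> s0 \<le> 1 / real d / w i" "\<And>i. i \<in> K \<Longrightarrow> s0 \<le> 1 / real d / w' i"
    unfolding s0_def using fin_I by (intro Min_le; blast)+
  show ?thesis
  proof (intro exI[of _ s0] conjI allI impI)
    fix \<tau> z assume \<tau>: "0 < Im \<tau>" and z: "0 < Im z" "Im z < s0 * Im \<tau>"
    have le: "s0 * Im \<tau> \<le> 1 * Im \<tau>" "s0 * Im \<tau> \<le> s1 * Im \<tau>"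
      using \<tau> s0 by (auto intro!: mult_right_mono)
    have wz: "w i * Im z < Im \<tau> / real d" "w' i * Im z < Im \<tau> / real d" if "i \<in> K" for i
    proof -
      have "w i * Im z < w i * (s0 * Im \<tau>)" "w' i * Im z < w' i * (s0 * Im \<tau>)"
        using z w(2)[OF that] w'(2)[OF that] by (auto intro!: mult_strict_left_mono)
      moreover have "s0 * w i \<le> 1 / real d" "s0 * w' i \<le> 1 / real d"
        using s0(3,4)[OF that] pos_le_divide_eq[OF w(2)[OF that], of s0 "1 / real d"]
          pos_le_divide_eq[OF w'(2)[OF that], of s0 "1 / real d"] by (simp_all only:)
      then have "s0 * w i * Im \<tau> \<le> 1 / real d * Im \<tau>" "s0 * w' i * Im \<tau> \<le> 1 / real d * Im \<tau>"
        using \<tau> by (intro mult_right_mono; simp)+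
      ultimately show "w i * Im z < Im \<tau> / real d" "w' i * Im z < Im \<tau> / real d"
        by (simp_all add: mult_ac)
    qed
    have "Im z < Im \<tau>" using z(2) le(1) by simp
    then have "\<exists>C. kronecker_constant \<tau> z C"
    proof (rule kronecker_theta1[OF \<tau> z(1)], goal_cases)
      case (1 C)
      show ?case unfolding kronecker_constant_def
        by (rule exI[of _ C], intro allI impI conjI, rule 1(2), assumption+, rule 1(3))
    qed
    then obtain C where C: "kronecker_constant \<tau> z C" by blast
    have W: "weight \<tau> (\<lambda>_. z) (\<lambda>_. z) a b = e2pi (of_real ((\<Sum>j\<in>K. b j) - (\<Sum>i\<in>K. a i)) * z + of_real (form a b) * \<tau>)" for a b
      by (simp add: weight_def left_diff_distrib sum_distrib_right)
    have "lattice_genus K L w \<tau> z = C ^ card K *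
       (\<Sum>\<^sub>\<infinity>(a, b)\<in>L \<times> M. of_real (\<Prod>i\<in>K. sgn_pair (col i b) (a i)) * weight \<tau> (\<lambda>_. z) (\<lambda>_. z) a b)"
      unfolding W using lattice_genus_eq_lattice_sum[OF w \<tau> z(1) wz(1) C] by simp
    also have "(\<Sum>\<^sub>\<infinity>(a, b)\<in>L \<times> M. of_real (\<Prod>i\<in>K. sgn_pair (col i b) (a i)) * weight \<tau> (\<lambda>_. z) (\<lambda>_. z) a b)
      = (\<Sum>\<^sub>\<infinity>(a, b)\<in>L \<times> M. of_real (\<Prod>j\<in>K. sgn_pair (b j) (row j a)) * weight \<tau> (\<lambda>_. z) (\<lambda>_. z) a b)"
      using s1(2)[OF \<tau> z(1)] z(2) le(2) by simp
    \<comment> \<open>Negation leaves the bilinear form alone, reverses the linear part of the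
      exponent as the dual side requires, and costs one sign per index by
      \<open>sgn_pair (- p) (- q) = - sgn_pair q p\<close>.\<close>
    also have "\<dots> = (\<Sum>\<^sub>\<infinity>(b, a)\<in>M \<times> L. (- 1) ^ card K * (of_real (\<Prod>j\<in>K. sgn_pair (row j a) (b j)) *
        e2pi (of_real ((\<Sum>i\<in>K. a i) - (\<Sum>j\<in>K. b j)) * z + of_real (sw.form b a) * \<tau>)))"
    proof (rule infsum_reindex_bij_witness[of _ "\<lambda>(b, a). (\<lambda>i. - a i, \<lambda>j. - b j)" "\<lambda>(a, b). (\<lambda>j. - b j, \<lambda>i. - a i)"])
      have nL: "(\<lambda>i. - a i) \<in> L" if "a \<in> L" for a using L_diff[OF zero_L that] by simp
      have nM: "(\<lambda>i. - b i) \<in> M" if "b \<in> M" for b using sw.L_diff[OF sw.zero_L that] by simp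
      show "(case x of (a, b) \<Rightarrow> (\<lambda>j. - b j, \<lambda>i. - a i)) \<in> M \<times> L" if "x \<in> L \<times> M" for x using that nL nM by auto
      show "(case x of (b, a) \<Rightarrow> (\<lambda>i. - a i, \<lambda>j. - b j)) \<in> L \<times> M" if "x \<in> M \<times> L" for x using that nL nM by auto
      fix x assume "x \<in> L \<times> M"
      obtain a b where x: "x = (a, b)" by (cases x)
      have sg: "sgn_pair (- p) (- q) = - 1 * sgn_pair q p" for p q by (simp add: sgn_pair_def)
      have "sw.form (\<lambda>j. - b j) (\<lambda>i. - a i) = form a b"
        by (simp add: sw.form_def form_alt lin_minus_right)
      moreover have "(\<Prod>j\<in>K. sgn_pair (row j (\<lambda>i. - a i)) (- b j)) = (- 1) ^ card K * (\<Prod>j\<in>K. sgn_pair (b j) (row j a))"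
        unfolding lin_minus_right sg prod.distrib by simp
      ultimately show "(case (case x of (a, b) \<Rightarrow> (\<lambda>j. - b j, \<lambda>i. - a i)) of (b, a) \<Rightarrow>
          (- 1) ^ card K * (of_real (\<Prod>j\<in>K. sgn_pair (row j a) (b j)) *
            e2pi (of_real ((\<Sum>i\<in>K. a i) - (\<Sum>j\<in>K. b j)) * z + of_real (sw.form b a) * \<tau>)))
        = (case x of (a, b) \<Rightarrow> of_real (\<Prod>j\<in>K. sgn_pair (b j) (row j a)) * weight \<tau> (\<lambda>_. z) (\<lambda>_. z) a b)"
        unfolding x prod.case W by (simp add: sum_negf power_mult_distrib[symmetric] flip: mult.assoc)
    qed auto
    also have "\<dots> = (- 1) ^ card K * (\<Sum>\<^sub>\<infinity>(b, a)\<in>M \<times> L. of_real (\<Prod>j\<in>K. sgn_pair (row j a) (b j)) *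
        e2pi (of_real ((\<Sum>i\<in>K. a i) - (\<Sum>j\<in>K. b j)) * z + of_real (sw.form b a) * \<tau>))"
      unfolding infsum_cmult_right'[symmetric] by (intro infsum_cong) auto
    also have "C ^ card K * \<dots> = (- 1) ^ card K * lattice_genus K M w' \<tau> z"
      using sw.lattice_genus_eq_lattice_sum[OF w' \<tau> z(1) wz(2) C] by simp
    finally show "lattice_genus K L w \<tau> z = (- 1) ^ card K * lattice_genus K M w' \<tau> z" .
  qed (rule \<open>0 < s0\<close>)
qed

end

section \<open>Elimination of quadratic monomials\<close>

lemma theta1_nonzero:
  assumes \<tau>: "0 < Im \<tau>" and u: "0 < Im u" "Im u < Im \<tau>"
  shows "theta1 \<tau> u \<noteq> 0"
proof
  assume "theta1 \<tau> u = 0"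
  then obtain m n :: int where "u = of_int m + of_int n * \<tau>" using theta1_eq_0D[OF \<tau>] by blast
  then have e: "Im u = of_int n * Im \<tau>" by simp
  then have "0 < real_of_int n" using u \<tau> by (simp add: zero_less_mult_iff)
  moreover have "real_of_int n < 1"
  proof (rule ccontr)
    assume "\<not> real_of_int n < 1"
    then have "1 * Im \<tau> \<le> of_int n * Im \<tau>" using \<tau> by (intro mult_right_mono) auto
    then have "Im \<tau> \<le> Im u" unfolding e by simp
    then show False using u by simp
  qed
  ultimately show False by simp
qed

text \<open>A quadratic monomial \<open>x y\<close> makes the theta factors of \<open>x\<close> and \<open>y\<close> cancel.\<close>

lemma theta_factor_pair:
  assumes \<tau>: "0 < Im \<tau>" and x: "x1 + x2 = 1"
    and \<alpha>: "0 \<le> \<alpha>1" "\<alpha>1 < 1" "0 \<le> \<alpha>2" "\<alpha>2 < 1" "\<alpha>1 + \<alpha>2 \<in> \<int>"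
    and \<beta>: "0 \<le> \<beta>1" "\<beta>1 < 1" "0 \<le> \<beta>2" "\<beta>2 < 1" "\<beta>1 + \<beta>2 \<in> \<int>"
    and z1: "0 < x1 * Im z" "x1 * Im z + \<alpha>1 * Im \<tau> < Im \<tau>"
    and z2: "0 < x2 * Im z" "x2 * Im z + \<alpha>2 * Im \<tau> < Im \<tau>"
  shows "theta_factor \<tau> z x1 \<alpha>1 \<beta>1 * theta_factor \<tau> z x2 \<alpha>2 \<beta>2 = 1"
proof -
  have int01: "a + b = 0 \<or> a + b = 1" if "0 \<le> a" "a < 1" "0 \<le> b" "b < 1" and abZ: "a + b \<in> \<int>" for a b :: real
  proof -
    obtain k :: int where k: "a + b = of_int k" using abZ by (auto elim: Ints_cases)
    then have "-1 < real_of_int k" "real_of_int k < 2" using that(1-4) by linarith+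
    then have "-1 < k" "k < 2" by linarith+
    then have "k = 0 \<or> k = 1" by auto
    then show ?thesis using k by auto
  qed
  \<comment> \<open>Because \<open>v + v' = z\<close>, the second factor is the reciprocal of the
    first up to translations by \<open>n * \<tau> + m\<close> with \<open>n\<close> and
    \<open>m\<close> in \<open>{0, 1}\<close>. The two factors of automorphy combine to
    \<open>e2pi (- z)\<close> when \<open>n = 1\<close>, and the signs for \<open>m\<close>
    cancel.\<close>
  define v v' where "v = of_real x2 * z - of_real \<alpha>1 * \<tau> - of_real \<beta>1" and "v' = of_real x1 * z + of_real \<alpha>1 * \<tau> + of_real \<beta>1"
  define n m where "n = \<alpha>1 + \<alpha>2" and "m = \<beta>1 + \<beta>2"
  have x2: "x2 = 1 - x1" and \<alpha>2: "\<alpha>2 = n - \<alpha>1" and \<beta>2: "\<beta>2 = m - \<beta>1" using x by (auto simp: n_def m_def)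
  have vv: "v + v' = z" by (simp add: v_def v'_def x2 algebra_simps)
  have f1: "theta_factor \<tau> z x1 \<alpha>1 \<beta>1 = e2pi (- of_real \<alpha>1 * z) * (theta1 \<tau> v / theta1 \<tau> v')"
    by (simp add: theta_factor_def v_def v'_def x2)
  have e2: "of_real x2 * z + of_real \<alpha>2 * \<tau> + of_real \<beta>2 = v + of_real n * \<tau> + of_real m"
    "(1 - of_real x2) * z - of_real \<alpha>2 * \<tau> - of_real \<beta>2 = v' - of_real n * \<tau> - of_real m"
    by (simp_all add: v_def v'_def x2 \<alpha>2 \<beta>2 algebra_simps)
  have f2: "theta_factor \<tau> z x2 \<alpha>2 \<beta>2 = e2pi (- of_real \<alpha>2 * z) *
      (theta1 \<tau> (v' - of_real n * \<tau> - of_real m) / theta1 \<tau> (v + of_real n * \<tau> + of_real m))"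
    unfolding theta_factor_def e2 ..
  have d1: "theta1 \<tau> v' \<noteq> 0"
    using z1 \<alpha> \<tau> by (intro theta1_nonzero[OF \<tau>]) (auto simp: v'_def intro!: add_pos_nonneg)
  have d2: "theta1 \<tau> (v + of_real n * \<tau> + of_real m) \<noteq> 0"
    unfolding e2(1)[symmetric] using z2 \<alpha> \<tau> by (intro theta1_nonzero[OF \<tau>]) (auto intro!: add_pos_nonneg)
  have ee: "e2pi (- of_real \<alpha>1 * z) * e2pi (- of_real \<alpha>2 * z) = e2pi (- of_real n * z)"
    unfolding e2pi_add[symmetric] by (rule arg_cong[where f=e2pi]) (simp add: n_def algebra_simps)
  have mm: "theta1 \<tau> (a - of_real m) * theta1 \<tau> b = theta1 \<tau> a * theta1 \<tau> (b + of_real m)" for a b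
    using int01[OF \<beta>] theta1_add_1[OF \<tau>, of "a - 1"] theta1_add_1[OF \<tau>, of b] unfolding m_def[symmetric] by auto
  have nn: "e2pi (- of_real n * z) * (theta1 \<tau> (v' - of_real n * \<tau>) * theta1 \<tau> v) = theta1 \<tau> v' * theta1 \<tau> (v + of_real n * \<tau>)"
    using int01[OF \<alpha>] unfolding n_def[symmetric]
  proof
    assume n: "n = 1"
    have a: "theta1 \<tau> v' = - e2pi (- \<tau> / 2 - (v' - \<tau>)) * theta1 \<tau> (v' - \<tau>)"
      using theta1_add_tau[OF \<tau>, of "v' - \<tau>"] by simp
    have b: "theta1 \<tau> (v + \<tau>) = - e2pi (- \<tau> / 2 - v) * theta1 \<tau> v" by (rule theta1_add_tau[OF \<tau>])
    have "e2pi (- z) = e2pi (- \<tau> / 2 - (v' - \<tau>)) * e2pi (- \<tau> / 2 - v)"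
      unfolding e2pi_add[symmetric] by (rule arg_cong[where f=e2pi]) (simp add: vv[symmetric] field_simps)
    then show ?thesis unfolding n a b by (simp add: mult_ac) (simp add: a b mult_ac)
  qed simp
  have "theta_factor \<tau> z x1 \<alpha>1 \<beta>1 * theta_factor \<tau> z x2 \<alpha>2 \<beta>2
    = e2pi (- of_real n * z) * (theta1 \<tau> v * theta1 \<tau> (v' - of_real n * \<tau> - of_real m)) /
      (theta1 \<tau> v' * theta1 \<tau> (v + of_real n * \<tau> + of_real m))"
    unfolding f1 f2 ee[symmetric] by simp
  moreover have "e2pi (- of_real n * z) * (theta1 \<tau> v * theta1 \<tau> (v' - of_real n * \<tau> - of_real m))
     = theta1 \<tau> v' * theta1 \<tau> (v + of_real n * \<tau> + of_real m)"
  proof (cases "m = 0")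
    case True
    then show ?thesis using nn by (simp add: mult_ac)
  next
    case False
    then have "m = 1" using int01[OF \<beta>] by (auto simp: m_def)
    moreover have "theta1 \<tau> (v' - of_real n * \<tau> - 1) = - theta1 \<tau> (v' - of_real n * \<tau>)"
      using theta1_add_1[OF \<tau>, of "v' - of_real n * \<tau> - 1"] by simp
    moreover have "theta1 \<tau> (v + of_real n * \<tau> + 1) = - theta1 \<tau> (v + of_real n * \<tau>)" by (rule theta1_add_1[OF \<tau>])
    ultimately show ?thesis using nn by (simp add: mult_ac)
  qed
  ultimately show ?thesis using d1 d2 by simp
qed

section \<open>Monomials, critical points and the elimination of two variables\<close>

definition mon :: "'k set \<Rightarrow> ('k \<Rightarrow> nat) \<Rightarrow> ('k \<Rightarrow> complex) \<Rightarrow> complex" where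
  "mon I e x = (\<Prod>i\<in>I. x i ^ e i)"

text \<open>The partial derivative of \<open>mon\<close> in \<open>x k\<close>. The truncated
  exponent for \<open>e k = 0\<close> does no harm, since the coefficient
  \<open>of_nat (e k)\<close> is then 0.\<close>

definition dmon :: "'k set \<Rightarrow> 'k \<Rightarrow> ('k \<Rightarrow> nat) \<Rightarrow> ('k \<Rightarrow> complex) \<Rightarrow> complex" where
  "dmon I k e x = of_nat (e k) * x k ^ (e k - 1) * (\<Prod>i\<in>I-{k}. x i ^ e i)"

definition only_critical_zero :: "'k set \<Rightarrow> 'k set \<Rightarrow> ('k \<Rightarrow> 'k \<Rightarrow> nat) \<Rightarrow> ('k \<Rightarrow> complex) \<Rightarrow> bool" where
  "only_critical_zero I J E c \<longleftrightarrow> (\<forall>x. (\<forall>k\<in>I. (\<Sum>j\<in>J. c j * dmon I k (E j) x) = 0) \<longrightarrow> (\<forall>i\<in>I. x i = 0))"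

lemma mon_has_derivative:
  assumes "finite I" "k \<in> I"
  shows "((\<lambda>t. mon I e (x(k := t))) has_field_derivative dmon I k e x) (at (x k))"
proof -
  have "mon I e (x(k := t)) = t ^ e k * (\<Prod>i\<in>I-{k}. x i ^ e i)" for t
    unfolding mon_def using assms by (subst prod.remove[of _ k]) (auto intro!: prod.cong)
  then show ?thesis
    by (auto intro!: derivative_eq_intros simp: dmon_def)
qed

text \<open>The product and chain rule for substituting a power of one monomial into another,
  obtained from uniqueness of the derivative and so without cases on zero exponents.\<close>

lemma dmon_add_mult:
  assumes "finite I" "k \<in> I"
  shows "dmon I k (\<lambda>i. u i + a * v i) x = dmon I k u x * mon I v x ^ a + mon I u x * (of_nat a * mon I v x ^ (a - 1) * dmon I k v x)"
proof (rule DERIV_unique)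
  show "((\<lambda>t. mon I (\<lambda>i. u i + a * v i) (x(k := t))) has_field_derivative dmon I k (\<lambda>i. u i + a * v i) x) (at (x k))"
    by (rule mon_has_derivative[OF assms])
  have "mon I (\<lambda>i. u i + a * v i) y = mon I u y * mon I v y ^ a" for y
    by (simp add: mon_def power_add power_mult prod.distrib mult.commute[of a] prod_power_distrib)
  moreover have "((\<lambda>t. mon I u (x(k := t)) * mon I v (x(k := t)) ^ a) has_field_derivative
     (dmon I k u x * mon I v x ^ a + mon I u x * (of_nat a * mon I v x ^ (a - 1) * dmon I k v x))) (at (x k))"
    by (auto intro!: derivative_eq_intros mon_has_derivative[OF assms])
  ultimately show "((\<lambda>t. mon I (\<lambda>i. u i + a * v i) (x(k := t))) has_field_derivative
     (dmon I k u x * mon I v x ^ a + mon I u x * (of_nat a * mon I v x ^ (a - 1) * dmon I k v x))) (at (x k))"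
    by simp
qed

text \<open>Otherwise the gradient would vanish along the whole \<open>k\<close>-th coordinate axis.\<close>

lemma short_monomial_exists:
  assumes nd: "only_critical_zero I J E c" and fin: "finite I" and k: "k \<in> I"
  shows "\<exists>j\<in>J. (\<Sum>i\<in>I-{k}. E j i) \<le> 1"
proof (rule ccontr)
  assume "\<not> ?thesis"
  then have big: "2 \<le> (\<Sum>i\<in>I-{k}. E j i)" if "j \<in> J" for j using that by force
  define x :: "'a \<Rightarrow> complex" where "x i = (if i = k then 1 else 0)" for i
  have "dmon I l (E j) x = 0" if j: "j \<in> J" and l: "l \<in> I" for j l
  proof -
    \<comment> \<open>Degree at least 2 away from \<open>x k\<close> means that one differentiation
      leaves at least one factor that is zero on the axis; either it is another variable, or
      \<open>x l\<close> itself survives.\<close>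
    have ex: "\<exists>i\<in>I-{k}-{l}. E j i \<noteq> 0" if "l = k \<or> E j l \<le> 1"
    proof (rule ccontr)
      assume "\<not> ?thesis"
      then have z: "(\<Sum>i\<in>I-{k}-{l}. E j i) = 0" by auto
      show False
      proof (cases "l = k")
        case True
        then show False using z big[OF j] by simp
      next
        case False
        then have "(\<Sum>i\<in>I-{k}. E j i) = E j l + (\<Sum>i\<in>I-{k}-{l}. E j i)"
          using fin l by (intro sum.remove) auto
        then show False using z big[OF j] that False by simp
      qed
    qed
    show ?thesis
    proof (cases "l = k \<or> E j l \<le> 1")
      case True
      then obtain i where i: "i \<in> I-{k}-{l}" "E j i \<noteq> 0" using ex by blast
      then have "(\<Prod>i\<in>I-{l}. x i ^ E j i) = 0"
        using fin by (intro prod_zero bexI[of _ i]) (auto simp: x_def)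
      then show ?thesis by (simp add: dmon_def)
    next
      case False
      then have "x l ^ (E j l - 1) = 0" by (auto simp: x_def)
      then show ?thesis by (simp add: dmon_def)
    qed
  qed
  then have "\<forall>i\<in>I. x i = 0" using nd unfolding only_critical_zero_def by simp
  then show False using k by (auto simp: x_def)
qed

text \<open>If \<open>x\<^sub>p x\<^sub>q\<close> is the monomial \<open>r\<close> and \<open>x\<^sub>p\<close> occurs otherwise only linearly in the monomial \<open>s\<close>, then the
  partial derivative in \<open>x\<^sub>p\<close> solves for \<open>x\<^sub>q\<close>, and restricting to this solution removes both variables.\<close>

locale elim_lattices = dual_lattices +
  fixes p q r s
  assumes pq: "p \<in> I" "q \<in> I" "p \<noteq> q" and rs: "r \<in> J" "s \<in> J" "r \<noteq> s"
    and Er: "E r p = 1" "E r q = 1" "\<And>i. i \<in> I - {p, q} \<Longrightarrow> E r i = 0"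
    and Ep: "E s p = 1" "\<And>j. j \<in> J - {r, s} \<Longrightarrow> E j p = 0"
    and Esq: "E s q = 0"
begin

definition "I' = I - {p, q}"
definition "J' = J - {r, s}"
text \<open>The exponents after replacing \<open>x q\<close> by a multiple of the monomial
  \<open>E s\<close> in the remaining variables.\<close>

definition "E' = (\<lambda>j i. E j i + E j q * E s i)"
definition resI :: "('a \<Rightarrow> real) \<Rightarrow> 'a \<Rightarrow> real" where "resI a = (\<lambda>i. if i \<in> I' then a i else 0)"
definition resJ :: "('a \<Rightarrow> real) \<Rightarrow> 'a \<Rightarrow> real" where "resJ b = (\<lambda>j. if j \<in> J' then b j else 0)"

lemma I_eq: "I = insert p (insert q I')" "p \<notin> I'" "q \<notin> I'" "finite I'"
  and J_eq: "J = insert r (insert s J')" "r \<notin> J'" "s \<notin> J'" "finite J'"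
  using pq rs fin_I fin_J by (auto simp: I'_def J'_def)

lemma sum_I: "(\<Sum>i\<in>I. f i) = f p + f q + (\<Sum>i\<in>I'. f i)" for f :: "'a \<Rightarrow> 'b::comm_monoid_add"
proof -
  have "sum f (insert p (insert q I')) = f p + f q + sum f I'"
    using I_eq(2-4) pq(3) by (simp add: add.assoc)
  then show ?thesis by (simp only: I_eq(1)[symmetric])
qed

lemma sum_J: "(\<Sum>j\<in>J. f j) = f r + f s + (\<Sum>j\<in>J'. f j)" for f :: "'a \<Rightarrow> 'b::comm_monoid_add"
proof -
  have "sum f (insert r (insert s J')) = f r + f s + sum f J'"
    using J_eq(2-4) rs(3) by (simp add: add.assoc)
  then show ?thesis by (simp only: J_eq(1)[symmetric])
qed

text \<open>The configuration is symmetric under transposition: column \<open>p\<close> has its two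
  entries 1 in rows \<open>r\<close> and \<open>s\<close>, just as row \<open>r\<close> has its in
  columns \<open>p\<close> and \<open>q\<close>. So each fact about \<open>L\<close> yields one
  about \<open>M\<close>.\<close>

lemma elim_swap: "elim_lattices J I (\<lambda>i j. E j i) M L d r s p q"
proof -
  interpret sw: dual_lattices J I "\<lambda>i j. E j i" M L d by (rule swap)
  show ?thesis by unfold_locales (use pq rs Er Ep Esq in auto)
qed

lemma row_r: "lin I (\<lambda>i. real (E r i)) a = a p + a q"
  using Er by (simp add: lin_def sum_I I'_def)

lemma row_s: "lin I (\<lambda>i. real (E s i)) a = a p + (\<Sum>i\<in>I'. real (E s i) * a i)"
  using Ep Esq by (simp add: lin_def sum_I)

lemma row_J': "j \<in> J' \<Longrightarrow> lin I (\<lambda>i. real (E j i)) a =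
   lin I' (\<lambda>i. real (E' j i)) a + real (E j q) * (lin I (\<lambda>i. real (E r i)) a - lin I (\<lambda>i. real (E s i)) a)"
  unfolding row_r row_s using Ep
  by (simp add: lin_def sum_I J'_def E'_def algebra_simps sum.distrib sum_distrib_left)

lemma lin_resI: "lin I' c (resI a) = lin I' c a"
  by (simp add: lin_def resI_def)

definition form' :: "('a \<Rightarrow> real) \<Rightarrow> ('a \<Rightarrow> real) \<Rightarrow> real" where
  "form' a b = (\<Sum>j\<in>J'. b j * lin I' (\<lambda>i. real (E' j i)) a)"

lemma form'_res: "form' (resI a) (resJ b) = form' a b"
  by (simp add: form'_def lin_resI resJ_def)

text \<open>For lattice vectors the first two summands are products of integers; thus
  \<open>form\<close> and \<open>form'\<close> agree modulo integers, and duality passes to the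
  restrictions.\<close>

lemma form_split: "form a b = lin J (\<lambda>j. real (E j q)) b * (lin I (\<lambda>i. real (E r i)) a - lin I (\<lambda>i. real (E s i)) a)
   + lin J (\<lambda>j. real (E j p)) b * lin I (\<lambda>i. real (E s i)) a + form' a b"
proof -
  define nr ns where "nr = lin I (\<lambda>i. real (E r i)) a" and "ns = lin I (\<lambda>i. real (E s i)) a"
  have 1: "lin J (\<lambda>j. real (E j q)) b = b r + (\<Sum>j\<in>J'. real (E j q) * b j)"
    using Er Esq by (simp add: lin_def sum_J)
  have 2: "lin J (\<lambda>j. real (E j p)) b = b r + b s"
    using Er Ep by (simp add: lin_def sum_J J'_def)
  have "form a b = b r * nr + b s * ns + (\<Sum>j\<in>J'. b j * (lin I' (\<lambda>i. real (E' j i)) a + real (E j q) * (nr - ns)))"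
    unfolding form_def sum_J nr_def ns_def by (intro arg_cong2[where f="(+)"] refl sum.cong) (simp_all add: row_J')
  also have "\<dots> = b r * nr + b s * ns + (form' a b + (\<Sum>j\<in>J'. real (E j q) * b j) * (nr - ns))"
    by (simp add: form'_def algebra_simps sum.distrib sum_distrib_left sum_subtractf)
  finally show ?thesis unfolding 1 2 nr_def[symmetric] ns_def[symmetric] by (simp add: algebra_simps)
qed

lemma resI_L_iff: "a \<in> resI ` L \<longleftrightarrow> (\<forall>i. i \<notin> I' \<longrightarrow> a i = 0) \<and> (\<forall>b\<in>resJ ` M. form' a b \<in> \<int>)"
proof
  assume "a \<in> resI ` L"
  then obtain a0 where a0: "a0 \<in> L" "a = resI a0" by blast
  have "form' a0 b \<in> \<int>" if b: "b \<in> M" for b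
  proof -
    have "form' a0 b = form a0 b - (lin J (\<lambda>j. real (E j q)) b * (lin I (\<lambda>i. real (E r i)) a0 - lin I (\<lambda>i. real (E s i)) a0)
       + lin J (\<lambda>j. real (E j p)) b * lin I (\<lambda>i. real (E s i)) a0)"
      using form_split[of a0 b] by simp
    also have "\<dots> \<in> \<int>"
      by (intro Ints_diff Ints_add Ints_mult form_Ints row_Ints col_Ints a0 b pq rs)
    finally show ?thesis .
  qed
  then show "(\<forall>i. i \<notin> I' \<longrightarrow> a i = 0) \<and> (\<forall>b\<in>resJ ` M. form' a b \<in> \<int>)"
    using a0 form'_res by (auto simp: resI_def)
next
  assume a: "(\<forall>i. i \<notin> I' \<longrightarrow> a i = 0) \<and> (\<forall>b\<in>resJ ` M. form' a b \<in> \<int>)"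
  \<comment> \<open>The lift sets \<open>a p = - t\<close> and \<open>a q = t\<close>, the unique
    values for which rows \<open>r\<close> and \<open>s\<close> both vanish; then
    \<open>form_split\<close> reduces to \<open>form'\<close>.\<close>
  define t where "t = (\<Sum>i\<in>I'. real (E s i) * a i)"
  define a0 where "a0 = (\<lambda>i. if i \<in> I' then a i else if i = p then - t else if i = q then t else 0)"
  have res: "resI a0 = a" using a by (auto simp: resI_def a0_def)
  have r0: "lin I (\<lambda>i. real (E r i)) a0 = 0" unfolding row_r using I_eq pq by (simp add: a0_def)
  have s0: "lin I (\<lambda>i. real (E s i)) a0 = 0" unfolding row_s using I_eq pq by (simp add: a0_def t_def)
  have "form a0 b \<in> \<int>" if "b \<in> M" for b
    using form_split[of a0 b] a that res form'_res[of a0 b] unfolding r0 s0 by auto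
  then have "a0 \<in> L" using L_iff[of a0] I_eq by (auto simp: form_def a0_def)
  then show "a \<in> resI ` L" using res by blast
qed

lemma surj_E': "\<exists>a. (\<forall>i. i \<notin> I' \<longrightarrow> a i = 0) \<and> (\<forall>j\<in>J'. lin I' (\<lambda>i. real (E' j i)) a = y j)"
proof -
  obtain a where a: "\<forall>j\<in>J. lin I (\<lambda>i. real (E j i)) a = (if j \<in> J' then y j else 0)"
    using surj_E[of "\<lambda>j. if j \<in> J' then y j else 0"] by blast
  have "lin I (\<lambda>i. real (E r i)) a = 0" "lin I (\<lambda>i. real (E s i)) a = 0"
    using a rs by (auto simp: J'_def)
  then have "lin I' (\<lambda>i. real (E' j i)) (resI a) = y j" if "j \<in> J'" for j
    using row_J'[OF that, of a] a that unfolding lin_resI by (auto simp: J'_def)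
  then show ?thesis by (intro exI[of _ "resI a"]) (auto simp: resI_def)
qed

lemma unit_res: "i \<in> I' \<Longrightarrow> uvec i \<in> resI ` L"
proof (rule image_eqI)
  assume i: "i \<in> I'"
  then show "uvec i = resI (uvec i)" by (auto simp: resI_def uvec_def)
  show "uvec i \<in> L" using i by (intro unit_L) (simp add: I'_def)
qed

lemma swap_simps: "elim_lattices.I' J r s = J'" "elim_lattices.J' I p q = I'"
  "elim_lattices.E' (\<lambda>i j. E j i) s q = (\<lambda>i j. E' j i)"
  "elim_lattices.resI J r s = resJ" "elim_lattices.resJ I p q = resI"
  "elim_lattices.form' J I (\<lambda>i j. E j i) r s p q = (\<lambda>b a. form' a b)"
proof -
  note el = elim_swap
  show I: "elim_lattices.I' J r s = J'" and J: "elim_lattices.J' I p q = I'"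
    by (simp_all add: elim_lattices.I'_def[OF el] elim_lattices.J'_def[OF el] I'_def J'_def)
  show E: "elim_lattices.E' (\<lambda>i j. E j i) s q = (\<lambda>i j. E' j i)"
    by (simp add: elim_lattices.E'_def[OF el] E'_def mult.commute)
  show "elim_lattices.resI J r s = resJ" "elim_lattices.resJ I p q = resI"
    by (simp_all add: elim_lattices.resI_def[OF el] elim_lattices.resJ_def[OF el] resI_def resJ_def I J fun_eq_iff)
  have "(\<Sum>i\<in>I'. a i * lin J' (\<lambda>j. real (E' j i)) b) = form' a b" for a b
    unfolding form'_def lin_def sum_distrib_left by (subst sum.swap) (simp add: mult_ac)
  then show "elim_lattices.form' J I (\<lambda>i j. E j i) r s p q = (\<lambda>b a. form' a b)"
    by (simp add: elim_lattices.form'_def[OF el] fun_eq_iff I J E)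
qed

lemmas resJ_M_iff = elim_lattices.resI_L_iff[OF elim_swap, unfolded swap_simps]
  and surj_ET' = elim_lattices.surj_E'[OF elim_swap, unfolded swap_simps]
  and unit_resJ = elim_lattices.unit_res[OF elim_swap, unfolded swap_simps]

lemma dual_lattices_elim: "dual_lattices I' J' E' (resI ` L) (resJ ` M) d"
proof
  show "card I' = card J'"
    using card_eq pq rs fin_I fin_J by (simp add: I'_def J'_def card_Diff_subset)
  show "a \<in> resI ` L \<longleftrightarrow> (\<forall>i. i \<notin> I' \<longrightarrow> a i = 0) \<and>
      (\<forall>b\<in>resJ ` M. (\<Sum>j\<in>J'. b j * lin I' (\<lambda>i. real (E' j i)) a) \<in> \<int>)" for a
    using resI_L_iff[of a] unfolding form'_def .
  show "b \<in> resJ ` M \<longleftrightarrow> (\<forall>j. j \<notin> J' \<longrightarrow> b j = 0) \<and>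
      (\<forall>a\<in>resI ` L. (\<Sum>j\<in>J'. b j * lin I' (\<lambda>i. real (E' j i)) a) \<in> \<int>)" for b
    using resJ_M_iff[of b] unfolding form'_def .
  show "real d * a i \<in> \<int>" if "a \<in> resI ` L" for a i
    using that den_L by (auto simp: resI_def)
  show "real d * b i \<in> \<int>" if "b \<in> resJ ` M" for b i
    using that den_M by (auto simp: resJ_def)
  show "\<exists>a. (\<forall>i. i \<notin> I' \<longrightarrow> a i = 0) \<and> (\<forall>j\<in>J'. lin I' (\<lambda>i. real (E' j i)) a = y j)" for y by (rule surj_E')
  show "\<exists>b. (\<forall>j. j \<notin> J' \<longrightarrow> b j = 0) \<and> (\<forall>i\<in>I'. lin J' (\<lambda>j. real (E' j i)) b = y i)" for y by (rule surj_ET')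
qed (use I_eq J_eq unit_res unit_resJ d_pos in auto)

lemma weight_elim:
  assumes "\<And>j. j \<in> J \<Longrightarrow> lin I (\<lambda>i. real (E j i)) w = 1" "j \<in> J'"
  shows "lin I' (\<lambda>i. real (E' j i)) w = 1"
  using row_J'[OF assms(2), of w] assms(1)[of j] assms(1)[OF rs(1)] assms(1)[OF rs(2)] assms(2) by (simp add: J'_def)

lemma fund_le: "\<alpha> \<in> fund_set I L \<Longrightarrow> i \<in> I \<Longrightarrow> \<alpha> i \<le> 1 - 1 / real d"
proof -
  assume a: "\<alpha> \<in> fund_set I L" "i \<in> I"
  then have al: "\<alpha> \<in> L" "\<alpha> i < 1" by (auto simp: fund_set_def)
  obtain n :: int where n: "real d * \<alpha> i = of_int n" using den_L[OF al(1)] by (auto elim: Ints_cases)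
  have "real d * \<alpha> i < real_of_int (int d)" using al(2) d_pos by simp
  then have "n < int d" unfolding n by (simp only: of_int_less_iff)
  then have "real_of_int n \<le> real d - 1" by linarith
  then show "\<alpha> i \<le> 1 - 1 / real d" using d_pos unfolding n[symmetric] by (simp add: field_simps)
qed

text \<open>Restriction is bijective on representatives because row \<open>s\<close> determines
  \<open>\<alpha> p\<close> modulo integers and then row \<open>r\<close> determines
  \<open>\<alpha> q\<close>. Row \<open>r\<close> also gives \<open>w p + w q = 1\<close>, so
  \<open>theta_factor_pair\<close> removes both factors.\<close>

lemma lattice_genus_elim:
  assumes w: "\<And>j. j \<in> J \<Longrightarrow> lin I (\<lambda>i. real (E j i)) w = 1" and wpos: "\<And>i. i \<in> I \<Longrightarrow> 0 < w i"
    and \<tau>: "0 < Im \<tau>" and z: "0 < Im z" "\<And>i. i \<in> I \<Longrightarrow> w i * Im z < Im \<tau> / real d"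
  shows "lattice_genus I L w \<tau> z = lattice_genus I' (resI ` L) w \<tau> z"
proof -
  have I'I: "I' \<subseteq> I" by (auto simp: I'_def)
  have pos: "0 < w i * Im z" "w i * Im z + \<alpha> i * Im \<tau> < Im \<tau>" if "i \<in> I" "\<alpha> \<in> fund_set I L" for i \<alpha>
  proof -
    show "0 < w i * Im z" using wpos[OF that(1)] z(1) by simp
    have "\<alpha> i * Im \<tau> \<le> (1 - 1 / real d) * Im \<tau>" using \<tau> fund_le[OF that(2,1)] by (intro mult_right_mono) auto
    then show "w i * Im z + \<alpha> i * Im \<tau> < Im \<tau>" using z(2)[OF that(1)] by (simp add: algebra_simps)
  qed
  have pqZ: "\<alpha> p + \<alpha> q \<in> \<int>" if "\<alpha> \<in> fund_set I L" for \<alpha>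
    using row_Ints[of \<alpha> r] that rs by (auto simp: row_r fund_set_def)
  have unit_eq: "x = y" if "0 \<le> x" "x < 1" "0 \<le> y" "y < 1" and xyZ: "x - y \<in> \<int>" for x y :: real
  proof -
    obtain n :: int where n: "x - y = of_int n" using xyZ by (auto elim: Ints_cases)
    then have "n = 0" using that by linarith
    then show ?thesis using n by simp
  qed
  have bij: "bij_betw resI (fund_set I L) (fund_set I' (resI ` L))"
    unfolding bij_betw_def
  proof
    show "inj_on resI (fund_set I L)"
    proof (rule inj_onI)
      fix \<alpha> \<beta> assume ab: "\<alpha> \<in> fund_set I L" "\<beta> \<in> fund_set I L" "resI \<alpha> = resI \<beta>"
      have e: "\<alpha> i = \<beta> i" if "i \<in> I'" for i using fun_cong[OF ab(3), of i] that by (simp add: resI_def)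
      have ab': "\<alpha> \<in> L" "\<beta> \<in> L" using ab by (auto simp: fund_set_def)
      have "lin I (\<lambda>i. real (E s i)) \<alpha> - lin I (\<lambda>i. real (E s i)) \<beta> \<in> \<int>"
        using row_Ints[OF ab'(1) rs(2)] row_Ints[OF ab'(2) rs(2)] by (rule Ints_diff)
      then have "\<alpha> p - \<beta> p \<in> \<int>" by (simp add: row_s e)
      then have p: "\<alpha> p = \<beta> p" using ab pq by (intro unit_eq) (auto simp: fund_set_def)
      have "(\<alpha> p + \<alpha> q) - (\<beta> p + \<beta> q) \<in> \<int>" using pqZ ab by (intro Ints_diff) auto
      then have q: "\<alpha> q = \<beta> q" using ab pq p by (intro unit_eq) (auto simp: fund_set_def)
      show "\<alpha> = \<beta>"
      proof
        fix i
        have "i \<notin> I \<or> i = p \<or> i = q \<or> i \<in> I'" by (auto simp: I'_def)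
        then show "\<alpha> i = \<beta> i"
          using e[of i] p q L_supp[OF ab'(1), of i] L_supp[OF ab'(2), of i] by auto
      qed
    qed
    show "resI ` fund_set I L = fund_set I' (resI ` L)"
    proof
      show "resI ` fund_set I L \<subseteq> fund_set I' (resI ` L)"
        using I'I by (auto simp: fund_set_def resI_def)
      show "fund_set I' (resI ` L) \<subseteq> resI ` fund_set I L"
      proof
        fix a assume a: "a \<in> fund_set I' (resI ` L)"
        then obtain a0 where a0: "a0 \<in> L" "a = resI a0" by (auto simp: fund_set_def)
        have "resI (frac_vec a0) = a"
        proof
          fix i show "resI (frac_vec a0) i = a i"
          proof (cases "i \<in> I'")
            case True
            then have "0 \<le> a0 i" "a0 i < 1" using a a0 by (auto simp: fund_set_def resI_def)
            then show ?thesis using True I'I a0 by (auto simp: resI_def frac_vec_def frac_eq)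
          qed (simp add: resI_def a0)
        qed
        then show "a \<in> resI ` fund_set I L" using frac_vec_fund[OF a0(1)] by blast
      qed
    qed
  qed
  have "(\<Prod>i\<in>I. theta_factor \<tau> z (w i) (\<alpha> i) (\<beta> i)) = (\<Prod>i\<in>I'. theta_factor \<tau> z (w i) (resI \<alpha> i) (resI \<beta> i))"
    if ab: "\<alpha> \<in> fund_set I L" "\<beta> \<in> fund_set I L" for \<alpha> \<beta>
  proof -
    have "theta_factor \<tau> z (w p) (\<alpha> p) (\<beta> p) * theta_factor \<tau> z (w q) (\<alpha> q) (\<beta> q) = 1"
      using w[OF rs(1)] pqZ ab pq \<tau> pos ab by (intro theta_factor_pair) (auto simp: row_r fund_set_def)
    then have "(\<Prod>i\<in>insert p (insert q I'). theta_factor \<tau> z (w i) (\<alpha> i) (\<beta> i)) = (\<Prod>i\<in>I'. theta_factor \<tau> z (w i) (\<alpha> i) (\<beta> i))"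
      using I_eq(2-4) pq(3) by (simp add: mult.assoc[symmetric])
    then have "(\<Prod>i\<in>I. theta_factor \<tau> z (w i) (\<alpha> i) (\<beta> i)) = (\<Prod>i\<in>I'. theta_factor \<tau> z (w i) (\<alpha> i) (\<beta> i))"
      by (simp only: I_eq(1)[symmetric])
    also have "\<dots> = (\<Prod>i\<in>I'. theta_factor \<tau> z (w i) (resI \<alpha> i) (resI \<beta> i))"
      by (intro prod.cong) (auto simp: resI_def)
    finally show ?thesis .
  qed
  then have "(\<Sum>\<alpha>\<in>fund_set I L. \<Sum>\<beta>\<in>fund_set I L. \<Prod>i\<in>I. theta_factor \<tau> z (w i) (\<alpha> i) (\<beta> i))
    = (\<Sum>\<alpha>\<in>fund_set I L. \<Sum>\<beta>\<in>fund_set I L. \<Prod>i\<in>I'. theta_factor \<tau> z (w i) (resI \<alpha> i) (resI \<beta> i))"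
    by (intro sum.cong refl)
  also have "\<dots> = (\<Sum>\<alpha>\<in>fund_set I' (resI ` L). \<Sum>\<beta>\<in>fund_set I' (resI ` L). \<Prod>i\<in>I'. theta_factor \<tau> z (w i) (\<alpha> i) (\<beta> i))"
    by (subst (1 2) sum.reindex_bij_betw[OF bij, symmetric]) (rule refl)
  finally show ?thesis
    unfolding lattice_genus_def using bij_betw_same_card[OF bij] by simp
qed

text \<open>A critical point of the reduced polynomial extends to one of the original: vanishing of
  the derivative in \<open>x p\<close> prescribes \<open>x q\<close>, and vanishing of the
  derivative in \<open>x q\<close> prescribes \<open>x p\<close>. The chain rule handles the other
  variables.\<close>

lemma only_critical_zero_elim:
  assumes nd: "only_critical_zero I J E c" and c: "\<And>j. j \<in> J \<Longrightarrow> c j \<noteq> 0"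
  shows "\<exists>c'. (\<forall>j\<in>J'. c' j \<noteq> 0) \<and> only_critical_zero I' J' E' c'"
proof -
  \<comment> \<open>The derivative in \<open>x p\<close> is \<open>c r * x q + c s * P\<close>,
    where \<open>P\<close> is the value of monomial \<open>s\<close> without \<open>x p\<close>; its
    zero is \<open>x q = g * P\<close>. Substituting this is what multiplies \<open>c j\<close> by
    \<open>g ^ E j q\<close>.\<close>
  define g where "g = - c s / c r"
  define c' where "c' j = c j * g ^ E j q" for j
  have cr: "c r \<noteq> 0" "c s \<noteq> 0" using c rs by auto
  have "only_critical_zero I' J' E' c'"
    unfolding only_critical_zero_def
  proof (intro allI impI)
    fix x assume crit: "\<forall>k\<in>I'. (\<Sum>j\<in>J'. c' j * dmon I' k (E' j) x) = 0"
    define P where "P = mon I' (E s) x"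
    define xq where "xq = g * P"
    define xp where "xp = - (1 / c r) * (\<Sum>j\<in>J'. c j * (of_nat (E j q) * xq ^ (E j q - 1) * mon I' (E j) x))"
    define y where "y = x(p := xp, q := xq)"
    have y: "y p = xp" "y q = xq" "\<And>i. i \<in> I' \<Longrightarrow> y i = x i" using I_eq pq by (auto simp: y_def)
    have dp: "dmon I p e y = of_nat (e p) * xp ^ (e p - 1) * (xq ^ e q * mon I' e x)" for e
    proof -
      have "I - {p} = insert q I'" using I_eq pq by auto
      then show ?thesis unfolding dmon_def using I_eq(2-4) y by (simp add: mon_def)
    qed
    have dq: "dmon I q e y = of_nat (e q) * xq ^ (e q - 1) * (xp ^ e p * mon I' e x)" for e
    proof -
      have "I - {q} = insert p I'" using I_eq pq by auto
      then show ?thesis unfolding dmon_def using I_eq(2-4) y by (simp add: mon_def)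
    qed
    have dk: "dmon I k e y = xp ^ e p * (xq ^ e q * dmon I' k e x)" if k: "k \<in> I'" for k e
    proof -
      have "I - {k} = insert p (insert q (I' - {k}))" using I_eq pq k by auto
      moreover have "(\<Prod>i\<in>I'-{k}. y i ^ e i) = (\<Prod>i\<in>I'-{k}. x i ^ e i)" using y by (intro prod.cong) auto
      ultimately show ?thesis unfolding dmon_def using I_eq(2-4) y k pq(3) by (simp add: mult_ac)
    qed
    have Er': "mon I' (E r) x = 1" "\<And>k. k \<in> I' \<Longrightarrow> dmon I' k (E r) x = 0"
      using Er(3) by (auto simp: mon_def dmon_def I'_def)
    have EJ: "E j p = 0" if "j \<in> J'" for j using Ep(2) that by (simp add: J'_def)
    have "(\<Sum>j\<in>J. c j * dmon I k (E j) y) = 0" if k: "k \<in> I" for k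
    proof -
      consider "k = p" | "k = q" | "k \<in> I'" using k I_eq by auto
      then show ?thesis
      proof cases
        case 1
        then show ?thesis
          using cr by (simp add: sum_J dp EJ Er Ep Esq Er' xq_def g_def P_def)
      next
        case 2
        have "(\<Sum>j\<in>J'. c j * dmon I q (E j) y) = - c r * xp"
          using cr by (simp add: dq EJ xp_def)
        then show ?thesis using 2 by (simp add: sum_J dq Er Esq Er')
      next
        case 3
        have "(\<Sum>j\<in>J'. c' j * dmon I' k (E' j) x) = (\<Sum>j\<in>J'. c j * dmon I k (E j) y) + c s * dmon I k (E s) y"
        proof -
          have t: "c' j * dmon I' k (E' j) x = c j * dmon I k (E j) y
              + g * dmon I' k (E s) x * (c j * (of_nat (E j q) * xq ^ (E j q - 1) * mon I' (E j) x))" if j: "j \<in> J'" for j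
          proof -
            have "dmon I' k (E' j) x = dmon I' k (E j) x * P ^ E j q
                + mon I' (E j) x * (of_nat (E j q) * P ^ (E j q - 1) * dmon I' k (E s) x)"
              unfolding E'_def P_def using I_eq 3 by (intro dmon_add_mult) auto
            moreover have "E j q = 0 \<or> g ^ E j q = g * g ^ (E j q - Suc 0)"
              by (cases "E j q") auto
            ultimately show ?thesis
              unfolding c'_def dk[OF 3] EJ[OF j] xq_def power_mult_distrib by (auto simp: algebra_simps)
          qed
          have "(\<Sum>j\<in>J'. c' j * dmon I' k (E' j) x) = (\<Sum>j\<in>J'. c j * dmon I k (E j) y)
             + g * dmon I' k (E s) x * (\<Sum>j\<in>J'. c j * (of_nat (E j q) * xq ^ (E j q - 1) * mon I' (E j) x))"
            unfolding sum_distrib_left sum.distrib[symmetric] by (intro sum.cong refl t)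
          also have "g * dmon I' k (E s) x * (\<Sum>j\<in>J'. c j * (of_nat (E j q) * xq ^ (E j q - 1) * mon I' (E j) x))
             = c s * dmon I k (E s) y"
            using cr by (simp add: dk[OF 3] Ep Esq xp_def g_def)
          finally show ?thesis .
        qed
        then show ?thesis using 3 crit by (simp add: sum_J dk Er' add.commute)
      qed
    qed
    then have "\<forall>i\<in>I. y i = 0" using nd unfolding only_critical_zero_def by blast
    then show "\<forall>i\<in>I'. x i = 0" using y(3) by (auto simp: I'_def)
  qed
  moreover have "\<forall>j\<in>J'. c' j \<noteq> 0" using c cr by (auto simp: c'_def g_def J'_def)
  ultimately show ?thesis by blast
qed

lemma row_sum_elim:
  assumes "\<And>j. j \<in> J \<Longrightarrow> 2 \<le> (\<Sum>i\<in>I. E j i)" "j \<in> J'"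
  shows "2 \<le> (\<Sum>i\<in>I'. E' j i)"
proof -
  have "1 \<le> (\<Sum>i\<in>I'. E s i)" using assms(1)[OF rs(2)] Ep Esq by (simp add: sum_I)
  then have "E j q * 1 \<le> E j q * (\<Sum>i\<in>I'. E s i)" by (rule mult_le_mono2)
  moreover have "2 \<le> E j q + (\<Sum>i\<in>I'. E j i)" using assms(1)[of j] assms(2) Ep(2)[of j] by (simp add: sum_I J'_def)
  ultimately show ?thesis by (simp add: E'_def sum.distrib sum_distrib_left)
qed

end

text \<open>Indexes monomials by variables through \<open>\<rho>\<close>, so that the chain and loop
  setting with a single index set applies.\<close>

locale relabel_lattices = dual_lattices +
  fixes \<rho>
  assumes \<rho>: "bij_betw \<rho> I J"
begin

definition pull :: "('a \<Rightarrow> real) \<Rightarrow> 'a \<Rightarrow> real" where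
  "pull b = (\<lambda>i. if i \<in> I then b (\<rho> i) else 0)"

definition push :: "('a \<Rightarrow> real) \<Rightarrow> 'a \<Rightarrow> real" where
  "push b = (\<lambda>j. if j \<in> J then b (inv_into I \<rho> j) else 0)"

lemma \<rho>_in: "i \<in> I \<Longrightarrow> \<rho> i \<in> J" and inv_in: "j \<in> J \<Longrightarrow> inv_into I \<rho> j \<in> I"
  and inv_left: "i \<in> I \<Longrightarrow> inv_into I \<rho> (\<rho> i) = i" and inv_right: "j \<in> J \<Longrightarrow> \<rho> (inv_into I \<rho> j) = j"
  using \<rho> by (auto simp: bij_betw_def inv_into_into f_inv_into_f)

lemma pull_push: "(\<And>i. i \<notin> I \<Longrightarrow> b i = 0) \<Longrightarrow> pull (push b) = b"
  by (auto simp: pull_def push_def \<rho>_in inv_left)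

lemma push_pull: "b \<in> M \<Longrightarrow> push (pull b) = b"
  using M_iff[of b] by (auto simp: pull_def push_def inv_in inv_right)

lemma sum_\<rho>: "(\<Sum>k\<in>I. f (\<rho> k)) = (\<Sum>j\<in>J. f j)"
  by (rule sum.reindex_bij_betw[OF \<rho>])

lemma form_pull: "(\<Sum>k\<in>I. pull b k * lin I (\<lambda>i. real (E (\<rho> k) i)) a) = form a b"
  unfolding form_def sum_\<rho>[symmetric] by (intro sum.cong) (auto simp: pull_def)

lemma lin_pull: "lin I (\<lambda>k. real (E (\<rho> k) i)) (pull b) = lin J (\<lambda>j. real (E j i)) b"
  unfolding lin_def sum_\<rho>[symmetric] by (intro sum.cong) (auto simp: pull_def)

lemma pull_M_iff: "b \<in> pull ` M \<longleftrightarrow> (\<forall>i. i \<notin> I \<longrightarrow> b i = 0) \<and>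
   (\<forall>a\<in>L. (\<Sum>k\<in>I. b k * lin I (\<lambda>i. real (E (\<rho> k) i)) a) \<in> \<int>)"
proof
  assume "b \<in> pull ` M"
  then obtain b0 where b0: "b0 \<in> M" "b = pull b0" by blast
  then show "(\<forall>i. i \<notin> I \<longrightarrow> b i = 0) \<and> (\<forall>a\<in>L. (\<Sum>k\<in>I. b k * lin I (\<lambda>i. real (E (\<rho> k) i)) a) \<in> \<int>)"
    using form_pull[of b0] form_Ints by (auto simp: pull_def)
next
  assume b: "(\<forall>i. i \<notin> I \<longrightarrow> b i = 0) \<and> (\<forall>a\<in>L. (\<Sum>k\<in>I. b k * lin I (\<lambda>i. real (E (\<rho> k) i)) a) \<in> \<int>)"
  then have e: "pull (push b) = b" by (intro pull_push) auto
  have "form a (push b) \<in> \<int>" if "a \<in> L" for a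
    using form_pull[of "push b" a] b that unfolding e by auto
  then have "push b \<in> M" using M_iff[of "push b"] by (auto simp: form_def push_def)
  then show "b \<in> pull ` M" using e by (metis image_eqI)
qed

lemma dual_lattices_pull: "dual_lattices I I (\<lambda>k i. E (\<rho> k) i) L (pull ` M) d"
proof
  show "b \<in> pull ` M \<longleftrightarrow> (\<forall>j. j \<notin> I \<longrightarrow> b j = 0) \<and>
     (\<forall>a\<in>L. (\<Sum>k\<in>I. b k * lin I (\<lambda>i. real (E (\<rho> k) i)) a) \<in> \<int>)" for b by (rule pull_M_iff)
  show "a \<in> L \<longleftrightarrow> (\<forall>i. i \<notin> I \<longrightarrow> a i = 0) \<and>
      (\<forall>b\<in>pull ` M. (\<Sum>k\<in>I. b k * lin I (\<lambda>i. real (E (\<rho> k) i)) a) \<in> \<int>)" for a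
    using L_iff[of a] by (simp add: form_pull form_def[symmetric])
  show "uvec j \<in> pull ` M" if "j \<in> I" for j
  proof (rule image_eqI)
    show "uvec (\<rho> j) \<in> M" using \<rho>_in[OF that] by (rule unit_M)
    show "uvec j = pull (uvec (\<rho> j))"
      using that \<rho> by (auto simp: pull_def uvec_def bij_betw_def inj_on_def fun_eq_iff)
  qed
  show "real d * b i \<in> \<int>" if "b \<in> pull ` M" for b i
    using that den_M by (auto simp: pull_def)
  show "\<exists>a. (\<forall>i. i \<notin> I \<longrightarrow> a i = 0) \<and> (\<forall>k\<in>I. lin I (\<lambda>i. real (E (\<rho> k) i)) a = y k)" for y
  proof -
    obtain a where "\<forall>i. i \<notin> I \<longrightarrow> a i = 0" "\<forall>j\<in>J. lin I (\<lambda>i. real (E j i)) a = y (inv_into I \<rho> j)"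
      using surj_E[of "\<lambda>j. y (inv_into I \<rho> j)"] by blast
    then show ?thesis using \<rho>_in inv_left by (intro exI[of _ a]) auto
  qed
  show "\<exists>b. (\<forall>j. j \<notin> I \<longrightarrow> b j = 0) \<and> (\<forall>i\<in>I. lin I (\<lambda>k. real (E (\<rho> k) i)) b = y i)" for y
  proof -
    obtain b where "\<forall>i\<in>I. lin J (\<lambda>j. real (E j i)) b = y i" using surj_ET[of y] by blast
    then have "\<forall>i\<in>I. lin I (\<lambda>k. real (E (\<rho> k) i)) (pull b) = y i" by (simp add: lin_pull)
    moreover have "\<forall>i. i \<notin> I \<longrightarrow> pull b i = 0" by (simp add: pull_def)
    ultimately show ?thesis by blast
  qed
qed (use fin_I unit_L d_pos den_L in auto)

lemma lattice_genus_pull: "lattice_genus I (pull ` M) (\<lambda>i. w' (\<rho> i)) \<tau> z = lattice_genus J M w' \<tau> z"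
proof -
  have bij: "bij_betw pull (fund_set J M) (fund_set I (pull ` M))"
    unfolding bij_betw_def
  proof
    show "inj_on pull (fund_set J M)"
      by (rule inj_on_inverseI[of _ push]) (auto simp: fund_set_def push_pull)
    show "pull ` fund_set J M = fund_set I (pull ` M)"
    proof
      show "pull ` fund_set J M \<subseteq> fund_set I (pull ` M)" using \<rho>_in by (auto simp: fund_set_def pull_def)
      show "fund_set I (pull ` M) \<subseteq> pull ` fund_set J M"
      proof
        fix b assume b: "b \<in> fund_set I (pull ` M)"
        then obtain b0 where b0: "b0 \<in> M" "b = pull b0" by (auto simp: fund_set_def)
        have "0 \<le> b0 j \<and> b0 j < 1" if "j \<in> J" for j
          using b inv_in[OF that] inv_right[OF that] by (force simp: fund_set_def b0 pull_def)
        then show "b \<in> pull ` fund_set J M" using b0 by (auto simp: fund_set_def)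
      qed
    qed
  qed
  have p: "(\<Prod>i\<in>I. theta_factor \<tau> z (w' (\<rho> i)) (pull \<alpha> i) (pull \<beta> i)) = (\<Prod>j\<in>J. theta_factor \<tau> z (w' j) (\<alpha> j) (\<beta> j))" for \<alpha> \<beta>
    unfolding prod.reindex_bij_betw[OF \<rho>, symmetric] by (intro prod.cong) (auto simp: pull_def)
  have s: "(\<Sum>\<alpha>\<in>fund_set I (pull ` M). F \<alpha>) = (\<Sum>\<alpha>\<in>fund_set J M. F (pull \<alpha>))" for F :: "('a \<Rightarrow> real) \<Rightarrow> complex"
    by (rule sum.reindex_bij_betw[OF bij, symmetric])
  show ?thesis
    unfolding lattice_genus_def s p using bij_betw_same_card[OF bij] by simp
qed

end

section \<open>Induction on the number of variables\<close>

lemma ex_small_bound: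
  fixes D :: real
  assumes "finite I" "finite J" "\<And>i. i \<in> I \<Longrightarrow> 0 < w i" "\<And>j. j \<in> J \<Longrightarrow> 0 < w' j" "0 < D" "0 < (s1 :: real)"
  shows "\<exists>s0>0. s0 \<le> s1 \<and> (\<forall>t y. 0 < t \<longrightarrow> 0 < y \<longrightarrow> y < s0 * t \<longrightarrow>
     (\<forall>i\<in>I. w i * y < t / D) \<and> (\<forall>j\<in>J. w' j * y < t / D))"
proof -
  define s0 where "s0 = Min (insert s1 ((\<lambda>i. 1 / D / w i) ` I \<union> (\<lambda>i. 1 / D / w' i) ` J))"
  have "0 < s0" unfolding s0_def using assms by (subst Min_gr_iff) auto
  have s0: "s0 \<le> s1" "\<And>i. i \<in> I \<Longrightarrow> s0 \<le> 1 / D / w i" "\<And>i. i \<in> J \<Longrightarrow> s0 \<le> 1 / D / w' i"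
    unfolding s0_def using assms(1,2) by (intro Min_le; blast)+
  have aux: "v * y < t / D" if "0 < v" "s0 \<le> 1 / D / v" "0 < t" "y < s0 * t" for v t y :: real
  proof -
    have "v * y < v * (s0 * t)" using that by (intro mult_strict_left_mono) auto
    also have "\<dots> = (s0 * v) * t" by (simp add: mult_ac)
    also have "\<dots> \<le> (1 / D) * t"
      using pos_le_divide_eq[OF that(1), of s0 "1 / D"] that by (intro mult_right_mono) auto
    finally show ?thesis by simp
  qed
  show ?thesis
    using \<open>0 < s0\<close> s0 assms(3,4) aux by (intro exI[of _ s0]) blast
qed

text \<open>The coefficients \<open>c\<close> and \<open>c'\<close> of the polynomial and of its
  transpose are independent, since elimination changes them in different ways. Each elimination
  removes two indices, so it does not affect the sign.\<close>

theorem abstract_duality: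
  assumes "dual_lattices I J E L M d"
    and "\<And>j. j \<in> J \<Longrightarrow> lin I (\<lambda>i. real (E j i)) w = 1" "\<And>i. i \<in> I \<Longrightarrow> 0 < w i"
    and "\<And>i. i \<in> I \<Longrightarrow> lin J (\<lambda>j. real (E j i)) w' = 1" "\<And>j. j \<in> J \<Longrightarrow> 0 < w' j"
    and "only_critical_zero I J E c" "\<And>j. j \<in> J \<Longrightarrow> c j \<noteq> 0"
    and "only_critical_zero J I (\<lambda>i j. E j i) c'" "\<And>i. i \<in> I \<Longrightarrow> c' i \<noteq> 0"
    and "\<And>j. j \<in> J \<Longrightarrow> 2 \<le> (\<Sum>i\<in>I. E j i)" "\<And>i. i \<in> I \<Longrightarrow> 2 \<le> (\<Sum>j\<in>J. E j i)"
  shows "\<exists>s0>0. \<forall>\<tau> z. 0 < Im \<tau> \<longrightarrow> 0 < Im z \<longrightarrow> Im z < s0 * Im \<tau> \<longrightarrow>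
    lattice_genus I L w \<tau> z = (- 1) ^ card I * lattice_genus J M w' \<tau> z"
  using assms
proof (induction "card I" arbitrary: I J E L M c c' rule: less_induct)
  case less
  interpret dual_lattices I J E L M d by (rule less.prems(1))
  note w = less.prems(2,3) and w' = less.prems(4,5) and nd = less.prems(6,7) and nd' = less.prems(8,9)
    and sums = less.prems(10,11)
  show ?case
  proof (cases "\<exists>r\<in>J. \<exists>i\<in>I. \<exists>i'\<in>I. i \<noteq> i' \<and> E r i = 1 \<and> E r i' = 1 \<and> (\<forall>k\<in>I-{i, i'}. E r k = 0)")
    case True
    then obtain r i i' where r: "r \<in> J" "i \<in> I" "i' \<in> I" "i \<noteq> i'" "E r i = 1" "E r i' = 1" "\<And>k. k \<in> I-{i, i'} \<Longrightarrow> E r k = 0"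
      by blast
    \<comment> \<open>\<open>r\<close> is quadratic on one side only. Nondegeneracy of the transpose
      at \<open>r\<close> provides the variable that occurs just once, linearly, outside monomial
      \<open>r\<close>; total column degree at least 2 forces it to be one of the two variables of
      \<open>r\<close>.\<close>
    obtain p where p: "p \<in> I" "(\<Sum>j\<in>J-{r}. E j p) \<le> 1"
      using short_monomial_exists[OF nd'(1) fin_J r(1)] by blast
    have colp: "(\<Sum>j\<in>J. E j p) = E r p + (\<Sum>j\<in>J-{r}. E j p)" using fin_J r by (intro sum.remove) auto
    then have "E r p \<noteq> 0" using sums(2)[OF p(1)] p(2) by linarith
    then have "p = i \<or> p = i'" using r(7)[of p] p(1) by auto
    then obtain q where q: "q \<in> I" "p \<noteq> q" "E r p = 1" "E r q = 1" "\<And>k. k \<in> I-{p, q} \<Longrightarrow> E r k = 0"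
    proof
      assume "p = i"
      then show thesis using that[of i'] r by blast
    next
      assume "p = i'"
      moreover have "I - {i', i} = I - {i, i'}" by blast
      ultimately show thesis using that[of i] r by simp
    qed
    have "(\<Sum>j\<in>J-{r}. E j p) = Suc 0" using colp q(3) sums(2)[OF p(1)] p(2) by linarith
    then obtain s where s: "s \<in> J-{r}" "E s p = Suc 0" "\<And>j. j \<in> J-{r} \<Longrightarrow> s \<noteq> j \<Longrightarrow> E j p = 0"
      using sum_eq_Suc0_iff[of "J-{r}" "\<lambda>j. E j p"] fin_J by auto
    have rest: "lin I (\<lambda>k. real (E j k)) a = real (E j p) * a p + (real (E j q) * a q + (\<Sum>k\<in>I-{p}-{q}. real (E j k) * a k))" for j a
      using p q fin_I by (simp add: lin_def sum.remove[of I p] sum.remove[of "I-{p}" q])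
    \<comment> \<open>If \<open>x q\<close> occurred in \<open>s\<close>, then
      \<open>w p + w q = 1\<close> and positivity of the weights would leave nothing else in
      \<open>s\<close>. Rows \<open>r\<close> and \<open>s\<close> would coincide, against
      nonsingularity.\<close>
    have Esq: "E s q = 0"
    proof (rule ccontr)
      assume "E s q \<noteq> 0"
      then have "1 * w q \<le> real (E s q) * w q" using w(2)[OF q(1)] by (intro mult_right_mono) auto
      moreover have "w p + w q = 1"
        using w(1)[OF r(1)] q(3,4,5) unfolding rest by (simp add: sum.neutral)
      moreover have "w p + (real (E s q) * w q + (\<Sum>k\<in>I-{p}-{q}. real (E s k) * w k)) = 1"
        using w(1)[of s] s unfolding rest by simp
      moreover have nn: "\<And>k. k \<in> I-{p}-{q} \<Longrightarrow> 0 \<le> real (E s k) * w k"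
        using less_imp_le[OF w(2)] by (intro mult_nonneg_nonneg) auto
      moreover have "0 \<le> (\<Sum>k\<in>I-{p}-{q}. real (E s k) * w k)" using nn by (rule sum_nonneg)
      ultimately have 0: "(\<Sum>k\<in>I-{p}-{q}. real (E s k) * w k) = 0" "real (E s q) * w q = w q" by linarith+
      have "E s q = 1" using 0(2) w(2)[OF q(1)] by simp
      have z: "E s k = 0" if "k \<in> I-{p}-{q}" for k
        using 0(1) nn that fin_I w(2)[of k] by (subst (asm) sum_nonneg_eq_0_iff) auto
      obtain a where a: "\<forall>j\<in>J. lin I (\<lambda>i. real (E j i)) a = (if j = r then 1 else 0)"
        using surj_E[of "\<lambda>j. if j = r then 1 else 0"] by blast
      have "lin I (\<lambda>k. real (E r k)) a = lin I (\<lambda>k. real (E s k)) a"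
        unfolding rest using q s z \<open>E s q = 1\<close> by (simp add: sum.neutral)
      then show False using a r s by auto
    qed
    have s': "s \<in> J" "r \<noteq> s" "E s p = 1" and Ep: "\<And>j. j \<in> J-{r, s} \<Longrightarrow> E j p = 0" using s by auto
    interpret el: elim_lattices I J E L M d p q r s
      by unfold_locales ((rule p(1) q r(1) s' Ep Esq; assumption?)+)
    note sw = elim_lattices.lattice_genus_elim[OF el.elim_swap, unfolded el.swap_simps]
      and nsw = elim_lattices.only_critical_zero_elim[OF el.elim_swap, unfolded el.swap_simps]
      and wsw = elim_lattices.weight_elim[OF el.elim_swap, unfolded el.swap_simps]
      and rsw = elim_lattices.row_sum_elim[OF el.elim_swap, unfolded el.swap_simps]
    obtain c1 where c1: "\<And>j. j \<in> el.J' \<Longrightarrow> c1 j \<noteq> 0" "only_critical_zero el.I' el.J' el.E' c1"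
      using el.only_critical_zero_elim[OF nd] by blast
    obtain c2 where c2: "\<And>j. j \<in> el.I' \<Longrightarrow> c2 j \<noteq> 0" "only_critical_zero el.J' el.I' (\<lambda>i j. el.E' j i) c2"
      using nsw[OF nd'] by blast
    have card: "card I = card el.I' + 2" using el.I_eq p q fin_I by (metis add_2_eq_Suc' card_insert_disjoint finite_insert insertE)
    have "\<exists>s0>0. \<forall>\<tau> z. 0 < Im \<tau> \<longrightarrow> 0 < Im z \<longrightarrow> Im z < s0 * Im \<tau> \<longrightarrow>
       lattice_genus el.I' (el.resI ` L) w \<tau> z = (- 1) ^ card el.I' * lattice_genus el.J' (el.resJ ` M) w' \<tau> z"
    proof (rule less.hyps[OF _ el.dual_lattices_elim])
      show "card el.I' < card I" using card by simp
    qed (use el.weight_elim[OF w(1)] wsw[OF w'(1)] w(2) w'(2) c1 c2 el.row_sum_elim[OF sums(1)] rsw[OF sums(2)]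
         in \<open>auto simp: el.I'_def el.J'_def\<close>)
    then obtain s1 where s1: "0 < s1" "\<And>\<tau> z. 0 < Im \<tau> \<Longrightarrow> 0 < Im z \<Longrightarrow> Im z < s1 * Im \<tau> \<Longrightarrow>
       lattice_genus el.I' (el.resI ` L) w \<tau> z = (- 1) ^ card el.I' * lattice_genus el.J' (el.resJ ` M) w' \<tau> z"
      by blast
    obtain s0 where s0: "0 < s0" "s0 \<le> s1" "\<And>t y. 0 < t \<Longrightarrow> 0 < y \<Longrightarrow> y < s0 * t \<Longrightarrow>
        (\<forall>i\<in>I. w i * y < t / real d) \<and> (\<forall>j\<in>J. w' j * y < t / real d)"
      using ex_small_bound[where I=I and J=J and w=w and w'=w' and D="real d", OF fin_I fin_J w(2) w'(2) _ s1(1)] d_pos by auto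
    show ?thesis
    proof (intro exI[of _ s0] conjI allI impI)
      fix \<tau> z assume \<tau>: "0 < Im \<tau>" and z: "0 < Im z" "Im z < s0 * Im \<tau>"
      have "s0 * Im \<tau> \<le> s1 * Im \<tau>" using s0(2) \<tau> by (intro mult_right_mono) auto
      then have "lattice_genus el.I' (el.resI ` L) w \<tau> z = (- 1) ^ card el.I' * lattice_genus el.J' (el.resJ ` M) w' \<tau> z"
        using s1(2)[OF \<tau> z(1)] z(2) by simp
      moreover have "lattice_genus I L w \<tau> z = lattice_genus el.I' (el.resI ` L) w \<tau> z"
        using el.lattice_genus_elim[OF w \<tau> z(1)] s0(3)[OF \<tau> z] by blast
      moreover have "lattice_genus J M w' \<tau> z = lattice_genus el.J' (el.resJ ` M) w' \<tau> z"
        using sw[OF w' \<tau> z(1)] s0(3)[OF \<tau> z] by blast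
      ultimately show "lattice_genus I L w \<tau> z = (- 1) ^ card I * lattice_genus J M w' \<tau> z"
        by (simp add: card)
    qed (rule s0(1))
  next
    case noquad: False
    \<comment> \<open>Each variable is assigned a monomial that is a power of it times at most one
      other variable. Without quadratic \<open>x_i x_l\<close> the power is at least 2, which also
      makes the assignment injective.\<close>
    have "\<forall>i\<in>I. \<exists>j\<in>J. (\<Sum>l\<in>I-{i}. E j l) \<le> 1"
      using short_monomial_exists[OF nd(1) fin_I] by blast
    then obtain \<rho> where \<rho>: "\<And>i. i \<in> I \<Longrightarrow> \<rho> i \<in> J" "\<And>i. i \<in> I \<Longrightarrow> (\<Sum>l\<in>I-{i}. E (\<rho> i) l) \<le> 1" by metis
    have diag: "2 \<le> E (\<rho> i) i" if i: "i \<in> I" for i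
    proof (rule ccontr)
      assume "\<not> 2 \<le> E (\<rho> i) i"
      moreover have "(\<Sum>l\<in>I. E (\<rho> i) l) = E (\<rho> i) i + (\<Sum>l\<in>I-{i}. E (\<rho> i) l)" using fin_I i by (intro sum.remove) auto
      ultimately have 1: "E (\<rho> i) i = 1" "(\<Sum>l\<in>I-{i}. E (\<rho> i) l) = Suc 0"
        using sums(1)[OF \<rho>(1)[OF i]] \<rho>(2)[OF i] by linarith+
      then obtain l where l: "l \<in> I-{i}" "E (\<rho> i) l = Suc 0" "\<And>k. k \<in> I-{i} \<Longrightarrow> l \<noteq> k \<Longrightarrow> E (\<rho> i) k = 0"
        using sum_eq_Suc0_iff[of "I-{i}" "E (\<rho> i)"] fin_I by auto
      have "\<forall>k\<in>I-{i, l}. E (\<rho> i) k = 0" using l(3) by blast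
      moreover have "E (\<rho> i) l = 1" "l \<in> I" "i \<noteq> l" using l(1,2) by auto
      ultimately show False using noquad \<rho>(1)[OF i] i 1(1) by blast
    qed
    have "inj_on \<rho> I"
    proof (rule inj_onI, rule ccontr)
      fix i i' assume ii: "i \<in> I" "i' \<in> I" "\<rho> i = \<rho> i'" "i \<noteq> i'"
      have "E (\<rho> i) i' \<le> (\<Sum>l\<in>I-{i}. E (\<rho> i) l)" using ii fin_I by (intro member_le_sum) auto
      then show False using \<rho>(2)[OF ii(1)] diag[OF ii(2)] ii(3) by simp
    qed
    moreover from this have "\<rho> ` I = J"
      using \<rho>(1) fin_J card_eq by (intro card_subset_eq) (auto simp: card_image)
    ultimately have bij: "bij_betw \<rho> I J" by (simp add: bij_betw_def)
    interpret rl: relabel_lattices I J E L M d \<rho> by unfold_locales (rule bij)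
    \<comment> \<open>The same axis argument for the transpose gives, at monomial
      \<open>\<rho> i\<close>, some variable \<open>i2\<close> of small remaining degree; the entry
      at least 2 in row \<open>\<rho> i2\<close> rules out every \<open>i2\<close> other than
      \<open>i\<close>.\<close>
    have colle: "(\<Sum>k\<in>I-{i}. E (\<rho> k) i) \<le> 1" if i: "i \<in> I" for i
    proof -
      obtain i2 where i2: "i2 \<in> I" "(\<Sum>j\<in>J-{\<rho> i}. E j i2) \<le> 1"
        using short_monomial_exists[OF nd'(1) fin_J \<rho>(1)[OF i]] by blast
      have "i2 = i"
      proof (rule ccontr)
        assume "i2 \<noteq> i"
        then have "\<rho> i2 \<in> J-{\<rho> i}" using \<open>inj_on \<rho> I\<close> i i2 \<rho>(1) by (auto simp: inj_on_def)
        then have "E (\<rho> i2) i2 \<le> (\<Sum>j\<in>J-{\<rho> i}. E j i2)" using fin_J by (intro member_le_sum) auto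
        then show False using i2(2) diag[OF i2(1)] by simp
      qed
      moreover have "bij_betw \<rho> (I-{i}) (J-{\<rho> i})" by (rule bij_betw_DiffI[OF bij]) (use i \<rho>(1) in \<open>auto simp: bij_betw_def\<close>)
      then have "(\<Sum>k\<in>I-{i}. E (\<rho> k) i) = (\<Sum>j\<in>J-{\<rho> i}. E j i)" by (rule sum.reindex_bij_betw)
      ultimately show ?thesis using i2 by simp
    qed
    interpret dl: dual_lattices I I "\<lambda>k i. E (\<rho> k) i" L "rl.pull ` M" d by (rule rl.dual_lattices_pull)
    interpret cl: chain_loop_lattices I "\<lambda>k i. E (\<rho> k) i" L "rl.pull ` M" d
      by unfold_locales (use diag \<rho>(2) colle in auto)
    have "lin I (\<lambda>k. real (E (\<rho> k) i)) (\<lambda>k. w' (\<rho> k)) = 1" if "i \<in> I" for i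
      using w'(1)[OF that] unfolding lin_def by (simp add: rl.sum_\<rho>[of "\<lambda>j. real (E j i) * w' j"])
    then show ?thesis
      by (rule cl.lattice_genus_duality[of w "\<lambda>k. w' (\<rho> k)", unfolded rl.lattice_genus_pull, rotated 2])
         (use w(1)[OF \<rho>(1)] w(2) w'(2)[OF \<rho>(1)] in auto)
  qed
qed

section \<open>Exponent matrices and symmetry groups\<close>

text \<open>Dedekind's argument: evaluate the relation at \<open>y * x\<close>, subtract
  \<open>m k y\<close> times the relation at \<open>x\<close>, and a shorter relation
  remains.\<close>

lemma linear_independent_characters:
  fixes m :: "'j \<Rightarrow> complex^'n \<Rightarrow> complex"
  assumes "finite S" "\<And>j x y. j \<in> S \<Longrightarrow> m j (x * y) = m j x * m j y" "\<And>j. j \<in> S \<Longrightarrow> m j 1 = 1"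
    and "\<And>j l. j \<in> S \<Longrightarrow> l \<in> S \<Longrightarrow> j \<noteq> l \<Longrightarrow> \<exists>y. m j y \<noteq> m l y"
    and "\<And>x. (\<Sum>j\<in>S. a j * m j x) = 0"
  shows "\<forall>j\<in>S. a j = 0"
  using assms
proof (induction S arbitrary: a rule: finite_induct)
  case (insert k S)
  have "a l = 0" if l: "l \<in> S" for l
  proof -
    have "l \<noteq> k" using l insert.hyps by auto
    then obtain y where y: "m l y \<noteq> m k y" using insert.prems(3)[of l k] l by auto
    have "(\<Sum>j\<in>S. (a j * (m j y - m k y)) * m j x) = 0" for x
    proof -
      have "(\<Sum>j\<in>S. (a j * (m j y - m k y)) * m j x) = (\<Sum>j\<in>S. a j * m j (y * x)) - m k y * (\<Sum>j\<in>S. a j * m j x)"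
        using insert.prems(1) by (simp add: sum_distrib_left sum_subtractf[symmetric] algebra_simps)
      also have "(\<Sum>j\<in>S. a j * m j (y * x)) = - (a k * m k (y * x))"
        using insert.prems(4)[of "y * x"] insert.hyps by (simp add: add_eq_0_iff)
      also have "(\<Sum>j\<in>S. a j * m j x) = - (a k * m k x)"
        using insert.prems(4)[of x] insert.hyps by (simp add: add_eq_0_iff)
      finally show ?thesis using insert.prems(1)[of k y x] by (simp add: algebra_simps)
    qed
    then have "\<forall>j\<in>S. a j * (m j y - m k y) = 0"
      using insert.prems by (intro insert.IH) auto
    then show ?thesis using l y by auto
  qed
  moreover have "a k = 0"
    using insert.prems(4)[of 1] insert.prems(2)[of k] insert.hyps calculation by simp
  ultimately show ?case by auto
qed auto

definition expn :: "nat^'n^'n \<Rightarrow> 'n \<Rightarrow> 'n \<Rightarrow> nat" where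
  "expn E j i = E $ j $ i"

lemma expn_transpose: "expn (transpose E) = (\<lambda>i j. expn E j i)"
  by (simp add: expn_def transpose_def fun_eq_iff)

lemma poly_of_eq: "poly_of c E x = (\<Sum>j\<in>UNIV. c $ j * mon UNIV (expn E j) (\<lambda>i. x $ i))"
  by (simp add: poly_of_def mon_def expn_def)

lemma of_real_of_rat: "of_real (of_rat r) = (of_rat r :: complex)"
  by (cases r) (simp add: of_rat_rat)

lemma mon_mult: "mon I e (\<lambda>i. (x * y :: complex^'n) $ i) = mon I e (\<lambda>i. x $ i) * mon I e (\<lambda>i. y $ i)"
  by (simp add: mon_def power_mult_distrib prod.distrib)

locale nonsingular_exponents =
  fixes E :: "nat^'n^'n"
  assumes inv: "invertible (of_nat_matrix E :: rat^'n^'n)"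
begin

lemma right_inverse: "\<exists>B :: rat^'n^'n. \<forall>j l. (\<Sum>i\<in>UNIV. of_nat (expn E j i) * B $ i $ l) = (if j = l then 1 else 0)"
proof -
  obtain B where B: "(of_nat_matrix E :: rat^'n^'n) ** B = mat 1" using inv by (auto simp: invertible_def)
  have "(\<Sum>i\<in>UNIV. of_nat (expn E j i) * B $ i $ l) = ((of_nat_matrix E :: rat^'n^'n) ** B) $ j $ l" for j l
    by (simp add: matrix_matrix_mult_def of_nat_matrix_def expn_def)
  then show ?thesis unfolding B by (intro exI[of _ B]) (simp add: mat_def)
qed

definition rinv :: "'n \<Rightarrow> 'n \<Rightarrow> real" where
  "rinv i l = of_rat ((SOME B :: rat^'n^'n. \<forall>j l. (\<Sum>i\<in>UNIV. of_nat (expn E j i) * B $ i $ l) = (if j = l then 1 else 0)) $ i $ l)"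

lemma rinv: "(\<Sum>i\<in>UNIV. real (expn E j i) * rinv i l) = (if j = l then 1 else 0)" "rinv i l \<in> \<rat>"
proof -
  define B where "B = (SOME B :: rat^'n^'n. \<forall>j l. (\<Sum>i\<in>UNIV. of_nat (expn E j i) * B $ i $ l) = (if j = l then 1 else 0))"
  have B: "\<forall>j l. (\<Sum>i\<in>UNIV. of_nat (expn E j i) * B $ i $ l) = (if j = l then 1 else 0)"
    unfolding B_def by (rule someI_ex[OF right_inverse])
  have "(\<Sum>i\<in>UNIV. real (expn E j i) * rinv i l) = of_rat (\<Sum>i\<in>UNIV. of_nat (expn E j i) * B $ i $ l)"
    by (simp add: rinv_def B_def of_rat_sum of_rat_mult)
  then show "(\<Sum>i\<in>UNIV. real (expn E j i) * rinv i l) = (if j = l then 1 else 0)" using B by simp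
  show "rinv i l \<in> \<rat>" by (simp add: rinv_def)
qed

lemma surj: "\<exists>a. \<forall>j. lin UNIV (\<lambda>i. real (expn E j i)) a = y j"
proof
  let ?a = "\<lambda>i. \<Sum>l\<in>UNIV. rinv i l * y l"
  show "\<forall>j. lin UNIV (\<lambda>i. real (expn E j i)) ?a = y j"
  proof
    fix j
    have "lin UNIV (\<lambda>i. real (expn E j i)) ?a = (\<Sum>l\<in>UNIV. (\<Sum>i\<in>UNIV. real (expn E j i) * rinv i l) * y l)"
      unfolding lin_def sum_distrib_left sum_distrib_right by (subst sum.swap) (simp add: mult_ac)
    also have "\<dots> = (\<Sum>l\<in>UNIV. if j = l then y l else 0)"
      unfolding rinv by (rule sum.cong) auto
    finally show "lin UNIV (\<lambda>i. real (expn E j i)) ?a = y j" by simp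
  qed
qed

lemma nonsingular_transpose: "nonsingular_exponents (transpose E)"
proof
  have "(of_nat_matrix (transpose E) :: rat^'n^'n) = transpose (of_nat_matrix E)"
    by (simp add: of_nat_matrix_def transpose_def vec_eq_iff)
  moreover obtain B :: "rat^'n^'n" where "of_nat_matrix E ** B = mat 1" "B ** of_nat_matrix E = mat 1"
    using inv by (auto simp: invertible_def)
  then have "transpose B ** transpose (of_nat_matrix E) = mat 1" "transpose (of_nat_matrix E) ** transpose B = mat 1"
    by (metis matrix_transpose_mul transpose_mat)+
  ultimately show "invertible (of_nat_matrix (transpose E) :: rat^'n^'n)"
    unfolding invertible_def by auto
qed

lemma surj_transpose: "\<exists>b. \<forall>i. lin UNIV (\<lambda>j. real (expn E j i)) b = y i"
  using nonsingular_exponents.surj[OF nonsingular_transpose, of y] by (simp add: expn_transpose)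

lemma inject:
  assumes "\<And>j. lin UNIV (\<lambda>i. real (expn E j i)) a = lin UNIV (\<lambda>i. real (expn E j i)) a'"
  shows "a = a'"
proof
  fix i
  obtain b where b: "\<And>k. lin UNIV (\<lambda>j. real (expn E j k)) b = uvec i k" using surj_transpose[of "uvec i"] by blast
  have s: "x i = (\<Sum>j\<in>UNIV. b j * lin UNIV (\<lambda>i. real (expn E j i)) x)" for x
  proof -
    have "(\<Sum>j\<in>UNIV. b j * lin UNIV (\<lambda>i. real (expn E j i)) x) = (\<Sum>k\<in>UNIV. lin UNIV (\<lambda>j. real (expn E j k)) b * x k)"
      unfolding lin_def sum_distrib_left sum_distrib_right by (subst sum.swap) (simp add: mult_ac)
    also have "\<dots> = x i" unfolding b by (simp add: uvec_def mult_delta_left)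
    finally show ?thesis by simp
  qed
  show "a i = a' i" unfolding s[of a] s[of a'] assms ..
qed

lemma eq_rinv: "a i = (\<Sum>l\<in>UNIV. rinv i l * lin UNIV (\<lambda>i. real (expn E l i)) a)"
proof -
  have "lin UNIV (\<lambda>i. real (expn E j i)) (\<lambda>i. \<Sum>l\<in>UNIV. rinv i l * lin UNIV (\<lambda>i. real (expn E l i)) a) = lin UNIV (\<lambda>i. real (expn E j i)) a" for j
  proof -
    have "lin UNIV (\<lambda>i. real (expn E j i)) (\<lambda>i. \<Sum>l\<in>UNIV. rinv i l * y l) = y j" for y
    proof -
      have "lin UNIV (\<lambda>i. real (expn E j i)) (\<lambda>i. \<Sum>l\<in>UNIV. rinv i l * y l) = (\<Sum>l\<in>UNIV. (\<Sum>i\<in>UNIV. real (expn E j i) * rinv i l) * y l)"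
        unfolding lin_def sum_distrib_left sum_distrib_right by (subst sum.swap) (simp add: mult_ac)
      also have "\<dots> = (\<Sum>l\<in>UNIV. if j = l then y l else 0)"
        unfolding rinv by (rule sum.cong) auto
      finally show ?thesis by simp
    qed
    then show ?thesis .
  qed
  then have "(\<lambda>i. \<Sum>l\<in>UNIV. rinv i l * lin UNIV (\<lambda>i. real (expn E l i)) a) = a" by (rule inject)
  from fun_cong[OF this, of i] show ?thesis by simp
qed

lemma denominator: "\<exists>d>0. \<forall>a. (\<forall>j. lin UNIV (\<lambda>i. real (expn E j i)) a \<in> \<int>) \<longrightarrow> (\<forall>i. real d * a i \<in> \<int>)"
proof -
  obtain d where d: "0 < d" "\<And>p. real d * (case p of (i, l) \<Rightarrow> rinv i l) \<in> \<int>"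
    using Rats_common_denominator[of "UNIV :: ('n \<times> 'n) set" "\<lambda>(i, l). rinv i l"] rinv(2) by auto
  have "real d * a i \<in> \<int>" if "\<forall>j. lin UNIV (\<lambda>i. real (expn E j i)) a \<in> \<int>" for a i
  proof -
    have "real d * a i = (\<Sum>l\<in>UNIV. (real d * rinv i l) * lin UNIV (\<lambda>i. real (expn E l i)) a)"
      by (subst eq_rinv) (simp add: sum_distrib_left mult_ac)
    also have "\<dots> \<in> \<int>"
    proof (rule Ints_sum)
      fix l
      have "real d * rinv i l \<in> \<int>" using d(2)[of "(i, l)"] by simp
      then show "(real d * rinv i l) * lin UNIV (\<lambda>i. real (expn E l i)) a \<in> \<int>" using spec[OF that] by (rule Ints_mult)
    qed
    finally show ?thesis .
  qed
  then show ?thesis using d(1) by blast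
qed

lemma rows_distinct:
  assumes "j \<noteq> l"
  shows "\<exists>y. mon UNIV (expn E j) (\<lambda>i. (y :: complex^'n) $ i) \<noteq> mon UNIV (expn E l) (\<lambda>i. y $ i)"
proof -
  have "\<exists>i. expn E j i \<noteq> expn E l i"
  proof (rule ccontr)
    assume "\<not> ?thesis"
    moreover obtain a where "\<And>k. lin UNIV (\<lambda>i. real (expn E k i)) a = uvec j k" using surj[of "uvec j"] by blast
    ultimately have "uvec j j = uvec j l" by (metis (no_types, lifting) lin_def sum.cong)
    then show False using assms by (simp add: uvec_def)
  qed
  then obtain i where i: "expn E j i \<noteq> expn E l i" by blast
  define y :: "complex^'n" where "y = (\<chi> k. if k = i then 2 else 1)"
  have "mon UNIV e (\<lambda>i. y $ i) = 2 ^ e i" for e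
    unfolding mon_def y_def by (subst prod.remove[of _ i]) (auto intro!: prod.neutral)
  moreover have "(2 :: complex) ^ m = 2 ^ n \<longleftrightarrow> m = n" for m n
    using of_nat_eq_iff[of "2 ^ m" "2 ^ n", where 'a=complex] by simp
  ultimately show ?thesis using i by (intro exI[of _ y]) simp
qed

lemma coefficients_zero:
  assumes "\<And>x :: complex^'n. (\<Sum>j\<in>UNIV. a j * mon UNIV (expn E j) (\<lambda>i. x $ i)) = 0"
  shows "a j = 0"
proof -
  have "\<forall>j\<in>UNIV. a j = 0"
  proof (rule linear_independent_characters[where m="\<lambda>j x. mon UNIV (expn E j) (\<lambda>i. x $ i)"])
    show "mon UNIV (expn E j) (\<lambda>i. (1 :: complex^'n) $ i) = 1" for j by (simp add: mon_def)
  qed (use assms in \<open>simp_all only: mon_mult rows_distinct finite not_False_eq_True\<close>)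
  then show ?thesis by simp
qed

text \<open>Different rows of \<open>E\<close> give different multiplicative functions, so
  invariance of the sum forces invariance of every monomial.\<close>

lemma diag_group_iff:
  assumes c: "\<And>j. c $ j \<noteq> 0"
  shows "g \<in> carrier (diag_group (poly_of c E)) \<longleftrightarrow> (\<forall>i. g $ i \<noteq> 0) \<and> (\<forall>j. mon UNIV (expn E j) (\<lambda>i. g $ i) = 1)"
proof
  assume g: "g \<in> carrier (diag_group (poly_of c E))"
  have "c $ j * (mon UNIV (expn E j) (\<lambda>i. g $ i) - 1) = 0" for j
  proof (rule coefficients_zero)
    fix x :: "complex^'n"
    have "poly_of c E (g * x) - poly_of c E x = 0" using g by (simp add: diag_group_def)
    moreover have "poly_of c E (g * x) - poly_of c E x = (\<Sum>j\<in>UNIV. c $ j * (mon UNIV (expn E j) (\<lambda>i. g $ i) - 1) * mon UNIV (expn E j) (\<lambda>i. x $ i))"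
      unfolding poly_of_eq mon_mult sum_subtractf[symmetric] by (intro sum.cong refl) (simp add: algebra_simps)
    ultimately show "(\<Sum>j\<in>UNIV. c $ j * (mon UNIV (expn E j) (\<lambda>i. g $ i) - 1) * mon UNIV (expn E j) (\<lambda>i. x $ i)) = 0" by simp
  qed
  then show "(\<forall>i. g $ i \<noteq> 0) \<and> (\<forall>j. mon UNIV (expn E j) (\<lambda>i. g $ i) = 1)"
    using g c by (auto simp: diag_group_def)
next
  assume "(\<forall>i. g $ i \<noteq> 0) \<and> (\<forall>j. mon UNIV (expn E j) (\<lambda>i. g $ i) = 1)"
  then show "g \<in> carrier (diag_group (poly_of c E))"
    unfolding diag_group_def poly_of_eq mon_mult by simp
qed

lemma mon_e2pi: "mon UNIV (expn E j) (\<lambda>i. e2pi_vec a $ i) = e2pi (of_real (lin UNIV (\<lambda>i. real (expn E j i)) (\<lambda>i. a $ i)))"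
proof -
  have "e2pi x ^ n = e2pi (of_nat n * x)" for x n
    using e2pi_of_int_mult[of "int n" x] by simp
  then show ?thesis by (simp add: mon_def lin_def e2pi_vec_def e2pi_sum)
qed

lemma e2pi_real_eq_1_iff: "e2pi (of_real x) = 1 \<longleftrightarrow> x \<in> \<int>"
proof
  assume "e2pi (of_real x) = 1"
  then obtain n where "complex_of_real x = of_int n" by (auto simp: e2pi_eq_1_iff elim: Ints_cases)
  then have "x = of_int n" by (metis of_real_eq_iff of_real_of_int_eq)
  then show "x \<in> \<int>" by simp
qed (rule e2pi_of_real_Ints)

lemma diag_group_e2pi:
  assumes c: "\<And>j. c $ j \<noteq> 0"
  shows "e2pi_vec a \<in> carrier (diag_group (poly_of c E)) \<longleftrightarrow> (\<forall>j. lin UNIV (\<lambda>i. real (expn E j i)) (\<lambda>i. a $ i) \<in> \<int>)"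
  unfolding diag_group_iff[OF c] mon_e2pi e2pi_real_eq_1_iff by (simp add: e2pi_vec_def)

text \<open>The logarithms of the absolute values lie in the kernel of \<open>E\<close>. This puts
  every coordinate on the unit circle, where \<open>alpha\<close> is well defined.\<close>

lemma diag_group_norm:
  assumes c: "\<And>j. c $ j \<noteq> 0" and g: "g \<in> carrier (diag_group (poly_of c E))"
  shows "norm (g $ i) = 1"
proof -
  have g: "\<And>i. g $ i \<noteq> 0" "\<And>j. mon UNIV (expn E j) (\<lambda>i. g $ i) = 1" using g diag_group_iff[OF c] by auto
  have "lin UNIV (\<lambda>i. real (expn E j i)) (\<lambda>i. ln (norm (g $ i))) = lin UNIV (\<lambda>i. real (expn E j i)) (\<lambda>i. 0)" for j
  proof -
    have "lin UNIV (\<lambda>i. real (expn E j i)) (\<lambda>i. ln (norm (g $ i))) = ln (\<Prod>i\<in>UNIV. norm (g $ i) ^ expn E j i)"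
      using g(1) by (subst ln_prod) (auto simp: lin_def ln_realpow)
    also have "(\<Prod>i\<in>UNIV. norm (g $ i) ^ expn E j i) = norm (mon UNIV (expn E j) (\<lambda>i. g $ i))"
      by (simp add: mon_def prod_norm[symmetric] norm_power)
    finally show ?thesis using g(2) by (simp add: lin_def)
  qed
  from fun_cong[OF inject[OF this], of i] show ?thesis using g(1)[of i] by simp
qed

lemma weighted_homogeneous_iff:
  assumes c: "\<And>j. c $ j \<noteq> 0"
  shows "weighted_homogeneous (poly_of c E) w \<longleftrightarrow> (\<forall>j. lin UNIV (\<lambda>i. real (expn E j i)) (\<lambda>i. of_rat (w $ i)) = 1)"
proof -
  have m: "mon UNIV (expn E j) (\<lambda>i. (\<chi> k. t powr of_rat (w $ k) * x $ k) $ i)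
    = t powr of_real (lin UNIV (\<lambda>i. real (expn E j i)) (\<lambda>i. of_rat (w $ i))) * mon UNIV (expn E j) (\<lambda>i. x $ i)"
    if t: "t \<noteq> 0" for t and x :: "complex^'n" and j
  proof -
    have "(t powr of_rat (w $ i)) ^ n = t powr of_real (real n * of_rat (w $ i))" for i n
      using t by (simp add: powr_def exp_of_nat_mult[symmetric] mult_ac of_real_of_rat)
    moreover have p: "(\<Prod>i\<in>UNIV. t powr of_real (h i)) = t powr of_real (sum h UNIV)" for h :: "'n \<Rightarrow> real"
      using t by (simp add: powr_def exp_sum sum_distrib_left sum_distrib_right)
    ultimately show ?thesis
      using p[of "\<lambda>i. real (expn E j i) * of_rat (w $ i)"]
      by (simp add: mon_def power_mult_distrib prod.distrib lin_def)
  qed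
  have of_rat_real: "(of_rat r :: complex) = of_real (of_rat r)" for r by (rule of_real_of_rat[symmetric])
  show ?thesis
  proof
    assume h: "weighted_homogeneous (poly_of c E) w"
    show "\<forall>j. lin UNIV (\<lambda>i. real (expn E j i)) (\<lambda>i. of_rat (w $ i)) = 1"
    proof
      fix j
      define l where "l j = lin UNIV (\<lambda>i. real (expn E j i)) (\<lambda>i. of_rat (w $ i))" for j
      \<comment> \<open>One parameter \<open>t = 2\<close> is enough: independence of the monomials
        separates the weights, and \<open>2 powr l = 2\<close> has the single real solution
        \<open>l = 1\<close>.\<close>
      have "c $ j * (2 powr of_real (l j) - 2) = 0"
      proof (rule coefficients_zero)
        fix x :: "complex^'n"
        have "poly_of c E (\<chi> k. 2 powr of_rat (w $ k) * x $ k) = 2 * poly_of c E x"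
          using h unfolding weighted_homogeneous_def by simp
        then have "0 = (\<Sum>j\<in>UNIV. c $ j * (2 powr of_real (l j) * mon UNIV (expn E j) (\<lambda>i. x $ i))) - 2 * (\<Sum>j\<in>UNIV. c $ j * mon UNIV (expn E j) (\<lambda>i. x $ i))"
          unfolding poly_of_eq m[of 2, OF zero_neq_numeral[symmetric]] l_def by simp
        also have "\<dots> = (\<Sum>j\<in>UNIV. c $ j * (2 powr of_real (l j) - 2) * mon UNIV (expn E j) (\<lambda>i. x $ i))"
          unfolding sum_distrib_left sum_subtractf[symmetric] by (intro sum.cong refl) (simp add: algebra_simps)
        finally show "(\<Sum>j\<in>UNIV. c $ j * (2 powr of_real (l j) - 2) * mon UNIV (expn E j) (\<lambda>i. x $ i)) = 0" by simp
      qed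
      then have "(2::complex) powr of_real (l j) = 2" using c by simp
      moreover have "(2::complex) powr of_real (l j) = of_real (2 powr l j)"
        using powr_of_real[of 2 "l j"] by simp
      ultimately have "complex_of_real (2 powr l j) = of_real 2" by simp
      then have "2 powr l j = (2::real)" by (simp only: of_real_eq_iff)
      then have "2 powr l j = 2 powr (1::real)" by simp
      then have "l j = 1" by (subst (asm) powr_inj) auto
      then show "lin UNIV (\<lambda>i. real (expn E j i)) (\<lambda>i. of_rat (w $ i)) = 1" by (simp add: l_def)
    qed
  next
    assume l: "\<forall>j. lin UNIV (\<lambda>i. real (expn E j i)) (\<lambda>i. of_rat (w $ i)) = 1"
    show "weighted_homogeneous (poly_of c E) w"
      unfolding weighted_homogeneous_def poly_of_eq
    proof (intro allI impI)
      fix t :: complex and x :: "complex^'n"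
      assume t: "t \<noteq> 0"
      show "(\<Sum>j\<in>UNIV. c $ j * mon UNIV (expn E j) (\<lambda>i. (\<chi> k. t powr of_rat (w $ k) * x $ k) $ i))
        = t * (\<Sum>j\<in>UNIV. c $ j * mon UNIV (expn E j) (\<lambda>i. x $ i))"
        unfolding m[OF t] sum_distrib_left using l t by (intro sum.cong) (simp_all add: mult_ac)
    qed
  qed
qed

end

section \<open>From symmetry groups to lattices of logarithms\<close>

lemma alpha_e2pi:
  assumes "norm \<zeta> = 1"
  shows "0 \<le> alpha \<zeta>" "alpha \<zeta> < 1" "e2pi (of_real (alpha \<zeta>)) = \<zeta>"
proof -
  define t where "t = Arg \<zeta> / (2 * pi)"
  have "\<zeta> = exp (\<i> * of_real (Arg \<zeta>))" using Arg_eq[of \<zeta>] assms by (cases "\<zeta> = 0") auto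
  then have t: "\<zeta> = e2pi (of_real t)" by (simp add: e2pi_def t_def mult_ac)
  have "e2pi (of_real (frac t)) = e2pi (of_real t)"
    by (simp add: frac_def e2pi_diff)
  then have ex: "0 \<le> frac t \<and> frac t < 1 \<and> \<zeta> = e2pi (of_real (frac t))" using t by (simp add: frac_lt_1)
  have uniq: "y = frac t" if y: "0 \<le> y \<and> y < 1 \<and> \<zeta> = e2pi (of_real y)" for y
  proof -
    have "e2pi (of_real (y - frac t)) = 1" using y ex by (simp add: e2pi_diff)
    then obtain n where "complex_of_real (y - frac t) = of_int n" by (auto simp only: e2pi_eq_1_iff elim: Ints_cases)
    then have n: "y - frac t = of_int n" by (metis of_real_eq_iff of_real_of_int_eq)
    then have "n = 0" using y ex by linarith
    then show ?thesis using n by simp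
  qed
  have "0 \<le> alpha \<zeta> \<and> alpha \<zeta> < 1 \<and> \<zeta> = e2pi (of_real (alpha \<zeta>))"
    unfolding alpha_def
  proof (rule theI)
    show "0 \<le> frac t \<and> frac t < 1 \<and> \<zeta> = e2pi (of_real (frac t))" by (rule ex)
  qed (rule uniq)
  then show "0 \<le> alpha \<zeta>" "alpha \<zeta> < 1" "e2pi (of_real (alpha \<zeta>)) = \<zeta>" by auto
qed

lemma e2pi_real_inject:
  assumes "e2pi (of_real x) = e2pi (of_real y)"
  shows "x - y \<in> \<int>"
proof -
  have "e2pi (of_real (x - y)) = 1" using assms by (simp add: e2pi_diff)
  then obtain n where "complex_of_real (x - y) = of_int n" by (auto simp only: e2pi_eq_1_iff elim: Ints_cases)
  then have "x - y = of_int n" by (metis of_real_eq_iff of_real_of_int_eq)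
  then show ?thesis by simp
qed

lemma unit_interval_eq:
  fixes x y :: real
  assumes "x - y \<in> \<int>" "0 \<le> x" "x < 1" "0 \<le> y" "y < 1"
  shows "x = y"
proof -
  obtain n :: int where n: "x - y = of_int n" using assms(1) by (auto elim: Ints_cases)
  then have "n = 0" using assms by linarith
  then show ?thesis using n by simp
qed

definition latt :: "(complex^'n) set \<Rightarrow> ('n \<Rightarrow> real) set" where
  "latt G = {a. e2pi_vec (\<chi> i. a i) \<in> G}"

lemma e2pi_vec_add: "e2pi_vec (\<chi> i. a i + b i) = e2pi_vec (\<chi> i. a i) * e2pi_vec (\<chi> i. b i)"
  by (simp add: e2pi_vec_def vec_eq_iff e2pi_add)

lemma e2pi_vec_Ints: "(\<And>i. a i \<in> \<int>) \<Longrightarrow> e2pi_vec (\<chi> i. a i) = 1"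
  by (simp add: e2pi_vec_def vec_eq_iff e2pi_of_real_Ints)

context nonsingular_exponents
begin

abbreviation row where "row j a \<equiv> lin UNIV (\<lambda>i. real (expn E j i)) a"
abbreviation col where "col i b \<equiv> lin UNIV (\<lambda>j. real (expn E j i)) b"

definition pair :: "('n \<Rightarrow> real) \<Rightarrow> ('n \<Rightarrow> real) \<Rightarrow> real" where
  "pair a b = (\<Sum>j\<in>UNIV. b j * row j a)"

lemma pair_alt: "pair a b = (\<Sum>i\<in>UNIV. a i * col i b)"
  unfolding pair_def lin_def sum_distrib_left by (subst sum.swap) (simp add: mult_ac)

lemma pair_diff_left: "pair (\<lambda>i. a i - a' i) b = pair a b - pair a' b"
  by (simp add: pair_def lin_diff_right ring_distribs sum_subtractf)

lemma pair_diff_right: "pair a (\<lambda>i. b i - b' i) = pair a b - pair a b'"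
  by (simp add: pair_def ring_distribs sum_subtractf)

lemma pair_Ints_right: "(\<And>j. row j a \<in> \<int>) \<Longrightarrow> (\<And>j. b j \<in> \<int>) \<Longrightarrow> pair a b \<in> \<int>"
  unfolding pair_def by (intro Ints_sum Ints_mult) auto

lemma pair_Ints_left: "(\<And>i. col i b \<in> \<int>) \<Longrightarrow> (\<And>i. a i \<in> \<int>) \<Longrightarrow> pair a b \<in> \<int>"
  unfolding pair_alt by (intro Ints_sum Ints_mult) auto

lemma pair_uvec: "pair a (uvec j) = row j a" "pair (uvec i) b = col i b"
  by (simp add: pair_def uvec_def mult_delta_left) (simp add: pair_alt uvec_def mult_delta_left)

definition ann :: "('n \<Rightarrow> real) set \<Rightarrow> ('n \<Rightarrow> real) set" where
  "ann L = {b. \<forall>a\<in>L. pair a b \<in> \<int>}"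

definition coann :: "('n \<Rightarrow> real) set \<Rightarrow> ('n \<Rightarrow> real) set" where
  "coann M = {a. \<forall>b\<in>M. pair a b \<in> \<int>}"

text \<open>The logarithms of the full symmetry group of the transposed polynomial.\<close>

definition dual_max :: "('n \<Rightarrow> real) set" where
  "dual_max = {b. \<forall>i. col i b \<in> \<int>}"

lemma uvec_of_int: "uvec i = (\<lambda>k. of_int (if k = i then 1 else 0))"
  by (auto simp: uvec_def)

lemma ann_col_Ints:
  assumes "denominator_lattice UNIV L d" "b \<in> ann L"
  shows "col i b \<in> \<int>"
proof -
  have "uvec i \<in> L" unfolding uvec_of_int by (rule denominator_lattice.lat_of_int[OF assms(1)]) auto
  then show ?thesis using assms(2) pair_uvec(2)[of i b] by (auto simp: ann_def)
qed

lemma dual_denominator: "\<exists>d>0. \<forall>b\<in>dual_max. \<forall>i. real d * b i \<in> \<int>"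
  using nonsingular_exponents.denominator[OF nonsingular_transpose] by (simp add: expn_transpose dual_max_def)

lemma dual_max_lattice: "\<exists>d. denominator_lattice UNIV dual_max d"
proof -
  obtain d where d: "0 < d" "\<forall>b\<in>dual_max. \<forall>i. real d * b i \<in> \<int>" using dual_denominator by blast
  have "denominator_lattice UNIV dual_max d"
  proof
    show "(\<lambda>i. of_int (n i)) \<in> dual_max" for n
      unfolding dual_max_def lin_def by (auto intro!: Ints_sum Ints_mult)
  qed (use d in \<open>auto simp: dual_max_def lin_diff_right\<close>)
  then show ?thesis ..
qed

text \<open>Sum the pairing character over representatives of \<open>L\<close> and of
  \<open>dual_max\<close> in both orders. In one order only \<open>\<alpha> = 0\<close> contributes,
  in the other exactly the annihilator of \<open>L\<close>.\<close>

lemma lattice_index: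
  assumes L: "denominator_lattice UNIV L d" and rowZ: "\<And>a j. a \<in> L \<Longrightarrow> row j a \<in> \<int>"
  shows "card (fund_set UNIV L) * card (fund_set UNIV (ann L)) = card (fund_set UNIV dual_max)"
proof -
  interpret L: denominator_lattice UNIV L d by (rule L)
  obtain d' where "denominator_lattice UNIV dual_max d'" using dual_max_lattice by blast
  then interpret D: denominator_lattice UNIV dual_max d' .
  let ?S = "\<Sum>\<alpha>\<in>fund_set UNIV L. \<Sum>b\<in>fund_set UNIV dual_max. e2pi (of_real (pair \<alpha> b))"
  have "?S = (\<Sum>\<alpha>\<in>fund_set UNIV L. if \<alpha> = (\<lambda>_. 0) then of_nat (card (fund_set UNIV dual_max)) else 0)"
  proof (rule sum.cong[OF refl])
    fix \<alpha> assume \<alpha>: "\<alpha> \<in> fund_set UNIV L"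
    then have \<alpha>L: "\<alpha> \<in> L" "\<And>i. 0 \<le> \<alpha> i" "\<And>i. \<alpha> i < 1" by (auto simp: fund_set_def)
    have "(\<forall>b\<in>dual_max. (\<Sum>j\<in>UNIV. row j \<alpha> * b j) \<in> \<int>) \<longleftrightarrow> \<alpha> = (\<lambda>_. 0)"
    proof
      assume h: "\<forall>b\<in>dual_max. (\<Sum>j\<in>UNIV. row j \<alpha> * b j) \<in> \<int>"
      show "\<alpha> = (\<lambda>_. 0)"
      proof
        fix i
        obtain b where b: "\<And>k. col k b = uvec i k" using surj_transpose[of "uvec i"] by blast
        then have "b \<in> dual_max" by (auto simp: dual_max_def uvec_def)
        then have "pair \<alpha> b \<in> \<int>" using h by (simp add: pair_def mult.commute)
        then have "\<alpha> i - 0 \<in> \<int>" by (simp add: pair_alt b uvec_def mult_delta_right)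
        then show "\<alpha> i = 0" by (rule unit_interval_eq) (use \<alpha>L in auto)
      qed
    qed (simp add: lin_def)
    then show "(\<Sum>b\<in>fund_set UNIV dual_max. e2pi (of_real (pair \<alpha> b))) = (if \<alpha> = (\<lambda>_. 0) then of_nat (card (fund_set UNIV dual_max)) else 0)"
      using D.character_sum[of "\<lambda>j. row j \<alpha>"] rowZ[OF \<alpha>L(1)] by (simp add: pair_def mult.commute)
  qed
  also have "\<dots> = of_nat (card (fund_set UNIV dual_max))"
    using L.fund_finite L.zero_L by (simp add: fund_set_def)
  finally have 1: "?S = of_nat (card (fund_set UNIV dual_max))" .
  have "?S = (\<Sum>b\<in>fund_set UNIV dual_max. \<Sum>\<alpha>\<in>fund_set UNIV L. e2pi (of_real (pair \<alpha> b)))" by (rule sum.swap)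
  also have "\<dots> = (\<Sum>b\<in>fund_set UNIV dual_max. if b \<in> ann L then of_nat (card (fund_set UNIV L)) else 0)"
  proof (rule sum.cong[OF refl])
    fix b assume "b \<in> fund_set UNIV dual_max"
    then have "col i b \<in> \<int>" for i by (simp add: fund_set_def dual_max_def)
    then show "(\<Sum>\<alpha>\<in>fund_set UNIV L. e2pi (of_real (pair \<alpha> b))) = (if b \<in> ann L then of_nat (card (fund_set UNIV L)) else 0)"
      using L.character_sum[of "\<lambda>i. col i b"] by (simp add: pair_alt mult.commute ann_def)
  qed
  also have "\<dots> = of_nat (card (fund_set UNIV L)) * of_nat (card {b \<in> fund_set UNIV dual_max. b \<in> ann L})"
    using D.fund_finite by (simp add: sum.If_cases Int_def)
  also have "{b \<in> fund_set UNIV dual_max. b \<in> ann L} = fund_set UNIV (ann L)"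
    using ann_col_Ints[OF L] by (auto simp: fund_set_def dual_max_def)
  finally have "?S = of_nat (card (fund_set UNIV L) * card (fund_set UNIV (ann L)))" by simp
  with 1 show ?thesis by (metis of_nat_eq_iff)
qed

text \<open>\<open>L\<close> and its double annihilator have the same annihilator, hence by
  \<open>lattice_index\<close> equally many representatives; an inclusion between finite sets of
  equal size is an equality.\<close>

lemma double_annihilator:
  assumes L: "denominator_lattice UNIV L d" and rowZ: "\<And>a j. a \<in> L \<Longrightarrow> row j a \<in> \<int>"
  shows "coann (ann L) = L"
proof -
  interpret L: denominator_lattice UNIV L d by (rule L)
  obtain d1 where d1: "0 < d1" "\<And>a i. (\<forall>j. row j a \<in> \<int>) \<Longrightarrow> real d1 * a i \<in> \<int>" using denominator by blast
  let ?L2 = "coann (ann L)"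
  have uM: "uvec j \<in> ann L" for j using rowZ by (simp add: ann_def pair_uvec)
  have rowZ2: "row j a \<in> \<int>" if "a \<in> ?L2" for a j
    using that uM[of j] pair_uvec(1)[of a j] by (auto simp: coann_def)
  have L2: "denominator_lattice UNIV ?L2 d1"
  proof
    show "(\<lambda>i. of_int (n i)) \<in> ?L2" for n
      using ann_col_Ints[OF L] by (auto simp: coann_def intro!: pair_Ints_left)
    show "real d1 * a i \<in> \<int>" if "a \<in> ?L2" for a i using rowZ2[OF that] d1(2) by blast
  qed (use d1 in \<open>auto simp: coann_def pair_diff_left\<close>)
  interpret L2: denominator_lattice UNIV ?L2 d1 by (rule L2)
  have sub: "L \<subseteq> ?L2" by (auto simp: coann_def ann_def)
  have "ann ?L2 = ann L" using sub by (auto simp: coann_def ann_def)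
  then have "card (fund_set UNIV L) * card (fund_set UNIV (ann L)) = card (fund_set UNIV ?L2) * card (fund_set UNIV (ann L))"
    using lattice_index[OF L rowZ] lattice_index[OF L2 rowZ2] by simp
  moreover have "card (fund_set UNIV dual_max) \<noteq> 0"
    using dual_max_lattice denominator_lattice.fund_card by (metis less_irrefl)
  then have "card (fund_set UNIV (ann L)) \<noteq> 0" using lattice_index[OF L rowZ] by (metis mult_0_right)
  ultimately have "card (fund_set UNIV L) = card (fund_set UNIV ?L2)" by simp
  then have eq: "fund_set UNIV L = fund_set UNIV ?L2"
    using sub by (intro card_subset_eq L2.fund_finite) (auto simp: fund_set_def)
  have "?L2 \<subseteq> L"
  proof
    fix a assume "a \<in> ?L2"
    then have "L2.frac_vec a \<in> L" using L2.frac_vec_fund[of a] eq by (auto simp: fund_set_def)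
    from L.lat_add[OF this L.lat_of_int[of "\<lambda>i. \<lfloor>a i\<rfloor>"]]
    show "a \<in> L" by (simp add: L2.frac_vec_def frac_def)
  qed
  then show ?thesis using sub by blast
qed

lemma latt_row_Ints:
  assumes c: "\<And>j. c $ j \<noteq> 0" and G: "G \<subseteq> carrier (diag_group (poly_of c E))" and a: "a \<in> latt G"
  shows "row j a \<in> \<int>"
  using diag_group_e2pi[OF c, of "\<chi> i. a i"] G a by (auto simp: latt_def)

lemma latt_denominator_lattice:
  assumes c: "\<And>j. c $ j \<noteq> 0" and G: "subgroup G (diag_group (poly_of c E))"
  shows "\<exists>d. denominator_lattice UNIV (latt G) d"
proof -
  have sub: "G \<subseteq> carrier (diag_group (poly_of c E))" using subgroup.subset[OF G] .
  have one: "1 \<in> G" using subgroup.one_closed[OF G] by (simp add: diag_group_def)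
  have mult: "x * y \<in> G" if "x \<in> G" "y \<in> G" for x y
    using subgroup.m_closed[OF G that] by (simp add: diag_group_def)
  obtain d where d: "0 < d" "\<And>a i. (\<forall>j. row j a \<in> \<int>) \<Longrightarrow> real d * a i \<in> \<int>" using denominator by blast
  have den: "real d * a i \<in> \<int>" if "a \<in> latt G" for a i
    using latt_row_Ints[OF c sub that] d(2) by blast
  have add: "(\<lambda>i. a i + a' i) \<in> latt G" if "a \<in> latt G" "a' \<in> latt G" for a a'
    using that mult by (simp add: latt_def e2pi_vec_add)
  have ints: "a \<in> latt G" if "\<And>i. a i \<in> \<int>" for a
    using e2pi_vec_Ints[of a] that one by (simp add: latt_def)
  have mul: "(\<lambda>i. real n * a i) \<in> latt G" if "a \<in> latt G" for a n
  proof (induction n)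
    case 0
    show ?case by (rule ints) simp
  next
    case (Suc n)
    from add[OF Suc that] show ?case by (simp add: algebra_simps)
  qed
  have neg: "(\<lambda>i. - a i) \<in> latt G" if "a \<in> latt G" for a
  proof -
    have "(\<lambda>i. - (real d * a i)) \<in> latt G" using den[OF that] by (intro ints) auto
    from add[OF mul[OF that, of "d - 1"] this] show ?thesis using d(1) by (simp add: of_nat_diff algebra_simps)
  qed
  have "denominator_lattice UNIV (latt G) d"
  proof
    show "(\<lambda>i. a i - a' i) \<in> latt G" if "a \<in> latt G" "a' \<in> latt G" for a a'
      using add[OF that(1) neg[OF that(2)]] by simp
  qed (use ints den d(1) in auto)
  then show ?thesis ..
qed

text \<open>\<open>dual_group\<close> quantifies over all logarithms. Two logarithms of one element
  differ by integers, and these pair integrally with the logarithms of symmetries, so a single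
  choice decides.\<close>

lemma latt_dual_group:
  assumes c: "\<And>j. c $ j \<noteq> 0" and G: "subgroup G (diag_group (poly_of c E))"
  shows "latt (dual_group c E G) = ann (latt G)"
proof -
  have sub: "G \<subseteq> carrier (diag_group (poly_of c E))" using subgroup.subset[OF G] .
  obtain d where L: "denominator_lattice UNIV (latt G) d" using latt_denominator_lattice[OF c G] by blast
  have inner: "b \<bullet> (of_nat_matrix E *v a) = pair (\<lambda>i. a $ i) (\<lambda>j. b $ j)" for a b :: "real^'n"
    by (simp add: inner_vec_def matrix_vector_mult_def of_nat_matrix_def pair_def lin_def expn_def)
  show ?thesis
  proof (intro equalityI subsetI)
    fix b assume b: "b \<in> latt (dual_group c E G)"
    have "pair a b \<in> \<int>" if "a \<in> latt G" for a
    proof -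
      have "e2pi (of_real ((\<chi> j. b j) \<bullet> (of_nat_matrix E *v (\<chi> i. a i)))) = 1"
        using b that by (auto simp: latt_def dual_group_def)
      then show ?thesis unfolding inner e2pi_real_eq_1_iff by (simp add: vec_lambda_inverse)
    qed
    then show "b \<in> ann (latt G)" by (simp add: ann_def)
  next
    fix b assume b: "b \<in> ann (latt G)"
    have "e2pi_vec (\<chi> j. b j) \<in> carrier (diag_group (poly_of c (transpose E)))"
      unfolding nonsingular_exponents.diag_group_e2pi[OF nonsingular_transpose c] expn_transpose
      using ann_col_Ints[OF L b] by (simp add: vec_lambda_inverse)
    moreover have "e2pi (of_real (b' \<bullet> (of_nat_matrix E *v a))) = 1"
      if a: "e2pi_vec a \<in> G" and b': "e2pi_vec b' = e2pi_vec (\<chi> j. b j)" for a b'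
    proof -
      have aL: "(\<lambda>i. a $ i) \<in> latt G" using a by (simp add: latt_def)
      have "b' $ j - b j \<in> \<int>" for j
        using arg_cong[OF b', of "\<lambda>v. v $ j"] by (intro e2pi_real_inject) (simp add: e2pi_vec_def)
      then have "pair (\<lambda>i. a $ i) (\<lambda>j. b' $ j - b j) \<in> \<int>"
        using latt_row_Ints[OF c sub aL] by (intro pair_Ints_right) auto
      moreover have "pair (\<lambda>i. a $ i) b \<in> \<int>" using b aL by (simp add: ann_def)
      ultimately have "pair (\<lambda>i. a $ i) (\<lambda>j. b' $ j) \<in> \<int>"
        using Ints_add[of "pair (\<lambda>i. a $ i) (\<lambda>j. b' $ j - b j)" "pair (\<lambda>i. a $ i) b"] by (simp add: pair_diff_right)
      then show ?thesis unfolding inner by (rule e2pi_of_real_Ints)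
    qed
    ultimately show "b \<in> latt (dual_group c E G)" by (simp add: latt_def dual_group_def)
  qed
qed

lemma dual_lattices_latt:
  assumes c: "\<And>j. c $ j \<noteq> 0" and G: "subgroup G (diag_group (poly_of c E))"
  shows "\<exists>d. dual_lattices UNIV UNIV (expn E) (latt G) (latt (dual_group c E G)) d"
proof -
  have sub: "G \<subseteq> carrier (diag_group (poly_of c E))" using subgroup.subset[OF G] .
  let ?L = "latt G" and ?M = "ann (latt G)"
  obtain d where L: "denominator_lattice UNIV ?L d" using latt_denominator_lattice[OF c G] by blast
  interpret L: denominator_lattice UNIV ?L d by (rule L)
  note rowZ = latt_row_Ints[OF c sub]
  obtain d' where d': "0 < d'" "\<forall>b\<in>dual_max. \<forall>i. real d' * b i \<in> \<int>" using dual_denominator by blast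
  have denM: "real d' * b i \<in> \<int>" if "b \<in> ?M" for b i
    using d'(2) ann_col_Ints[OF L that] by (simp add: dual_max_def)
  have da: "coann ?M = ?L" by (rule double_annihilator[OF L rowZ])
  have "dual_lattices UNIV UNIV (expn E) ?L ?M (d * d')"
  proof
    show "a \<in> ?L \<longleftrightarrow> (\<forall>i. i \<notin> UNIV \<longrightarrow> a i = 0) \<and> (\<forall>b\<in>?M. (\<Sum>j\<in>UNIV. b j * row j a) \<in> \<int>)" for a
      using da unfolding coann_def pair_def by blast
    show "b \<in> ?M \<longleftrightarrow> (\<forall>i. i \<notin> UNIV \<longrightarrow> b i = 0) \<and> (\<forall>a\<in>?L. (\<Sum>j\<in>UNIV. b j * row j a) \<in> \<int>)" for b
      by (simp add: ann_def pair_def)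
    show "uvec i \<in> ?L" for i unfolding uvec_of_int by (rule L.lat_of_int) auto
    show "uvec j \<in> ?M" for j using rowZ by (simp add: ann_def pair_uvec)
    show "real (d * d') * a i \<in> \<int>" if "a \<in> ?L" for a i
      using Ints_mult[OF Ints_of_nat[of d'] L.lat_den[OF that, of i]] by (simp add: mult_ac)
    show "real (d * d') * b i \<in> \<int>" if "b \<in> ?M" for b i
      using Ints_mult[OF Ints_of_nat[of d] denM[OF that, of i]] by (simp add: mult_ac)
  qed (use surj surj_transpose L.lat_d_pos d' in auto)
  then show ?thesis unfolding latt_dual_group[OF c G] ..
qed

lemma alpha_bij:
  assumes c: "\<And>j. c $ j \<noteq> 0" and G: "G \<subseteq> carrier (diag_group (poly_of c E))"
  shows "bij_betw (\<lambda>g i. alpha (g $ i)) G (fund_set UNIV (latt G))"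
proof -
  have n1: "norm (g $ i) = 1" if "g \<in> G" for g i using diag_group_norm[OF c] G that by blast
  have e: "e2pi_vec (\<chi> i. alpha (g $ i)) = g" if "g \<in> G" for g
    using alpha_e2pi(3)[OF n1[OF that]] by (simp add: e2pi_vec_def vec_eq_iff)
  show ?thesis
    unfolding bij_betw_def
  proof
    show "inj_on (\<lambda>g i. alpha (g $ i)) G"
      by (rule inj_on_inverseI[of _ "\<lambda>a. e2pi_vec (\<chi> i. a i)"]) (rule e)
    show "(\<lambda>g i. alpha (g $ i)) ` G = fund_set UNIV (latt G)"
    proof
      show "(\<lambda>g i. alpha (g $ i)) ` G \<subseteq> fund_set UNIV (latt G)"
        using e alpha_e2pi(1,2)[OF n1] by (auto simp: fund_set_def latt_def)
      show "fund_set UNIV (latt G) \<subseteq> (\<lambda>g i. alpha (g $ i)) ` G"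
      proof
        fix a assume a: "a \<in> fund_set UNIV (latt G)"
        then have gG: "e2pi_vec (\<chi> i. a i) \<in> G" by (simp add: fund_set_def latt_def)
        have "a = (\<lambda>i. alpha (e2pi_vec (\<chi> i. a i) $ i))"
        proof
          fix i
          note al = alpha_e2pi[OF n1[OF gG], of i]
          have "a i - alpha (e2pi_vec (\<chi> i. a i) $ i) \<in> \<int>"
            by (rule e2pi_real_inject) (use al(3) in \<open>simp add: e2pi_vec_def\<close>)
          then show "a i = alpha (e2pi_vec (\<chi> i. a i) $ i)"
            by (rule unit_interval_eq) (use al a in \<open>auto simp: fund_set_def\<close>)
        qed
        then show "a \<in> (\<lambda>g i. alpha (g $ i)) ` G" using gG by blast
      qed
    qed
  qed
qed

lemma elliptic_genus_eq:
  assumes c: "\<And>j. c $ j \<noteq> 0" and G: "G \<subseteq> carrier (diag_group (poly_of c E))"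
  shows "elliptic_genus f G \<tau> z = lattice_genus UNIV (latt G) (\<lambda>i. of_rat (weights f $ i)) \<tau> z"
proof -
  note bij = alpha_bij[OF c G]
  have "(\<Sum>\<alpha>\<in>fund_set UNIV (latt G). \<Sum>\<beta>\<in>fund_set UNIV (latt G). \<Prod>i\<in>UNIV. theta_factor \<tau> z (of_rat (weights f $ i)) (\<alpha> i) (\<beta> i))
    = (\<Sum>g\<in>G. \<Sum>h\<in>G. \<Prod>i\<in>UNIV. theta_factor \<tau> z (of_rat (weights f $ i)) (alpha (g $ i)) (alpha (h $ i)))"
    by (subst (1 2) sum.reindex_bij_betw[OF bij, symmetric]) (rule refl)
  then show ?thesis
    unfolding elliptic_genus_def lattice_genus_def bij_betw_same_card[OF bij]
    by (simp add: theta_factor_def genus_denom_def of_real_of_rat)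
qed

lemma weights_eq:
  assumes c: "\<And>j. c $ j \<noteq> 0" and nd: "nondegenerate (poly_of c E)"
  shows "row j (\<lambda>i. of_rat (weights (poly_of c E) $ i)) = 1" "0 < weights (poly_of c E) $ i"
proof -
  obtain w where w: "\<And>i. 0 < w $ i" "weighted_homogeneous (poly_of c E) w"
    using nd by (auto simp: nondegenerate_def)
  have "weights (poly_of c E) = w"
    unfolding weights_def
  proof (rule the_equality[where P="weighted_homogeneous (poly_of c E)"])
    fix v assume "weighted_homogeneous (poly_of c E) v"
    then have "(\<lambda>i. of_rat (v $ i)) = (\<lambda>i. of_rat (w $ i) :: real)"
      using w(2) weighted_homogeneous_iff[OF c] by (intro inject) simp
    then show "v = w" by (auto simp: vec_eq_iff fun_eq_iff)
  qed (rule w(2))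
  then show "row j (\<lambda>i. of_rat (weights (poly_of c E) $ i)) = 1" "0 < weights (poly_of c E) $ i"
    using w weighted_homogeneous_iff[OF c, of w] by auto
qed

section \<open>Consequences of nondegeneracy\<close>

lemma poly_of_derivative:
  "(poly_of c E has_derivative (\<lambda>h. \<Sum>k\<in>UNIV. (\<Sum>j\<in>UNIV. c $ j * dmon UNIV k (expn E j) (\<lambda>i. x $ i)) * h $ k)) (at x)"
proof -
  have p: "((\<lambda>y :: complex^'n. y $ i ^ e) has_derivative (\<lambda>h. of_nat e * x $ i ^ (e - 1) * h $ i)) (at x)" for i e
  proof -
    have "((\<lambda>y :: complex^'n. y $ i) has_derivative (\<lambda>h. h $ i)) (at x)"
      by (rule bounded_linear_imp_has_derivative[OF bounded_linear_vec_nth])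
    then show ?thesis by (auto intro!: derivative_eq_intros simp: mult_ac)
  qed
  have "((\<lambda>y :: complex^'n. \<Prod>i\<in>UNIV. y $ i ^ expn E j i) has_derivative
      (\<lambda>h. \<Sum>k\<in>UNIV. of_nat (expn E j k) * x $ k ^ (expn E j k - 1) * h $ k * (\<Prod>i\<in>UNIV-{k}. x $ i ^ expn E j i))) (at x)" for j
    by (rule has_derivative_prod) (rule p)
  then have "((\<lambda>y :: complex^'n. \<Sum>j\<in>UNIV. c $ j * (\<Prod>i\<in>UNIV. y $ i ^ expn E j i)) has_derivative
      (\<lambda>h. \<Sum>j\<in>UNIV. c $ j * (\<Sum>k\<in>UNIV. of_nat (expn E j k) * x $ k ^ (expn E j k - 1) * h $ k * (\<Prod>i\<in>UNIV-{k}. x $ i ^ expn E j i)))) (at x)"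
    by (intro has_derivative_sum has_derivative_mult_right)
  moreover have "(\<Sum>j\<in>UNIV. c $ j * (\<Sum>k\<in>UNIV. of_nat (expn E j k) * x $ k ^ (expn E j k - 1) * h $ k * (\<Prod>i\<in>UNIV-{k}. x $ i ^ expn E j i)))
    = (\<Sum>k\<in>UNIV. (\<Sum>j\<in>UNIV. c $ j * dmon UNIV k (expn E j) (\<lambda>i. x $ i)) * h $ k)" for h :: "complex^'n"
    unfolding sum_distrib_left sum_distrib_right dmon_def by (subst sum.swap) (simp add: mult_ac)
  moreover have "poly_of c E = (\<lambda>y. \<Sum>j\<in>UNIV. c $ j * (\<Prod>i\<in>UNIV. y $ i ^ expn E j i))"
    by (simp add: poly_of_def expn_def fun_eq_iff)
  ultimately show ?thesis by simp
qed

lemma critical_point_iff: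
  "critical_point (poly_of c E) x \<longleftrightarrow> (\<forall>k. (\<Sum>j\<in>UNIV. c $ j * dmon UNIV k (expn E j) (\<lambda>i. x $ i)) = 0)"
proof
  assume "critical_point (poly_of c E) x"
  then have "(\<lambda>h. \<Sum>k\<in>UNIV. (\<Sum>j\<in>UNIV. c $ j * dmon UNIV k (expn E j) (\<lambda>i. x $ i)) * h $ k) = (\<lambda>_. 0)"
    unfolding critical_point_def by (rule has_derivative_unique[OF poly_of_derivative])
  from fun_cong[OF this, of "axis k 1" for k]
  show "\<forall>k. (\<Sum>j\<in>UNIV. c $ j * dmon UNIV k (expn E j) (\<lambda>i. x $ i)) = 0"
    by (simp add: axis_def mult_delta_right)
next
  assume "\<forall>k. (\<Sum>j\<in>UNIV. c $ j * dmon UNIV k (expn E j) (\<lambda>i. x $ i)) = 0"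
  then show "critical_point (poly_of c E) x"
    using poly_of_derivative[of c x] by (simp add: critical_point_def)
qed

text \<open>By quasihomogeneity a nonzero critical point produces critical points arbitrarily close to \<open>0\<close>.\<close>

lemma only_critical_zero_UNIV:
  assumes c: "\<And>j. c $ j \<noteq> 0" and nd: "nondegenerate (poly_of c E)"
  shows "only_critical_zero UNIV UNIV (expn E) (\<lambda>j. c $ j)"
  unfolding only_critical_zero_def
proof (intro allI impI, rule ccontr)
  fix x :: "'n \<Rightarrow> complex"
  assume crit: "\<forall>k\<in>UNIV. (\<Sum>j\<in>UNIV. c $ j * dmon UNIV k (expn E j) x) = 0" and "\<not> (\<forall>i\<in>UNIV. x i = 0)"
  then obtain i0 where i0: "x i0 \<noteq> 0" by blast
  define w :: "'n \<Rightarrow> real" where "w i = of_rat (weights (poly_of c E) $ i)" for i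
  have w: "row j w = 1" "0 < w i" for i j using weights_eq[OF c nd] unfolding w_def by auto
  \<comment> \<open>Quasihomogeneous scaling by \<open>exp (- n)\<close>: the derivative in
    \<open>x k\<close> is multiplied by \<open>exp (- n) / r n k\<close>, a factor common to all
    monomials, so its zeros are preserved.\<close>
  define r where "r n i = complex_of_real (exp (- w i)) ^ n" for n i
  define X where "X n = (\<chi> i. r n i * x i)" for n
  have r0: "r n i \<noteq> 0" for n i by (simp add: r_def)
  have rp: "(\<Prod>i\<in>UNIV. r n i ^ expn E j i) = of_real (exp (- real n))" for n j
  proof -
    have "exp (- (real n * (real e * w i))) = exp (- w i) ^ (n * e)" for e i
      using exp_of_nat_mult[of "n * e" "- w i"] by (simp add: mult_ac)
    then have "(\<Prod>i\<in>UNIV. r n i ^ expn E j i) = of_real (\<Prod>i\<in>UNIV. exp (- (real n * (real (expn E j i) * w i))))"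
      by (simp add: r_def power_mult[symmetric])
    also have "(\<Prod>i\<in>UNIV. exp (- (real n * (real (expn E j i) * w i)))) = exp (- (real n * row j w))"
      by (simp add: lin_def exp_sum[symmetric] sum_negf sum_distrib_left)
    finally show ?thesis using w by simp
  qed
  have "dmon UNIV k (expn E j) (\<lambda>i. X n $ i) = of_real (exp (- real n)) / r n k * dmon UNIV k (expn E j) x" for n j k
  proof (cases "expn E j k = 0")
    case True
    then show ?thesis by (simp add: dmon_def)
  next
    case False
    have "r n k ^ expn E j k = r n k * r n k ^ (expn E j k - 1)" using False by (simp add: power_eq_if)
    then have "r n k * (r n k ^ (expn E j k - 1) * (\<Prod>i\<in>UNIV-{k}. r n i ^ expn E j i)) = of_real (exp (- real n))"
      unfolding rp[of n j, symmetric] by (simp add: prod.remove[of UNIV k] mult_ac)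
    then have "r n k ^ (expn E j k - 1) * (\<Prod>i\<in>UNIV-{k}. r n i ^ expn E j i) = of_real (exp (- real n)) / r n k"
      using r0[of n k] by (simp add: field_simps)
    moreover have "dmon UNIV k (expn E j) (\<lambda>i. X n $ i) = (r n k ^ (expn E j k - 1) * (\<Prod>i\<in>UNIV-{k}. r n i ^ expn E j i)) * dmon UNIV k (expn E j) x"
      by (simp add: dmon_def X_def power_mult_distrib prod.distrib mult_ac)
    ultimately show ?thesis by simp
  qed
  then have "(\<Sum>j\<in>UNIV. c $ j * dmon UNIV k (expn E j) (\<lambda>i. X n $ i)) = of_real (exp (- real n)) / r n k * (\<Sum>j\<in>UNIV. c $ j * dmon UNIV k (expn E j) x)" for n k
    by (simp add: sum_distrib_left mult_ac)
  then have cX: "critical_point (poly_of c E) (X n)" for n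
    unfolding critical_point_iff using crit by simp
  have "(\<lambda>n. r n i) \<longlonglongrightarrow> 0" for i
    unfolding r_def using w by (intro LIMSEQ_power_zero) simp
  then have "(\<lambda>n. X n) \<longlonglongrightarrow> (\<chi> i. 0 * x i)"
    unfolding X_def by (intro tendsto_vec_lambda tendsto_mult tendsto_const)
  then have "X \<longlonglongrightarrow> 0" by (simp add: zero_vec_def)
  moreover have "X n \<noteq> 0" for n using i0 r0 by (auto simp: X_def vec_eq_iff)
  ultimately have "filterlim X (at 0) sequentially"
    unfolding filterlim_at by simp
  moreover have "eventually (\<lambda>y. \<not> critical_point (poly_of c E) y) (at 0)"
    using nd by (simp add: nondegenerate_def isolated_singularity_at_origin_def)
  ultimately have "eventually (\<lambda>n. \<not> critical_point (poly_of c E) (X n)) sequentially"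
    unfolding filterlim_iff by blast
  then show False using cX by simp
qed

text \<open>A linear monomial \<open>x_k\<close> would contribute its nonzero coefficient to the
  derivative at the origin, and no other monomial contributes there because the rows of
  \<open>E\<close> are distinct. Constant monomials have weight 0 and not 1.\<close>

lemma row_sum_ge_2:
  assumes c: "\<And>j. c $ j \<noteq> 0" and nd: "nondegenerate (poly_of c E)"
  shows "2 \<le> (\<Sum>i\<in>UNIV. expn E j i)"
proof (rule ccontr)
  assume "\<not> ?thesis"
  moreover have "(\<Sum>i\<in>UNIV. expn E j i) \<noteq> 0"
  proof
    assume "(\<Sum>i\<in>UNIV. expn E j i) = 0"
    then have "row j a = 0" for a by (simp add: lin_def)
    then show False using weights_eq(1)[OF c nd, of j] by simp
  qed
  ultimately have "(\<Sum>i\<in>UNIV. expn E j i) = Suc 0" by linarith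
  then obtain k where k: "expn E j k = Suc 0" "\<And>i. i \<noteq> k \<Longrightarrow> expn E j i = 0"
    using sum_eq_Suc0_iff[of UNIV "expn E j"] by auto
  have "dmon UNIV k (expn E l) (\<lambda>i. (0 :: complex^'n) $ i) = (if l = j then 1 else 0)" for l
  proof (cases "l = j")
    case True
    then show ?thesis using k by (simp add: dmon_def)
  next
    case False
    show ?thesis
    proof (rule ccontr)
      assume "\<not> ?thesis"
      then have nz: "dmon UNIV k (expn E l) (\<lambda>i. 0) \<noteq> 0" using False by simp
      have "of_nat (expn E l k) * (0::complex) ^ (expn E l k - 1) * (\<Prod>i\<in>UNIV-{k}. 0 ^ expn E l i) \<noteq> 0"
        using nz unfolding dmon_def .
      then have l: "expn E l k \<noteq> 0" "(0::complex) ^ (expn E l k - 1) \<noteq> 0" "(\<Prod>i\<in>UNIV-{k}. (0::complex) ^ expn E l i) \<noteq> 0"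
        by auto
      have "expn E l i = expn E j i" for i
      proof (cases "i = k")
        case True
        have "expn E l k - 1 = 0" using l(2) by (metis power_0_left)
        then show ?thesis using l(1) k(1) True by simp
      next
        case ik: False
        have "(0::complex) ^ expn E l i \<noteq> 0" using l(3) ik by (simp add: prod_zero_iff)
        then have "expn E l i = 0" by (metis power_0_left)
        then show ?thesis using k(2)[OF ik] by simp
      qed
      then have "expn E l = expn E j" ..
      then show False using rows_distinct[OF False] by simp
    qed
  qed
  then have "(\<Sum>l\<in>UNIV. c $ l * dmon UNIV k (expn E l) (\<lambda>i. (0 :: complex^'n) $ i)) = c $ j"
    by (simp add: mult_delta_right)
  moreover have "critical_point (poly_of c E) 0"
    using nd by (simp add: nondegenerate_def isolated_singularity_at_origin_def)
  ultimately show False using c[of j] unfolding critical_point_iff by metis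
qed

end

section \<open>Analytic continuation\<close>

lemma countable_theta1_zeros:
  assumes "0 < Im \<tau>" "w \<noteq> 0"
  shows "countable {z. theta1 \<tau> (w * z + k) = 0}"
proof -
  have "{z. theta1 \<tau> (w * z + k) = 0} \<subseteq> (\<lambda>(m, n). (of_int m + of_int n * \<tau> - k) / w) ` (UNIV :: (int \<times> int) set)"
  proof
    fix z assume "z \<in> {z. theta1 \<tau> (w * z + k) = 0}"
    then obtain m n :: int where "w * z + k = of_int m + of_int n * \<tau>"
      using theta1_eq_0D[OF assms(1)] by blast
    then have "w * z = of_int m + of_int n * \<tau> - k" by (simp add: eq_diff_eq)
    then have "z = (of_int m + of_int n * \<tau> - k) / w"
      using assms(2) by (simp add: eq_divide_eq mult.commute)
    then show "z \<in> (\<lambda>(m, n). (of_int m + of_int n * \<tau> - k) / w) ` (UNIV :: (int \<times> int) set)"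
      by (intro image_eqI[of _ _ "(m, n)"]) auto
  qed
  then show ?thesis by (rule countable_subset) simp
qed

lemma theta1_comp_holomorphic:
  assumes "0 < Im \<tau>" "h holomorphic_on A"
  shows "(\<lambda>z. theta1 \<tau> (h z)) holomorphic_on A"
  using holomorphic_on_compose[OF assms(2) theta1_holomorphic[OF assms(1)]] by (simp add: o_def)

lemma closed_theta1_zeros:
  assumes "0 < Im \<tau>"
  shows "closed {z. theta1 \<tau> (w * z + k) = 0}"
  by (intro closed_Collect_eq continuous_on_const holomorphic_on_imp_continuous_on
        theta1_comp_holomorphic[OF assms] holomorphic_intros)

text \<open>Continuation takes place in \<open>z\<close> for fixed \<open>\<tau>\<close>. For
  positive weights and a finite group this set is closed and countable, so its complement is open,
  connected and dense.\<close>

definition polar_slice :: "(complex^'n \<Rightarrow> complex) \<Rightarrow> (complex^'n) set \<Rightarrow> complex \<Rightarrow> complex set" where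
  "polar_slice f G \<tau> = {z. (\<tau>, z) \<in> genus_polar_set f G}"

lemma polar_slice_eq: "polar_slice f G \<tau> = (\<Union>g\<in>G. \<Union>h\<in>G. \<Union>i. {z. theta1 \<tau> (of_rat (weights f $ i) * z
    + (of_real (alpha (g $ i)) * \<tau> + of_real (alpha (h $ i)))) = 0})"
  by (auto simp: polar_slice_def genus_polar_set_def genus_denom_def add.assoc)

lemma polar_slice_countable:
  assumes "0 < Im \<tau>" "finite G" "\<And>i. weights f $ i \<noteq> 0"
  shows "countable (polar_slice f G \<tau>)"
  unfolding polar_slice_eq using assms
  by (intro countable_UN countable_theta1_zeros countable_finite) auto

lemma polar_slice_closed:
  assumes "0 < Im \<tau>" "finite G"
  shows "closed (polar_slice f G \<tau>)"
  unfolding polar_slice_eq using assms by (intro closed_UN ballI closed_theta1_zeros finite) auto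

lemma elliptic_genus_holomorphic:
  assumes \<tau>: "0 < Im \<tau>"
  shows "(\<lambda>z. elliptic_genus f G \<tau> z) holomorphic_on - polar_slice f G \<tau>"
proof -
  have e: "(\<lambda>z. e2pi (a * z)) holomorphic_on A" for a A
    unfolding e2pi_def by (intro holomorphic_intros)
  have d: "(\<lambda>z. genus_denom f g h i \<tau> z) holomorphic_on A" for g h i A
    unfolding genus_denom_def by (intro theta1_comp_holomorphic[OF \<tau>] holomorphic_intros)
  show ?thesis
    unfolding elliptic_genus_def
    by (intro holomorphic_on_mult holomorphic_on_const holomorphic_on_sum holomorphic_on_prod
          holomorphic_on_divide theta1_comp_holomorphic[OF \<tau>] holomorphic_on_diff holomorphic_on_ident e d)
       (auto simp: polar_slice_def genus_polar_set_def)
qed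

lemma countable_imp_dense_complement:
  fixes P :: "complex set"
  assumes "countable P"
  shows "closure (- P) = UNIV"
proof -
  have "interior P = {}"
  proof (rule ccontr)
    assume "interior P \<noteq> {}"
    then obtain x e where "0 < e" "ball x e \<subseteq> P" by (auto simp: mem_interior)
    then show False using assms countable_subset uncountable_ball by blast
  qed
  then show ?thesis by (simp add: closure_complement)
qed

text \<open>The inclusion in a closure shows that the excluded points have no interior in the
  domain; so the pointwise equality off the polar sets is the equality of meromorphic
  functions.\<close>

theorem corollary3:
  fixes c :: "complex^'n" and E :: "nat^'n^'n"
    and f f' :: "complex^'n \<Rightarrow> complex" and G G' :: "(complex^'n) set"
  assumes "f = poly_of c E" and "invertible_polynomial c E"
    and "subgroup G (diag_group f)"
    and "f' = poly_of c (transpose E)" and "invertible_polynomial c (transpose E)"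
    and "G' = dual_group c E G"
  shows "(\<forall>(\<tau>, z) \<in> genus_domain - (genus_polar_set f G \<union> genus_polar_set f' G').
            elliptic_genus f G \<tau> z = (-1) ^ CARD('n) * elliptic_genus f' G' \<tau> z)
       \<and> genus_domain \<subseteq> closure (genus_domain - (genus_polar_set f G \<union> genus_polar_set f' G'))"
proof -
  note f = assms(1) and f' = assms(4) and G' = assms(6)
  have c: "\<And>j. c $ j \<noteq> 0" and nd: "nondegenerate (poly_of c E)" and nd': "nondegenerate (poly_of c (transpose E))"
    using assms(2,5) by (auto simp: invertible_polynomial_def)
  interpret N: nonsingular_exponents E by standard (use assms(2) in \<open>simp add: invertible_polynomial_def\<close>)
  interpret T: nonsingular_exponents "transpose E" by (rule N.nonsingular_transpose)
  have G: "subgroup G (diag_group (poly_of c E))" using assms(3) by (simp only: f)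
  have sub: "G \<subseteq> carrier (diag_group (poly_of c E))" using subgroup.subset[OF G] .
  have sub': "G' \<subseteq> carrier (diag_group (poly_of c (transpose E)))" by (auto simp: G' dual_group_def)
  obtain d where dl: "dual_lattices UNIV UNIV (expn E) (latt G) (latt G') d"
    using N.dual_lattices_latt[OF c G] unfolding G' by blast
  interpret D: dual_lattices UNIV UNIV "expn E" "latt G" "latt G'" d by (rule dl)
  interpret S: dual_lattices UNIV UNIV "\<lambda>i j. expn E j i" "latt G'" "latt G" d by (rule D.swap)
  have fin: "finite G" "finite G'"
    using bij_betw_finite[OF N.alpha_bij[OF c sub]] bij_betw_finite[OF T.alpha_bij[OF c sub']]
      D.fund_finite S.fund_finite by auto
  define w where "w = (\<lambda>i. real_of_rat (weights f $ i))"
  define w' where "w' = (\<lambda>i. real_of_rat (weights f' $ i))"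
  note wt = N.weights_eq[OF c nd, folded f] and wt' = T.weights_eq[OF c nd', folded f']
  obtain s0 where s0: "0 < s0" and strip: "\<And>\<tau> z. 0 < Im \<tau> \<Longrightarrow> 0 < Im z \<Longrightarrow> Im z < s0 * Im \<tau> \<Longrightarrow>
      lattice_genus UNIV (latt G) w \<tau> z = (- 1) ^ CARD('n) * lattice_genus UNIV (latt G') w' \<tau> z"
  proof -
    have "\<exists>s0>0. \<forall>\<tau> z. 0 < Im \<tau> \<longrightarrow> 0 < Im z \<longrightarrow> Im z < s0 * Im \<tau> \<longrightarrow>
      lattice_genus UNIV (latt G) w \<tau> z = (- 1) ^ CARD('n) * lattice_genus UNIV (latt G') w' \<tau> z"
    proof (rule abstract_duality[OF dl])
      show "lin UNIV (\<lambda>i. real (expn E j i)) w = 1" "0 < w i" for i j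
        using wt by (simp_all add: w_def)
      show "lin UNIV (\<lambda>j. real (expn E j i)) w' = 1" "0 < w' i" for i
        using wt' by (simp_all add: w'_def expn_transpose)
      show "only_critical_zero UNIV UNIV (expn E) (\<lambda>j. c $ j)"
        by (rule N.only_critical_zero_UNIV[OF c nd])
      show "only_critical_zero UNIV UNIV (\<lambda>i j. expn E j i) (\<lambda>j. c $ j)"
        using T.only_critical_zero_UNIV[OF c nd'] by (simp only: expn_transpose)
      show "2 \<le> (\<Sum>i\<in>UNIV. expn E j i)" for j by (rule N.row_sum_ge_2[OF c nd])
      show "2 \<le> (\<Sum>j\<in>UNIV. expn E j i)" for i using T.row_sum_ge_2[OF c nd', of i] by (simp only: expn_transpose)
    qed (rule c)+
    then show thesis using that by blast
  qed
  have genus: "elliptic_genus f G \<tau> z = lattice_genus UNIV (latt G) w \<tau> z"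
    "elliptic_genus f' G' \<tau> z = lattice_genus UNIV (latt G') w' \<tau> z" for \<tau> z
    unfolding w_def w'_def by (rule N.elliptic_genus_eq[OF c sub] T.elliptic_genus_eq[OF c sub'])+
  define P where "P \<tau> = polar_slice f G \<tau> \<union> polar_slice f' G' \<tau>" for \<tau>
  have P: "countable (P \<tau>)" "closed (P \<tau>)" if "0 < Im \<tau>" for \<tau>
    unfolding P_def using that fin wt(2) wt'(2)
    by (auto intro!: polar_slice_countable polar_slice_closed simp: less_imp_neq[symmetric])
  have memP: "(\<tau>, z) \<in> genus_domain - (genus_polar_set f G \<union> genus_polar_set f' G') \<longleftrightarrow> 0 < Im \<tau> \<and> z \<notin> P \<tau>" for \<tau> z
    by (auto simp: P_def polar_slice_def genus_domain_def)
  have "elliptic_genus f G \<tau> z = (-1) ^ CARD('n) * elliptic_genus f' G' \<tau> z"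
    if \<tau>: "0 < Im \<tau>" and z: "z \<notin> P \<tau>" for \<tau> z
  \<comment> \<open>The strip where the series converge is open, and a countable set cannot cover
    it; this gives the nonempty open set on which the identity is already known.\<close>
  proof (rule analytic_continuation_open[where f="\<lambda>z. elliptic_genus f G \<tau> z"
        and g="\<lambda>z. (-1) ^ CARD('n) * elliptic_genus f' G' \<tau> z"])
    let ?S = "{z. 0 < Im z} \<inter> {z. Im z < s0 * Im \<tau>}"
    have oS: "open ?S" by (intro open_Int open_halfspace_Im_gt open_halfspace_Im_lt)
    show "open (- P \<tau> \<inter> ?S)" using P(2)[OF \<tau>] oS by (intro open_Int[OF _ oS]) auto
    show "open (- P \<tau>)" using P(2)[OF \<tau>] by auto
    have "Complex 0 (s0 * Im \<tau> / 2) \<in> ?S" using s0 \<tau> by simp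
    then have "?S \<noteq> {}" by blast
    then show "- P \<tau> \<inter> ?S \<noteq> {}"
      using open_Int_closure_eq_empty[OF oS, of "- P \<tau>"] countable_imp_dense_complement[OF P(1)[OF \<tau>]] by auto
    have "connected (UNIV - P \<tau>)" using P(1)[OF \<tau>] by (intro connected_open_diff_countable) auto
    then show "connected (- P \<tau>)" by (simp add: Compl_eq_Diff_UNIV)
    show "(\<lambda>z. elliptic_genus f G \<tau> z) holomorphic_on - P \<tau>"
      by (rule holomorphic_on_subset[OF elliptic_genus_holomorphic[OF \<tau>]]) (auto simp: P_def)
    show "(\<lambda>z. (-1) ^ CARD('n) * elliptic_genus f' G' \<tau> z) holomorphic_on - P \<tau>"
      by (intro holomorphic_on_mult holomorphic_on_const holomorphic_on_subset[OF elliptic_genus_holomorphic[OF \<tau>]])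
         (auto simp: P_def)
    show "elliptic_genus f G \<tau> z = (-1) ^ CARD('n) * elliptic_genus f' G' \<tau> z" if "z \<in> - P \<tau> \<inter> ?S" for z
      unfolding genus by (rule strip) (use that \<tau> in auto)
  qed (use z in auto)
  moreover have "genus_domain \<subseteq> closure (genus_domain - (genus_polar_set f G \<union> genus_polar_set f' G'))"
  proof clarify
    fix \<tau> z assume "(\<tau>, z) \<in> genus_domain"
    then have \<tau>: "0 < Im \<tau>" by (simp add: genus_domain_def)
    have "(\<tau>, z) \<in> closure ({\<tau>} \<times> (- P \<tau>))"
      by (simp add: closure_Times countable_imp_dense_complement[OF P(1)[OF \<tau>]])
    moreover have "{\<tau>} \<times> (- P \<tau>) \<subseteq> genus_domain - (genus_polar_set f G \<union> genus_polar_set f' G')"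
      using \<tau> memP by auto
    ultimately show "(\<tau>, z) \<in> closure (genus_domain - (genus_polar_set f G \<union> genus_polar_set f' G'))"
      using closure_mono by blast
  qed
  ultimately show ?thesis using memP by fast
qed

end
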